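(* Let $\mathbf{u}:\mathbb{R}^3\to\mathbb{C}^3$ be an entire solution of the spectral Navier equation $\mu\Delta\mathbf{u}+(\lambda+\mu)\nabla(\nabla\cdot\mathbf{u})+\rho\,\omega^2\mathbf{u}=0$. Then $\mathbf{u}$ is a three-dimensional elastic Herglotz wave function if and only if $$\|\mathbf{u}\|_{\mathcal{H}(\mathbb{R}^3)}^2:=\int_{\mathbb{R}^3}\left(|\mathbf{u}(x)|^2+|\nabla_S\mathbf{u}(x)|^2\right)\frac{dx}{\langle x\rangle^3}<\infty,\qquad \langle x\rangle:=(1+|x|^2)^{1/2}.$$ Moreover, for such $\mathbf{u}$, $$\|\mathbf{u}\|_{\mathcal{H}(\mathbb{R}^3)}\sim\|\mathbf{g}_1\|_{\mathbf{L}^2(\mathbb{S}^2)}+\|\mathbf{g}_2\|_{\mathbf{L}^2(\mathbb{S}^2)}\sim\|\mathbf{u}_p\|_{\mathcal{H}(\mathbb{R}^3)}+\|\mathbf{u}_s\|_{\mathcal{H}(\mathbb{R}^3)},$$ where $\mathbf{g}_1$ and $\mathbf{g}_2$ are the longitudinal and transverse far-field patterns of $\mathbf{u}$, and $\mathbf{u}_p,\mathbf{u}_s$ are its compressional and shear parts.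
   Context: Constants: $\rho>0$, $\omega>0$, and the Lamé constants $\lambda,\mu\in\mathbb{R}$ satisfy $\mu>0$ and $2\mu+\lambda>0$. The numbers $k_p,k_s>0$ are given by $k_p^2=\frac{\omega^2\rho}{2\mu+\lambda}$ and $k_s^2=\frac{\omega^2\rho}{\mu}$. "Entire solution" means a solution defined on the whole of $\mathbb{R}^3$. The vector Laplacian acts componentwise. Compressional and shear parts: $\mathbf{u}=\mathbf{u}_p+\mathbf{u}_s$ with $\mathbf{u}_p=-\frac{1}{k_p^2}\nabla(\nabla\cdot\mathbf{u})$ and $\mathbf{u}_s=\frac{1}{k_s^2}\nabla\times(\nabla\times\mathbf{u})$. Spaces: $\mathbf{L}^2(\mathbb{S}^2)=[L^2(\mathbb{S}^2)]^3$ (complex-valued components), $\mathbf{L}^2_p(\mathbb{S}^2)=\{\mathbf{g}\in\mathbf{L}^2(\mathbb{S}^2):\xi\times\mathbf{g}(\xi)=\mathbf{0}\}$, $\mathbf{L}^2_s(\mathbb{S}^2)=\{\mathbf{g}\in\mathbf{L}^2(\mathbb{S}^2):\xi\cdot\mathbf{g}(\xi)=0\}$. A three-dimensional elastic Herglotz wave function is an entire solution $\mathbf{u}$ of the spectral Navier equation such that $$\mathbf{u}(x)=\int_{\mathbb{S}^2}\left(e^{ik_p x\cdot\xi}\mathbf{g}_1(\xi)+e^{ik_s x\cdot\xi}\mathbf{g}_2(\xi)\right)d\sigma(\xi)$$ with $\mathbf{g}_1\in\mathbf{L}^2_p(\mathbb{S}^2)$ (the longitudinal far-field pattern of $\mathbf{u}$)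 and $\mathbf{g}_2\in\mathbf{L}^2_s(\mathbb{S}^2)$ (the transverse far-field pattern of $\mathbf{u}$), where $d\sigma$ is the surface measure of $\mathbb{S}^2$. Spherical gradient: use spherical coordinates $x=(r\sin\theta\cos\varphi,r\sin\theta\sin\varphi,r\cos\theta)$, $r>0$, $0<\theta<\pi$, $0<\varphi<2\pi$, with unit vectors $\widehat{\mathbf r},\widehat{\boldsymbol\theta},\widehat{\boldsymbol\varphi}$ in the radial and angular directions, and write $\mathbf{u}=u^r\widehat{\mathbf r}+u^\theta\widehat{\boldsymbol\theta}+u^\varphi\widehat{\boldsymbol\varphi}$. Then $\nabla_S\mathbf{u}$ is the second-order tensor $$\nabla_S\mathbf{u}=\left(\tfrac{\partial u^r}{\partial\theta}-u^\theta\right)\widehat{\boldsymbol\theta}\otimes\widehat{\mathbf r}+\left(\tfrac{\partial u^\theta}{\partial\theta}+u^r\right)\widehat{\boldsymbol\theta}\otimes\widehat{\boldsymbol\theta}+\tfrac{\partial u^\varphi}{\partial\theta}\,\widehat{\boldsymbol\theta}\otimes\widehat{\boldsymbol\varphi}+\left(\tfrac{1}{\sin\theta}\tfrac{\partial u^r}{\partial\varphi}-u^\varphi\right)\widehat{\boldsymbol\varphi}\otimes\widehat{\mathbf r}$$ $$+\left(\tfrac{1}{\sin\theta}\tfrac{\partial u^\theta}{\partial\varphi}-u^\varphi\cot\theta\right)\widehat{\boldsymbol\varphi}\otimes\widehat{\boldsymbol\theta}+\left(\tfrac{1}{\sin\theta}\tfrac{\partial u^\varphi}{\partial\varphi}+u^r+u^\theta\cot\theta\right)\widehat{\boldsymbol\varphi}\otimes\widehat{\boldsymbol\varphi}.$$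 For tensors with components $A_{ij},B_{ij}$ in an orthonormal basis, $A:B=\sum_{i,j}A_{ij}B_{ij}$ and $|A|=\sqrt{A:\overline{A}}$. Notation: $a\sim b$ means that there are positive constants $c,C$ with $c\,b\le a\le C\,b$; the constants do not depend on $\mathbf{u}$ (they may depend on $\lambda,\mu,\rho,\omega$). *)

theory Defs
  imports "HOL-Analysis.Analysis"
begin

section \<open>Vector calculus on three-dimensional space\<close>

definition partial_d ::
  "3 \<Rightarrow> (real^3 \<Rightarrow> 'b::real_normed_vector) \<Rightarrow> real^3 \<Rightarrow> 'b" where
  "partial_d j f x = vector_derivative (\<lambda>t. f (x + t *\<^sub>R axis j 1)) (at 0)"

fun C_k :: "nat \<Rightarrow> (real^3 \<Rightarrow> 'b::real_normed_vector) \<Rightarrow> bool" where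
  "C_k 0 f \<longleftrightarrow> continuous_on UNIV f"
| "C_k (Suc k) f \<longleftrightarrow> (\<forall>x. f differentiable (at x)) \<and> (\<forall>j. C_k k (partial_d j f))"

definition laplacian :: "(real^3 \<Rightarrow> complex) \<Rightarrow> real^3 \<Rightarrow> complex" where
  "laplacian f x = (\<Sum>j\<in>UNIV. partial_d j (partial_d j f) x)"

definition vector_laplacian :: "(real^3 \<Rightarrow> complex^3) \<Rightarrow> real^3 \<Rightarrow> complex^3" where
  "vector_laplacian u x = (\<chi> i. laplacian (\<lambda>y. u y $ i) x)"

definition gradient :: "(real^3 \<Rightarrow> complex) \<Rightarrow> real^3 \<Rightarrow> complex^3" where
  "gradient f x = (\<chi> i. partial_d i f x)"

definition divergence :: "(real^3 \<Rightarrow> complex^3) \<Rightarrow> real^3 \<Rightarrow> complex" where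
  "divergence u x = (\<Sum>i\<in>UNIV. partial_d i (\<lambda>y. u y $ i) x)"

definition curl :: "(real^3 \<Rightarrow> complex^3) \<Rightarrow> real^3 \<Rightarrow> complex^3" where
  "curl u x = vector
     [partial_d 2 (\<lambda>y. u y $ 3) x - partial_d 3 (\<lambda>y. u y $ 2) x,
      partial_d 3 (\<lambda>y. u y $ 1) x - partial_d 1 (\<lambda>y. u y $ 3) x,
      partial_d 1 (\<lambda>y. u y $ 2) x - partial_d 2 (\<lambda>y. u y $ 1) x]"

text \<open>
  The products of a real vector \<open>a\<close> with a complex vector \<open>v\<close> are bilinear:
  there is no complex conjugation.
\<close>

definition dot_rc :: "real^3 \<Rightarrow> complex^3 \<Rightarrow> complex" where
  "dot_rc a v = (\<Sum>i\<in>UNIV. complex_of_real (a $ i) * v $ i)"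

definition cross_rc :: "real^3 \<Rightarrow> complex^3 \<Rightarrow> complex^3" where
  "cross_rc a v = vector
     [complex_of_real (a $ 2) * v $ 3 - complex_of_real (a $ 3) * v $ 2,
      complex_of_real (a $ 3) * v $ 1 - complex_of_real (a $ 1) * v $ 3,
      complex_of_real (a $ 1) * v $ 2 - complex_of_real (a $ 2) * v $ 1]"

section \<open>Entire solutions of the spectral Navier equation\<close>

text \<open>Solutions are classical, that is, twice continuously differentiable.\<close>

definition entire_navier_solution ::
  "real \<Rightarrow> real \<Rightarrow> real \<Rightarrow> real \<Rightarrow> (real^3 \<Rightarrow> complex^3) \<Rightarrow> bool" where
  "entire_navier_solution lam mu rho om u \<longleftrightarrow>
     C_k 2 u \<and>
     (\<forall>x. mu *\<^sub>R vector_laplacian u x + (lam + mu) *\<^sub>R gradient (divergence u) x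
            + (rho * om\<^sup>2) *\<^sub>R u x = 0)"

definition compressional_part ::
  "real \<Rightarrow> (real^3 \<Rightarrow> complex^3) \<Rightarrow> real^3 \<Rightarrow> complex^3" where
  "compressional_part kp u x = - ((1 / kp\<^sup>2) *\<^sub>R gradient (divergence u) x)"

definition shear_part ::
  "real \<Rightarrow> (real^3 \<Rightarrow> complex^3) \<Rightarrow> real^3 \<Rightarrow> complex^3" where
  "shear_part ks u x = (1 / ks\<^sup>2) *\<^sub>R curl (curl u) x"

section \<open>Spherical coordinates and the surface measure of the unit sphere\<close>

definition r_hat :: "real \<Rightarrow> real \<Rightarrow> real^3" where
  "r_hat \<theta> \<phi> = vector [sin \<theta> * cos \<phi>, sin \<theta> * sin \<phi>, cos \<theta>]"

definition theta_hat :: "real \<Rightarrow> real \<Rightarrow> real^3" where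
  "theta_hat \<theta> \<phi> = vector [cos \<theta> * cos \<phi>, cos \<theta> * sin \<phi>, - sin \<theta>]"

definition phi_hat :: "real \<Rightarrow> real \<Rightarrow> real^3" where
  "phi_hat \<theta> \<phi> = vector [- sin \<phi>, cos \<phi>, 0]"

definition sphere_measure :: "(real^3) measure" where
  "sphere_measure =
     distr
       (density (restrict_space lborel ({0<..<pi} \<times> {0<..<2 * pi}))
          (\<lambda>(\<theta>, \<phi>). ennreal (sin \<theta>)))
       (restrict_space borel (sphere 0 1))
       (\<lambda>(\<theta>, \<phi>). r_hat \<theta> \<phi>)"

definition L2_sphere :: "(real^3 \<Rightarrow> complex^3) set" where
  "L2_sphere =
     {g \<in> borel_measurable sphere_measure. integrable sphere_measure (\<lambda>\<xi>. (norm (g \<xi>))\<^sup>2)}"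

definition L2_sphere_norm :: "(real^3 \<Rightarrow> complex^3) \<Rightarrow> real" where
  "L2_sphere_norm g = sqrt (\<integral>\<xi>. (norm (g \<xi>))\<^sup>2 \<partial>sphere_measure)"

definition L2_sphere_p :: "(real^3 \<Rightarrow> complex^3) set" where
  "L2_sphere_p = {g \<in> L2_sphere. AE \<xi> in sphere_measure. cross_rc \<xi> (g \<xi>) = 0}"

definition L2_sphere_s :: "(real^3 \<Rightarrow> complex^3) set" where
  "L2_sphere_s = {g \<in> L2_sphere. AE \<xi> in sphere_measure. dot_rc \<xi> (g \<xi>) = 0}"

section \<open>Elastic Herglotz wave functions\<close>

definition far_field_patterns ::
  "real \<Rightarrow> real \<Rightarrow> (real^3 \<Rightarrow> complex^3) \<Rightarrow>
   (real^3 \<Rightarrow> complex^3) \<Rightarrow> (real^3 \<Rightarrow> complex^3) \<Rightarrow> bool" where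
  "far_field_patterns kp ks u g1 g2 \<longleftrightarrow>
     g1 \<in> L2_sphere_p \<and> g2 \<in> L2_sphere_s \<and>
     (\<forall>x. u x = (\<integral>\<xi>. (exp (\<i> * complex_of_real (kp * (x \<bullet> \<xi>))) *s g1 \<xi>
                        + exp (\<i> * complex_of_real (ks * (x \<bullet> \<xi>))) *s g2 \<xi>)
                    \<partial>sphere_measure))"

definition elastic_herglotz ::
  "real \<Rightarrow> real \<Rightarrow> real \<Rightarrow> real \<Rightarrow> real \<Rightarrow> real \<Rightarrow> (real^3 \<Rightarrow> complex^3) \<Rightarrow> bool" where
  "elastic_herglotz lam mu rho om kp ks u \<longleftrightarrow>
     entire_navier_solution lam mu rho om u \<and> (\<exists>g1 g2. far_field_patterns kp ks u g1 g2)"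

section \<open>The spherical gradient and the norm\<close>

text \<open>
  \<open>tensor3 c a b\<close> is the second-order tensor \<open>c\<close> times \<open>a \<otimes> b\<close>, as a matrix in the
  Cartesian basis; the library norm on \<open>complex^3^3\<close> is the Frobenius norm.
\<close>

definition tensor3 :: "complex \<Rightarrow> real^3 \<Rightarrow> real^3 \<Rightarrow> complex^3^3" where
  "tensor3 c a b = (\<chi> i j. c * complex_of_real (a $ i) * complex_of_real (b $ j))"

definition sph_grad_coord ::
  "(real^3 \<Rightarrow> complex^3) \<Rightarrow> real \<Rightarrow> real \<Rightarrow> real \<Rightarrow> complex^3^3" where
  "sph_grad_coord u r \<theta> \<phi> =
     (let ur = (\<lambda>t p. dot_rc (r_hat t p) (u (r *\<^sub>R r_hat t p)));
          ut = (\<lambda>t p. dot_rc (theta_hat t p) (u (r *\<^sub>R r_hat t p)));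
          up = (\<lambda>t p. dot_rc (phi_hat t p) (u (r *\<^sub>R r_hat t p)));
          d\<theta> = (\<lambda>f. vector_derivative (\<lambda>t. f t \<phi>) (at \<theta>));
          d\<phi> = (\<lambda>f. vector_derivative (\<lambda>p. f \<theta> p) (at \<phi>));
          isin = complex_of_real (1 / sin \<theta>);
          ctg = complex_of_real (cot \<theta>);
          R = r_hat \<theta> \<phi>; T = theta_hat \<theta> \<phi>; P = phi_hat \<theta> \<phi>
      in tensor3 (d\<theta> ur - ut \<theta> \<phi>) T R
         + tensor3 (d\<theta> ut + ur \<theta> \<phi>) T T
         + tensor3 (d\<theta> up) T P
         + tensor3 (isin * d\<phi> ur - up \<theta> \<phi>) P R
         + tensor3 (isin * d\<phi> ut - up \<theta> \<phi> * ctg) P T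
         + tensor3 (isin * d\<phi> up + ur \<theta> \<phi> + ut \<theta> \<phi> * ctg) P P)"

text \<open>
  The values on the null set \<open>{x. x $ 2 = 0 \<and> x $ 1 \<ge> 0}\<close>, where the spherical coordinates
  with \<open>0 < \<theta> < pi\<close> and \<open>0 < \<phi> < 2 * pi\<close> are not defined, are irrelevant.
\<close>

definition sph_grad :: "(real^3 \<Rightarrow> complex^3) \<Rightarrow> real^3 \<Rightarrow> complex^3^3" where
  "sph_grad u x =
     sph_grad_coord u (norm x) (arccos (x $ 3 / norm x)) (Arg2pi (Complex (x $ 1) (x $ 2)))"

definition japanese_bracket :: "real^3 \<Rightarrow> real" where
  "japanese_bracket x = sqrt (1 + (norm x)\<^sup>2)"

definition H_norm_sq :: "(real^3 \<Rightarrow> complex^3) \<Rightarrow> ennreal" where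
  "H_norm_sq u =
     (\<integral>\<^sup>+ x. ennreal (((norm (u x))\<^sup>2 + (norm (sph_grad u x))\<^sup>2) / japanese_bracket x ^ 3) \<partial>lborel)"

text \<open>Meaningful only if \<open>H_norm_sq u < \<infinity>\<close>: \<open>enn2real \<infinity> = 0\<close>.\<close>

definition H_norm :: "(real^3 \<Rightarrow> complex^3) \<Rightarrow> real" where
  "H_norm u = sqrt (enn2real (H_norm_sq u))"

end

theory Submission
 imports Defs "HOL-Probability.Probability" "HOL-Real_Asymp.Real_Asymp"
begin

text \<open>The norm \<open>H_norm\<close> is the sum over the three components of a scalar weighted norm: \<open>sph_grad u\<close> is
\<open>|x|\<close> times the matrix of the derivatives of \<open>u\<close> in the directions tangent to the spheres, so \<open>|sph_grad u|^2\<close> is the sum of the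
\<open>angular\<close> energies \<open>|x|^2 |grad f|^2 - |x . grad f|^2\<close> of the components \<open>f\<close> (\<open>H_norm_sq_components\<close>).
This energy is the sum of the squares of the rotation fields applied to \<open>f\<close>, which commute with the Laplacian and with radial
convolutions. The proof therefore needs two scalar facts and a way to split a Navier solution. All three are
obtained by testing against Gaussians, without spherical harmonics.

Scalar norm equivalence. Let \<open>f\<close> be the Herglotz transform with wave number \<open>k\<close> of a density \<open>g\<close>. Schur's test bounds
\<open>M s = sqrt s * \<integral> exp (- s |x|^2) |f|^2\<close> by the squared \<open>L^2\<close> norm of \<open>g\<close>, uniformly in \<open>s\<close>
(\<open>herglotz_gauss_mean_le\<close>). A virial identity for Helmholtz solutions (\<open>angular_identity\<close>) expresses \<open>k^2 M'(s)\<close> by the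
Gaussian mean of the angular energy and of \<open>|f|^2\<close>. Since \<open>sqrt s exp (- s |x|^2)\<close>, integrated over \<open>0 < s < 1\<close>, is
comparable to the weight \<open>(1 + |x|^2) powr (-3/2)\<close>, integrating the identity in \<open>s\<close> yields both that a bound on \<open>M\<close> bounds
the weighted norm (\<open>jet_upper\<close>) and that the weighted norm bounds \<open>M\<close> (\<open>jet_lower\<close>). In the latter case the Gaussian
regularised Fourier transforms of \<open>f\<close>, restricted to the sphere of radius \<open>k\<close>, form a Cauchy sequence along suitable \<open>s\<close> tending
to 0, and its limit is a density for \<open>f\<close> (\<open>herglotz_lower\<close>). The hypothesis on \<open>f\<close> used here is \<open>reproducing k f\<close>: convolution
with a Gaussian multiplies \<open>f\<close> by a number, as the Helmholtz equation predicts.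

Splitting. For a Navier solution \<open>u\<close> the Gaussian convolution \<open>T s\<close> of a component satisfies linear differential equations in the
Gaussian parameter \<open>s\<close>, whose solutions are combinations of the two factors belonging to \<open>kp\<close> and \<open>ks\<close>
(\<open>navier_decomposition\<close>). If \<open>kp\<close> and \<open>ks\<close> differ, the compressional and the shear part are combinations of \<open>T 1\<close> and \<open>T 2\<close>, and
convolution is bounded for the weighted norm, so each part is controlled by \<open>u\<close> (\<open>separated_part\<close>). If \<open>kp = ks\<close>, every
component is a Herglotz wave, and the pointwise splitting of its density into radial and tangential part does the same.
Finally, a gradient field has a radial density and a divergence free field a tangential one, by uniqueness of densities
(\<open>herglotz_injective\<close>).\<close>

section \<open>Notation\<close>

abbreviation cor :: "real \<Rightarrow> complex" where "cor \<equiv> complex_of_real"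

abbreviation S2 :: "(real^3) measure" where "S2 \<equiv> sphere_measure"

abbreviation gaussian :: "real \<Rightarrow> 'a::real_normed_vector \<Rightarrow> real" where
 "gaussian s x \<equiv> exp (- s * (norm x)\<^sup>2)"

notation scaleR (infixr "*R" 75)

abbreviation converges_to :: "(nat => 'a::topological_space) => 'a => bool" (infix "---->" 60) where
 "X ----> L == (X \<longlonglongrightarrow> L)"

abbreviation nn_integral_lborel :: "('a::euclidean_space => ennreal) => ennreal" (binder "NN " 10) where
 "nn_integral_lborel f == nn_integral lborel f"

abbreviation bracket3 :: "real^3 => real" where "bracket3 x == japanese_bracket x ^ 3"

text \<open>These facts share their base names with facts about the Henstock-Kurzweil integral; the prefix selects the Bochner integral.\<close>

lemmas Bintegrable_add = Bochner_Integration.integrable_add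
lemmas Bintegrable_bound = Bochner_Integration.integrable_bound
lemmas Bintegrable_cong = Bochner_Integration.integrable_cong
lemmas Bintegrable_sum = Bochner_Integration.integrable_sum
lemmas Bintegral_add = Bochner_Integration.integral_add
lemmas Bintegral_cong = Bochner_Integration.integral_cong
lemmas Bintegral_diff = Bochner_Integration.integral_diff
lemmas Bintegral_sum = Bochner_Integration.integral_sum

section \<open>Integration tools\<close>

text \<open>Differentiation under the integral sign for parameters in a normed space, by dominated convergence of the difference quotients.\<close>

lemma has_derivative_integral:
 fixes f :: "'x::real_normed_vector => 'a => 'b::{banach, second_countable_topology}"
 assumes r: "r > 0"
  and f_int: "!!x. x \<in> ball x0 r ==> integrable M (f x)"
  and f_der: "!!x y. x \<in> ball x0 r ==> y \<in> space M ==> ((%x. f x y) has_derivative f' x y) (at x)"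
  and bnd: "!!x y h. x \<in> ball x0 r ==> y \<in> space M ==> norm (f' x y h) <= B y * norm h"
  and B_int: "integrable M B"
  and meas: "!!h. (%y. f' x0 y h) \<in> borel_measurable M"
 shows "((%x. \<integral>y. f x y \<partial>M) has_derivative (%h. \<integral>y. f' x0 y h \<partial>M)) (at x0)"
  and "!!h. integrable M (%y. f' x0 y h)"
proof -
 have x0: "x0 \<in> ball x0 r" using r by simp
 show int': "integrable M (%y. f' x0 y h)" for h
  by (rule Bintegrable_bound[of M "%y. B y * norm h"])
    (use B_int meas bnd[OF x0, of _ h] in \<open>auto intro!: AE_I2 order_trans[OF _ abs_ge_self]\<close>)
 have lin: "linear (f' x0 y)" if "y \<in> space M" for y
  using f_der[OF x0 that] has_derivative_linear by blast
 have bl: "bounded_linear (%h. \<integral>y. f' x0 y h \<partial>M)"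
 proof (rule bounded_linear_intro[where K = "\<integral>y. B y \<partial>M"])
  fix h k
  show "(LINT y|M. f' x0 y (h + k)) = (LINT y|M. f' x0 y h) + (LINT y|M. f' x0 y k)" by (subst Bintegral_add[symmetric])
     (auto intro!: int' Bintegral_cong simp: linear_add[OF lin])
 next
  fix c :: real and h
  have "(LINT y|M. f' x0 y (c *R h)) = (LINT y|M. c *R f' x0 y h)" by (rule Bintegral_cong) (simp_all add: linear_cmul[OF lin])
  also have "... = c *R (LINT y|M. f' x0 y h)" by (intro integral_scaleR_right int')
  finally show "(LINT y|M. f' x0 y (c *R h)) = c *R (LINT y|M. f' x0 y h)" .
 next
  fix h
  have "norm (LINT y|M. f' x0 y h) <= (LINT y|M. B y * norm h)" by (rule order_trans[OF integral_norm_bound])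
     (intro integral_mono integrable_norm int' integrable_mult_left B_int bnd[OF x0])
  then show "norm (LINT y|M. f' x0 y h) <= norm h * (LINT y|M. B y)" by (simp add: mult.commute)
 qed
 show "((%x. \<integral>y. f x y \<partial>M) has_derivative (%h. \<integral>y. f' x0 y h \<partial>M)) (at x0)"
 proof (rule has_derivativeI[OF bl])
  let ?Q = "%x y. (f x y - f x0 y - f' x0 y (x - x0)) /\<^sub>R norm (x - x0)"
  show "((%y. ((LINT z|M. f y z) - (LINT z|M. f x0 z) - (LINT z|M. f' x0 z (y - x0))) /\<^sub>R norm (y - x0)) \<longlongrightarrow> 0) (at x0)"
   unfolding tendsto_at_iff_sequentially
  proof safe
   fix X assume X: "\<forall>i. X i \<in> UNIV - {x0}" "X ----> x0"
   obtain N where N: "!!n. n >= N ==> X n \<in> ball x0 r" using X(2) r by (metis lim_sequentially mem_ball dist_commute)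
   let ?X = "%n. X (n + N)"
   have XN: "?X n \<in> ball x0 r" for n by (rule N) simp
   have X': "?X ----> x0" using X(2) by (rule LIMSEQ_ignore_initial_segment)
   have bd: "norm (?Q x y) <= 2 * B y" if x: "x \<in> ball x0 r" "x ~= x0" and y: "y \<in> space M" for x y
   proof -
    have "norm (f x y - f x0 y) <= B y * norm (x - x0)"
    proof (rule differentiable_bound[of "ball x0 r" "%x. f x y" "%x. f' x y"])
     fix z assume "z \<in> ball x0 r"
     have "0 <= B y * norm (x - x0)" by (rule order_trans[OF norm_ge_zero bnd[OF x0 y]])
     then have "0 <= B y" using x(2) by (simp add: zero_le_mult_iff)
     then show "onorm (f' z y) <= B y" using bnd[OF \<open>z \<in> ball x0 r\<close> y] by (rule onorm_bound)
    qed (use x y f_der r in \<open>auto intro: has_derivative_at_withinI\<close>)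
    moreover have "norm (f' x0 y (x - x0)) <= B y * norm (x - x0)" by (rule bnd[OF x0 y])
    ultimately have "norm (f x y - f x0 y - f' x0 y (x - x0)) <= 2 * B y * norm (x - x0)"
     using norm_triangle_ineq4[of "f x y - f x0 y" "f' x0 y (x - x0)"] by linarith
    moreover have "norm (?Q x y) = norm (f x y - f x0 y - f' x0 y (x - x0)) / norm (x - x0)" by (simp add: divide_inverse_commute)
    ultimately show ?thesis using x(2) by (simp add: pos_divide_le_eq)
   qed
   have "(%n. \<integral>y. ?Q (?X n) y \<partial>M) ----> (LINT y|M. 0)"
   proof (rule integral_dominated_convergence[where w = "%y. 2 * B y"])
    show "AE y in M. (%n. ?Q (?X n) y) ----> 0"
    proof (rule AE_I2)
     fix y assume y: "y \<in> space M"
     have "((%x. ?Q x y) \<longlongrightarrow> 0) (at x0)" using f_der[OF x0 y] by (simp add: has_derivative_at_within)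
     then show "(%n. ?Q (?X n) y) ----> 0" using X(1) X' unfolding tendsto_at_iff_sequentially o_def by (elim allE[of _ ?X]) auto
    qed
    show "AE y in M. norm (?Q (?X n) y) <= 2 * B y" for n
     using bd[OF XN] X(1) by auto
    show "(%y. ?Q (?X n) y) \<in> borel_measurable M" for n
     using f_int[OF XN[of n]] f_int[OF x0] meas[of "?X n - x0"] by (auto intro!: borel_measurable_scaleR borel_measurable_diff)
   qed (use B_int in auto)
   moreover have "(LINT y|M. ?Q (?X n) y) = ((LINT z|M. f (?X n) z) - (LINT z|M. f x0 z) - (LINT z|M. f' x0 z (?X n - x0))) /\<^sub>R norm (?X n - x0)" for n
    using f_int[OF XN[of n]] f_int[OF x0] int' by simp
   ultimately have "(%n. ((LINT z|M. f (?X n) z) - (LINT z|M. f x0 z) - (LINT z|M. f' x0 z (?X n - x0))) /\<^sub>R norm (?X n - x0)) ----> 0"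
    by (simp only: Bochner_Integration.integral_zero)
   then show "((%y. ((LINT z|M. f y z) - (LINT z|M. f x0 z) - (LINT z|M. f' x0 z (y - x0))) /\<^sub>R norm (y - x0)) \<circ> X) ----> 0"
    unfolding o_def by (rule LIMSEQ_offset[where k = N])
  qed
 qed
qed

lemma integral_shift:
 fixes f :: "'a::euclidean_space => 'b::{banach, second_countable_topology}"
 assumes "f \<in> borel_measurable borel"
 shows "(LBINT x. f (c + x)) = (LBINT x. f x)"
proof -
 have "(LBINT x. f x) = (\<integral>x. f x \<partial>(distr lborel borel ((+) c)))" by (simp add: lborel_distr_plus)
 also have "... = (LBINT x. f (c + x))" by (rule integral_distr) (use assms in auto)
 finally show ?thesis ..
qed

lemma integrable_shift:
 fixes f :: "'a::euclidean_space => 'b::{banach, second_countable_topology}"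
 assumes "integrable lborel f"
 shows "integrable lborel (%x. f (c + x))"
proof -
 have "integrable (distr lborel borel ((+) c)) f" using assms by (simp add: lborel_distr_plus)
 then show ?thesis by (subst (asm) integrable_distr_eq) (use assms in auto)
qed

lemma nn_integral_shift:
 fixes f :: "'a::euclidean_space => ennreal"
 assumes "f \<in> borel_measurable borel"
 shows "(NN x. f (c + x)) = (NN x. f x)"
proof -
 have "(NN x. f x) = (\<integral>\<^sup>+x. f x \<partial>(distr lborel borel ((+) c)))" by (simp add: lborel_distr_plus)
 also have "... = (NN x. f (c + x))" by (rule nn_integral_distr) (use assms in auto)
 finally show ?thesis ..
qed

text \<open>The divergence theorem in the only form needed: translation invariance makes the integral of a difference quotient vanish,
and the fundamental theorem with Fubini turns difference quotients into derivatives.\<close>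

lemma integral_directional_derivative_eq_0:
 fixes v v' :: "'a::euclidean_space => 'b::euclidean_space"
 assumes v: "integrable lborel v" and v': "integrable lborel v'" and cont: "continuous_on UNIV v'"
  and der: "!!x. ((%t. v (x + t *R e)) has_vector_derivative v' x) (at 0)"
 shows "(LBINT x. v' x) = 0"
proof -
 have [measurable]: "v' \<in> borel_measurable borel" "v \<in> borel_measurable borel" using v v' by auto
 have der': "((%t. v (x + t *R e)) has_vector_derivative v' (x + t *R e)) (at t)" for x t
 proof -
  have "((%s. v ((x + t *R e) + (s - t) *R e)) has_vector_derivative 1 *R v' (x + t *R e)) (at t)"
   by (rule vector_diff_chain_at[where g = "%s. v ((x + t *R e) + s *R e)" and f = "%s. s - t", unfolded o_def])
     (auto intro!: derivative_eq_intros der)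
  then show ?thesis by (simp add: algebra_simps)
 qed
 have ftc: "(LBINT t. indicator {0..1} t *R v' (x + t *R e)) = v (x + e) - v x" for x
 proof -
  have "has_bochner_integral lborel (%t. indicator {0..1} t *R v' (x + t *R e)) (v (x + 1 *R e) - v (x + 0 *R e))"
  proof (rule has_bochner_integral_FTC_Icc)
   show "continuous_on {0..1} (%t. v' (x + t *R e))" by (intro continuous_on_compose2[OF cont]) (auto intro!: continuous_intros)
  qed (auto intro: has_vector_derivative_at_within der')
  then show ?thesis by (simp add: has_bochner_integral_iff)
 qed
 have pair: "integrable (lborel \<Otimes>\<^sub>M lborel) (%(t, x). indicator {0..1::real} t *R v' (x + t *R e))"
 proof (rule lborel_pair.Fubini_integrable)
  show "(%(t, x). indicator {0..1::real} t *R v' (x + t *R e)) \<in> borel_measurable (lborel \<Otimes>\<^sub>M lborel)" by measurable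
  have "(LBINT x. norm (indicator {0..1} t *R v' (x + t *R e))) = indicator {0..1} t *R (LBINT x. norm (v' x))" for t :: real
   using integral_shift[of "%x. norm (v' x)" "t *R e"] by (simp add: add.commute)
  then show "integrable lborel (%t. \<integral>x. norm (case (t, x) of (t, x) => indicator {0..1::real} t *R v' (x + t *R e)) \<partial>lborel)"
   by (simp only: prod.case) (rule integrable_scaleR_left, simp)
  show "AE t in lborel. integrable lborel (%x. case (t, x) of (t, x) => indicator {0..1::real} t *R v' (x + t *R e))"
   using integrable_shift[OF v', of "_ *R e"] by (auto simp: add.commute)
 qed
 have "(\<integral>t. \<integral>x. indicator {0..1::real} t *R v' (x + t *R e) \<partial>lborel \<partial>lborel)
   = (\<integral>x. \<integral>t. indicator {0..1::real} t *R v' (x + t *R e) \<partial>lborel \<partial>lborel)"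
  using lborel_pair.Fubini_integral[of "%t x. indicator {0..1::real} t *R v' (x + t *R e)"] pair by simp
 also have "... = (LBINT x. v (x + e) - v x)" by (simp add: ftc)
 also have "... = 0" using integrable_shift[OF v, of e] integral_shift[of v e] v by (simp add: add.commute)
 finally have "(\<integral>t. \<integral>x. indicator {0..1::real} t *R v' (x + t *R e) \<partial>lborel \<partial>lborel) = 0" .
 moreover have "(LBINT x. indicator {0..1::real} t *R v' (x + t *R e)) = indicator {0..1} t *R (LBINT x. v' x)" for t
  using integral_shift[of v' "t *R e"] by (simp add: add.commute)
 moreover have "(LBINT t. indicator {0..1::real} t *R (LBINT x. v' x)) = (LBINT x. v' x)" by (subst integral_scaleR_left) (auto simp: measure_def)
 ultimately show ?thesis by (simp only:)
qed

lemma integral_Cauchy_Schwarz: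
 fixes f g :: "'a => complex"
 assumes [measurable]: "f \<in> borel_measurable M" "g \<in> borel_measurable M"
  and f: "integrable M (%x. (norm (f x))^2)" and g: "integrable M (%x. (norm (g x))^2)"
 shows "integrable M (%x. f x * g x)"
  and "(LINT x|M. norm (f x) * norm (g x))^2 <= (LINT x|M. (norm (f x))^2) * (LINT x|M. (norm (g x))^2)"
  and "(norm (LINT x|M. f x * g x))^2 <= (LINT x|M. (norm (f x))^2) * (LINT x|M. (norm (g x))^2)"
proof -
 show int: "integrable M (%x. f x * g x)"
 proof (rule Bintegrable_bound[OF Bintegrable_add[OF f g]])
  show "AE x in M. norm (f x * g x) <= norm ((norm (f x))^2 + (norm (g x))^2)"
  proof (rule AE_I2)
   fix x
   have "2 * norm (f x) * norm (g x) <= (norm (f x))^2 + (norm (g x))^2" by (rule sum_squares_bound)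
   moreover have "0 <= norm (f x) * norm (g x)" by simp
   ultimately have "norm (f x) * norm (g x) <= (norm (f x))^2 + (norm (g x))^2" by linarith
   then show "norm (f x * g x) <= norm ((norm (f x))^2 + (norm (g x))^2)" by (simp add: norm_mult)
  qed
 qed simp
 have int': "integrable M (%x. norm (f x) * norm (g x))" using integrable_norm[OF int] by (simp add: norm_mult)
 define A B C where "A = (LINT x|M. (norm (f x))^2)" and "B = (LINT x|M. (norm (g x))^2)" and "C = (LINT x|M. norm (f x) * norm (g x))"
 have A0: "A >= 0" "B >= 0" "C >= 0" by (auto simp: A_def B_def C_def)
 have q: "0 <= A * t^2 - 2 * C * t + B" for t
 proof -
  have "0 <= (LINT x|M. (t * norm (f x) - norm (g x))^2)" by simp
  also have "... = (LINT x|M. t^2 * (norm (f x))^2 - 2 * t * (norm (f x) * norm (g x)) + (norm (g x))^2)"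
   by (simp add: power2_diff power_mult_distrib algebra_simps)
  also have "... = t^2 * A - 2 * t * C + B" using f g int' by (simp add: A_def B_def C_def)
  finally show ?thesis by (simp add: algebra_simps)
 qed
 show le: "C^2 <= A * B"
 proof (cases "A = 0")
  case True
  have "C = 0"
  proof (rule ccontr)
   assume "C ~= 0"
   then show False using q[of "(B + 1) / (2 * C)"] True A0 by simp
  qed
  then show ?thesis using A0 by simp
 next
  case False
  then show ?thesis using q[of "C / A"] A0 by (simp add: power2_eq_square field_simps)
 qed
 have "norm (LINT x|M. f x * g x) <= C" unfolding C_def by (rule order_trans[OF integral_norm_bound]) (simp add: norm_mult)
 then have "(norm (LINT x|M. f x * g x))^2 <= C^2" by (simp add: power_mono)
 then show "(norm (LINT x|M. f x * g x))^2 <= A * B" using le by simp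
qed

section \<open>Gaussian integrals\<close>

lemma gaussian_fourier_1d:
 assumes s: "s > (0::real)"
 shows "integrable lborel (%x::real. exp (- s * x^2) *R iexp (t * x))"
  and "(LBINT x. exp (- s * x^2) *R iexp (t * x)) = cor (sqrt (pi / s) * exp (- (t^2 / (4 * s))))"
proof -
 define c where "c = 1 / sqrt (2 * s)"
 have c: "c > 0" and c2: "c^2 = 1 / (2 * s)" using s by (auto simp: c_def power_divide)
 let ?f = "%x::real. exp (- s * x^2) *R iexp (t * x)"
 have norm_int: "integrable lborel (%x. std_normal_density x)" using integrable_normal_moment[of 1 0 0] by simp
 have eq: "?f (0 + c * x) = sqrt (2 * pi) *R (std_normal_density x *R iexp ((t * c) * x))" for x
  using s by (simp add: std_normal_density_def power_mult_distrib c2 field_simps scaleR_conv_of_real)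
 have ex: "integrable lborel (%x. std_normal_density x *R iexp ((t * c) * x))"
  by (rule Bintegrable_bound[OF norm_int]) (auto simp: abs_mult normal_density_nonneg)
 have val: "(LBINT x. std_normal_density x *R iexp ((t * c) * x)) = cor (exp (- ((t * c)^2) / 2))"
  using fun_cong[OF char_std_normal_distribution, of "t * c"] unfolding char_def by (subst (asm) integral_density) (auto simp: normal_density_nonneg)
 have "integrable lborel (%x. ?f (0 + c * x))" unfolding eq by (intro integrable_scaleR_right ex)
 then show "integrable lborel ?f" using lborel_integrable_real_affine_iff[of c ?f 0] c by simp
 have "(LBINT x. ?f x) = \<bar>c\<bar> *R (LBINT x. ?f (0 + c * x))" by (rule lborel_integral_real_affine) (use c in simp)
 also have "... = c *R sqrt (2 * pi) *R cor (exp (- ((t * c)^2) / 2))" unfolding eq integral_scaleR_right val using c by simp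
 also have "... = cor (sqrt (pi / s) * exp (- (t^2 / (4 * s))))"
  using s by (simp add: power_mult_distrib c2 scaleR_conv_of_real) (simp add: c_def real_sqrt_mult real_sqrt_divide field_simps)
 finally show "(LBINT x. ?f x) = cor (sqrt (pi / s) * exp (- (t^2 / (4 * s))))" .
qed

lemma gaussian_fourier:
 fixes zeta :: "'a::euclidean_space"
 assumes s: "s > 0"
 shows "integrable lborel (%x::'a. gaussian s x *R iexp (zeta \<bullet> x))"
  and "(LBINT x. gaussian s x *R iexp (zeta \<bullet> x))
    = cor (sqrt (pi / s) ^ DIM('a) * exp (- ((norm zeta)^2 / (4 * s))))"
proof -
 interpret product_sigma_finite "%_::'a. lborel :: real measure" ..
 let ?g = "%b x. exp (- s * x^2) *R iexp ((zeta \<bullet> b) * x)"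
 have norm_sq: "(norm z)^2 = (\<Sum>b\<in>Basis. (z \<bullet> b)^2)" for z :: 'a
  by (subst power2_norm_eq_inner, subst euclidean_inner) (simp add: power2_eq_square)
 have eq: "gaussian s x *R iexp (zeta \<bullet> x) = (\<Prod>b\<in>Basis. ?g b (x \<bullet> b))" for x
  unfolding norm_sq euclidean_inner[of zeta x]
  by (simp add: scaleR_conv_of_real prod.distrib exp_sum[symmetric] sum_distrib_left flip: of_real_prod sum_negf)
 let ?T = "%f. \<Sum>b\<in>Basis. f b *R (b::'a)"
 have T: "?T f \<bullet> b = f b" if "b \<in> Basis" for f b using that by (simp add: inner_sum_left inner_Basis if_distrib cong: if_cong)
 have [measurable]: "?T \<in> (\<Pi>\<^sub>M b\<in>Basis. lborel) \<rightarrow>\<^sub>M borel" by measurable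
 have eqT: "(%f. \<Prod>b\<in>Basis. ?g b (?T f \<bullet> b)) = (%f. \<Prod>b\<in>Basis. ?g b (f b))" by (intro ext prod.cong refl) (simp add: T)
 have i: "integrable (Pi\<^sub>M Basis (%_::'a. lborel)) (%f. \<Prod>b\<in>Basis. ?g b (f b))"
  by (rule product_integrable_prod) (simp, rule gaussian_fourier_1d(1)[OF s])
 show "integrable lborel (%x::'a. gaussian s x *R iexp (zeta \<bullet> x))"
  unfolding eq by (subst lborel_eq, subst integrable_distr_eq) (use i eqT in auto)
 have "(LBINT x. gaussian s x *R iexp (zeta \<bullet> x)) = (\<integral>f. (\<Prod>b\<in>Basis. ?g b (f b)) \<partial>Pi\<^sub>M Basis (%_::'a. lborel))"
  unfolding eq by (subst lborel_eq, subst integral_distr) (use eqT in auto)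
 also have "... = (\<Prod>b\<in>(Basis::'a set). cor (sqrt (pi / s) * exp (- ((zeta \<bullet> b)^2 / (4 * s)))))"
  by (subst product_integral_prod[OF finite_Basis gaussian_fourier_1d(1)[OF s]]) (rule prod.cong[OF refl gaussian_fourier_1d(2)[OF s]])
 also have "... = cor (sqrt (pi / s) ^ DIM('a) * exp (- ((norm zeta)^2 / (4 * s))))"
  unfolding norm_sq by (simp add: prod.distrib sum_divide_distrib flip: of_real_prod exp_sum sum_negf)
 finally show "(LBINT x. gaussian s x *R iexp (zeta \<bullet> x))
    = cor (sqrt (pi / s) ^ DIM('a) * exp (- ((norm zeta)^2 / (4 * s))))" .
qed

lemma gaussian_integral:
 assumes s: "s > 0"
 shows "integrable lborel (%x::'a::euclidean_space. gaussian s x)"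
  and "(LBINT x. gaussian s (x::'a::euclidean_space)) = sqrt (pi / s) ^ DIM('a)"
proof -
 have "integrable lborel (%x::'a. norm (gaussian s x *R iexp (0 \<bullet> x)))" by (rule integrable_norm[OF gaussian_fourier(1)[OF s]])
 then show "integrable lborel (%x::'a::euclidean_space. gaussian s x)" by simp
 have "cor (LBINT x. gaussian s (x::'a)) = cor (sqrt (pi / s) ^ DIM('a))"
  using gaussian_fourier(2)[OF s, of "0::'a"] by (simp add: scaleR_conv_of_real)
 then show "(LBINT x. gaussian s (x::'a::euclidean_space)) = sqrt (pi / s) ^ DIM('a)" using of_real_eq_iff by blast
qed

section \<open>Functions of subgaussian growth\<close>

text \<open>Two classes of functions on which all Gaussian integrals converge. The first is closed under products and serves for
kernels and regularised functions; the second is all that is known of a function with finite weighted norm.\<close>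

definition subgaussian :: "(real^3 => 'b::real_normed_vector) => bool" where
 "subgaussian f \<longleftrightarrow> continuous_on UNIV f & (\<forall>\<delta>>0. \<exists>C. \<forall>x. norm (f x) <= C * exp (\<delta> * (norm x)^2))"

definition gauss_integrable :: "(real^3 => 'b::{banach, second_countable_topology}) => bool" where
 "gauss_integrable f \<longleftrightarrow> continuous_on UNIV f &
   (\<forall>\<delta>>0. integrable lborel (%x. gaussian \<delta> x *R f x))"

lemma subgaussianD:
 assumes "subgaussian f" "\<delta> > 0"
 obtains C where "C >= 0" "!!x. norm (f x) <= C * exp (\<delta> * (norm x)^2)"
proof -
 obtain C where C: "!!x. norm (f x) <= C * exp (\<delta> * (norm x)^2)" using assms unfolding subgaussian_def by blast
 have "C >= 0" using order_trans[OF norm_ge_zero C[of 0]] by simp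
 then show ?thesis using that C by blast
qed

lemma subgaussian_cont: "subgaussian f ==> continuous_on UNIV f" by (simp add: subgaussian_def)

lemma subgaussian_bound:
 assumes "subgaussian g" "continuous_on UNIV f" "!!x. norm (f x) <= K * norm (g x)"
 shows "subgaussian f" unfolding subgaussian_def
proof (intro conjI allI impI)
 fix \<delta> :: real assume "\<delta> > 0"
 then obtain C where C: "C >= 0" "!!x. norm (g x) <= C * exp (\<delta> * (norm x)^2)" using subgaussianD[OF assms(1)] by blast
 have "norm (f x) <= (\<bar>K\<bar> * C) * exp (\<delta> * (norm x)^2)" for x
 proof -
  have "norm (f x) <= \<bar>K\<bar> * norm (g x)" using assms(3)[of x] by (meson abs_ge_self mult_right_mono norm_ge_zero order_trans)
  also have "... <= \<bar>K\<bar> * (C * exp (\<delta> * (norm x)^2))" by (intro mult_left_mono C) auto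
  finally show ?thesis by (simp add: mult.assoc)
 qed
 then show "\<exists>C. \<forall>x. norm (f x) <= C * exp (\<delta> * (norm x)^2)" by blast
qed (rule assms)

lemma subgaussian_const [intro, simp]: "subgaussian (%x. c)" unfolding subgaussian_def
proof (intro conjI allI impI exI)
 fix \<delta> :: real and x :: "real^3" assume "\<delta> > 0"
 then have "1 <= exp (\<delta> * (norm x)^2)" by simp
 then show "norm c <= norm c * exp (\<delta> * (norm x)^2)" using mult_left_mono[of 1 _ "norm c"] by simp
qed auto

lemma subgaussian_add [intro]:
 assumes "subgaussian f" "subgaussian g" shows "subgaussian (%x. f x + g x)" unfolding subgaussian_def
proof (intro conjI allI impI)
 show "continuous_on UNIV (%x. f x + g x)" using assms by (auto intro!: continuous_intros simp: subgaussian_def)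
 fix \<delta> :: real assume "\<delta> > 0"
 then obtain C D where C: "!!x. norm (f x) <= C * exp (\<delta> * (norm x)^2)" and D: "!!x. norm (g x) <= D * exp (\<delta> * (norm x)^2)"
  using assms unfolding subgaussian_def by meson
 have "norm (f x + g x) <= (C + D) * exp (\<delta> * (norm x)^2)" for x
  using norm_triangle_ineq[of "f x" "g x"] C[of x] D[of x] by (simp add: distrib_right)
 then show "\<exists>C. \<forall>x. norm (f x + g x) <= C * exp (\<delta> * (norm x)^2)" by blast
qed

lemma subgaussian_scaleR [intro]:
 assumes f: "subgaussian f" and g: "subgaussian g" shows "subgaussian (%x. f x *R g x)" unfolding subgaussian_def
proof (intro conjI allI impI)
 show "continuous_on UNIV (%x. f x *R g x)" using assms by (auto intro!: continuous_intros simp: subgaussian_def)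
 fix \<delta> :: real assume "\<delta> > 0"
 then have d: "\<delta> / 2 > 0" by simp
 obtain C where C: "C >= 0" "!!x. norm (f x) <= C * exp (\<delta> / 2 * (norm x)^2)" using subgaussianD[OF f d] by blast
 obtain D where D: "D >= 0" "!!x. norm (g x) <= D * exp (\<delta> / 2 * (norm x)^2)" using subgaussianD[OF g d] by blast
 have "norm (f x *R g x) <= (C * D) * exp (\<delta> * (norm x)^2)" for x
 proof -
  have "norm (f x *R g x) <= (C * exp (\<delta> / 2 * (norm x)^2)) * (D * exp (\<delta> / 2 * (norm x)^2))"
   using C(2)[of x] D(2)[of x] C(1) D(1) unfolding norm_scaleR real_norm_def[symmetric] by (intro mult_mono) auto
  also have "... = (C * D) * (exp (\<delta> / 2 * (norm x)^2) * exp (\<delta> / 2 * (norm x)^2))" by simp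
  also have "exp (\<delta> / 2 * (norm x)^2) * exp (\<delta> / 2 * (norm x)^2) = exp (\<delta> * (norm x)^2)" by (simp flip: exp_add)
  finally show ?thesis .
 qed
 then show "\<exists>C. \<forall>x. norm (f x *R g x) <= C * exp (\<delta> * (norm x)^2)" by blast
qed

lemma subgaussian_linear:
 assumes "bounded_linear L" "subgaussian f" shows "subgaussian (%x. L (f x))"
proof -
 obtain K where K: "!!x. norm (L x) <= norm x * K" using bounded_linear.bounded[OF assms(1)] by blast
 show ?thesis
 proof (rule subgaussian_bound[OF assms(2), where K = K])
  show "continuous_on UNIV (%x. L (f x))" using bounded_linear.continuous_on[OF assms(1) subgaussian_cont[OF assms(2)]] .
 qed (use K in \<open>simp add: mult.commute\<close>)
qed

lemma subgaussian_mult [intro]: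
 fixes f g :: "_ => 'b::real_normed_algebra"
 assumes "subgaussian f" "subgaussian g" shows "subgaussian (%x. f x * g x)"
proof (rule subgaussian_bound[where K = 1])
 have *: "subgaussian (%x. norm (h x))" if "subgaussian h" for h :: "_ => 'b"
  by (rule subgaussian_bound[OF that, where K = 1]) (use that in \<open>auto intro!: continuous_intros simp: subgaussian_def\<close>)
 show "subgaussian (%x. norm (f x) *R norm (g x))" by (intro subgaussian_scaleR * assms)
qed (use assms norm_mult_ineq in \<open>auto intro!: continuous_intros simp: subgaussian_def\<close>)

lemma subgaussian_cmult [intro]: "subgaussian f ==> subgaussian (%x. c *R f x)" by (rule subgaussian_scaleR) auto

lemma subgaussian_minus [intro]: "subgaussian f ==> subgaussian (%x. - f x)" using subgaussian_cmult[of f "-1"] by simp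

lemma subgaussian_diff [intro]: "subgaussian f ==> subgaussian g ==> subgaussian (%x. f x - g x)"
 using subgaussian_add[of f "%x. - g x"] subgaussian_minus[of g] by simp

lemma subgaussian_power [intro]:
 fixes f :: "_ => 'b::real_normed_algebra_1"
 shows "subgaussian f ==> subgaussian (%x. f x ^ n)" by (induction n) auto

lemma subgaussian_sum [intro]: "(!!i. i \<in> I ==> subgaussian (f i)) ==> subgaussian (%x. \<Sum>i\<in>I. f i x)"
 by (induction I rule: infinite_finite_induct) auto

lemma subgaussian_norm [intro]: "subgaussian h ==> subgaussian (%x. norm (h x))"
 by (rule subgaussian_bound[where K = 1]) (auto intro!: continuous_intros simp: subgaussian_def)

lemma subgaussian_ident [intro, simp]: "subgaussian (%x. x)" unfolding subgaussian_def
proof (intro conjI allI impI exI)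
 fix \<delta> :: real and x :: "real^3" assume d: "\<delta> > 0"
 have "norm x <= 1 + (norm x)^2" using zero_le_power2[of "norm x - 1"] norm_ge_zero[of x] by (simp add: power2_diff del: norm_ge_zero)
 also have "... <= (1 + 1 / \<delta>) * (1 + \<delta> * (norm x)^2)" using d by (simp add: field_simps)
 also have "... <= (1 + 1 / \<delta>) * exp (\<delta> * (norm x)^2)" using d by (intro mult_left_mono exp_ge_add_one_self) auto
 finally show "norm x <= (1 + 1 / \<delta>) * exp (\<delta> * (norm x)^2)" .
qed auto

lemma subgaussian_component [intro, simp]: "subgaussian (%x. x $ i)" by (rule subgaussian_linear[OF bounded_linear_vec_nth subgaussian_ident])

lemmas subgaussian_intros = subgaussian_const subgaussian_ident subgaussian_component subgaussian_add
 subgaussian_diff subgaussian_minus subgaussian_mult subgaussian_scaleR subgaussian_power subgaussian_norm subgaussian_sum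

lemma gauss_integrableD:
 assumes "gauss_integrable f" "\<delta> > 0"
 shows "integrable lborel (%x. gaussian \<delta> x *R f x)" using assms by (simp add: gauss_integrable_def)

lemma gauss_integrable_cont: "gauss_integrable f ==> continuous_on UNIV f" by (simp add: gauss_integrable_def)

lemma gauss_integrable_meas [measurable_dest]: "gauss_integrable f ==> f \<in> borel_measurable borel"
 by (simp add: gauss_integrable_def borel_measurable_continuous_onI)

lemma subgaussian_meas [measurable_dest]: "subgaussian f ==> f \<in> borel_measurable borel"
 by (simp add: subgaussian_def borel_measurable_continuous_onI)

text \<open>Moves a Gaussian centred at \<open>x\<close> to the origin at the price of a growing factor in \<open>x\<close>; this gives the local uniformity in
\<open>x\<close> needed to differentiate Gaussian transforms.\<close>

lemma exp_shift_bound: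
 fixes x y :: "real^3"
 assumes "0 <= a" "a <= s"
 shows "gaussian s (y - x) <= exp (a * (norm x)^2) * gaussian (a / 2) y"
proof -
 have "(norm y)^2 <= (norm (y - x) + norm x)^2" using norm_triangle_ineq[of "y - x" x] by (intro power_mono) auto
 also have "... <= 2 * (norm (y - x))^2 + 2 * (norm x)^2" using zero_le_power2[of "norm (y - x) - norm x"] by (simp add: power2_sum power2_diff)
 finally have "a / 2 * (norm y)^2 <= a / 2 * (2 * (norm (y - x))^2 + 2 * (norm x)^2)" using assms by (intro mult_left_mono) auto
 moreover have "a * (norm (y - x))^2 <= s * (norm (y - x))^2" using assms by (intro mult_right_mono) auto
 ultimately have "- s * (norm (y - x))^2 <= a * (norm x)^2 + (- (a / 2) * (norm y)^2)" by (simp add: algebra_simps)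
 then show ?thesis by (simp flip: exp_add)
qed

lemma subgaussian_kernel_bound:
 assumes "subgaussian p" "a > 0" "a < s"
 obtains C where "C >= 0"
  "!!x y. norm (gaussian s (y - x) *R p (y - x)) <= C * exp (a * (norm x)^2) * gaussian (a / 2) y"
proof -
 have sa: "s - a > 0" using assms by simp
 obtain C where C: "C >= 0" "!!x. norm (p x) <= C * exp ((s - a) * (norm x)^2)" using subgaussianD[OF assms(1) sa] by blast
 have "norm (gaussian s (y - x) *R p (y - x)) <= C * exp (a * (norm x)^2) * gaussian (a / 2) y" for x y
 proof -
  have "norm (gaussian s (y - x) *R p (y - x)) <= gaussian s (y - x) * (C * exp ((s - a) * (norm (y - x))^2))" using C(2)[of "y - x"] by simp
  also have "... = C * (gaussian s (y - x) * exp ((s - a) * (norm (y - x))^2))" by simp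
  also have "gaussian s (y - x) * exp ((s - a) * (norm (y - x))^2) = gaussian a (y - x)" by (simp flip: exp_add add: algebra_simps)
  also have "C * gaussian a (y - x) <= C * (exp (a * (norm x)^2) * gaussian (a / 2) y)" using assms C by (intro mult_left_mono exp_shift_bound) auto
  finally show ?thesis by (simp add: mult.assoc)
 qed
 then show ?thesis using that C(1) by blast
qed

lemma subgaussian_imp_gauss_integrable:
 assumes "subgaussian f" shows "gauss_integrable f" unfolding gauss_integrable_def
proof (intro conjI allI impI)
 fix \<delta> :: real assume d: "\<delta> > 0"
 then obtain C where C: "C >= 0" "!!x y. norm (gaussian \<delta> (y - x) *R f (y - x)) <= C * exp (\<delta>/2 * (norm x)^2) * gaussian (\<delta> / 2 / 2) y"
  using subgaussian_kernel_bound[OF assms, of "\<delta>/2" \<delta>] by auto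
 have [measurable]: "f \<in> borel_measurable borel" using assms by measurable
 show "integrable lborel (%x. gaussian \<delta> x *R f x)"
 proof (rule Bintegrable_bound)
  show "integrable lborel (%x::real^3. C * gaussian (\<delta> / 4) x)" using gaussian_integral(1)[of "\<delta>/4", where 'a = "real^3"] d by simp
 qed (use C(2)[of _ 0] C(1) in auto)
qed (use assms in \<open>simp add: subgaussian_def\<close>)

lemma gauss_integrable_mult:
 assumes p: "subgaussian p" and f: "gauss_integrable f"
 shows "gauss_integrable (%x. p x *R f x)" unfolding gauss_integrable_def
proof (intro conjI allI impI)
 fix \<delta> :: real assume d: "\<delta> > 0"
 then obtain C where C: "C >= 0" "!!x y. norm (gaussian \<delta> (y - x) *R p (y - x)) <= C * exp (\<delta>/2 * (norm x)^2) * gaussian (\<delta> / 2 / 2) y"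
  using subgaussian_kernel_bound[OF p, of "\<delta>/2" \<delta>] by auto
 have [measurable]: "f \<in> borel_measurable borel" "p \<in> borel_measurable borel" using assms by measurable
 show "integrable lborel (%x. gaussian \<delta> x *R p x *R f x)"
 proof (rule Bintegrable_bound)
  show "integrable lborel (%x. C *R norm (gaussian (\<delta> / 4) x *R f x))"
   by (intro integrable_scaleR_right integrable_norm gauss_integrableD f) (use d in simp)
  show "AE x in lborel. norm (gaussian \<delta> x *R p x *R f x) <= norm (C *R norm (gaussian (\<delta> / 4) x *R f x))"
  proof (rule AE_I2)
   fix x
   have "norm (gaussian \<delta> x *R p x *R f x) = norm (gaussian \<delta> x *R p x) * norm (f x)" by simp
   also have "... <= (C * gaussian (\<delta> / 4) x) * norm (f x)" using C(2)[of x 0] by (intro mult_right_mono) auto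
   finally show "norm (gaussian \<delta> x *R p x *R f x) <= norm (C *R norm (gaussian (\<delta> / 4) x *R f x))" using C(1) by simp
  qed
 qed measurable
qed (use assms in \<open>auto intro!: continuous_intros simp: subgaussian_def gauss_integrable_def\<close>)

lemma gauss_integrable_add:
 assumes "gauss_integrable f" "gauss_integrable g" shows "gauss_integrable (%x. f x + g x)"
 using assms by (auto simp: gauss_integrable_def scaleR_add_right intro!: continuous_intros)

lemma gauss_integrable_cmult:
 assumes "gauss_integrable f" shows "gauss_integrable (%x. c *R f x)" using gauss_integrable_mult[OF subgaussian_const assms] .

section \<open>Gaussian transforms\<close>

text \<open>Correlation with a Gaussian times a kernel \<open>p\<close>. Polynomial kernels \<open>p\<close> are needed because derivatives in \<open>x\<close> and in \<open>s\<close>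
stay in this class and fall on the kernel, so that \<open>f\<close> need only be continuous.\<close>

definition gauss_transform :: "real => (real^3 => real) => (real^3 => complex) => real^3 => complex" where
 "gauss_transform s p f x = (LBINT y. (gaussian s (y - x) * p (y - x)) *R f y)"

abbreviation gauss_conv :: "real \<Rightarrow> (real^3 \<Rightarrow> complex) \<Rightarrow> real^3 \<Rightarrow> complex" where
 "gauss_conv s \<equiv> gauss_transform s (\<lambda>_. 1)"

lemma gauss_transform_integrable:
 assumes s: "s > 0" and p: "subgaussian p" and f: "gauss_integrable f"
 shows "integrable lborel (%y. (gaussian s (y - x) * p (y - x)) *R f y)"
proof -
 obtain C where C: "C >= 0" "!!x y. norm (gaussian s (y - x) *R p (y - x)) <= C * exp (s/2 * (norm x)^2) * gaussian (s / 2 / 2) y"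
  using subgaussian_kernel_bound[OF p, of "s/2" s] s by auto
 have [measurable]: "f \<in> borel_measurable borel" "p \<in> borel_measurable borel" using assms by measurable
 show ?thesis
 proof (rule Bintegrable_bound)
  show "integrable lborel (%y. (C * exp (s/2 * (norm x)^2)) *R norm (gaussian (s / 4) y *R f y))"
   by (intro integrable_scaleR_right integrable_norm gauss_integrableD f) (use s in simp)
  show "AE y in lborel. norm ((gaussian s (y - x) * p (y - x)) *R f y) <= norm ((C * exp (s/2 * (norm x)^2)) *R norm (gaussian (s / 4) y *R f y))"
  proof (rule AE_I2)
   fix y
   have "norm ((gaussian s (y - x) * p (y - x)) *R f y) <= (C * exp (s/2 * (norm x)^2) * gaussian (s / 4) y) * norm (f y)"
    using C(2)[of y x] unfolding norm_scaleR by (intro mult_right_mono) (auto simp: abs_mult)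
   then show "norm ((gaussian s (y - x) * p (y - x)) *R f y) <= norm ((C * exp (s/2 * (norm x)^2)) *R norm (gaussian (s / 4) y *R f y))"
    using C(1) by (simp add: mult.assoc)
  qed
 qed measurable
qed

lemma gauss_transform_linear:
 assumes s: "s > 0" and p: "subgaussian p" "subgaussian q" and f: "gauss_integrable f"
 shows "gauss_transform s (%z. a * p z + b * q z) f x = a *R gauss_transform s p f x + b *R gauss_transform s q f x"
proof -
 have "gauss_transform s (%z. a * p z + b * q z) f x = (LBINT y. a *R ((gaussian s (y - x) * p (y - x)) *R f y)
    + b *R ((gaussian s (y - x) * q (y - x)) *R f y))" unfolding gauss_transform_def by (intro Bintegral_cong refl) (simp add: algebra_simps)
 also have "... = a *R gauss_transform s p f x + b *R gauss_transform s q f x" unfolding gauss_transform_def by (subst Bintegral_add)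
    (simp_all only: integral_scaleR_right integrable_scaleR_right gauss_transform_integrable[OF s _ f] p)
 finally show ?thesis .
qed

lemma gauss_transform_cmult:
 assumes s: "s > 0" and p: "subgaussian p" and f: "gauss_integrable f"
 shows "gauss_transform s (%z. a * p z) f x = a *R gauss_transform s p f x" using gauss_transform_linear[OF s p p f, of a 0] by simp

lemma gauss_transform_sum:
 assumes s: "s > 0" and p: "!!i. i \<in> I ==> subgaussian (p i)" and f: "gauss_integrable f"
 shows "gauss_transform s (%z. \<Sum>i\<in>I. p i z) f x = (\<Sum>i\<in>I. gauss_transform s (p i) f x)"
proof -
 have "gauss_transform s (%z. \<Sum>i\<in>I. p i z) f x = (LBINT y. (\<Sum>i\<in>I. (gaussian s (y - x) * p i (y - x)) *R f y))"
  unfolding gauss_transform_def by (simp add: sum_distrib_left scaleR_sum_left)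
 also have "... = (\<Sum>i\<in>I. gauss_transform s (p i) f x)"
  unfolding gauss_transform_def by (intro Bintegral_sum gauss_transform_integrable s p f)
 finally show ?thesis .
qed

lemma gauss_transform_add_fun:
 assumes s: "s > 0" and p: "subgaussian p" and f: "gauss_integrable f" "gauss_integrable g"
 shows "gauss_transform s p (%y. a *R f y + b *R g y) x = a *R gauss_transform s p f x + b *R gauss_transform s p g x"
proof -
 have "gauss_transform s p (%y. a *R f y + b *R g y) x = (LBINT y. a *R ((gaussian s (y - x) * p (y - x)) *R f y)
    + b *R ((gaussian s (y - x) * p (y - x)) *R g y))" unfolding gauss_transform_def by (intro Bintegral_cong refl) (simp add: algebra_simps)
 also have "... = a *R gauss_transform s p f x + b *R gauss_transform s p g x" unfolding gauss_transform_def by (subst Bintegral_add)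
    (simp_all only: integral_scaleR_right integrable_scaleR_right gauss_transform_integrable[OF s p] f)
 finally show ?thesis .
qed

lemma has_derivative_gauss_kernel:
 fixes p :: "real^3 => real"
 assumes "!!z. (p has_derivative (%h. SUM j:UNIV. h $ j * dp j z)) (at z)"
 shows "((%x. gaussian s (y - x) * p (y - x)) has_derivative
   (%h. SUM j:UNIV. h $ j * (gaussian s (y - x) * (2 * s * (y - x) $ j * p (y - x) - dp j (y - x))))) (at x)"
proof -
 have p': "((%x. p (y - x)) has_derivative (%h. SUM j:UNIV. (- h) $ j * dp j (y - x))) (at x)"
  by (rule has_derivative_compose[of "%x. y - x" uminus x UNIV p, OF _ assms, unfolded o_def])
    (auto intro!: derivative_eq_intros)
 have n': "((%x. (y - x) \<bullet> (y - x)) has_derivative (%h. - 2 * ((y - x) \<bullet> h))) (at x)"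
  by (auto intro!: derivative_eq_intros simp: inner_commute)
 have "((%x. exp (- s * ((y - x) \<bullet> (y - x))) * p (y - x)) has_derivative
   (%h. exp (- s * ((y - x) \<bullet> (y - x))) * (SUM j:UNIV. (- h) $ j * dp j (y - x)) + (exp (- s * ((y - x) \<bullet> (y - x))) * (- s * (- 2 * ((y - x) \<bullet> h)))) * p (y - x))) (at x)"
  by (rule derivative_eq_intros has_derivative_exp has_derivative_mult_right n' p' refl | simp)+ (auto simp: inner_commute algebra_simps fun_eq_iff)
 moreover have "(%h. exp (- s * ((y - x) \<bullet> (y - x))) * (SUM j:UNIV. (- h) $ j * dp j (y - x)) + (exp (- s * ((y - x) \<bullet> (y - x))) * (- s * (- 2 * ((y - x) \<bullet> h)))) * p (y - x))
  = (%h. SUM j:UNIV. h $ j * (exp (- s * ((y - x) \<bullet> (y - x))) * (2 * s * (y - x) $ j * p (y - x) - dp j (y - x))))"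
  by (simp add: inner_vec_def fun_eq_iff sum_3 algebra_simps)
 ultimately show ?thesis by (simp add: power2_norm_eq_inner)
qed

lemma gauss_transform_has_derivative:
 assumes s: "s > 0" and p: "subgaussian p" and dp: "!!j. subgaussian (dp j)"
  and der: "!!z. (p has_derivative (%h. SUM j:UNIV. h $ j * dp j z)) (at z)"
  and f: "gauss_integrable f"
 shows "(gauss_transform s p f has_derivative
   (%h. SUM j:UNIV. h $ j *R gauss_transform s (%z. 2 * s * z $ j * p z - dp j z) f x)) (at x)"
proof -
 define q where "q j z = 2 * s * z $ j * p z - dp j z" for j z
 have q: "subgaussian (q j)" for j unfolding q_def by (intro subgaussian_intros p dp)
 have [measurable]: "f \<in> borel_measurable borel" "p \<in> borel_measurable borel" "q j \<in> borel_measurable borel" for j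
  using p f q by measurable
 define f' where "f' x y h = (SUM j:UNIV. h $ j *R ((gaussian s (y - x) * q j (y - x)) *R f y))" for x y :: "real^3" and h :: "real^3"
 have "\<exists>C\<ge>0. \<forall>x y. norm (gaussian s (y - x) *R q j (y - x)) <= C * exp (s/2 * (norm x)^2) * gaussian (s / 2 / 2) y" for j
  using subgaussian_kernel_bound[OF q[of j], of "s/2" s] s by (metis half_gt_zero field_sum_of_halves less_add_same_cancel1)
 then obtain C where C: "!!j. C j >= 0" "!!j x y. norm (gaussian s (y - x) *R q j (y - x)) <= C j * exp (s/2 * (norm x)^2) * gaussian (s / 2 / 2) y"
  by metis
 define R where "R = norm x + 1"
 define B where "B y = (SUM j:UNIV. C j * exp (s/2 * R^2) * norm (gaussian (s / 4) y *R f y))" for y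
 have "((%x. \<integral>y. (gaussian s (y - x) * p (y - x)) *R f y \<partial>lborel) has_derivative (%h. \<integral>y. f' x y h \<partial>lborel)) (at x)"
 proof (rule has_derivative_integral(1)[where r = 1 and B = B])
  fix x' y assume "x' \<in> ball x 1"
  have "((%x. (gaussian s (y - x) * p (y - x)) *R f y) has_derivative (%h. (SUM j:UNIV. h $ j * (gaussian s (y - x') * q j (y - x'))) *R f y)) (at x')"
   unfolding q_def by (intro has_derivative_scaleR_left has_derivative_gauss_kernel der)
  then show "((%x. (gaussian s (y - x) * p (y - x)) *R f y) has_derivative f' x' y) (at x')"
   unfolding f'_def by (simp add: scaleR_sum_left mult.assoc)
 next
  fix x' y h :: "real^3" assume x': "x' \<in> ball x 1"
  have "norm x' <= R" using x' norm_triangle_ineq[of "x' - x" x] by (simp add: R_def dist_norm norm_minus_commute)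
  then have "s/2 * (norm x')^2 <= s/2 * R^2" using s by (intro mult_left_mono power_mono) auto
  then have e: "exp (s/2 * (norm x')^2) <= exp (s/2 * R^2)" by (simp only: exp_le_cancel_iff)
  then have le: "norm (gaussian s (y - x') * q j (y - x')) <= C j * exp (s/2 * R^2) * gaussian (s / 4) y" for j
   using mult_right_mono[OF mult_left_mono[OF e C(1)[of j]], of "gaussian (s / 4) y"]
   by (intro order_trans[OF C(2)[of y x' j, unfolded real_scaleR_def]]) simp
  have "norm (f' x' y h) <= (SUM j:UNIV. norm h * ((C j * exp (s/2 * R^2) * gaussian (s / 4) y) * norm (f y)))" unfolding f'_def
  proof (intro order_trans[OF norm_sum] sum_mono)
   fix j :: 3
   have "\<bar>h $ j\<bar> * (norm (gaussian s (y - x') * q j (y - x')) * norm (f y))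
    <= norm h * ((C j * exp (s/2 * R^2) * gaussian (s / 4) y) * norm (f y))" by (intro mult_mono le component_le_norm_cart mult_right_mono) auto
   then show "norm (h $ j *R ((gaussian s (y - x') * q j (y - x')) *R f y)) <= norm h * ((C j * exp (s/2 * R^2) * gaussian (s / 4) y) * norm (f y))"
    by (simp only: norm_scaleR real_norm_def)
  qed
  also have "... = B y * norm h" by (simp add: B_def sum_distrib_right sum_distrib_left mult_ac)
  finally show "norm (f' x' y h) <= B y * norm h" .
 next
  show "integrable lborel B" unfolding B_def by (intro Bintegrable_sum integrable_mult_right integrable_norm gauss_integrableD f) (use s in simp)
  show "(%y. f' x y h) \<in> borel_measurable lborel" for h unfolding f'_def by measurable
 qed (use gauss_transform_integrable[OF s p f] in auto)
 moreover have "(LBINT y. f' x y h) = (SUM j:UNIV. h $ j *R gauss_transform s (q j) f x)" for h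
  unfolding f'_def gauss_transform_def by (subst Bintegral_sum)
    (simp_all only: integral_scaleR_right integrable_scaleR_right gauss_transform_integrable[OF s q f])
 ultimately show ?thesis by (simp add: gauss_transform_def[abs_def] q_def)
qed

lemma gauss_transform_subgaussian:
 assumes s: "s > 0" and p: "subgaussian p" and dp: "!!j. subgaussian (dp j)"
  and der: "!!z. (p has_derivative (%h. SUM j:UNIV. h $ j * dp j z)) (at z)"
  and f: "gauss_integrable f"
 shows "subgaussian (gauss_transform s p f)" unfolding subgaussian_def
proof (intro conjI allI impI)
 show "continuous_on UNIV (gauss_transform s p f)"
  by (intro continuous_at_imp_continuous_on ballI has_derivative_continuous[OF gauss_transform_has_derivative[OF assms]])
 fix \<delta> :: real assume d: "\<delta> > 0"
 define a where "a = min \<delta> (s / 2)"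
 have a: "a > 0" "a < s" "a <= \<delta>" using d s by (auto simp: a_def)
 obtain C where C: "C >= 0" "!!x y. norm (gaussian s (y - x) *R p (y - x)) <= C * exp (a * (norm x)^2) * gaussian (a / 2) y"
  using subgaussian_kernel_bound[OF p a(1,2)] by auto
 have int: "integrable lborel (%y. norm (gaussian (a / 2) y *R f y))" by (intro integrable_norm gauss_integrableD f) (use a in simp)
 have "norm (gauss_transform s p f x) <= (C * (LBINT y. norm (gaussian (a / 2) y *R f y))) * exp (\<delta> * (norm x)^2)" for x
 proof -
  have "norm (gauss_transform s p f x) <= (LBINT y. norm ((gaussian s (y - x) * p (y - x)) *R f y))"
   unfolding gauss_transform_def by (rule integral_norm_bound)
  also have "... <= (LBINT y. (C * exp (a * (norm x)^2)) * norm (gaussian (a / 2) y *R f y))"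
  proof (rule integral_mono)
   fix y
   have "norm ((gaussian s (y - x) * p (y - x)) *R f y) <= (C * exp (a * (norm x)^2) * gaussian (a / 2) y) * norm (f y)"
    using C(2)[of y x] unfolding norm_scaleR by (intro mult_right_mono) (auto simp: abs_mult)
   then show "norm ((gaussian s (y - x) * p (y - x)) *R f y) <= (C * exp (a * (norm x)^2)) * norm (gaussian (a / 2) y *R f y)"
    by (simp add: mult.assoc)
  qed (intro integrable_norm integrable_mult_right int gauss_transform_integrable[OF s p f])+
  also have "... = (C * (LBINT y. norm (gaussian (a / 2) y *R f y))) * exp (a * (norm x)^2)" by (simp only: integral_mult_right_zero mult_ac)
  also have "... <= (C * (LBINT y. norm (gaussian (a / 2) y *R f y))) * exp (\<delta> * (norm x)^2)"
   using a C by (intro mult_left_mono) (auto intro!: mult_nonneg_nonneg mult_right_mono)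
  finally show ?thesis .
 qed
 then show "\<exists>C. \<forall>x. norm (gauss_transform s p f x) <= C * exp (\<delta> * (norm x)^2)" by blast
qed

lemma gauss_transform_has_derivative_scale:
 assumes s: "s > 0" and p: "subgaussian p" and f: "gauss_integrable f"
 shows "((%s. gauss_transform s p f x) has_vector_derivative - gauss_transform s (%z. (norm z)^2 * p z) f x) (at s)"
proof -
 have q: "subgaussian (%z. (norm z)^2 * p z)" by (intro subgaussian_intros p)
 have s2: "s / 2 > 0" using s by simp
 have [measurable]: "f \<in> borel_measurable borel" "p \<in> borel_measurable borel" using p f by measurable
 have "((%s. \<integral>y. (gaussian s (y - x) * p (y - x)) *R f y \<partial>lborel) has_derivative
   (%h. \<integral>y. h *R - ((gaussian s (y - x) * ((norm (y - x))^2 * p (y - x))) *R f y) \<partial>lborel)) (at s)"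
 proof (rule has_derivative_integral(1)[where r = "s / 2" and B = "%y. norm ((gaussian (s / 2) (y - x) * ((norm (y - x))^2 * p (y - x))) *R f y)"])
  fix s' y assume "s' \<in> ball s (s / 2)"
  show "((%s. (gaussian s (y - x) * p (y - x)) *R f y) has_derivative (%h. h *R - ((gaussian s' (y - x) * ((norm (y - x))^2 * p (y - x))) *R f y))) (at s')"
   by (auto intro!: derivative_eq_intros simp: algebra_simps)
 next
  fix s' h y assume "s' \<in> ball s (s / 2)"
  then have "\<bar>s - s'\<bar> < s / 2" by (simp add: dist_real_def)
  then have "s' > s / 2" by linarith
  then have "s / 2 * (norm (y - x))^2 <= s' * (norm (y - x))^2" by (intro mult_right_mono) auto
  then have "gaussian s' (y - x) <= gaussian (s / 2) (y - x)" by simp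
  then show "norm (h *R - ((gaussian s' (y - x) * ((norm (y - x))^2 * p (y - x))) *R f y)) <= norm ((gaussian (s / 2) (y - x) * ((norm (y - x))^2 * p (y - x))) *R f y) * norm h"
   by (simp add: abs_mult mult.assoc mult_ac mult_left_mono mult_right_mono)
 next
  fix s' assume "s' \<in> ball s (s / 2)"
  then have "\<bar>s - s'\<bar> < s / 2" by (simp add: dist_real_def)
  then have "s' > 0" using s by linarith
  then show "integrable lborel (%y. (gaussian s' (y - x) * p (y - x)) *R f y)" by (rule gauss_transform_integrable[OF _ p f])
 next
  show "integrable lborel (%y. norm ((gaussian (s / 2) (y - x) * ((norm (y - x))^2 * p (y - x))) *R f y))"
   by (rule integrable_norm[OF gauss_transform_integrable[OF s2 q f]])
 qed (use s in auto)
 then show ?thesis unfolding has_vector_derivative_def gauss_transform_def integral_scaleR_right by (simp only: Bochner_Integration.integral_minus)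
qed

text \<open>Normalised Gaussians are an approximate identity. Outside a ball of radius \<open>d\<close> the kernel with \<open>s > 1\<close> is at most
\<open>exp (- (s - 1) d^2)\<close> times the one with \<open>s = 1\<close>.\<close>

lemma gauss_transform_limit:
 assumes f: "gauss_integrable f"
 shows "((%s. (1 / sqrt (pi / s) ^ 3) *R gauss_conv s f x) \<longlongrightarrow> f x) at_top"
proof (rule tendstoI)
 fix e :: real assume e: "e > 0"
 have "isCont f x" using gauss_integrable_cont[OF f] continuous_on_eq_continuous_at by blast
 then obtain d where d: "d > 0" "!!y. norm (y - x) < d ==> norm (f y - f x) < e / 2"
  using e unfolding continuous_at_eps_delta dist_norm by (metis half_gt_zero)
 let ?w = "%y. gaussian 1 (y - x)"
 have one: "subgaussian (%_. 1::real)" by simp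
 have fx: "gauss_integrable (%y. f x)" by (rule subgaussian_imp_gauss_integrable) simp
 have g: "gauss_integrable (%y. f y - f x)" using gauss_integrable_add[OF f gauss_integrable_cmult[OF fx, of "-1"]] by simp
 have w_int: "integrable lborel (%y. (?w y * 1) *R (f y - f x))" by (rule gauss_transform_integrable[OF _ one g]) simp
 \<comment> \<open>The mass outside the ball of radius d is measured by the fixed kernel with parameter 1.\<close>
 define K where "K = (LBINT y. norm ((?w y * 1) *R (f y - f x)))"
 have K0: "K >= 0" by (simp add: K_def)
 have norm1: "integrable lborel (%y. gaussian s (y - x))" "(LBINT y. gaussian s (y - x)) = sqrt (pi / s) ^ 3" if "s > 0" for s
 proof -
  show "integrable lborel (%y. gaussian s (y - x))" using integrable_shift[OF gaussian_integral(1)[OF that], of "-x"] by simp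
  show "(LBINT y. gaussian s (y - x)) = sqrt (pi / s) ^ 3"
   using integral_shift[of "%y::real^3. gaussian s y" "-x"] gaussian_integral(2)[OF that, where 'a = "real^3"] by simp
 qed
 have bound: "norm ((1 / sqrt (pi / s) ^ 3) *R gauss_conv s f x - f x) <= e / 2 + K * (exp (- (s - 1) * d^2) / sqrt (pi / s) ^ 3)" if s: "s > 1" for s
 proof -
  have s0: "s > 0" and n: "sqrt (pi / s) ^ 3 > 0" using s by auto
  have "gauss_conv s (%y. f y - f x) x = gauss_conv s f x - gauss_conv s (%_. f x) x" using gauss_transform_add_fun[OF s0 one f fx, of 1 "-1"] by simp
  also have "gauss_conv s (%_. f x) x = sqrt (pi / s) ^ 3 *R f x" using norm1[OF s0] by (simp add: gauss_transform_def)
  finally have eq: "(1 / sqrt (pi / s) ^ 3) *R gauss_conv s f x - f x = (1 / sqrt (pi / s) ^ 3) *R gauss_conv s (%y. f y - f x) x"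
   using n s0 by (simp only: scaleR_diff_right scaleR_scaleR) simp
  have "norm (gauss_conv s (%y. f y - f x) x) <= (LBINT y. (e / 2) * gaussian s (y - x) + exp (- (s - 1) * d^2) * norm ((?w y * 1) *R (f y - f x)))"
   unfolding gauss_transform_def
  proof (rule order_trans[OF integral_norm_bound integral_mono])
   fix y
   show "norm ((gaussian s (y - x) * 1) *R (f y - f x)) <= (e / 2) * gaussian s (y - x) + exp (- (s - 1) * d^2) * norm ((?w y * 1) *R (f y - f x))"
   proof (cases "norm (y - x) < d")
    case True
    have "norm ((gaussian s (y - x) * 1) *R (f y - f x)) <= gaussian s (y - x) * (e / 2)" using d(2)[OF True] by simp
    then show ?thesis by (smt (verit, best) exp_ge_zero mult.commute mult_nonneg_nonneg norm_ge_zero)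
   next
    case False
    then have "d^2 <= (norm (y - x))^2" using d(1) by (intro power_mono) auto
    then have "(s - 1) * d^2 <= (s - 1) * (norm (y - x))^2" using s by (intro mult_left_mono) auto
    then have "- s * (norm (y - x))^2 <= - (s - 1) * d^2 + - 1 * (norm (y - x))^2" by (simp add: algebra_simps)
    then have "gaussian s (y - x) <= exp (- (s - 1) * d^2) * ?w y" by (simp flip: exp_add)
    then have "gaussian s (y - x) * norm (f y - f x) <= (exp (- (s - 1) * d^2) * ?w y) * norm (f y - f x)" by (rule mult_right_mono) simp
    moreover have "0 <= (e / 2) * gaussian s (y - x)" using e by simp
    ultimately show ?thesis by (simp add: mult.assoc)
   qed
  next
   show "integrable lborel (%y. norm ((gaussian s (y - x) * 1) *R (f y - f x)))" by (rule integrable_norm[OF gauss_transform_integrable[OF s0 one g]])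
   show "integrable lborel (%y. (e / 2) * gaussian s (y - x) + exp (- (s - 1) * d^2) * norm ((?w y * 1) *R (f y - f x)))"
    by (intro Bintegrable_add integrable_mult_right norm1 s0 integrable_norm w_int)
  qed
  also have "... = (e / 2) * sqrt (pi / s) ^ 3 + exp (- (s - 1) * d^2) * K" unfolding K_def norm1(2)[OF s0, symmetric] by (subst Bintegral_add)
     (simp_all only: integrable_mult_right norm1(1)[OF s0] integrable_norm[OF w_int] integral_mult_right_zero)
  finally have "norm (gauss_conv s (%y. f y - f x) x) / sqrt (pi / s) ^ 3 <= ((e / 2) * sqrt (pi / s) ^ 3 + exp (- (s - 1) * d^2) * K) / sqrt (pi / s) ^ 3"
   using n by (intro divide_right_mono) auto
  then show ?thesis unfolding eq using n s0 by (simp add: add_divide_distrib mult.commute del: real_sqrt_divide)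
 qed
 have "((%s. K * (exp (- (s - 1) * d^2) / sqrt (pi / s) ^ 3)) \<longlongrightarrow> 0) at_top" using d(1) by real_asymp
 then have "\<forall>\<^sub>F s in at_top. K * (exp (- (s - 1) * d^2) / sqrt (pi / s) ^ 3) < e / 2" using e by (intro order_tendstoD) auto
 then show "\<forall>\<^sub>F s in at_top. dist ((1 / sqrt (pi / s) ^ 3) *R gauss_conv s f x) (f x) < e" using eventually_gt_at_top[of 1]
 proof eventually_elim
  case (elim s)
  then show ?case unfolding dist_norm using bound[of s] by linarith
 qed
qed

section \<open>Helmholtz functions and the dilation identity\<close>

text \<open>The numerical factor is the one by which convolution with a Gaussian acts on plane waves with wave number \<open>k\<close>. This
substitute for the Helmholtz equation asks for no derivatives of \<open>f\<close>.\<close>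

definition reproducing :: "real => (real^3 => complex) => bool" where
 "reproducing k f \<longleftrightarrow> gauss_integrable f &
   (\<forall>s>0. \<forall>x. gauss_conv s f x = (sqrt (pi / s) ^ 3 * exp (- (k^2 / (4 * s)))) *R f x)"

text \<open>\<open>f\<close> solves the Helmholtz equation, with explicit gradient \<open>p\<close> and Hessian \<open>q\<close>.\<close>

definition helmholtz_jet ::
 "real => (real^3 => 'b::real_normed_vector) => (3 => real^3 => 'b) => (3 => 3 => real^3 => 'b) => bool" where
 "helmholtz_jet k f p q \<longleftrightarrow>
   subgaussian f & (\<forall>j. subgaussian (p j)) & (\<forall>i j. subgaussian (q i j)) &
   (\<forall>x. (f has_derivative (%h. SUM j:UNIV. h $ j *R p j x)) (at x)) &
   (\<forall>j x. (p j has_derivative (%h. SUM i:UNIV. h $ i *R q i j x)) (at x)) &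
   (\<forall>i j. q i j = q j i) &
   (\<forall>x. (SUM j:UNIV. q j j x) = - (k^2 *R f x))"

lemma has_derivative_component_sum: "((%z::real^3. z $ i) has_derivative (%h. SUM j:UNIV. h $ j * (if j = i then 1 else 0))) (at z)"
proof -
 have "((%z::real^3. z $ i) has_derivative (%h. h $ i)) (at z)" by (rule bounded_linear_imp_has_derivative) (rule bounded_linear_vec_nth)
 moreover have "(SUM j:UNIV. h $ j * (if j = i then 1 else 0)) = h $ i" for h :: "real^3" using exhaust_3[of i] by (auto simp: sum_3)
 ultimately show ?thesis by simp
qed

lemma norm_sq_vec3: "(norm (z::real^3))^2 = (SUM j:UNIV. (z $ j)^2)" by (simp add: norm_vec_def L2_set_def sum_nonneg)

text \<open>As \<open>f\<close> is a multiple of its own Gaussian transform, it inherits smoothness and growth bounds from the kernel. Comparing the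
derivative in \<open>s\<close> of the reproducing identity with the Laplacian of the kernel gives the Helmholtz equation.\<close>

lemma reproducing_jet:
 assumes "reproducing k f"
 obtains p q where "helmholtz_jet k f p q"
proof -
 have f: "gauss_integrable f" and rep: "!!s x. s > 0 ==> gauss_conv s f x = (sqrt (pi / s) ^ 3 * exp (- (k^2 / (4 * s)))) *R f x"
  using assms by (auto simp: reproducing_def)
 define E where "E = exp (k^2 / 4) / sqrt pi ^ 3"
 define p1 :: "3 => real^3 => real" where "p1 j z = 2 * z $ j" for j z
 define p2 :: "3 => 3 => real^3 => real" where "p2 i j z = 2 * 1 * z $ i * (2 * z $ j) - 2 * (if i = j then 1 else 0)" for i j z
 define p where "p j x = E *R gauss_transform 1 (p1 j) f x" for j x
 define q where "q i j x = E *R gauss_transform 1 (p2 i j) f x" for i j x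
 have E1: "E * (sqrt (pi / 1) ^ 3 * exp (- (k^2 / (4 * 1)))) = 1" by (simp add: E_def exp_minus)
 have f_eq: "f x = E *R gauss_conv 1 f x" for x
  using rep[of 1 x] E1 by (simp add: E_def exp_minus)
 have sg: "subgaussian (%_. 1::real)" "subgaussian (%_. 0::real)" "!!j. subgaussian (p1 j)" "!!i j. subgaussian (p2 i j)"
  "!!i j. subgaussian (%z::real^3. 2 * (if i = j then 1 else 0) :: real)" unfolding p1_def p2_def by (intro subgaussian_intros)+
 have d0: "((%_. 1::real) has_derivative (%h. \<Sum>j\<in>(UNIV::3 set). h $ j * 0)) (at z)" for z :: "real^3" by simp
 have d1: "(p1 j has_derivative (%h. \<Sum>i\<in>(UNIV::3 set). h $ i * (2 * (if i = j then 1 else 0)))) (at z)" for j z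
 proof -
  have "((%z. 2 * z $ j) has_derivative (%h. 2 * (\<Sum>i\<in>(UNIV::3 set). h $ i * (if i = j then 1 else 0)))) (at z)"
   by (intro has_derivative_mult_right has_derivative_component_sum)
  then show ?thesis unfolding p1_def sum_distrib_left by (simp only: mult.left_commute)
 qed
 have df: "(gauss_conv 1 f has_derivative (%h. SUM j:UNIV. h $ j *R gauss_transform 1 (p1 j) f x)) (at x)" for x
  using gauss_transform_has_derivative[OF zero_less_one sg(1) sg(2) d0 f] unfolding p1_def by simp
 have dp: "(gauss_transform 1 (p1 j) f has_derivative (%h. SUM i:UNIV. h $ i *R gauss_transform 1 (p2 i j) f x)) (at x)" for j x
  using gauss_transform_has_derivative[OF zero_less_one sg(3)[of j] sg(5) d1 f] unfolding p2_def p1_def by simp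
 have d2: "\<exists>r. (\<forall>l. subgaussian (r l)) & (\<forall>z. (p2 i j has_derivative (%h. \<Sum>l\<in>(UNIV::3 set). h $ l * r l z)) (at z))" for i j
 proof (intro exI conjI allI)
  let ?r = "%l (z::real^3). 4 * (z $ i * (if l = j then 1 else 0)) + 4 * ((if l = i then 1 else 0) * z $ j)"
  show "subgaussian (?r l)" for l by (intro subgaussian_intros)
  fix z :: "real^3"
  have "((%z. (4::real) * (z $ i * z $ j) - 2 * (if i = j then 1 else 0)) has_derivative
   (%h. 4 * (z $ i * (\<Sum>l\<in>(UNIV::3 set). h $ l * (if l = j then 1 else 0)) + (\<Sum>l\<in>(UNIV::3 set). h $ l * (if l = i then 1 else 0)) * z $ j) - 0)) (at z)"
   by (intro has_derivative_diff has_derivative_const has_derivative_mult_right has_derivative_mult has_derivative_component_sum)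
  then show "(p2 i j has_derivative (%h. \<Sum>l\<in>(UNIV::3 set). h $ l * ?r l z)) (at z)"
   unfolding p2_def by (simp add: sum_distrib_left sum_distrib_right algebra_simps sum.distrib)
 qed
 have sub_q: "subgaussian (gauss_transform 1 (p2 i j) f)" for i j
  using d2[of i j] gauss_transform_subgaussian[OF zero_less_one sg(4)[of i j] _ _ f] by blast
 let ?c = "sqrt pi ^ 3 * exp (- (k^2 / 4)) * (k^2 / 4 - 3 / 2)"
 have trace: "(SUM j:UNIV. q j j x) = - (k^2 *R f x)" for x
 proof -
  let ?n = "%s. sqrt (pi / s) ^ 3 * exp (- (k^2 / (4 * s)))"
  have n': "(?n has_real_derivative ?c) (at 1)"
  proof -
   have "((%s. (sqrt (pi / s)) ^ 3 * exp (- (k^2 / (4 * s)))) has_real_derivative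
     (real 3 * (sqrt (pi / 1)) ^ 2 * ((- (pi / 1^2)) * (inverse (sqrt (pi / 1)) / 2))) * exp (- (k^2 / (4 * 1))) + (exp (- (k^2 / (4 * 1))) * (k^2 / 4)) * (sqrt (pi / 1)) ^ 3) (at 1)"
    by (auto intro!: derivative_eq_intros simp: power2_eq_square)
   moreover have "(real 3 * (sqrt (pi / 1)) ^ 2 * ((- (pi / 1^2)) * (inverse (sqrt (pi / 1)) / 2))) * exp (- (k^2 / (4 * 1))) + (exp (- (k^2 / (4 * 1))) * (k^2 / 4)) * (sqrt (pi / 1)) ^ 3
     = sqrt pi ^ 3 * exp (- (k^2 / 4)) * (k^2 / 4 - 3 / 2)"
   proof -
    have "pi * inverse (sqrt pi) = sqrt pi" by (simp add: real_div_sqrt flip: divide_inverse)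
    then have "(sqrt pi)^2 * (pi * inverse (sqrt pi)) = sqrt pi ^ 3" by (simp add: power3_eq_cube power2_eq_square)
    then show ?thesis by (simp add: algebra_simps)
   qed
   ultimately show ?thesis by simp
  qed
  have "((%s. ?n s *R f x) has_vector_derivative ?c *R f x) (at 1)"
   using has_vector_derivative_scaleR[OF n' has_vector_derivative_const[of "f x" "at 1"]] by simp
  then have "((%s. gauss_conv s f x) has_vector_derivative ?c *R f x) (at 1)"
   by (rule has_vector_derivative_transform_within_open[where S = "{0<..}"]) (auto simp: rep)
  moreover have "((%s. gauss_conv s f x) has_vector_derivative - gauss_transform 1 (%z. (norm z)^2 * 1) f x) (at 1)"
   by (rule gauss_transform_has_derivative_scale[OF zero_less_one sg(1) f])
  ultimately have m: "- gauss_transform 1 (%z. (norm z)^2) f x = ?c *R f x"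
   using vector_derivative_unique_at by fastforce
  have nsub: "subgaussian (%z. (norm z)^2)" by (intro subgaussian_intros)
  have "(SUM j:UNIV. q j j x) = E *R gauss_transform 1 (%z. SUM j:UNIV. p2 j j z) f x"
   unfolding q_def by (subst gauss_transform_sum[OF zero_less_one sg(4) f]) (simp add: scaleR_sum_right)
  also have "(%z. SUM j:UNIV. p2 j j z) = (%z. 4 * (norm z)^2 + (-6) * 1)"
   by (rule ext) (simp add: p2_def sum_3 norm_sq_vec3 power2_eq_square[of "_ $ _"])
  also have "E *R gauss_transform 1 (%z. 4 * (norm z)^2 + (-6) * 1) f x = E *R (4 *R gauss_transform 1 (%z. (norm z)^2) f x + (-6) *R gauss_conv 1 f x)"
   by (subst gauss_transform_linear[OF zero_less_one nsub sg(1) f]) simp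
  also have "gauss_transform 1 (%z. (norm z)^2) f x = - (?c *R f x)" using m by (metis minus_minus)
  also have "E *R (4 *R - (?c *R f x) + (-6) *R gauss_conv 1 f x)
    = (E * (sqrt (pi / 1) ^ 3 * exp (- (k^2 / (4 * 1)))) * (- k\<^sup>2)) *R f x"
  proof -
   have alg: "4 *R - ((N * c) *R y) + (-6) *R (N *R y) = (N * (- 4 * c - 6)) *R y" for N c :: real and y :: complex
    by (simp add: scaleR_conv_of_real algebra_simps)
   have r: "gauss_conv 1 f x = (sqrt pi ^ 3 * exp (- (k^2 / 4))) *R f x" using rep[of 1 x] by simp
   show ?thesis unfolding r alg by (simp add: mult.assoc)
  qed
  also have "... = - (k^2 *R f x)" unfolding E1 by simp
  finally show ?thesis .
 qed
 have "helmholtz_jet k f p q" unfolding helmholtz_jet_def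
 proof (intro conjI allI)
  have "(%x. E *R gauss_conv 1 f x) = f" using f_eq by auto
  moreover have "subgaussian (%x. E *R gauss_conv 1 f x)" by (intro subgaussian_cmult gauss_transform_subgaussian[OF zero_less_one sg(1) sg(2) d0 f])
  moreover have "((%x. E *R gauss_conv 1 f x) has_derivative (%h. E *R (SUM j:UNIV. h $ j *R gauss_transform 1 (p1 j) f x))) (at x)" for x
   by (intro has_derivative_scaleR_right df)
  ultimately show "subgaussian f" "(f has_derivative (%h. SUM j:UNIV. h $ j *R p j x)) (at x)" for x
   by (simp_all add: p_def scaleR_sum_right mult.commute)
  show "subgaussian (p j)" for j unfolding p_def by (intro subgaussian_cmult gauss_transform_subgaussian[OF zero_less_one sg(3) sg(5) d1 f])
  show "subgaussian (q i j)" for i j unfolding q_def by (intro subgaussian_cmult sub_q)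
  have "((%x. E *R gauss_transform 1 (p1 j) f x) has_derivative (%h. E *R (SUM i:UNIV. h $ i *R gauss_transform 1 (p2 i j) f x))) (at x)" for j x
   by (intro has_derivative_scaleR_right dp)
  then show "(p j has_derivative (%h. SUM i:UNIV. h $ i *R q i j x)) (at x)" for j x
   by (simp add: p_def[abs_def] q_def scaleR_sum_right mult.commute)
  have "p2 i j = p2 j i" for i j by (auto simp: p2_def)
  then show "q i j = q j i" for i j by (simp add: q_def[abs_def])
  show "(SUM j:UNIV. q j j x) = - (k^2 *R f x)" for x by (rule trace)
 qed
 then show ?thesis using that by blast
qed

definition angular :: "real^3 => (3 => 'b::real_inner) => real" where
 "angular x v = (norm x)^2 * (SUM j:UNIV. (norm (v j))^2) - (norm (SUM j:UNIV. x $ j *R v j))^2"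

text \<open>A virial identity: the divergence of a field built from the dilation multiplier \<open>x . grad f\<close>, with a Gaussian weight, has
integral 0. The two terms of lower order in the field are chosen so that only \<open>f^2\<close> and the angular energy survive.\<close>

lemma angular_identity_real:
 fixes f :: "real^3 => real"
 assumes jet: "helmholtz_jet k f p q" and s: "s > 0"
 shows "(LBINT x. gaussian s x * (2 * k^2 * (1 - 2 * s * (norm x)^2) * (f x)^2 + 4 * s * angular x (%j. p j x)
   - s * (3 - 12 * (s * (norm x)^2) + 4 * (s * (norm x)^2)^2) * (f x)^2)) = 0"
proof -
 note J = jet[unfolded helmholtz_jet_def]
 have f[intro]: "subgaussian f" and p[intro]: "!!j. subgaussian (p j)" and q[intro]: "!!i j. subgaussian (q i j)"
  and df: "!!x. (f has_derivative (%h. SUM j:UNIV. h $ j *R p j x)) (at x)"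
  and dp: "!!j x. (p j has_derivative (%h. SUM i:UNIV. h $ i *R q i j x)) (at x)"
  and sym: "!!i j. q i j = q j i" and tr: "!!x. (SUM j:UNIV. q j j x) = - (k^2 *R f x)" using J by blast+
 \<comment> \<open>The vector field is the Gaussian times v; its derivative in direction j is the Gaussian times w j.\<close>
 define v where "v j x = 2 * (SUM i:UNIV. x $ i * p i x) * p j x - x $ j * (SUM i:UNIV. (p i x)^2) + k^2 * x $ j * (f x)^2
   + (1 + 2 * s * (norm x)^2) * f x * p j x - s * x $ j * (1 - 2 * s * (norm x)^2) * (f x)^2" for j x
 define w where "w j x = - 2 * s * x $ j * v j x
   + (2 * (p j x + (SUM i:UNIV. x $ i * q j i x)) * p j x + 2 * (SUM i:UNIV. x $ i * p i x) * q j j x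
     - (SUM i:UNIV. (p i x)^2) - x $ j * (SUM i:UNIV. 2 * p i x * q j i x)
     + k^2 * (f x)^2 + k^2 * x $ j * (2 * f x * p j x)
     + (4 * s * x $ j) * f x * p j x + (1 + 2 * s * (norm x)^2) * (p j x * p j x + f x * q j j x)
     - s * (1 - 2 * s * (norm x)^2) * (f x)^2 + 4 * s^2 * x $ j * x $ j * (f x)^2
     - s * x $ j * (1 - 2 * s * (norm x)^2) * (2 * f x * p j x))" for j x
 have v_sub: "subgaussian (v j)" for j unfolding v_def by (intro subgaussian_intros f p q)
 have w_sub: "subgaussian (w j)" for j unfolding w_def by (intro subgaussian_intros f p q v_sub)
 have int: "integrable lborel (%x. gaussian s x * u x)" if "subgaussian u" for u :: "real^3 => real"
  using gauss_integrableD[OF subgaussian_imp_gauss_integrable[OF that] s] by simp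
 have zero: "(LBINT x. gaussian s x * w j x) = 0" for j
 proof (rule integral_directional_derivative_eq_0[where e = "axis j 1"])
  show "continuous_on UNIV (%x. gaussian s x * w j x)" by (intro continuous_intros subgaussian_cont w_sub)
  fix x
  have path: "((%t. x + t *R (axis j 1 :: real^3)) has_derivative (%t. t *R axis j 1)) (at 0)" by (auto intro!: derivative_eq_intros)
  have along: "((%t. g (x + t *R axis j 1)) has_real_derivative (g' (axis j 1))) (at 0)"
   if "(g has_derivative g') (at x)" for g :: "real^3 => real" and g'
  proof -
   have "((%t. g (x + t *R axis j 1)) has_derivative (%t. g' (t *R axis j 1))) (at 0)"
    by (rule has_derivative_compose[OF path, of g g']) (use that in simp)
   moreover have "(%t. g' (t *R axis j 1)) = (*) (g' (axis j 1))" using linear_cmul[OF has_derivative_linear[OF that]] by (auto simp: mult.commute)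
   ultimately show ?thesis by (simp add: has_field_derivative_def)
  qed
  have ax: "(SUM i:UNIV. (axis j 1 :: real^3) $ i *R c i) = c j" for c :: "3 => real" using exhaust_3[of j] by (auto simp: sum_3 axis_def)
  have f': "((%t. f (x + t *R axis j 1)) has_real_derivative p j x) (at 0)" using along[OF df] by (simp only: ax)
  have p': "((%t. p i (x + t *R axis j 1)) has_real_derivative q j i x) (at 0)" for i
   using along[OF dp] by (simp only: ax)
  have x': "((%t. (x + t *R (axis j 1 :: real^3)) $ i) has_real_derivative (if i = j then 1 else 0)) (at 0)" for i
   by (auto intro!: derivative_eq_intros simp: axis_def)
  have n': "((%t. (norm (x + t *R (axis j 1 :: real^3)))^2) has_real_derivative 2 * x $ j) (at 0)" unfolding norm_sq_vec3
  proof -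
   have "((%t. SUM i:UNIV. ((x + t *R (axis j 1 :: real^3)) $ i)^2) has_real_derivative (SUM i:UNIV. 2 * ((x + 0 *R (axis j 1 :: real^3)) $ i) * (if i = j then 1 else 0))) (at 0)"
    by (intro DERIV_sum DERIV_cong[OF DERIV_power[OF x']]) simp
   moreover have "(SUM i:UNIV. 2 * ((x + 0 *R (axis j 1 :: real^3)) $ i) * (if i = j then 1 else 0)) = 2 * x $ j"
    using exhaust_3[of j] by (auto simp: sum_3)
   ultimately show "((%t. SUM i:UNIV. ((x + t *R (axis j 1 :: real^3)) $ i)^2) has_real_derivative 2 * x $ j) (at 0)" by simp
  qed
  have e': "((%t. gaussian s (x + t *R axis j 1)) has_real_derivative gaussian s x * (- s * (2 * x $ j))) (at 0)"
   using DERIV_fun_exp[OF DERIV_cmult[OF n', of "-s"]] by simp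
  have A': "((%t. SUM i:UNIV. (x + t *R axis j 1) $ i * p i (x + t *R axis j 1)) has_real_derivative p j x + (SUM i:UNIV. x $ i * q j i x)) (at 0)"
  proof -
   have "((%t. SUM i:UNIV. (x + t *R axis j 1) $ i * p i (x + t *R axis j 1)) has_real_derivative (SUM i:UNIV. (if i = j then 1 else 0) * p i (x + 0 *R axis j 1) + q j i x * (x + 0 *R axis j 1) $ i)) (at 0)"
    by (intro DERIV_sum DERIV_mult x' p')
   moreover have "(SUM i:UNIV. (if i = j then 1 else 0) * p i (x + 0 *R axis j 1) + q j i x * (x + 0 *R axis j 1) $ i) = p j x + (SUM i:UNIV. x $ i * q j i x)"
    using exhaust_3[of j] by (auto simp: sum_3 algebra_simps)
   ultimately show ?thesis by simp
  qed
  have B': "((%t. SUM i:UNIV. (p i (x + t *R axis j 1))^2) has_real_derivative (SUM i:UNIV. 2 * p i x * q j i x)) (at 0)"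
   by (rule derivative_eq_intros p' refl | simp)+ (simp add: mult_ac)
  have v': "((%t. v j (x + t *R axis j 1)) has_real_derivative (w j x + 2 * s * x $ j * v j x)) (at 0)" unfolding v_def w_def
   by (rule derivative_eq_intros A' B' f' p' x' n' refl | simp)+ (simp add: algebra_simps power2_eq_square)
  have "((%t. gaussian s (x + t *R axis j 1) * v j (x + t *R axis j 1)) has_real_derivative gaussian s x * w j x) (at 0)"
   using DERIV_mult[OF e' v'] by (simp add: algebra_simps)
  then show "((%t. gaussian s (x + t *R axis j 1) * v j (x + t *R axis j 1)) has_vector_derivative gaussian s x * w j x) (at 0)"
   by (simp add: has_real_derivative_iff_has_vector_derivative)
 qed (intro int v_sub w_sub)+
 have "(LBINT x. gaussian s x * (SUM j:UNIV. w j x)) = 0"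
  unfolding sum_distrib_left by (subst Bintegral_sum) (simp_all only: int[OF w_sub] zero sum.neutral_const)
 moreover have "(SUM j:UNIV. w j x) = 2 * k^2 * (1 - 2 * s * (norm x)^2) * (f x)^2 + 4 * s * angular x (%j. p j x)
   - s * (3 - 12 * (s * (norm x)^2) + 4 * (s * (norm x)^2)^2) * (f x)^2" for x
 proof -
  have q3: "q 3 3 x = - (k^2 * f x) - q 1 1 x - q 2 2 x" using tr[of x] by (simp add: sum_3)
  have s1: "q 2 1 = q 1 2" "q 3 1 = q 1 3" "q 3 2 = q 2 3" using sym by blast+
  show ?thesis unfolding w_def v_def angular_def sum_3 norm_sq_vec3 q3 s1 real_norm_def power2_abs real_scaleR_def by algebra
 qed
 ultimately show ?thesis by simp
qed

lemma angular_of_real_parts: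
 fixes v :: "3 => complex"
 shows "angular x v = angular x (%j. Re (v j)) + angular x (%j. Im (v j))" by (simp add: angular_def sum_3 cmod_power2 algebra_simps)

text \<open>Lagrange's identity: the angular energy consists of the squares of the three rotation fields.\<close>

lemma angular_eq_rotations:
 fixes v :: "3 => complex"
 shows "angular x v = (norm (x $ 1 *R v 2 - x $ 2 *R v 1))^2 + (norm (x $ 2 *R v 3 - x $ 3 *R v 2))^2
   + (norm (x $ 3 *R v 1 - x $ 1 *R v 3))^2" unfolding angular_def sum_3 cmod_power2 norm_sq_vec3 by (simp add: power2_eq_square algebra_simps)

lemma angular_nonneg: "angular x (v :: 3 => complex) >= 0" by (simp add: angular_eq_rotations)

lemma subgaussian_angular:
 fixes p :: "3 => real^3 => complex"
 assumes "!!j. subgaussian (p j)"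
 shows "subgaussian (%x. angular x (%j. p j x))" unfolding angular_def by (intro subgaussian_intros assms)

lemma subgaussian_Re: "subgaussian f ==> subgaussian (%x. Re (f x))"
 and subgaussian_Im: "subgaussian f ==> subgaussian (%x. Im (f x))"
 by (rule subgaussian_linear[OF bounded_linear_Re] subgaussian_linear[OF bounded_linear_Im], assumption)+

lemma jet_Re: "helmholtz_jet k f p q ==> helmholtz_jet k (%x. Re (f x)) (%j x. Re (p j x)) (%i j x. Re (q i j x))" unfolding helmholtz_jet_def
 apply (intro conjI allI)
    apply (blast intro: subgaussian_Re)
    apply (blast intro: subgaussian_Re)
   apply (blast intro: subgaussian_Re)
 subgoal for x using bounded_linear.has_derivative[OF bounded_linear_Re, of f "%h. SUM j:UNIV. h $ j *R p j x" "at x"] by simp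
 subgoal for j x using bounded_linear.has_derivative[OF bounded_linear_Re, of "p j" "%h. SUM i:UNIV. h $ i *R q i j x" "at x"] by simp
  apply metis
 subgoal for x
  by (elim conjE, drule spec[of "%x. (SUM j:UNIV. q j j x) = - (k^2 *R f x)" x], drule arg_cong[of _ _ Re]) simp
 done

lemma jet_Im: "helmholtz_jet k f p q ==> helmholtz_jet k (%x. Im (f x)) (%j x. Im (p j x)) (%i j x. Im (q i j x))" unfolding helmholtz_jet_def
 apply (intro conjI allI)
    apply (blast intro: subgaussian_Im)
    apply (blast intro: subgaussian_Im)
   apply (blast intro: subgaussian_Im)
 subgoal for x using bounded_linear.has_derivative[OF bounded_linear_Im, of f "%h. SUM j:UNIV. h $ j *R p j x" "at x"] by simp
 subgoal for j x using bounded_linear.has_derivative[OF bounded_linear_Im, of "p j" "%h. SUM i:UNIV. h $ i *R q i j x" "at x"] by simp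
  apply metis
 subgoal for x
  by (elim conjE, drule spec[of "%x. (SUM j:UNIV. q j j x) = - (k^2 *R f x)" x], drule arg_cong[of _ _ Im]) simp
 done

definition gauss_mean :: "(real^3 => real) => real => real" where
 "gauss_mean F s = (LBINT x. gaussian s x * F x)"

lemma gauss_mean_integrable:
 assumes "subgaussian (F :: real^3 => real)" "s > 0"
 shows "integrable lborel (%x. gaussian s x * F x)" using gauss_integrableD[OF subgaussian_imp_gauss_integrable[OF assms(1)] assms(2)] by simp

lemma gauss_mean_add:
 assumes "subgaussian F" "subgaussian H" "s > 0"
 shows "gauss_mean (%x. a * F x + b * H x) s = a * gauss_mean F s + b * gauss_mean H s"
proof -
 have "gauss_mean (%x. a * F x + b * H x) s = (LBINT x. a * (gaussian s x * F x) + b * (gaussian s x * H x))"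
  unfolding gauss_mean_def by (simp add: algebra_simps)
 also have "... = a * gauss_mean F s + b * gauss_mean H s" unfolding gauss_mean_def by (subst Bintegral_add)
    (simp_all only: integrable_mult_right gauss_mean_integrable assms integral_mult_right_zero)
 finally show ?thesis .
qed

lemma gauss_mean_nonneg: "(!!x. F x >= 0) ==> gauss_mean F s >= 0" unfolding gauss_mean_def by (intro Bochner_Integration.integral_nonneg) simp

lemma gauss_mean_has_derivative:
 assumes F: "subgaussian F" and s: "s > 0"
 shows "(gauss_mean F has_real_derivative - gauss_mean (%x. (norm x)^2 * F x) s) (at s)"
proof -
 have F': "gauss_integrable (%x. cor (F x))" by (intro subgaussian_imp_gauss_integrable subgaussian_linear[OF bounded_linear_of_real] F)
 have one: "subgaussian (%_. 1::real)" by simp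
 have eq: "gauss_transform s p (%x. cor (F x)) 0 = cor (gauss_mean (%x. p x * F x) s)" for s p
  by (simp add: gauss_transform_def gauss_mean_def scaleR_conv_of_real mult.assoc flip: of_real_mult)
 have "((%s. Re (gauss_conv s (%x. cor (F x)) 0)) has_vector_derivative
   Re (- gauss_transform s (%z. (norm z)^2 * 1) (%x. cor (F x)) 0)) (at s)"
  by (rule bounded_linear.has_vector_derivative[OF bounded_linear_Re gauss_transform_has_derivative_scale[OF s one F']])
 then show ?thesis unfolding eq by (simp add: has_real_derivative_iff_has_vector_derivative)
qed

lemma gauss_mean_cont:
 assumes F: "subgaussian F"
 shows "continuous_on {0<..} (gauss_mean F)"
 using gauss_mean_has_derivative[OF F] by (intro continuous_at_imp_continuous_on ballI) (auto intro: DERIV_isCont)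

lemma angular_identity:
 fixes f :: "real^3 => complex"
 assumes jet: "helmholtz_jet k f p q" and s: "s > 0"
 defines "F == %x. (norm (f x))^2"
 shows "2 * k^2 * (gauss_mean F s - 2 * s * gauss_mean (%x. (norm x)^2 * F x) s) + 4 * s * gauss_mean (%x. angular x (%j. p j x)) s
   = s * gauss_mean (%x. (3 - 12 * (s * (norm x)^2) + 4 * (s * (norm x)^2)^2) * F x) s"
proof -
 have f: "subgaussian f" and p: "!!j. subgaussian (p j)" using jet by (auto simp: helmholtz_jet_def)
 define I where "I F S = (LBINT x. gaussian s x * (2 * k^2 * (1 - 2 * s * (norm x)^2) * F x + 4 * s * S x
   - s * (3 - 12 * (s * (norm x)^2) + 4 * (s * (norm x)^2)^2) * F x))" for F S :: "real^3 => real"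
 let ?P = "%x. 3 - 12 * (s * (norm (x::real^3))^2) + 4 * (s * (norm x)^2)^2"
 have I: "I F S = 2 * k^2 * (gauss_mean F s - 2 * s * gauss_mean (%x. (norm x)^2 * F x) s) + 4 * s * gauss_mean S s - s * gauss_mean (%x. ?P x * F x) s"
  if F: "subgaussian F" and S: "subgaussian S" for F S
 proof -
  have a: "subgaussian (%x. (norm x)^2 * F x)" "subgaussian (%x. ?P x * F x)" "subgaussian (%x. (2 * k^2) * F x + (- 4 * s * k^2) * ((norm x)^2 * F x))"
    "subgaussian (%x. (4 * s) * S x + (- s) * (?P x * F x))" by (intro subgaussian_intros F S)+
  have "I F S = gauss_mean (%x. 1 * ((2 * k^2) * F x + (- 4 * s * k^2) * ((norm x)^2 * F x)) + 1 * ((4 * s) * S x + (- s) * (?P x * F x))) s"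
   unfolding I_def gauss_mean_def by (intro Bintegral_cong refl) (simp add: algebra_simps)
  also have "... = 2 * k^2 * (gauss_mean F s - 2 * s * gauss_mean (%x. (norm x)^2 * F x) s) + 4 * s * gauss_mean S s - s * gauss_mean (%x. ?P x * F x) s"
   by (subst gauss_mean_add[OF a(3,4) s], subst gauss_mean_add[OF F a(1) s], subst gauss_mean_add[OF S a(2) s]) (simp add: algebra_simps)
  finally show ?thesis .
 qed
 have F_sub: "subgaussian F" "subgaussian (%x. angular x (%j. p j x))" unfolding F_def by (intro subgaussian_intros f subgaussian_angular p)+
 have R: "I (%x. (Re (f x))^2) (%x. angular x (%j. Re (p j x))) = 0"
  and Im: "I (%x. (Im (f x))^2) (%x. angular x (%j. Im (p j x))) = 0"
  unfolding I_def by (rule angular_identity_real[OF jet_Re[OF jet] s], rule angular_identity_real[OF jet_Im[OF jet] s])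
 have sub: "subgaussian (%x. (Re (f x))^2)" "subgaussian (%x. (Im (f x))^2)" "subgaussian (%x. angular x (%j. Re (p j x)))" "subgaussian (%x. angular x (%j. Im (p j x)))"
  unfolding angular_def by (intro subgaussian_intros subgaussian_Re subgaussian_Im f p)+
 have int: "integrable lborel (%x. gaussian s x * (2 * k^2 * (1 - 2 * s * (norm x)^2) * F x + 4 * s * S x - s * ?P x * F x))"
  if "subgaussian F" "subgaussian S" for F S
  by (intro gauss_mean_integrable s subgaussian_intros that)
 have "I F (%x. angular x (%j. p j x)) = I (%x. (Re (f x))^2) (%x. angular x (%j. Re (p j x))) + I (%x. (Im (f x))^2) (%x. angular x (%j. Im (p j x)))"
  unfolding I_def by (subst Bintegral_add[symmetric, OF int int])
    (auto intro!: Bintegral_cong sub simp: F_def cmod_power2 angular_of_real_parts[of _ "%j. p j _"] algebra_simps)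
 then show ?thesis using R Im I[OF F_sub] by simp
qed

text \<open>The virial identity read as a differential equation for \<open>k^2 M\<close>, where \<open>M s = sqrt s * gauss_mean F s\<close>. In the remainder the
polynomial in \<open>s |x|^2\<close> is absorbed by half of the Gaussian.\<close>

lemma gauss_energy_has_derivative:
 fixes f :: "real^3 => complex"
 assumes jet: "helmholtz_jet k f p q" and s: "s > 0"
 defines "F == %x. (norm (f x))^2"
 defines "R == %s. gauss_mean (%x. (3 - 12 * (s * (norm x)^2) + 4 * (s * (norm x)^2)^2) * F x) s"
 shows "((%s. k^2 * (sqrt s * gauss_mean F s)) has_real_derivative
   (sqrt s * R s / 4 - sqrt s * gauss_mean (%x. angular x (%j. p j x)) s)) (at s)"
  and "\<bar>R s\<bar> <= 59 * gauss_mean F (s / 2)"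
proof -
 have f: "subgaussian f" and p: "!!j. subgaussian (p j)" using jet by (auto simp: helmholtz_jet_def)
 have F: "subgaussian F" unfolding F_def by (intro subgaussian_intros f)
 let ?Q = "gauss_mean (%x. angular x (%j. p j x)) s"
 let ?T = "gauss_mean (%x. (norm x)^2 * F x) s"
 have id: "2 * k^2 * (gauss_mean F s - 2 * s * ?T) + 4 * s * ?Q = s * R s" using angular_identity[OF jet s] by (simp add: F_def R_def)
 have "((%s. k^2 * (sqrt s * gauss_mean F s)) has_real_derivative k\<^sup>2 * (inverse (sqrt s) / 2 * gauss_mean F s + (- ?T) * sqrt s)) (at s)"
  by (intro DERIV_cmult DERIV_mult gauss_mean_has_derivative F s DERIV_real_sqrt)
 moreover have "k^2 * (inverse (sqrt s) / 2 * gauss_mean F s + (- ?T) * sqrt s) = sqrt s * R s / 4 - sqrt s * ?Q"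
 proof -
  have ss: "sqrt s * sqrt s = s" "sqrt s > 0" using s by auto
  have "4 * sqrt s * (k^2 * (inverse (sqrt s) / 2 * gauss_mean F s + (- ?T) * sqrt s)) = 2 * k^2 * gauss_mean F s - 4 * k^2 * (sqrt s * sqrt s) * ?T"
   using ss(2) by (simp add: field_simps)
  also have "... = s * R s - 4 * s * ?Q" unfolding ss(1) using id by (simp add: algebra_simps)
  also have "... = 4 * sqrt s * (sqrt s * R s / 4 - sqrt s * ?Q)"
  proof -
   have "4 * sqrt s * (sqrt s * a / 4 - sqrt s * b) = (sqrt s * sqrt s) * a - 4 * (sqrt s * sqrt s) * b" for a b
    by (simp add: algebra_simps)
   then show ?thesis unfolding ss(1) by simp
  qed
  finally show ?thesis using ss(2) by simp
 qed
 ultimately show "((%s. k^2 * (sqrt s * gauss_mean F s)) has_real_derivative (sqrt s * R s / 4 - sqrt s * ?Q)) (at s)" by simp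
 have pt: "\<bar>exp (- u) * (3 - 12 * u + 4 * u^2)\<bar> <= 59 * exp (- (u / 2))" if "u >= 0" for u :: real
 proof -
  have e: "exp (u / 2) >= 1 + u / 2 + (u / 2)^2 / 2" using exp_lower_Taylor_quadratic[of "u / 2"] that by simp
  then have "\<bar>3 - 12 * u + 4 * u\<^sup>2\<bar> <= 59 * exp (u / 2)"
  proof -
   have "1 + u / 2 + u^2 / 8 <= exp (u / 2)" using e by (simp add: power_divide)
   moreover have "0 <= u^2" by simp
   ultimately have "3 - 12 * u + 4 * u^2 <= 59 * exp (u / 2)" "- (3 - 12 * u + 4 * u^2) <= 59 * exp (u / 2)" using that by linarith+
   then show ?thesis by (simp only: abs_le_iff)
  qed
  then have "exp (- u) * \<bar>3 - 12 * u + 4 * u\<^sup>2\<bar> <= exp (- u) * (59 * exp (u / 2))" by (intro mult_left_mono) auto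
  also have "... = 59 * exp (- (u / 2))" by (simp flip: exp_add)
  finally show ?thesis by (simp add: abs_mult)
 qed
 have s2: "s / 2 > 0" using s by simp
 have "\<bar>R s\<bar> <= (LBINT x. norm (gaussian s x * ((3 - 12 * (s * (norm x)^2) + 4 * (s * (norm x)^2)^2) * F x)))"
  unfolding R_def gauss_mean_def using integral_norm_bound[of lborel "%x. gaussian s x * ((3 - 12 * (s * (norm x)^2) + 4 * (s * (norm x)^2)^2) * F x)"] by simp
 also have "... <= (LBINT x. 59 * (gaussian (s / 2) x * F x))"
 proof (rule integral_mono)
  fix x :: "real^3"
  have "\<bar>exp (- (s * (norm x)^2)) * (3 - 12 * (s * (norm x)^2) + 4 * (s * (norm x)^2)^2)\<bar> * F x <= 59 * exp (- (s * (norm x)^2 / 2)) * F x"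
   using s by (intro mult_right_mono pt) (auto simp: F_def)
  then show "norm (gaussian s x * ((3 - 12 * (s * (norm x)^2) + 4 * (s * (norm x)^2)^2) * F x)) <= 59 * (gaussian (s / 2) x * F x)"
   by (simp add: abs_mult F_def mult.assoc)
 qed (intro integrable_norm integrable_mult_right gauss_mean_integrable subgaussian_intros F s s2)+
 also have "... = 59 * gauss_mean F (s / 2)" unfolding gauss_mean_def by simp
 finally show "\<bar>R s\<bar> <= 59 * gauss_mean F (s / 2)" .
qed

section \<open>The weight as a superposition of Gaussians\<close>

definition gauss_weight :: "real => ennreal" where
 "gauss_weight t = (NN s. ennreal (indicator {0<..1} s * (sqrt s * exp (- s * t))))"

lemma japanese_bracket_cube: "bracket3 x = (1 + (norm x)^2) * sqrt (1 + (norm x)^2)" by (simp add: japanese_bracket_def power3_eq_cube)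

lemma japanese_bracket_pos: "japanese_bracket x > 0" by (simp add: japanese_bracket_def add_pos_nonneg)


lemma gauss_weight_upper:
 assumes t: "t >= 0"
 shows "gauss_weight t <= ennreal (2 * exp 1 / ((1 + t) * sqrt (1 + t)))"
proof -
 define A where "A = 1 + t"
 have A: "A >= 1" using t by (simp add: A_def)
 have pt: "indicator {0<..1} s * (sqrt s * exp (- s * t)) <= (exp 1 / sqrt A * exp (- (A / 2) * s)) * indicator {0..1} s" for s :: real
 proof (cases "s \<in> {0<..1}")
  case True
  have "s * A <= exp (s * A)" using exp_ge_add_one_self[of "s * A"] by linarith
  then have "sqrt (s * A) <= sqrt (exp (s * A))" by simp
  also have "sqrt (exp (s * A)) = exp (s * A / 2)" by (rule real_sqrt_unique) (auto simp: power2_eq_square simp flip: exp_add)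
  finally have 1: "sqrt s <= exp (s * A / 2) / sqrt A" using A by (simp add: real_sqrt_mult pos_le_divide_eq)
  have 2: "exp (- s * t) <= exp 1 * exp (- (s * A))" using True by (simp add: A_def algebra_simps flip: exp_add)
  have "sqrt s * exp (- s * t) <= (exp (s * A / 2) / sqrt A) * (exp 1 * exp (- (s * A)))" using True A by (intro mult_mono 1 2) auto
  also have "... = exp 1 / sqrt A * (exp (s * A / 2) * exp (- (s * A)))" by simp
  also have "exp (s * A / 2) * exp (- (s * A)) = exp (- (A / 2) * s)" by (simp flip: exp_add)
  finally show ?thesis using True by simp
 qed (use A in \<open>auto simp: indicator_def\<close>)
 let ?F = "%s. - (exp 1 / sqrt A * (2 / A) * exp (- (A / 2) * s))"
 have "gauss_weight t <= (NN s. ennreal (exp 1 / sqrt A * exp (- (A / 2) * s)) * indicator {0..1} s)" unfolding gauss_weight_def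
  by (intro nn_integral_mono) (metis pt ennreal_leI ennreal_indicator ennreal_mult'' indicator_pos_le)
 also have "... = ennreal (?F 1 - ?F 0)" using A by (intro nn_integral_FTC_Icc) (auto intro!: derivative_eq_intros)
 also have "... <= ennreal (2 * exp 1 / (A * sqrt A))" using A by (intro ennreal_leI) (simp add: field_simps)
 finally show ?thesis by (simp add: A_def)
qed

lemma gauss_weight_lower:
 assumes t: "t >= 0"
 shows "ennreal (1 / (2 * sqrt 2 * exp 1) / ((1 + t) * sqrt (1 + t))) <= gauss_weight t"
proof -
 define A where "A = 1 + t"
 have A: "A >= 1" using t by (simp add: A_def)
 define c where "c = sqrt (1 / (2 * A)) * exp (- 1)"
 have pt: "c * indicator {1 / (2 * A)..1 / A} s <= indicator {0<..1} s * (sqrt s * exp (- s * t))" for s :: real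
 proof (cases "s \<in> {1 / (2 * A)..1 / A}")
  case True
  have "0 < 1 / (2 * A)" "1 / A <= 1" using A by auto
  moreover have "1 / (2 * A) <= s" "s <= 1 / A" using True by auto
  ultimately have s: "0 < s" "s <= 1" by linarith+
  have "s * A <= 1" using True A by (auto simp: field_simps)
  then have "s * t <= 1" using s by (simp add: A_def algebra_simps)
  moreover have "sqrt (1 / (2 * A)) <= sqrt s" using True by simp
  ultimately have "c <= sqrt s * exp (- s * t)" unfolding c_def using s by (intro mult_mono) auto
  then show ?thesis using True s by simp
 next
  case False
  have "0 <= sqrt s * exp (- s * t)" if "s \<in> {0<..1}" using that by auto
  then show ?thesis using False by (auto simp: indicator_def)
 qed
 have "ennreal (1 / (2 * sqrt 2 * exp 1) / (A * sqrt A)) = ennreal c * ennreal (1 / A - 1 / (2 * A))"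
  using A by (subst ennreal_mult'[symmetric]) (auto simp: c_def exp_minus real_sqrt_divide real_sqrt_mult field_simps)
 also have "... = ennreal c * emeasure lborel {1 / (2 * A)..1 / A}" using A by (simp add: field_simps)
 also have "... = (NN s. ennreal c * indicator {1 / (2 * A)..1 / A} s)" by (subst nn_integral_cmult_indicator) auto
 also have "... <= gauss_weight t" unfolding gauss_weight_def
  by (intro nn_integral_mono) (metis pt ennreal_leI ennreal_indicator ennreal_mult'' indicator_pos_le)
 finally show ?thesis by (simp add: A_def)
qed

lemma gauss_weight_bracket:
 shows "ennreal (1 / bracket3 x) <= ennreal (2 * sqrt 2 * exp 1) * gauss_weight ((norm x)^2)"
  and "gauss_weight ((norm x)^2) <= ennreal (2 * exp 1 / bracket3 x)"
proof -
 have p: "(1 + (norm x)^2) * sqrt (1 + (norm x)^2) > 0" by (simp add: add_pos_nonneg)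
 have "ennreal (1 / bracket3 x) = ennreal (2 * sqrt 2 * exp 1) * ennreal (1 / (2 * sqrt 2 * exp 1) / ((1 + (norm x)^2) * sqrt (1 + (norm x)^2)))"
  unfolding japanese_bracket_cube using p by (subst ennreal_mult'[symmetric]) auto
 also have "... <= ennreal (2 * sqrt 2 * exp 1) * gauss_weight ((norm x)^2)" by (intro mult_left_mono gauss_weight_lower) auto
 finally show "ennreal (1 / bracket3 x) <= ennreal (2 * sqrt 2 * exp 1) * gauss_weight ((norm x)^2)" .
 show "gauss_weight ((norm x)^2) <= ennreal (2 * exp 1 / bracket3 x)" unfolding japanese_bracket_cube by (intro gauss_weight_upper) simp
qed

lemma gauss_weight_tonelli:
 assumes F: "subgaussian F" "!!x. F x >= 0" and c: "c > 0"
 shows "(NN s. ennreal (indicator {0<..1} s * (sqrt s * gauss_mean F (s * c)))) = (NN x. ennreal (F x) * gauss_weight (c * (norm x)^2))"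
proof -
 have [measurable]: "F \<in> borel_measurable borel" using F by measurable
 let ?k = "%s x. indicator {0<..1} s * (sqrt s * exp (- s * (c * (norm x)^2)))"
 have "ennreal (indicator {0<..1} s * (sqrt s * gauss_mean F (s * c))) = (NN x. ennreal (F x) * ennreal (?k s x))" for s :: real
 proof (cases "s \<in> {0<..1}")
  case True
  then have sc: "s * c > 0" using c by simp
  have "ennreal (indicator {0<..1} s * (sqrt s * gauss_mean F (s * c))) = ennreal (LBINT x. sqrt s * (gaussian (s * c) x * F x))"
   using True by (simp add: gauss_mean_def)
  also have "... = (NN x. ennreal (sqrt s * (gaussian (s * c) x * F x)))"
   using True F by (intro nn_integral_eq_integral[symmetric] integrable_mult_right gauss_mean_integrable sc) auto
  also have "... = (NN x. ennreal (F x) * ennreal (?k s x))"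
   using True F by (intro nn_integral_cong) (simp add: ennreal_mult[symmetric] mult_ac)
  finally show ?thesis .
 qed simp
 then have "(NN s. ennreal (indicator {0<..1} s * (sqrt s * gauss_mean F (s * c)))) = (\<integral>\<^sup>+s. \<integral>\<^sup>+x. ennreal (F x) * ennreal (?k s x) \<partial>lborel \<partial>lborel)"
  by simp
 also have "... = (\<integral>\<^sup>+x. \<integral>\<^sup>+s. ennreal (F x) * ennreal (?k s x) \<partial>lborel \<partial>lborel)"
  by (rule lborel_pair.Fubini') measurable
 also have "... = (NN x. ennreal (F x) * gauss_weight (c * (norm x)^2))"
  unfolding gauss_weight_def by (intro nn_integral_cong nn_integral_cmult) measurable
 finally show ?thesis .
qed

lemma nn_integral_interval:
 fixes h :: "real => real"
 assumes cont: "continuous_on {0<..} h" and pos: "!!s. s > 0 ==> h s >= 0" and e: "e > 0"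
 shows "ennreal (integral {e..1} h) = (NN s. ennreal (indicator {e..1} s * h s))"
proof -
 have c: "continuous_on {e..1} h" by (rule continuous_on_subset[OF cont]) (use e in auto)
 have "(NN s. ennreal (indicator {e..1} s * h s)) = ennreal (integral {e..1} h)"
 proof (rule nn_integral_has_integral_lborel)
  show "(%s. indicator {e..1} s * h s) \<in> borel_measurable borel" using borel_measurable_continuous_on_indicator[OF _ c] by simp
  show "0 <= indicator {e..1} s * h s" for s using pos[of s] e by (auto simp: indicator_def)
  have "(h has_integral integral {e..1} h) {e..1}" by (intro integrable_integral integrable_continuous_real c)
  then have "((%s. if s \<in> {e..1} then h s else 0) has_integral integral {e..1} h) UNIV" by (simp only: has_integral_restrict_UNIV)
  moreover have "(%s. if s \<in> {e..1} then h s else 0) = (%s. indicator {e..1} s * h s)" by (auto simp: indicator_def)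
  ultimately show "((%s. indicator {e..1} s * h s) has_integral integral {e..1} h) UNIV" by metis
 qed
 then show ?thesis by simp
qed

lemma nn_integral_interval_le:
 fixes h :: "real => real"
 assumes cont: "continuous_on {0<..} h" and pos: "!!s. s > 0 ==> h s >= 0" and e: "e > 0"
 shows "ennreal (integral {e..1} h) <= (NN s. ennreal (indicator {0<..1} s * h s))"
 by (subst nn_integral_interval[OF assms], assumption, intro nn_integral_mono ennreal_leI)
   (use pos e in \<open>auto simp: indicator_def\<close>)

text \<open>Monotone convergence from the intervals \<open>{e..1}\<close>, on which the fundamental theorem applies, to \<open>{0<..1}\<close>.\<close>

lemma nn_integral_interval_bound:
 fixes h :: "real => real"
 assumes cont: "continuous_on {0<..} h" and pos: "!!s. s > 0 ==> h s >= 0"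
  and B: "!!e. 0 < e ==> e < 1 ==> integral {e..1} h <= B"
 shows "(NN s. ennreal (indicator {0<..1} s * h s)) <= ennreal B"
proof -
 define E where "E n = 1 / real (n + 2)" for n :: nat
 have E: "0 < E n" "E n < 1" for n by (auto simp: E_def)
 let ?g = "%n s. ennreal (indicator {E n..1} s * h s)"
 have meas: "?g n \<in> borel_measurable borel" for n
 proof -
  have c: "continuous_on {E n..1} h" by (rule continuous_on_subset[OF cont]) (use E[of n] in auto)
  show ?thesis using borel_measurable_continuous_on_indicator[OF _ c] by simp
 qed
 have lim: "(%n. ?g n s) ----> ennreal (indicator {0<..1} s * h s)" for s
 proof (cases "s > 0")
  case True
  obtain N where N: "1 / real N < s" "N > 0" using True by (metis reals_Archimedean2 inverse_eq_divide gr_zeroI ex_inverse_of_nat_less)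
  have "\<forall>\<^sub>F n in sequentially. ennreal (indicator {0<..1} s * h s) = ?g n s" using eventually_ge_at_top[of N]
  proof eventually_elim
   case (elim n)
   have "E n <= 1 / real N" unfolding E_def using elim N by (intro divide_left_mono) auto
   then show ?case using N True by (simp add: indicator_def)
  qed
  then show ?thesis by (rule tendsto_eventually[OF eventually_mono]) simp
 next
  case False
  then have "?g n s = 0" for n using E[of n] by (auto simp: indicator_def)
  then show ?thesis using False by (simp add: indicator_def)
 qed
 have "(NN s. ennreal (indicator {0<..1} s * h s)) = (NN s. liminf (%n. ?g n s))"
  by (intro nn_integral_cong lim_imp_Liminf[OF trivial_limit_sequentially lim, symmetric])
 also have "... <= liminf (%n. \<integral>\<^sup>+s. ?g n s \<partial>lborel)" by (rule nn_integral_liminf) (use meas in simp)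
 also have "... <= ennreal B"
 proof (rule Liminf_le)
  show "\<forall>\<^sub>F n in sequentially. (NN s. ?g n s) <= ennreal B"
   by (intro always_eventually allI) (simp only: nn_integral_interval[OF cont pos E(1), symmetric] ennreal_leI B E)
 qed simp
 finally show ?thesis .
qed


definition scalar_H :: "(real^3 => complex) => (3 => real^3 => complex) => ennreal" where
 "scalar_H f p = (NN x. ennreal (((norm (f x))^2 + angular x (%j. p j x)) / bracket3 x))"

lemma gauss_energy_facts:
 fixes f :: "real^3 => complex"
 assumes jet: "helmholtz_jet k f p q"
 defines "F == %x. (norm (f x))^2"
 defines "h == %s. sqrt s * gauss_mean (%x. angular x (%j. p j x)) s"
 shows "subgaussian F" "subgaussian (%x. angular x (%j. p j x))" "!!x. F x >= 0"
  "continuous_on {0<..} h" "!!s. s > 0 ==> h s >= 0"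
  "c > 0 ==> continuous_on {0<..} (%s. sqrt s * gauss_mean F (s * c))" "s > 0 ==> sqrt s * gauss_mean F (s * c) >= 0"
proof -
 have f: "subgaussian f" and p: "!!j. subgaussian (p j)" using jet by (auto simp: helmholtz_jet_def)
 show F: "subgaussian F" unfolding F_def by (intro subgaussian_intros f)
 show S: "subgaussian (%x. angular x (%j. p j x))" by (intro subgaussian_angular p)
 show F0: "!!x. F x >= 0" by (simp add: F_def)
 show "continuous_on {0<..} h" unfolding h_def by (intro continuous_intros gauss_mean_cont S)
 show "!!s. s > 0 ==> h s >= 0" unfolding h_def by (intro mult_nonneg_nonneg gauss_mean_nonneg angular_nonneg) simp
 show "c > 0 ==> continuous_on {0<..} (%s. sqrt s * gauss_mean F (s * c))"
  by (intro continuous_intros continuous_on_compose2[OF gauss_mean_cont[OF F]]) auto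
 show "s > 0 ==> sqrt s * gauss_mean F (s * c) >= 0" by (intro mult_nonneg_nonneg gauss_mean_nonneg F0) simp
qed

lemma gauss_energy_FTC:
 fixes f :: "real^3 => complex"
 assumes jet: "helmholtz_jet k f p q" and e: "0 < e" "e < 1"
 defines "F == %x. (norm (f x))^2"
 defines "h == %s. sqrt s * gauss_mean (%x. angular x (%j. p j x)) s"
 shows "\<bar>integral {e..1} h - (k^2 * (sqrt e * gauss_mean F e) - k^2 * gauss_mean F 1)\<bar>
   <= 59 / 4 * integral {e..1} (%s. sqrt s * gauss_mean F (s * (1 / 2)))"
proof -
 note J = gauss_energy_facts[OF jet, folded F_def h_def]
 define R where "R s = gauss_mean (%x. (3 - 12 * (s * (norm x)^2) + 4 * (s * (norm x)^2)^2) * F x) s" for s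
 have R: "\<bar>R s\<bar> <= 59 * gauss_mean F (s * (1 / 2))" if "s > 0" for s
  using gauss_energy_has_derivative(2)[OF jet that] by (simp add: R_def F_def)
 have sub: "{e..1} \<subseteq> {0<..}" using e by auto
 have "((%s. sqrt s * R s / 4 - h s) has_integral (k^2 * (sqrt 1 * gauss_mean F 1) - k^2 * (sqrt e * gauss_mean F e))) {e..1}"
 proof (rule fundamental_theorem_of_calculus)
  fix s assume "s \<in> {e..1}"
  then have "s > 0" using e by auto
  then have "((%s. k^2 * (sqrt s * gauss_mean F s)) has_real_derivative (sqrt s * R s / 4 - h s)) (at s)"
   using gauss_energy_has_derivative(1)[OF jet] by (simp add: R_def F_def h_def)
  then show "((%s. k^2 * (sqrt s * gauss_mean F s)) has_vector_derivative (sqrt s * R s / 4 - h s)) (at s within {e..1})"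
   by (simp add: has_real_derivative_iff_has_vector_derivative has_vector_derivative_at_within)
 qed (use e in simp)
 moreover have h_int: "(h has_integral integral {e..1} h) {e..1}"
  by (intro integrable_integral integrable_continuous_real continuous_on_subset[OF J(4) sub])
 ultimately have 1: "((%s. (sqrt s * R s / 4 - h s) + h s) has_integral (k^2 * (sqrt 1 * gauss_mean F 1) - k^2 * (sqrt e * gauss_mean F e)) + integral {e..1} h) {e..1}"
  by (rule has_integral_add)
 have g_int: "(%s. sqrt s * gauss_mean F (s * (1 / 2))) integrable_on {e..1}"
  by (intro integrable_continuous_real continuous_on_subset[OF J(6) sub]) simp
 have "norm (integral {e..1} (%s. (sqrt s * R s / 4 - h s) + h s)) <= integral {e..1} (%s. 59 / 4 * (sqrt s * gauss_mean F (s * (1 / 2))))"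
 proof (rule integral_norm_bound_integral)
  fix s assume "s \<in> {e..1}"
  then have "s > 0" using e by auto
  then have "sqrt s * \<bar>R s\<bar> <= sqrt s * (59 * gauss_mean F (s * (1 / 2)))" by (intro mult_left_mono R) auto
  then show "norm ((sqrt s * R s / 4 - h s) + h s) <= 59 / 4 * (sqrt s * gauss_mean F (s * (1 / 2)))"
   using \<open>s > 0\<close> by (simp add: abs_mult)
 qed (use has_integral_integrable[OF 1] integrable_cmul[OF g_int, of "59 / 4"] in simp_all)
 moreover have "integral {e..1} (%s. 59 / 4 * (sqrt s * gauss_mean F (s * (1 / 2)))) = 59 / 4 * integral {e..1} (%s. sqrt s * gauss_mean F (s * (1 / 2)))"
  by (rule integral_mult_right)
 moreover have "(k^2 * (sqrt 1 * gauss_mean F 1) - k^2 * (sqrt e * gauss_mean F e)) + integral {e..1} h = integral {e..1} h - (k^2 * (sqrt e * gauss_mean F e) - k^2 * gauss_mean F 1)"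
  by simp
 ultimately show ?thesis unfolding integral_unique[OF 1] by (simp only: real_norm_def)
qed

text \<open>If \<open>M\<close> is bounded by \<open>A\<close> on \<open>{0<..1}\<close>, then so are its increments and the integral of the remainder; hence the integral of the
angular energy against the superposition of Gaussians is bounded, uniformly in the lower end of the interval.\<close>

lemma jet_upper:
 assumes jet: "helmholtz_jet k f p q" and A: "!!s. 0 < s ==> s <= 1 ==> sqrt s * gauss_mean (%x. (norm (f x))^2) s <= A"
 shows "scalar_H f p <= ennreal (2 * sqrt 2 * exp 1 * (k^2 + 60 * sqrt 2) * A)"
proof -
 define F where "F = (%x. (norm (f x))^2)"
 define h where "h = (%s. sqrt s * gauss_mean (%x. angular x (%j. p j x)) s)"
 define S where "S = (%x. angular x (%j. p j x))"
 note J = gauss_energy_facts[OF jet, folded F_def h_def S_def]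
 have J3: "F x >= 0" for x by (simp add: F_def)
 have J5: "h s >= 0" if "s > 0" for s
  using that by (simp add: h_def gauss_mean_nonneg angular_nonneg)
 have J7: "sqrt s * gauss_mean F (s * c) >= 0" if "s > 0" for s c
  using that J3 by (simp add: gauss_mean_nonneg)
 have S0: "S x >= 0" for x by (simp add: S_def angular_nonneg)
 have [measurable]: "F \<in> borel_measurable borel" "S \<in> borel_measurable borel" using J(1,2) by measurable
 have A0: "A >= 0" using A[of 1] J7[of 1 1] by (simp add: F_def)
 have A': "sqrt s * gauss_mean F (s * c) <= sqrt (1 / c) * A" if "0 < s" "s <= 1" "0 < c" "c <= 1" for s c
 proof -
  have "sqrt s * gauss_mean F (s * c) = sqrt (1 / c) * (sqrt (s * c) * gauss_mean F (s * c))" using that by (simp flip: real_sqrt_mult mult.assoc)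
  also have "... <= sqrt (1 / c) * A" using that A[of "s * c"] by (intro mult_left_mono) (auto simp: F_def mult_le_one)
  finally show ?thesis .
 qed
 have intA: "integral {e..1} (%s. sqrt s * gauss_mean F (s * c)) <= sqrt (1 / c) * A" if e: "0 < e" "e < 1" and c: "0 < c" "c <= 1" for e c
 proof -
  have sub: "{e..1} \<subseteq> {0<..}" using e by auto
  have "integral {e..1} (%s. sqrt s * gauss_mean F (s * c)) <= integral {e..1} (%s. sqrt (1 / c) * A)"
   by (intro integral_le integrable_continuous_real continuous_on_subset[OF J(6) sub] A' c continuous_on_const) (use e in auto)
  also have "... <= sqrt (1 / c) * A" using e A0 c by (simp add: mult_left_le_one_le)
  finally show ?thesis .
 qed
 have hB: "integral {e..1} h <= (k^2 + 15 * sqrt 2) * A" if e: "0 < e" "e < 1" for e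
 proof -
  have "\<bar>integral {e..1} h - (k^2 * (sqrt e * gauss_mean F e) - k^2 * gauss_mean F 1)\<bar> <= 59 / 4 * (sqrt 2 * A)"
   using gauss_energy_FTC[OF jet e, folded F_def h_def] intA[OF e, of "1/2"] by simp
  moreover have "k^2 * (sqrt e * gauss_mean F e) <= k^2 * A" using A[of e] e by (intro mult_left_mono) (auto simp: F_def)
  moreover have "0 <= k^2 * gauss_mean F 1" by (intro mult_nonneg_nonneg gauss_mean_nonneg) (simp_all add: F_def)
  moreover have "0 <= sqrt 2 * A" using A0 by simp
  moreover have "(k^2 + 15 * sqrt 2) * A = k^2 * A + 15 * (sqrt 2 * A)" by (simp add: algebra_simps)
  ultimately show ?thesis by linarith
 qed
 have 1: "(NN x. ennreal (S x) * gauss_weight ((norm x)^2)) <= ennreal ((k^2 + 15 * sqrt 2) * A)"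
  using nn_integral_interval_bound[OF J(4) J5 hB] gauss_weight_tonelli[OF J(2) S0, of 1] by (simp add: h_def S_def)
 have 2: "(NN x. ennreal (F x) * gauss_weight ((norm x)^2)) <= ennreal A"
  using nn_integral_interval_bound[OF J(6)[of 1] J7[of _ 1] intA[of _ 1, unfolded div_by_1 real_sqrt_one mult_1_left]] gauss_weight_tonelli[OF J(1) J3, of 1] by simp
 have gw [measurable]: "(%x::real^3. gauss_weight ((norm x)^2)) \<in> borel_measurable borel" unfolding gauss_weight_def by measurable
 have "scalar_H f p <= (NN x. ennreal (2 * sqrt 2 * exp 1) * (ennreal (F x) * gauss_weight ((norm x)^2) + ennreal (S x) * gauss_weight ((norm x)^2)))"
  unfolding scalar_H_def
 proof (rule nn_integral_mono)
  fix x :: "real^3"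
  have "ennreal (((norm (f x))^2 + angular x (%j. p j x)) / bracket3 x) = ennreal (F x + S x) * ennreal (1 / bracket3 x)"
   using S0[of x] J3[of x] japanese_bracket_pos[of x] by (subst ennreal_mult[symmetric]) (auto simp: F_def S_def)
  also have "... <= ennreal (F x + S x) * (ennreal (2 * sqrt 2 * exp 1) * gauss_weight ((norm x)^2))"
   by (intro mult_left_mono gauss_weight_bracket) auto
  also have "... = ennreal (2 * sqrt 2 * exp 1) * (ennreal (F x) * gauss_weight ((norm x)^2) + ennreal (S x) * gauss_weight ((norm x)^2))"
   using S0[of x] J3[of x] by (simp add: ennreal_plus algebra_simps)
  finally show "ennreal (((norm (f x))^2 + angular x (%j. p j x)) / bracket3 x) <= ..." .
 qed
 also have "... = ennreal (2 * sqrt 2 * exp 1) * ((NN x. ennreal (F x) * gauss_weight ((norm x)^2)) + (NN x. ennreal (S x) * gauss_weight ((norm x)^2)))"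
  by (subst nn_integral_cmult, measurable, subst nn_integral_add) auto
 also have "... <= ennreal (2 * sqrt 2 * exp 1) * (ennreal A + ennreal ((k^2 + 15 * sqrt 2) * A))" by (intro mult_left_mono add_mono 1 2) auto
 also have "... = ennreal (2 * sqrt 2 * exp 1 * (A + (k^2 + 15 * sqrt 2) * A))"
  using A0 by (simp add: ennreal_plus[symmetric] ennreal_mult'[symmetric] del: ennreal_plus)
 also have "... <= ennreal (2 * sqrt 2 * exp 1 * (k^2 + 60 * sqrt 2) * A)"
 proof (rule ennreal_leI)
  have "1 <= sqrt 2" by simp
  then have "1 <= 45 * sqrt 2" by linarith
  then have "1 * A <= 45 * sqrt 2 * A" by (intro mult_right_mono A0)
  then have "A + (k^2 + 15 * sqrt 2) * A <= (k^2 + 60 * sqrt 2) * A" by (simp add: algebra_simps)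
  then show "2 * sqrt 2 * exp 1 * (A + (k^2 + 15 * sqrt 2) * A) <= 2 * sqrt 2 * exp 1 * (k^2 + 60 * sqrt 2) * A"
   unfolding mult.assoc[of "2 * sqrt 2 * exp 1"] by (intro mult_left_mono) auto
 qed
 finally show ?thesis .
qed

text \<open>The same identity read in the other direction: \<open>k^2 M s\<close> differs from \<open>k^2 M 1\<close> by at most integrals that the weighted norm controls.\<close>

lemma jet_lower:
 assumes jet: "helmholtz_jet k f p q" and N: "scalar_H f p <= ennreal N" "N >= 0" and s: "0 < s" "s <= 1"
 shows "k^2 * (sqrt s * gauss_mean (%x. (norm (f x))^2) s) <= (2 * k^2 + 100 * exp 1) * N"
proof -
 define F where "F = (%x. (norm (f x))^2)"
 define h where "h = (%s. sqrt s * gauss_mean (%x. angular x (%j. p j x)) s)"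
 define S where "S = (%x. angular x (%j. p j x))"
 note J = gauss_energy_facts[OF jet, folded F_def h_def S_def]
 have J3: "F x >= 0" for x by (simp add: F_def)
 have J5: "h s >= 0" if "s > 0" for s
  using that by (simp add: h_def gauss_mean_nonneg angular_nonneg)
 have J7: "sqrt s * gauss_mean F (s * c) >= 0" if "s > 0" for s c
  using that J3 by (simp add: gauss_mean_nonneg)
 have S0: "S x >= 0" for x by (simp add: S_def angular_nonneg)
 have [measurable]: "F \<in> borel_measurable borel" "S \<in> borel_measurable borel" using J(1,2) by measurable
 let ?w = "%x. ((norm (f x))^2 + angular x (%j. p j x)) / bracket3 x"
 have bound: "(NN x. ennreal (G x) * W x) <= ennreal (c * N)"
  if G: "!!x. 0 <= G x" "!!x. G x <= F x + S x" and W: "!!x. W x <= ennreal (c / bracket3 x)" and c: "c >= 0" for G W c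
 proof -
  have "(NN x. ennreal (G x) * W x) <= (NN x. ennreal c * ennreal (?w x))"
  proof (rule nn_integral_mono)
   fix x
   have "ennreal (G x) * W x <= ennreal (F x + S x) * ennreal (c / bracket3 x)" by (intro mult_mono ennreal_leI G W) auto
   also have "... = ennreal c * ennreal (?w x)" using S0[of x] J3[of x] japanese_bracket_pos[of x] c
    by (subst (1 2) ennreal_mult'[symmetric]) (auto simp: F_def S_def mult_ac)
   finally show "ennreal (G x) * W x <= ..." .
  qed
  also have "... = ennreal c * scalar_H f p"
  proof -
   have eq: "(%x. ennreal (?w x)) = (%x. ennreal ((F x + S x) / sqrt (1 + (norm x)^2) ^ 3))"
    by (simp add: F_def S_def japanese_bracket_def)
   have "(%x. ennreal (?w x)) \<in> borel_measurable lborel" unfolding eq by measurable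
   then show ?thesis unfolding scalar_H_def by (rule nn_integral_cmult)
  qed
  also have "... <= ennreal (c * N)" using N c by (subst ennreal_mult) (auto intro: mult_left_mono)
  finally show ?thesis .
 qed
 have M1: "gauss_mean F 1 <= 2 * N"
 proof -
  have "ennreal (gauss_mean F 1) = (NN x. ennreal (F x) * ennreal (gaussian 1 x))" unfolding gauss_mean_def
   using gauss_mean_integrable[OF J(1), of 1] J3
   by (subst nn_integral_eq_integral[symmetric]) (auto intro!: nn_integral_cong simp: ennreal_mult[symmetric] mult_ac)
  also have "... <= ennreal (2 * N)"
  proof (rule bound)
   fix x :: "real^3"
   define t where "t = (norm x)^2"
   have t: "t >= 0" by (simp add: t_def)
   have "(1 + t) * sqrt (1 + t) <= (1 + t) * (1 + t)" using t by (intro mult_left_mono real_le_lsqrt) (auto simp: power2_eq_square)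
   also have "... <= 2 * (1 + t + t^2 / 2)" using t by (simp add: power2_eq_square algebra_simps)
   also have "... <= 2 * exp t" using exp_lower_Taylor_quadratic[OF t] by simp
   finally have "exp (- t) * ((1 + t) * sqrt (1 + t)) <= exp (- t) * (2 * exp t)" by (intro mult_left_mono) auto
   also have "... = 2" by (simp flip: exp_add)
   finally have "exp (- t) <= 2 / ((1 + t) * sqrt (1 + t))" using t by (simp add: pos_le_divide_eq)
   then show "ennreal (gaussian 1 x) <= ennreal (2 / bracket3 x)" unfolding japanese_bracket_cube t_def by (intro ennreal_leI) simp
  qed (use J3 S0 in auto)
  finally show ?thesis using N by (simp add: ennreal_le_iff)
 qed
 show ?thesis
 proof (cases "s = 1")
  case True
  have "k^2 * gauss_mean F 1 <= k^2 * (2 * N)" by (intro mult_left_mono M1) simp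
  moreover have "0 <= 100 * exp 1 * N" using N by simp
  ultimately show ?thesis using True by (simp add: F_def algebra_simps)
 next
  case False
  then have e: "0 < s" "s < 1" using s by auto
  have "ennreal (integral {s..1} h) <= ennreal (2 * exp 1 * N)"
  proof -
   have "ennreal (integral {s..1} h) <= (NN x. ennreal (S x) * gauss_weight ((norm x)^2))"
    using nn_integral_interval_le[OF J(4) J5 e(1)] gauss_weight_tonelli[OF J(2) S0, of 1] by (simp add: h_def S_def)
   also have "... <= ennreal (2 * exp 1 * N)" by (rule bound) (use J3 S0 gauss_weight_bracket in auto)
   finally show ?thesis .
  qed
  then have 1: "integral {s..1} h <= 2 * exp 1 * N" using N by (subst (asm) ennreal_le_iff) auto
  have "ennreal (integral {s..1} (%s. sqrt s * gauss_mean F (s * (1 / 2)))) <= ennreal (6 * exp 1 * N)"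
  proof -
   have "ennreal (integral {s..1} (%s. sqrt s * gauss_mean F (s * (1 / 2)))) <= (NN x. ennreal (F x) * gauss_weight (1 / 2 * (norm x)^2))"
    using nn_integral_interval_le[OF J(6)[of "1/2"] J7[of _ "1/2"] e(1)] gauss_weight_tonelli[OF J(1) J3, of "1/2"] by simp
   also have "... <= ennreal (6 * exp 1 * N)"
   proof (rule bound)
    fix x :: "real^3"
    define t where "t = (norm x)^2"
    have t: "t >= 0" by (simp add: t_def)
    have "gauss_weight (1 / 2 * t) <= ennreal (2 * exp 1 / ((1 + 1 / 2 * t) * sqrt (1 + 1 / 2 * t)))" using t by (intro gauss_weight_upper) auto
    also have "... <= ennreal (6 * exp 1 / ((1 + t) * sqrt (1 + t)))"
    proof (rule ennreal_leI)
     have "sqrt (1 + t) <= sqrt (2 * (1 + 1 / 2 * t))" using t by simp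
     then have "sqrt (1 + t) <= sqrt 2 * sqrt (1 + 1 / 2 * t)" by (simp only: real_sqrt_mult)
     also have "... <= 3 / 2 * sqrt (1 + 1 / 2 * t)" using t by (intro mult_right_mono real_le_lsqrt) (auto simp: power2_eq_square)
     finally have "(1 + t) * sqrt (1 + t) <= (2 * (1 + 1 / 2 * t)) * (3 / 2 * sqrt (1 + 1 / 2 * t))" using t by (intro mult_mono) auto
     moreover have "(2 * a) * (3 / 2 * b) = 3 * (a * b)" for a b :: real by simp
     ultimately have le: "(1 + t) * sqrt (1 + t) <= 3 * ((1 + 1 / 2 * t) * sqrt (1 + 1 / 2 * t))" by (simp only:)
     have "2 * exp 1 / ((1 + 1 / 2 * t) * sqrt (1 + 1 / 2 * t)) = 6 * exp 1 / (3 * ((1 + 1 / 2 * t) * sqrt (1 + 1 / 2 * t)))" by simp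
     also have "... <= 6 * exp 1 / ((1 + t) * sqrt (1 + t))" using t le by (intro divide_left_mono) auto
     finally show "2 * exp 1 / ((1 + 1 / 2 * t) * sqrt (1 + 1 / 2 * t)) <= 6 * exp 1 / ((1 + t) * sqrt (1 + t))" .
    qed
    finally show "gauss_weight (1 / 2 * (norm x)^2) <= ennreal (6 * exp 1 / bracket3 x)" unfolding japanese_bracket_cube t_def .
   qed (use J3 S0 in auto)
   finally show ?thesis .
  qed
  then have 2: "integral {s..1} (%s. sqrt s * gauss_mean F (s * (1 / 2))) <= 6 * exp 1 * N" using N by (subst (asm) ennreal_le_iff) auto
  have "k^2 * (sqrt s * gauss_mean F s) <= k^2 * gauss_mean F 1 + 2 * exp 1 * N + 59 / 4 * (6 * exp 1 * N)"
   using gauss_energy_FTC[OF jet e, folded F_def h_def] 1 2 by (simp only: abs_le_iff) linarith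
  also have "k^2 * gauss_mean F 1 <= k^2 * (2 * N)" by (intro mult_left_mono M1) simp
  finally have "k^2 * (sqrt s * gauss_mean F s) <= k^2 * (2 * N) + 2 * exp 1 * N + 59 / 4 * (6 * exp 1 * N)" by simp
  moreover have "0 <= exp 1 * N" using N by simp
  ultimately show ?thesis by (simp add: F_def algebra_simps)
 qed
qed

section \<open>The unit sphere\<close>

lemma r_hat_nth [simp]: "r_hat th ph $ 1 = sin th * cos ph" "r_hat th ph $ 2 = sin th * sin ph" "r_hat th ph $ 3 = cos th"
 by (simp_all add: r_hat_def)

lemma inner_vec3: "(x::real^3) \<bullet> y = x $ 1 * y $ 1 + x $ 2 * y $ 2 + x $ 3 * y $ 3" by (simp add: inner_vec_def sum_3)

lemma norm_r_hat [simp]: "norm (r_hat th ph) = 1"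
proof -
 have "(sin th * cos ph)^2 + (sin th * sin ph)^2 + (cos th)^2 = (sin th)^2 * ((sin ph)^2 + (cos ph)^2) + (cos th)^2"
  by (simp only: power_mult_distrib distrib_left add_ac)
 then have "(norm (r_hat th ph))^2 = 1" by (simp add: norm_sq_vec3 sum_3)
 then show ?thesis by (simp add: power2_eq_1_iff) (metis norm_ge_zero not_one_le_zero neg_0_le_iff_le)
qed

text \<open>The definition of \<open>sph_grad\<close> evaluates at these angles, so this holds also on the half-plane that the chart omits.\<close>

lemma spherical_coordinates:
 assumes "x ~= 0"
 shows "x = norm x *R r_hat (arccos (x $ 3 / norm x)) (Arg2pi (Complex (x $ 1) (x $ 2)))"
proof -
 have n: "norm x > 0" and le: "\<bar>x $ 3\<bar> <= norm x" using assms component_le_norm_cart[of x 3] by auto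
 then have c: "-1 <= x $ 3 / norm x" "x $ 3 / norm x <= 1" by (auto simp: field_simps abs_le_iff)
 have "norm x * sqrt (1 - (x $ 3 / norm x)^2) = sqrt ((norm x)^2 * (1 - (x $ 3 / norm x)^2))" using n by (simp add: real_sqrt_mult)
 also have "(norm x)^2 * (1 - (x $ 3 / norm x)^2) = (norm x)^2 - (x $ 3)^2" using n by (simp add: field_simps)
 also have "... = (x $ 1)^2 + (x $ 2)^2" by (simp add: norm_sq_vec3 sum_3)
 finally have m: "norm x * sin (arccos (x $ 3 / norm x)) = cmod (Complex (x $ 1) (x $ 2))" using c by (simp add: sin_arccos cmod_def)
 show ?thesis using m cos_Arg2pi[of "Complex (x $ 1) (x $ 2)"] sin_Arg2pi[of "Complex (x $ 1) (x $ 2)"] c n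
  by (simp add: vec_eq_iff forall_3 mult.assoc[symmetric])
qed

lemma r_hat_continuous [continuous_intros]:
 fixes f g :: "'a::t2_space => real"
 assumes "continuous_on A f" "continuous_on A g"
 shows "continuous_on A (%x. r_hat (f x) (g x))"
proof -
 define R where "R i x = (if i = (1::3) then sin (f x) * cos (g x) else if i = 2 then sin (f x) * sin (g x) else cos (f x))" for i x
 have "continuous_on A (R i)" for i
  using exhaust_3[of i] assms unfolding R_def by (auto intro!: continuous_intros)
 then have "continuous_on A (%x. \<chi> i. R i x)" by (intro continuous_on_vec_lambda)
 moreover have "(\<chi> i. R i x) = r_hat (f x) (g x)" for x
  by (simp add: vec_eq_iff forall_3 R_def)
 ultimately show ?thesis by simp
qed

definition angle_measure :: "(real \<times> real) measure" where
 "angle_measure = density (restrict_space lborel ({0<..<pi} \<times> {0<..<2 * pi})) (%(th, ph). ennreal (sin th))"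

lemma angle_rect [measurable]: "{0<..<pi} \<times> {0<..<2 * pi} \<in> sets (borel :: (real \<times> real) measure)"
 by (intro borel_open open_Times) auto

lemma r_hat_measurable [measurable]: "(%(th, ph). r_hat th ph) \<in> angle_measure \<rightarrow>\<^sub>M restrict_space borel (sphere 0 1)"
proof (rule measurable_restrict_space2)
 have "(%p. r_hat (fst p) (snd p)) \<in> borel_measurable borel" by (intro borel_measurable_continuous_onI continuous_intros)
 then have "(%(th, ph). r_hat th ph) \<in> borel_measurable borel" by (simp add: case_prod_beta)
 then show "(%(th, ph). r_hat th ph) \<in> borel_measurable angle_measure" unfolding angle_measure_def by (simp add: measurable_restrict_space1)
qed (auto simp: angle_measure_def)

lemma sphere_measure_eq: "S2 = distr angle_measure (restrict_space borel (sphere 0 1)) (%(th, ph). r_hat th ph)"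
 by (simp add: sphere_measure_def angle_measure_def)

lemma space_sphere_measure [simp]: "space S2 = sphere 0 1" by (simp add: sphere_measure_eq space_restrict_space)

lemma sets_sphere_measure [measurable_cong]: "sets S2 = sets (restrict_space borel (sphere 0 1))" by (simp add: sphere_measure_eq)

lemma borel_imp_sphere_measurable: "f \<in> borel \<rightarrow>\<^sub>M N ==> f \<in> S2 \<rightarrow>\<^sub>M N"
 by (simp add: measurable_cong_sets[OF sets_sphere_measure refl] measurable_restrict_space1)

lemma continuous_imp_sphere_measurable:
 fixes f :: "real^3 => 'b::{second_countable_topology, t2_space}"
 assumes "continuous_on (sphere 0 1) f" shows "f \<in> borel_measurable S2" using borel_measurable_continuous_on_restrict[OF assms]
 by (simp add: measurable_cong_sets[OF sets_sphere_measure refl])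

lemma finite_sphere_measure: "finite_measure S2"
proof
 let ?R = "{0<..<pi} \<times> {0<..<2 * pi}"
 have R: "?R \<inter> space lborel \<in> sets lborel" by simp
 have sin_fst [measurable]: "(%p::real \<times> real. sin (fst p)) \<in> borel_measurable borel"
  by (intro borel_measurable_continuous_onI continuous_intros)
 have "emeasure S2 (space S2) = emeasure angle_measure (space angle_measure)" unfolding sphere_measure_eq space_distr
  by (subst emeasure_distr[OF r_hat_measurable sets.top]) (auto intro!: arg_cong[where f = "emeasure angle_measure"] simp: space_restrict_space)
 also have "... = (\<integral>\<^sup>+p. ennreal (sin (fst p)) \<partial>restrict_space lborel ?R)"
  using sin_fst sets.top[of "restrict_space lborel ?R"] unfolding angle_measure_def by (subst emeasure_density) (auto simp: case_prod_beta space_restrict_space intro!: nn_integral_cong measurable_restrict_space1)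
 also have "... <= (\<integral>\<^sup>+p. 1 \<partial>restrict_space lborel ?R)" by (intro nn_integral_mono) (metis ennreal_leI ennreal_1 sin_le_one)
 also have "... = emeasure lborel ?R" using R by (simp add: emeasure_restrict_space space_restrict_space)
 also have "... <= emeasure lborel (cbox (0, 0) (pi, 2 * pi))" by (intro emeasure_mono) auto
 also have "... < \<infinity>" by (simp add: emeasure_lborel_cbox_eq)
 finally show "emeasure S2 (space S2) ~= \<infinity>" by simp
qed

interpretation sphere: finite_measure S2 by (rule finite_sphere_measure)

lemma integrable_sphere_bounded:
 fixes f :: "real^3 => 'b::{banach, second_countable_topology}"
 assumes "f \<in> borel_measurable S2" "!!xi. norm xi = 1 ==> norm (f xi) <= B"
 shows "integrable S2 f" by (rule sphere.integrable_const_bound[of _ B]) (use assms in auto)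

lemma sphere_integral_coordinates:
 fixes f :: "real^3 => complex"
 assumes f: "continuous_on UNIV f"
 shows "(LINT xi|S2. f xi) = integral (cbox (0, 0) (pi, 2 * pi)) (%p. sin (fst p) *R f (r_hat (fst p) (snd p)))"
proof -
 let ?R = "{0<..<pi} \<times> {0<..<2 * pi}"
 let ?h = "%p. sin (fst p) *R f (r_hat (fst p) (snd p))"
 have R: "?R \<inter> space lborel \<in> sets lborel" by simp
 have sin_fst [measurable]: "(%p::real \<times> real. sin (fst p)) \<in> borel_measurable borel"
  by (intro borel_measurable_continuous_onI continuous_intros)
 have h: "continuous_on UNIV ?h" by (intro continuous_intros continuous_on_compose2[OF f]) auto
 have "(LINT xi|S2. f xi) = (\<integral>p. f (r_hat (fst p) (snd p)) \<partial>angle_measure)" unfolding sphere_measure_eq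
  by (subst integral_distr) (auto intro!: measurable_restrict_space1 borel_measurable_continuous_onI f simp: case_prod_beta)
 also have "... = (\<integral>p. sin (fst p) *R f (r_hat (fst p) (snd p)) \<partial>restrict_space lborel ?R)"
  unfolding angle_measure_def case_prod_beta
 proof (subst integral_density)
  show "(%p. f (r_hat (fst p) (snd p))) \<in> borel_measurable (restrict_space lborel ?R)"
   by (intro measurable_restrict_space1) (simp add: borel_measurable_continuous_onI continuous_on_compose2[OF f] r_hat_continuous continuous_on_fst continuous_on_snd)
  show "AE p in restrict_space lborel ?R. 0 <= sin (fst p)" by (rule AE_I2) (auto simp: space_restrict_space intro!: sin_ge_zero)
 qed (auto intro!: measurable_restrict_space1)
 also have "... = (LBINT p. indicator ?R p *R ?h p)" by (rule integral_restrict_space[OF R])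
 also have "... = integral ?R ?h"
 proof -
  have "set_integrable lborel (cbox (0, 0) (pi, 2 * pi)) ?h"
   unfolding set_integrable_def by (intro borel_integrable_compact compact_cbox continuous_on_subset[OF h]) simp
  then have "set_integrable lborel ?R ?h" by (rule set_integrable_subset) auto
  then show ?thesis using set_borel_integral_eq_integral(2) unfolding set_lebesgue_integral_def by blast
 qed
 also have "?R = box (0, 0) (pi, 2 * pi)" by (auto simp: box_def Basis_prod_def)
 also have "integral (box (0, 0) (pi, 2 * pi)) ?h = integral (cbox (0, 0) (pi, 2 * pi)) ?h" by (rule integral_open_interval)
 finally show ?thesis .
qed

lemma integral_rectangle_swap:
 fixes f :: "real \<times> real => complex"
 assumes "continuous_on UNIV f"
 shows "integral (cbox (a, c) (b, d)) f = integral {a..b} (%x. integral {c..d} (%y. f (x, y)))"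
  and "integral (cbox (a, c) (b, d)) f = integral {c..d} (%y. integral {a..b} (%x. f (x, y)))"
proof -
 have c: "continuous_on A f" for A by (rule continuous_on_subset[OF assms]) simp
 show 1: "integral (cbox (a, c) (b, d)) f = integral {a..b} (%x. integral {c..d} (%y. f (x, y)))" using integral_prod_continuous[OF c] by simp
 show "integral (cbox (a, c) (b, d)) f = integral {c..d} (%y. integral {a..b} (%x. f (x, y)))"
  unfolding 1 using integral_swap_continuous[of a c b d "%x y. f (x, y)"] c by simp
qed

lemma integral_eq_0_FTC:
 fixes F f :: "real => complex"
 assumes "a <= b" "!!x. (F has_vector_derivative f x) (at x)" "F a = F b"
 shows "integral {a..b} f = 0"
proof -
 have "(f has_integral (F b - F a)) {a..b}"
  by (rule fundamental_theorem_of_calculus) (use assms in \<open>auto intro: has_vector_derivative_at_within\<close>)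
 then show ?thesis using assms(3) by (simp add: integral_unique)
qed

text \<open>Rotation invariance of the sphere measure, for exponentials only: the derivative of the integral in the polar angle of the
direction is the integral of two total derivatives, one in \<open>\<theta>\<close> and one in \<open>\<phi>\<close>, and both vanish over the full rectangle.\<close>

lemma sphere_exp_rotation:
 fixes c :: complex
 shows "(LINT xi|S2. exp (c * cor (r_hat \<beta> \<alpha> \<bullet> xi))) = (LINT xi|S2. exp (c * cor (r_hat 0 0 \<bullet> xi)))"
proof -
 define u where "u \<beta> p = sin \<beta> * (sin (fst p) * cos (snd p - \<alpha>)) + cos \<beta> * cos (fst p)" for \<beta> and p :: "real \<times> real"
 define u' where "u' \<beta> p = cos \<beta> * (sin (fst p) * cos (snd p - \<alpha>)) - sin \<beta> * cos (fst p)" for \<beta> and p :: "real \<times> real"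
 let ?e = "%\<beta> p. exp (c * cor (u \<beta> p)) * (c * cor (u' \<beta> p))"
 define g where "g \<beta> = integral (cbox (0, 0) (pi, 2 * pi)) (%p. sin (fst p) *R exp (c * cor (u \<beta> p)))" for \<beta>
 have inner: "r_hat \<beta> \<alpha> \<bullet> r_hat th ph = u \<beta> (th, ph)" for \<beta> th ph
  by (simp add: inner_vec3 u_def cos_diff algebra_simps)
 have g_eq: "(LINT xi|S2. exp (c * cor (r_hat \<beta> \<alpha> \<bullet> xi))) = g \<beta>" for \<beta>
  unfolding g_def by (subst sphere_integral_coordinates) (auto intro!: continuous_intros simp: inner)
 have deriv: "(g has_vector_derivative integral (cbox (0, 0) (pi, 2 * pi)) (%p. sin (fst p) *R (?e \<beta> p))) (at \<beta>)" for \<beta>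
  unfolding g_def
 proof (rule leibniz_rule_vector_derivative[where U = UNIV])
  fix \<beta> and p :: "real \<times> real"
  have "((%\<beta>. u \<beta> p) has_vector_derivative u' \<beta> p) (at \<beta>)"
   unfolding u_def u'_def has_real_derivative_iff_has_vector_derivative[symmetric] by (auto intro!: derivative_eq_intros)
  then have "((%\<beta>. c * cor (u \<beta> p)) has_vector_derivative c * cor (u' \<beta> p)) (at \<beta>)"
   by (intro has_vector_derivative_mult_right has_vector_derivative_of_real) (simp add: has_real_derivative_iff_has_vector_derivative)
  then have "((%\<beta>. exp (c * cor (u \<beta> p))) has_vector_derivative (c * cor (u' \<beta> p)) * exp (c * cor (u \<beta> p))) (at \<beta>)"
   using field_vector_diff_chain_at[of "%\<beta>. c * cor (u \<beta> p)" _ \<beta> exp "exp (c * cor (u \<beta> p))", unfolded o_def] DERIV_exp by blast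
  then show "((%\<beta>. sin (fst p) *R exp (c * cor (u \<beta> p))) has_vector_derivative sin (fst p) *R (?e \<beta> p)) (at \<beta> within UNIV)"
   using bounded_linear.has_vector_derivative[OF bounded_linear_scaleR_right, of _ _ _ "sin (fst p)"] by (simp add: mult.commute)
 next
  fix \<beta>
  show "(%p. sin (fst p) *R exp (c * cor (u \<beta> p))) integrable_on cbox (0, 0) (pi, 2 * pi)"
   unfolding u_def by (intro integrable_continuous continuous_intros)
  show "continuous_on (UNIV \<times> cbox (0, 0) (pi, 2 * pi)) (%(\<beta>, p). sin (fst p) *R (?e \<beta> p))"
   unfolding u_def u'_def case_prod_beta by (intro continuous_intros)
 qed auto
 have zero: "integral (cbox (0, 0) (pi, 2 * pi)) (%p. sin (fst p) *R (?e \<beta> p)) = 0" for \<beta>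
 proof -
  define G where "G p = exp (c * cor (u \<beta> p))" for p
  define ut where "ut p = sin \<beta> * (cos (fst p) * cos (snd p - \<alpha>)) - cos \<beta> * sin (fst p)" for p :: "real \<times> real"
  define up where "up p = - (sin \<beta> * (sin (fst p) * sin (snd p - \<alpha>)))" for p :: "real \<times> real"
  define A where "A p = (cos (fst p) * cos (snd p - \<alpha>)) *R G p + (sin (fst p) * cos (snd p - \<alpha>)) *R (G p * (c * cor (ut p)))" for p
  define B where "B p = (cos (fst p) * cos (snd p - \<alpha>)) *R G p + (cos (fst p) * sin (snd p - \<alpha>)) *R (G p * (c * cor (up p)))" for p
  have cont: "continuous_on UNIV A" "continuous_on UNIV B" unfolding A_def B_def G_def ut_def up_def u_def by (intro continuous_intros)+
  have eq: "sin (fst p) *R (?e \<beta> p) = B p - A p" for p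
  proof -
   have sc: "(sin (snd p - \<alpha>))^2 = 1 - (cos (snd p - \<alpha>))^2" "(sin (fst p))^2 = 1 - (cos (fst p))^2" by (simp_all add: sin_squared_eq)
   have "sin (fst p) * u' \<beta> p = cos (fst p) * sin (snd p - \<alpha>) * up p - sin (fst p) * cos (snd p - \<alpha>) * ut p"
   proof -
    have "sin (fst p) * u' \<beta> p - (cos (fst p) * sin (snd p - \<alpha>) * up p - sin (fst p) * cos (snd p - \<alpha>) * ut p)
     = - sin (fst p) * sin \<beta> * cos (fst p) * (1 - (sin (snd p - \<alpha>))^2 - (cos (snd p - \<alpha>))^2) + cos \<beta> * sin (fst p) * cos (snd p - \<alpha>) * (sin (fst p) - sin (fst p))"
     unfolding u'_def up_def ut_def by algebra
    then show ?thesis unfolding sc by simp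
   qed
   then have "cor (sin (fst p)) * cor (u' \<beta> p) = cor (cos (fst p) * sin (snd p - \<alpha>)) * cor (up p) - cor (sin (fst p) * cos (snd p - \<alpha>)) * cor (ut p)"
    by (metis of_real_diff of_real_mult)
   then have "G p * c * (cor (sin (fst p)) * cor (u' \<beta> p)) = G p * c * (cor (cos (fst p) * sin (snd p - \<alpha>)) * cor (up p) - cor (sin (fst p) * cos (snd p - \<alpha>)) * cor (ut p))"
    by simp
   then show ?thesis unfolding A_def B_def G_def by (simp add: scaleR_conv_of_real algebra_simps)
  qed
  have d: "((%t. exp (c * cor (w t))) has_vector_derivative exp (c * cor (w t)) * (c * cor w')) (at t)"
   if "(w has_real_derivative w') (at t)" for w w' t
  proof -
   have "((%t. c * cor (w t)) has_vector_derivative c * cor w') (at t)"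
    using that by (intro has_vector_derivative_mult_right has_vector_derivative_of_real) (simp add: has_real_derivative_iff_has_vector_derivative)
   then have "((%t. exp (c * cor (w t))) has_vector_derivative (c * cor w') * exp (c * cor (w t))) (at t)"
    using field_vector_diff_chain_at[of "%t. c * cor (w t)" _ t exp "exp (c * cor (w t))", unfolded o_def] DERIV_exp by blast
   then show ?thesis by (simp only: mult.commute)
  qed
  have "integral (cbox (0, 0) (pi, 2 * pi)) A = 0"
  proof -
   have "integral {0..pi} (%t. A (t, ph)) = 0" for ph
   proof (rule integral_eq_0_FTC)
    fix t
    have 1: "((%t. sin t * cos (ph - \<alpha>)) has_real_derivative cos t * cos (ph - \<alpha>)) (at t)" by (auto intro!: derivative_eq_intros)
    have 2: "((%t. u \<beta> (t, ph)) has_real_derivative ut (t, ph)) (at t)" unfolding u_def ut_def by (auto intro!: derivative_eq_intros)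
    show "((%t. (sin t * cos (ph - \<alpha>)) *R G (t, ph)) has_vector_derivative A (t, ph)) (at t)"
     using has_vector_derivative_scaleR[OF 1 d[OF 2]] unfolding A_def G_def by (simp add: add.commute)
   qed auto
   then show ?thesis using integral_rectangle_swap(2)[OF cont(1), of 0 0 pi "2 * pi"] by simp
  qed
  moreover have "integral (cbox (0, 0) (pi, 2 * pi)) B = 0"
  proof -
   have "integral {0..2 * pi} (%t. B (th, t)) = 0" for th
   proof (rule integral_eq_0_FTC)
    fix t
    have 1: "((%t. cos th * sin (t - \<alpha>)) has_real_derivative cos th * cos (t - \<alpha>)) (at t)" by (auto intro!: derivative_eq_intros)
    have 2: "((%t. u \<beta> (th, t)) has_real_derivative up (th, t)) (at t)" unfolding u_def up_def by (auto intro!: derivative_eq_intros)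
    show "((%t. (cos th * sin (t - \<alpha>)) *R G (th, t)) has_vector_derivative B (th, t)) (at t)"
     using has_vector_derivative_scaleR[OF 1 d[OF 2]] unfolding B_def G_def by (simp add: add.commute)
    have per: "sin (2 * pi - \<alpha>) = sin (0 - \<alpha>)" "cos (2 * pi - \<alpha>) = cos (0 - \<alpha>)" by (simp_all add: sin_diff cos_diff)
    show "(cos th * sin (0 - \<alpha>)) *R G (th, 0) = (cos th * sin (2 * pi - \<alpha>)) *R G (th, 2 * pi)"
     unfolding G_def u_def fst_conv snd_conv per by simp
   qed auto
   then show ?thesis using integral_rectangle_swap(1)[OF cont(2), of 0 0 pi "2 * pi"] by simp
  qed
  moreover have "A integrable_on cbox (0, 0) (pi, 2 * pi)" "B integrable_on cbox (0, 0) (pi, 2 * pi)"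
   by (intro integrable_continuous continuous_on_subset[OF cont(1)] continuous_on_subset[OF cont(2)] subset_UNIV)+
  ultimately show ?thesis unfolding eq by (simp add: Henstock_Kurzweil_Integration.integral_diff)
 qed
 have "g \<beta> = g 0"
 proof -
  have "(g has_derivative (%h. 0)) (at x within UNIV)" for x
   using deriv[of x] unfolding zero has_vector_derivative_def by simp
  then show ?thesis using has_derivative_zero_unique[of UNIV g] by (metis UNIV_I convex_UNIV)
 qed
 moreover have "r_hat 0 \<alpha> = r_hat 0 0" by (simp add: r_hat_def)
 ultimately show ?thesis using g_eq[of \<beta>] g_eq[of 0] by simp
qed

text \<open>By rotation invariance \<open>x\<close> may be put on the polar axis, where the integral is elementary. Complex \<open>c\<close> covers both the plane
waves and the Gaussian kernel of Schur's test.\<close>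

lemma sphere_exp_integral:
 fixes c :: complex
 assumes c: "c ~= 0" and x: "x ~= 0"
 shows "(LINT xi|S2. exp (c * cor (x \<bullet> xi)))
   = 2 * pi * (exp (c * norm x) - exp (- (c * norm x))) / (c * norm x)"
proof -
 define d where "d = c * norm x"
 have d: "d ~= 0" using c x by (simp add: d_def)
 obtain \<beta> \<alpha> where ba: "x = norm x *R r_hat \<beta> \<alpha>" using spherical_coordinates[OF x] by blast
 have "c * cor (x \<bullet> xi) = d * cor (r_hat \<beta> \<alpha> \<bullet> xi)" for xi
  by (subst ba) (simp add: d_def)
 then have "(LINT xi|S2. exp (c * cor (x \<bullet> xi))) = (LINT xi|S2. exp (d * cor (r_hat 0 0 \<bullet> xi)))"
  using sphere_exp_rotation[of d \<beta> \<alpha>] by simp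
 also have "... = integral (cbox (0, 0) (pi, 2 * pi)) (%p. sin (fst p) *R exp (d * cor (cos (fst p))))"
  by (subst sphere_integral_coordinates) (auto intro!: continuous_intros simp: inner_vec3)
 also have "... = integral {0..2 * pi} (%ph. integral {0..pi} (%t. sin t *R exp (d * cor (cos t))))"
  by (subst integral_rectangle_swap(2)) (auto intro!: continuous_intros)
 also have "integral {0..pi} (%t. sin t *R exp (d * cor (cos t))) = (exp d - exp (- d)) / d"
 proof -
  have "((%t. sin t *R exp (d * cor (cos t))) has_integral (- exp (d * cor (cos pi)) / d - (- exp (d * cor (cos 0)) / d))) {0..pi}"
  proof (rule fundamental_theorem_of_calculus)
   fix t
   have "((%t. cor (cos t)) has_vector_derivative cor (- sin t)) (at t)" by (intro has_vector_derivative_of_real) (auto intro!: derivative_eq_intros)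
   then have "((%t. d * cor (cos t)) has_vector_derivative d * cor (- sin t)) (at t)" by (intro has_vector_derivative_mult_right)
   then have "((%t. exp (d * cor (cos t))) has_vector_derivative (d * cor (- sin t)) * exp (d * cor (cos t))) (at t)"
    using field_vector_diff_chain_at[of "%t. d * cor (cos t)" _ t exp "exp (d * cor (cos t))", unfolded o_def] DERIV_exp by blast
   then have hv: "((%t. (- 1 / d) * exp (d * cor (cos t))) has_vector_derivative (- 1 / d) * ((d * cor (- sin t)) * exp (d * cor (cos t)))) (at t)"
    by (rule has_vector_derivative_mult_right)
   have "(- 1 / d) * ((d * - s) * E) = s * E" for s E using d by simp
   then have e2: "(- 1 / d) * ((d * cor (- sin t)) * exp (d * cor (cos t))) = sin t *R exp (d * cor (cos t))"
    unfolding of_real_minus scaleR_conv_of_real by blast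
   have "(- 1 / d) * E = - E / d" for E by simp
   then have e1: "(%t. (- 1 / d) * exp (d * cor (cos t))) = (%t. - exp (d * cor (cos t)) / d)" by blast
   show "((%t. - exp (d * cor (cos t)) / d) has_vector_derivative sin t *R exp (d * cor (cos t))) (at t within {0..pi})"
    using has_vector_derivative_at_within[OF hv] unfolding e1 e2 .
  qed simp
  then show ?thesis using d by (simp add: integral_unique diff_divide_distrib)
 qed
 also have "integral {0..2 * pi} (%ph. (exp d - exp (- d)) / d) = 2 * pi * (exp d - exp (- d)) / d" by (simp add: scaleR_conv_of_real)
 finally show ?thesis by (simp add: d_def)
qed

lemma sphere_measure_total: "measure S2 (space S2) = 4 * pi"
proof -
 have "cor (measure S2 (space S2)) = (LINT xi|S2. 1)" by (simp add: scaleR_conv_of_real)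
 also have "... = integral (cbox (0, 0) (pi, 2 * pi)) (%p. sin (fst p) *R (1::complex))" by (subst sphere_integral_coordinates) auto
 also have "... = integral {0..2 * pi} (%ph. integral {0..pi} (%t. sin t *R (1::complex)))"
  by (subst integral_rectangle_swap(2)) (auto intro!: continuous_intros)
 also have "integral {0..pi} (%t. sin t *R (1::complex)) = 2"
 proof -
  have "((%t. sin t *R (1::complex)) has_integral (cor (- cos pi) - cor (- cos 0))) {0..pi}"
  proof (rule fundamental_theorem_of_calculus)
   fix t
   have "((%t. cor (- cos t)) has_vector_derivative cor (sin t)) (at t)" by (intro has_vector_derivative_of_real) (auto intro!: derivative_eq_intros)
   then show "((%t. cor (- cos t)) has_vector_derivative sin t *R (1::complex)) (at t within {0..pi})"
    unfolding scaleR_conv_of_real mult_1_right by (rule has_vector_derivative_at_within)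
  qed simp
  then show ?thesis by (simp add: integral_unique)
 qed
 finally have "cor (measure S2 (space S2)) = cor (4 * pi)" by (simp add: scaleR_conv_of_real)
 then show ?thesis using of_real_eq_iff by blast
qed

lemma sphere_gaussian_integral:
 fixes xi :: "real^3"
 assumes a: "a > 0" and xi: "norm xi = 1"
 shows "(LINT eta|S2. gaussian a (xi - eta)) = pi / a * (1 - exp (- 4 * a))"
proof -
 have "cor (LINT eta|S2. gaussian a (xi - eta)) = (LINT eta|S2. cor (gaussian a (xi - eta)))" by simp
 also have "... = (LINT eta|S2. cor (exp (- 2 * a)) * exp (cor (2 * a) * cor (xi \<bullet> eta)))"
 proof (rule Bintegral_cong[OF refl])
  fix eta :: "real^3" assume "eta \<in> space S2"
  then have "norm eta = 1" by simp
  then have "(norm (xi - eta))^2 = 2 - 2 * (xi \<bullet> eta)" using xi by (simp add: power2_norm_eq_inner inner_diff inner_commute norm_eq_1)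
  then have "- a * (norm (xi - eta))^2 = - 2 * a + 2 * a * (xi \<bullet> eta)" by (simp only: right_diff_distrib mult_ac)
  then show "cor (gaussian a (xi - eta)) = cor (exp (- 2 * a)) * exp (cor (2 * a) * cor (xi \<bullet> eta))"
   by (simp only: exp_add of_real_mult[of "exp _"] exp_of_real[symmetric] of_real_mult[of "2 * a"])
 qed
 also have "... = cor (exp (- 2 * a)) * (2 * pi * (exp (cor (2 * a) * norm xi) - exp (- (cor (2 * a) * norm xi))) / (cor (2 * a) * norm xi))"
  using a xi by (subst sphere_exp_integral[symmetric]) auto
 also have "... = cor (pi / a * (exp (- 2 * a) * exp (2 * a) - exp (- 2 * a) * exp (- 2 * a)))"
  using a xi by (simp add: exp_of_real[symmetric] field_simps)
 also have "exp (- 2 * a) * exp (2 * a) - exp (- 2 * a) * exp (- 2 * a) = 1 - exp (- 4 * a)" by (simp flip: exp_add)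
 finally show ?thesis using of_real_eq_iff by blast
qed

section \<open>The Herglotz transform\<close>

lemma integral_norm_le:
 fixes f :: "'a => 'b::{banach, second_countable_topology}"
 assumes B: "integrable M B" and le: "!!x. x \<in> space M ==> norm (f x) <= B x"
 shows "norm (LINT x|M. f x) <= (LINT x|M. B x)"
proof (cases "integrable M f")
 case True
 have "norm (LINT x|M. f x) <= (LINT x|M. norm (f x))" by (rule integral_norm_bound)
 also have "... <= (LINT x|M. B x)" by (intro integral_mono integrable_norm True B le)
 finally show ?thesis .
next
 case False
 have "0 <= (LINT x|M. B x)" by (rule Bochner_Integration.integral_nonneg_AE) (use order_trans[OF norm_ge_zero le] in auto)
 then show ?thesis using False by (simp add: not_integrable_integral_eq)
qed

lemma Fubini_bounded_kernel:
 fixes F :: "'a => complex" and g :: "'b => complex" and K :: "'a => 'b => complex"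
 assumes M: "sigma_finite_measure M" and N: "sigma_finite_measure N"
  and F: "integrable M F" and g: "integrable N g"
  and K [measurable]: "(%(x, y). K x y) \<in> borel_measurable (M \<Otimes>\<^sub>M N)"
  and K1: "!!x y. x \<in> space M ==> y \<in> space N ==> norm (K x y) <= 1"
 shows "(LINT x|M. F x * (LINT y|N. K x y * g y)) = (LINT y|N. g y * (LINT x|M. K x y * F x))"
proof -
 interpret P: pair_sigma_finite M N using M N by (simp add: pair_sigma_finite_def)
 have [measurable]: "F \<in> borel_measurable M" "g \<in> borel_measurable N" using F g by auto
 have "integrable (M \<Otimes>\<^sub>M N) (%(x, y). F x * g y)"
 proof (rule P.Fubini_integrable)
  show "integrable M (%x. \<integral>y. norm (case (x, y) of (x, y) => F x * g y) \<partial>N)" using F by (simp add: norm_mult)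
 qed (use g in auto)
 then have int: "integrable (M \<Otimes>\<^sub>M N) (%(x, y). F x * (K x y * g y))"
 proof (rule Bintegrable_bound)
  show "AE p in M \<Otimes>\<^sub>M N. norm (case p of (x, y) => F x * (K x y * g y)) <= norm (case p of (x, y) => F x * g y)"
  proof (rule AE_I2)
   fix p assume "p \<in> space (M \<Otimes>\<^sub>M N)"
   then have "norm (K (fst p) (snd p)) <= 1" using K1 by (auto simp: space_pair_measure)
   then have "norm (F (fst p)) * (norm (K (fst p) (snd p)) * norm (g (snd p))) <= norm (F (fst p)) * (1 * norm (g (snd p)))"
    by (intro mult_left_mono mult_right_mono) auto
   then show "norm (case p of (x, y) => F x * (K x y * g y)) <= norm (case p of (x, y) => F x * g y)" by (simp add: case_prod_beta norm_mult)
  qed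
 qed measurable
 have "(LINT x|M. F x * (LINT y|N. K x y * g y)) = (LINT x|M. (LINT y|N. F x * (K x y * g y)))" by (simp only: integral_mult_right_zero)
 also have "... = (LINT y|N. (LINT x|M. F x * (K x y * g y)))" using P.Fubini_integral[OF int] by simp
 also have "... = (LINT y|N. g y * (LINT x|M. K x y * F x))"
  by (simp only: mult.left_commute[of _ "g _"] mult.commute[of "F _"] mult.commute[of _ "g _"] mult.assoc integral_mult_right_zero)
 finally show ?thesis .
qed

definition L2s :: "(real^3 => complex) => bool" where
 "L2s g \<longleftrightarrow> g \<in> borel_measurable S2 & integrable S2 (%xi. (norm (g xi))^2)"

definition l2sq :: "(real^3 => complex) => real" where
 "l2sq g = (LINT xi|S2. (norm (g xi))^2)"

definition herglotz :: "real => (real^3 => complex) => real^3 => complex" where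
 "herglotz k g x = (LINT xi|S2. iexp (k * (x \<bullet> xi)) * g xi)"

lemma L2s_meas [measurable_dest]: "L2s g ==> g \<in> borel_measurable S2" by (simp add: L2s_def)

lemma L2s_integrable:
 assumes "L2s g" shows "integrable S2 g"
proof (rule Bintegrable_bound)
 show "integrable S2 (%xi. 1 + (norm (g xi))^2)" using assms by (intro Bintegrable_add) (auto simp: L2s_def)
 show "AE xi in S2. norm (g xi) <= norm (1 + (norm (g xi))^2)"
 proof (rule AE_I2)
  fix xi
  have "2 * norm (g xi) <= 1 + (norm (g xi))^2" using zero_le_power2[of "norm (g xi) - 1"] by (simp add: power2_diff)
  then show "norm (g xi) <= norm (1 + (norm (g xi))^2)" by (smt (verit, ccfv_SIG) norm_ge_zero real_norm_def)
 qed
qed (use assms in \<open>simp add: L2s_def\<close>)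

lemma l2sq_nonneg: "l2sq g >= 0" by (simp add: l2sq_def)

lemma L2s_bounded_mult:
 assumes g: "L2s g" and m: "m \<in> borel_measurable S2" and B: "!!xi. norm xi = 1 ==> norm (m xi) <= B"
 shows "L2s (%xi. m xi * g xi)" unfolding L2s_def
proof
 show meas: "(%xi. m xi * g xi) \<in> borel_measurable S2" using g m by (auto simp: L2s_def)
 show "integrable S2 (%xi. (norm (m xi * g xi))^2)"
 proof (rule Bintegrable_bound)
  show "integrable S2 (%xi. B^2 * (norm (g xi))^2)" using g by (simp add: L2s_def)
  show "AE xi in S2. norm ((norm (m xi * g xi))^2) <= norm (B^2 * (norm (g xi))^2)"
  proof (rule AE_I2)
   fix xi assume "xi \<in> space S2"
   then have "norm (m xi) <= B" using B by simp
   then have "(norm (m xi))^2 * (norm (g xi))^2 <= B^2 * (norm (g xi))^2" by (intro mult_right_mono power_mono) auto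
   then show "norm ((norm (m xi * g xi))^2) <= norm (B^2 * (norm (g xi))^2)" by (simp add: norm_mult power_mult_distrib)
  qed
 qed (use meas in measurable)
qed

lemma L2s_add:
 assumes f: "L2s f" and g: "L2s g" shows "L2s (%xi. f xi + g xi)" unfolding L2s_def
proof
 show meas: "(%xi. f xi + g xi) \<in> borel_measurable S2" using f g by (auto simp: L2s_def)
 show "integrable S2 (%xi. (norm (f xi + g xi))^2)"
 proof (rule Bintegrable_bound)
  show "integrable S2 (%xi. 2 * (norm (f xi))^2 + 2 * (norm (g xi))^2)" using f g by (simp add: L2s_def)
  show "AE xi in S2. norm ((norm (f xi + g xi))^2) <= norm (2 * (norm (f xi))^2 + 2 * (norm (g xi))^2)"
  proof (rule AE_I2)
   fix xi
   have "(norm (f xi + g xi))^2 <= (norm (f xi) + norm (g xi))^2" by (intro power_mono norm_triangle_ineq) auto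
   also have "... <= 2 * (norm (f xi))^2 + 2 * (norm (g xi))^2"
    using zero_le_power2[of "norm (f xi) - norm (g xi)"] by (simp add: power2_sum power2_diff)
   finally show "norm ((norm (f xi + g xi))^2) <= norm (2 * (norm (f xi))^2 + 2 * (norm (g xi))^2)" by simp
  qed
 qed (use meas in measurable)
qed

lemma L2s_cmult: "L2s g ==> L2s (%xi. c * g xi)" by (rule L2s_bounded_mult[where B = "norm c"]) auto

lemma L2s_component: "L2s g ==> L2s (%xi. cor (xi $ j) * g xi)"
proof (rule L2s_bounded_mult[where B = 1])
 show "(%xi. cor (xi $ j)) \<in> borel_measurable S2" by (rule continuous_imp_sphere_measurable) (auto intro!: continuous_intros)
 show "norm (cor (xi $ j)) <= 1" if "norm xi = 1" for xi :: "real^3" using component_le_norm_cart[of xi j] that by simp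
qed

lemma exp_kernel_meas [measurable]:
 "(%xi. iexp (k * (x \<bullet> xi))) \<in> borel_measurable S2" by (rule continuous_imp_sphere_measurable) (auto intro!: continuous_intros)

lemma herglotz_integrable:
 assumes "L2s g"
 shows "integrable S2 (%xi. iexp (k * (x \<bullet> xi)) * g xi)" by (rule Bintegrable_bound[OF L2s_integrable[OF assms]])
   (use assms in \<open>auto simp: norm_mult intro!: borel_measurable_times exp_kernel_meas L2s_meas simp del: of_real_mult\<close>)

lemma herglotz_add: "L2s f ==> L2s g ==> herglotz k (%xi. f xi + g xi) x = herglotz k f x + herglotz k g x"
 unfolding herglotz_def by (subst Bintegral_add[symmetric]) (simp_all only: herglotz_integrable distrib_left)

lemma herglotz_cmult: "herglotz k (%xi. c * g xi) x = c * herglotz k g x" unfolding herglotz_def by (simp add: mult.left_commute)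

lemma herglotz_norm_le: "norm (herglotz k g x) <= (LINT xi|S2. norm (g xi))"
 unfolding herglotz_def by (rule order_trans[OF integral_norm_bound]) (simp add: norm_mult)

lemma herglotz_has_derivative:
 assumes g: "L2s g"
 shows "(herglotz k g has_derivative (%h. SUM j:UNIV. h $ j *R herglotz k (%xi. (\<i> * cor k) * (cor (xi $ j) * g xi)) x)) (at x)"
proof -
 define f' where "f' x xi h = (\<i> * cor (k * (h \<bullet> xi))) * iexp (k * (x \<bullet> xi)) * g xi" for x xi h :: "real^3"
 have [measurable]: "g \<in> borel_measurable S2" using g by measurable
 have comp: "L2s (%xi. (\<i> * cor k) * (cor (xi $ j) * g xi))" for j
  by (intro L2s_cmult L2s_component g)
 have "((%x. \<integral>xi. iexp (k * (x \<bullet> xi)) * g xi \<partial>S2) has_derivative (%h. \<integral>xi. f' x xi h \<partial>S2)) (at x)"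
 proof (rule has_derivative_integral(1)[where r = 1 and B = "%xi. \<bar>k\<bar> * norm (g xi)"])
  fix x xi :: "real^3"
  have "((%x. x \<bullet> xi) has_derivative (%h. h \<bullet> xi)) (at x)"
   by (rule bounded_linear_imp_has_derivative) (rule bounded_linear_inner_left)
  then have "((%x. \<i> * cor (k * (x \<bullet> xi))) has_derivative (%h. \<i> * cor (k * (h \<bullet> xi)))) (at x)"
   by (intro has_derivative_mult_right has_derivative_of_real)
  then have "((%x. iexp (k * (x \<bullet> xi))) has_derivative (%h. iexp (k * (x \<bullet> xi)) * (\<i> * cor (k * (h \<bullet> xi))))) (at x)"
   by (rule has_derivative_compose) (rule DERIV_exp[unfolded has_field_derivative_def])
  then have "((%x. iexp (k * (x \<bullet> xi)) * g xi) has_derivative (%h. (iexp (k * (x \<bullet> xi)) * (\<i> * cor (k * (h \<bullet> xi)))) * g xi)) (at x)"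
   by (rule has_derivative_mult_left)
  then show "((%x. iexp (k * (x \<bullet> xi)) * g xi) has_derivative f' x xi) (at x)" unfolding f'_def by (simp only: mult.commute[of "exp _"])
 next
  fix y xi h :: "real^3" assume "xi \<in> space S2"
  then have "\<bar>h \<bullet> xi\<bar> <= norm h" using Cauchy_Schwarz_ineq2[of h xi] by simp
  then have "\<bar>k\<bar> * \<bar>h \<bullet> xi\<bar> * norm (g xi) <= \<bar>k\<bar> * norm h * norm (g xi)" by (intro mult_right_mono mult_left_mono) auto
  then show "norm (f' y xi h) <= \<bar>k\<bar> * norm (g xi) * norm h" by (simp add: f'_def norm_mult abs_mult mult_ac)
 next
  have [measurable]: "(%xi. h \<bullet> xi) \<in> borel_measurable S2" for h :: "real^3"
   by (rule continuous_imp_sphere_measurable) (auto intro!: continuous_intros)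
  show "(%xi. f' x xi h) \<in> borel_measurable S2" for h unfolding f'_def by measurable
 qed (simp_all only: herglotz_integrable[OF g] integrable_mult_right integrable_norm L2s_integrable[OF g] zero_less_one)
 moreover have "(LINT xi|S2. f' x xi h) = (SUM j:UNIV. h $ j *R herglotz k (%xi. (\<i> * cor k) * (cor (xi $ j) * g xi)) x)" for h
 proof -
  have "(LINT xi|S2. f' x xi h) = (LINT xi|S2. (SUM j:UNIV. h $ j *R (iexp (k * (x \<bullet> xi)) * ((\<i> * cor k) * (cor (xi $ j) * g xi)))))"
   by (intro Bintegral_cong refl) (simp add: f'_def inner_vec3 sum_3 scaleR_conv_of_real algebra_simps)
  also have "... = (SUM j:UNIV. h $ j *R herglotz k (%xi. (\<i> * cor k) * (cor (xi $ j) * g xi)) x)"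
   unfolding herglotz_def by (subst Bintegral_sum) (simp_all only: integral_scaleR_right integrable_scaleR_right herglotz_integrable[OF comp])
  finally show ?thesis .
 qed
 ultimately show ?thesis by (simp add: herglotz_def[abs_def])
qed

lemma herglotz_continuous: "L2s g ==> continuous_on UNIV (herglotz k g)"
 using herglotz_has_derivative by (intro continuous_at_imp_continuous_on ballI) (auto intro: has_derivative_continuous)

lemma herglotz_subgaussian: "L2s g ==> subgaussian (herglotz k g)"
 by (rule subgaussian_bound[OF subgaussian_const[of "1::real"], where K = "\<integral>xi. norm (g xi) \<partial>S2"])
   (auto simp: herglotz_continuous herglotz_norm_le)

lemma herglotz_pairing:
 assumes g: "L2s g" and F: "integrable lborel F"
 shows "(LBINT x. F x * herglotz k g x) = (LINT xi|S2. g xi * (LBINT x. iexp (k * (x \<bullet> xi)) * F x))" unfolding herglotz_def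
proof (rule Fubini_bounded_kernel)
 have "(%p::(real^3) \<times> (real^3). iexp (k * (fst p \<bullet> snd p))) \<in> borel_measurable (borel \<Otimes>\<^sub>M borel)"
  unfolding borel_prod by (intro borel_measurable_continuous_onI continuous_intros)
 then have m: "(%p::(real^3) \<times> (real^3). iexp (k * (fst p \<bullet> snd p))) \<in> borel_measurable (lborel \<Otimes>\<^sub>M borel)"
  by (simp cong: measurable_cong_sets)
 have "(%p. p) \<in> lborel \<Otimes>\<^sub>M S2 \<rightarrow>\<^sub>M lborel \<Otimes>\<^sub>M borel"
  by (intro measurable_pair) (auto intro!: measurable_compose[OF measurable_snd borel_imp_sphere_measurable] simp: o_def)
 then have "(%p. iexp (k * (fst p \<bullet> snd p))) \<in> borel_measurable (lborel \<Otimes>\<^sub>M S2)" using m by (rule measurable_compose)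
 then show "(%(x, xi). iexp (k * (x \<bullet> xi))) \<in> borel_measurable (lborel \<Otimes>\<^sub>M S2)" by (simp add: case_prod_beta)
qed (use F L2s_integrable[OF g] lborel.sigma_finite_measure_axioms sphere.sigma_finite_measure_axioms in auto)

lemma gaussian_fourier_shifted:
 fixes x zeta :: "real^3"
 assumes s: "s > 0"
 shows "integrable lborel (%y. cor (gaussian s (y - x)))"
  and "(LBINT y. iexp (y \<bullet> zeta) * cor (gaussian s (y - x)))
   = cor (sqrt (pi / s) ^ 3 * exp (- ((norm zeta)^2 / (4 * s)))) * iexp (x \<bullet> zeta)"
proof -
 have "integrable lborel (%y::real^3. gaussian s (- x + y))" by (rule integrable_shift[OF gaussian_integral(1)[OF s]])
 then show "integrable lborel (%y. cor (gaussian s (y - x)))" by (intro integrable_of_real) simp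
 let ?f = "%y::real^3. iexp ((x + y) \<bullet> zeta) * cor (gaussian s y)"
 have "(LBINT y. iexp (y \<bullet> zeta) * cor (gaussian s (y - x))) = (LBINT y. ?f (- x + y))" by simp
 also have "... = (LBINT y. ?f y)" by (rule integral_shift) (intro borel_measurable_continuous_onI continuous_intros)
 also have "... = (LBINT y. iexp (x \<bullet> zeta) * (gaussian s y *R iexp (zeta \<bullet> y)))"
 proof (intro Bintegral_cong refl)
  fix y
  have "(x + y) \<bullet> zeta = x \<bullet> zeta + zeta \<bullet> y" by (simp add: inner_add_left inner_commute[of y])
  then show "?f y = iexp (x \<bullet> zeta) * (gaussian s y *R iexp (zeta \<bullet> y))" by (simp add: distrib_left exp_add scaleR_conv_of_real)
 qed
 also have "... = iexp (x \<bullet> zeta) * cor (sqrt (pi / s) ^ 3 * exp (- ((norm zeta)^2 / (4 * s))))"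
  using gaussian_fourier(2)[OF s, of zeta] by (simp only: integral_mult_right_zero) simp
 finally show "(LBINT y. iexp (y \<bullet> zeta) * cor (gaussian s (y - x)))
   = cor (sqrt (pi / s) ^ 3 * exp (- ((norm zeta)^2 / (4 * s)))) * iexp (x \<bullet> zeta)" by (simp only: mult.commute)
qed

lemma herglotz_reproducing:
 assumes g: "L2s g"
 shows "reproducing k (herglotz k g)" unfolding reproducing_def
proof (intro conjI allI impI)
 show "gauss_integrable (herglotz k g)" by (intro subgaussian_imp_gauss_integrable herglotz_subgaussian g)
 fix s :: real and x :: "real^3" assume s: "s > 0"
 have "gauss_conv s (herglotz k g) x = (LBINT y. cor (gaussian s (y - x)) * herglotz k g y)" by (simp add: gauss_transform_def scaleR_conv_of_real)
 also have "... = (LINT xi|S2. g xi * (LBINT y. iexp (k * (y \<bullet> xi)) * cor (gaussian s (y - x))))"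
  by (rule herglotz_pairing[OF g gaussian_fourier_shifted(1)[OF s]])
 also have "... = (LINT xi|S2. cor (sqrt (pi / s) ^ 3 * exp (- (k^2 / (4 * s)))) * (iexp (k * (x \<bullet> xi)) * g xi))"
 proof (intro Bintegral_cong refl)
  fix xi :: "real^3" assume "xi \<in> space S2"
  then have "norm xi = 1" by simp
  then show "g xi * (LBINT y. iexp (k * (y \<bullet> xi)) * cor (gaussian s (y - x))) =
    cor (sqrt (pi / s) ^ 3 * exp (- (k^2 / (4 * s)))) * (iexp (k * (x \<bullet> xi)) * g xi)"
   using gaussian_fourier_shifted(2)[OF s, of "k *R xi" x] by (simp add: mult_ac)
 qed
 also have "... = (sqrt (pi / s) ^ 3 * exp (- (k^2 / (4 * s)))) *R herglotz k g x"
  unfolding herglotz_def by (simp only: integral_mult_right_zero scaleR_conv_of_real)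
 finally show "gauss_conv s (herglotz k g) x = (sqrt (pi / s) ^ 3 * exp (- (k^2 / (4 * s)))) *R herglotz k g x" .
qed

text \<open>Schur's test for the Gaussian kernel on the sphere, whose integral over one variable is at most \<open>pi / a\<close>.\<close>

lemma sphere_Schur:
 assumes a: "a > 0" and g: "L2s g"
 shows "(LINT eta|S2. norm (g eta) * (LINT xi|S2. norm (g xi) * gaussian a (eta - xi))) <= pi / a * l2sq g"
  and "integrable S2 (%eta. norm (g eta) * (LINT xi|S2. norm (g xi) * gaussian a (eta - xi)))"
proof -
 interpret P: pair_sigma_finite S2 S2 by (simp add: pair_sigma_finite_def sphere.sigma_finite_measure_axioms)
 have [measurable]: "g \<in> borel_measurable S2" using g by measurable
 define K where "K p = gaussian a (fst p - snd p)" for p :: "(real^3) \<times> (real^3)"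
 have K01: "0 <= K p" "K p <= 1" for p using a by (auto simp: K_def)
 have Ks: "K (x, y) = K (y, x)" for x y by (simp add: K_def norm_minus_commute)
 have "K \<in> borel_measurable (borel \<Otimes>\<^sub>M borel)"
  unfolding borel_prod K_def by (intro borel_measurable_continuous_onI continuous_intros)
 moreover have "(%p. p) \<in> S2 \<Otimes>\<^sub>M S2 \<rightarrow>\<^sub>M borel \<Otimes>\<^sub>M borel"
  by (intro measurable_pair) (auto intro!: measurable_compose[OF measurable_snd borel_imp_sphere_measurable] measurable_compose[OF measurable_fst borel_imp_sphere_measurable] simp: o_def)
 ultimately have K [measurable]: "K \<in> borel_measurable (S2 \<Otimes>\<^sub>M S2)" using measurable_compose by blast
 have g2: "integrable S2 (%xi. (norm (g xi))^2)" using g by (simp add: L2s_def)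
 have n: "(LINT xi|S2. K (eta, xi)) <= pi / a" if "norm eta = 1" for eta
  using sphere_gaussian_integral[OF a that] a by (simp add: K_def divide_right_mono mult_left_le)
 have intK: "integrable S2 (%xi. K (eta, xi))" for eta
  by (rule integrable_sphere_bounded[where B = 1])
    (use K01 in \<open>auto simp: K_def intro!: continuous_imp_sphere_measurable continuous_intros\<close>)
 have prod1: "integrable (S2 \<Otimes>\<^sub>M S2) (%p. (norm (g (fst p)))^2)" using P.Fubini_integrable[of "%p. (norm (g (fst p)))^2"] g2 by simp
 have prod1K: "integrable (S2 \<Otimes>\<^sub>M S2) (%p. (norm (g (fst p)))^2 * K p)"
  by (rule Bintegrable_bound[OF prod1]) (use K01 in \<open>auto simp: abs_mult mult_left_le\<close>)
 have prod2K: "integrable (S2 \<Otimes>\<^sub>M S2) (%p. (norm (g (snd p)))^2 * K p)"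
 proof -
  have "(%(x, y). (norm (g (fst (y, x))))^2 * K (y, x)) = (%p. (norm (g (snd p)))^2 * K p)" using Ks by (auto simp: fun_eq_iff)
  then show ?thesis using P.integrable_product_swap[OF prod1K] by (simp only:)
 qed
 have intP: "integrable (S2 \<Otimes>\<^sub>M S2) (%p. norm (g (fst p)) * norm (g (snd p)) * K p)"
 proof (rule Bintegrable_bound[OF Bintegrable_add[OF prod1K prod2K]])
  show "AE p in S2 \<Otimes>\<^sub>M S2. norm (norm (g (fst p)) * norm (g (snd p)) * K p) <= norm ((norm (g (fst p)))^2 * K p + (norm (g (snd p)))^2 * K p)"
  proof (rule AE_I2)
   fix p
   have "2 * norm (g (fst p)) * norm (g (snd p)) <= (norm (g (fst p)))^2 + (norm (g (snd p)))^2" by (rule sum_squares_bound)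
   moreover have "0 <= norm (g (fst p)) * norm (g (snd p))" by simp
   ultimately have "norm (g (fst p)) * norm (g (snd p)) <= (norm (g (fst p)))^2 + (norm (g (snd p)))^2" by linarith
   then have "norm (g (fst p)) * norm (g (snd p)) * K p <= ((norm (g (fst p)))^2 + (norm (g (snd p)))^2) * K p" by (intro mult_right_mono K01)
   then show "norm (norm (g (fst p)) * norm (g (snd p)) * K p) <= norm ((norm (g (fst p)))^2 * K p + (norm (g (snd p)))^2 * K p)"
    using K01[of p] by (simp add: abs_mult distrib_right)
  qed
 qed measurable
 have eq: "(LINT xi|S2. norm (g eta) * norm (g xi) * K (eta, xi)) = norm (g eta) * (LINT xi|S2. norm (g xi) * gaussian a (eta - xi))" for eta
  by (simp add: K_def mult.assoc)
 show "integrable S2 (%eta. norm (g eta) * (LINT xi|S2. norm (g xi) * gaussian a (eta - xi)))"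
  using P.integrable_fst'[OF intP] by (simp only: fst_conv snd_conv eq)
 have "(LINT eta|S2. norm (g eta) * (LINT xi|S2. norm (g xi) * gaussian a (eta - xi)))
   = (\<integral>p. norm (g (fst p)) * norm (g (snd p)) * K p \<partial>(S2 \<Otimes>\<^sub>M S2))"
  using P.integral_fst'[OF intP] by (simp only: fst_conv snd_conv eq)
 also have "... <= (\<integral>p. 1 / 2 * ((norm (g (fst p)))^2 * K p) + 1 / 2 * ((norm (g (snd p)))^2 * K p) \<partial>(S2 \<Otimes>\<^sub>M S2))"
 proof (rule integral_mono)
  fix p
  have "2 * norm (g (fst p)) * norm (g (snd p)) <= (norm (g (fst p)))^2 + (norm (g (snd p)))^2" by (rule sum_squares_bound)
  then have "norm (g (fst p)) * norm (g (snd p)) <= 1 / 2 * (norm (g (fst p)))^2 + 1 / 2 * (norm (g (snd p)))^2" by simp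
  then have "norm (g (fst p)) * norm (g (snd p)) * K p <= (1 / 2 * (norm (g (fst p)))^2 + 1 / 2 * (norm (g (snd p)))^2) * K p" by (intro mult_right_mono K01)
  then show "norm (g (fst p)) * norm (g (snd p)) * K p <= 1 / 2 * ((norm (g (fst p)))^2 * K p) + 1 / 2 * ((norm (g (snd p)))^2 * K p)"
   by (simp add: distrib_right)
 qed (use intP prod1K prod2K in auto)
 also have "... = 1 / 2 * (\<integral>p. (norm (g (fst p)))^2 * K p \<partial>(S2 \<Otimes>\<^sub>M S2)) + 1 / 2 * (\<integral>p. (norm (g (snd p)))^2 * K p \<partial>(S2 \<Otimes>\<^sub>M S2))"
  by (subst Bintegral_add) (simp_all only: integrable_mult_right prod1K prod2K integral_mult_right_zero)
 also have "(\<integral>p. (norm (g (snd p)))^2 * K p \<partial>(S2 \<Otimes>\<^sub>M S2)) = (\<integral>p. (norm (g (fst p)))^2 * K p \<partial>(S2 \<Otimes>\<^sub>M S2))"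
 proof -
  have "(%(x, y). (norm (g (fst (y, x))))^2 * K (y, x)) = (%p. (norm (g (snd p)))^2 * K p)" using Ks by (auto simp: fun_eq_iff)
  then show ?thesis using P.integral_product_swap[OF borel_measurable_integrable[OF prod1K]] by (simp only:)
 qed
 also have "(\<integral>p. (norm (g (fst p)))^2 * K p \<partial>(S2 \<Otimes>\<^sub>M S2)) = (LINT eta|S2. (norm (g eta))^2 * (LINT xi|S2. K (eta, xi)))"
  using P.integral_fst'[OF prod1K] by (simp only: fst_conv integral_mult_right_zero)
 also have "... <= (LINT eta|S2. (norm (g eta))^2 * (pi / a))"
 proof (rule integral_mono)
  show "integrable S2 (%eta. (norm (g eta))^2 * (LINT xi|S2. K (eta, xi)))"
   using P.integrable_fst'[OF prod1K] by (simp only: fst_conv integral_mult_right_zero)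
  fix eta :: "real^3" assume "eta \<in> space S2"
  then show "(norm (g eta))^2 * (LINT xi|S2. K (eta, xi)) <= (norm (g eta))^2 * (pi / a)" by (intro mult_left_mono n) auto
 qed (simp_all only: g2 integrable_mult_left)
 also have "... = pi / a * l2sq g" by (simp add: l2sq_def)
 finally show "(LINT eta|S2. norm (g eta) * (LINT xi|S2. norm (g xi) * gaussian a (eta - xi))) <= pi / a * l2sq g" by simp
qed

text \<open>Expanding the square and integrating over \<open>x\<close> first produces the kernel \<open>exp (- k^2 |\<xi> - \<eta>|^2 / (4 s))\<close> on the sphere. The
factor \<open>s\<close> gained in Schur's test is what makes the bound uniform in \<open>s\<close>.\<close>

lemma herglotz_gauss_mean_le:
 assumes g: "L2s g" and k: "k > 0" and s: "s > 0"
 shows "sqrt s * gauss_mean (%x. (norm (herglotz k g x))^2) s <= 4 * pi^2 * sqrt pi / k^2 * l2sq g"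
proof -
 define a where "a = k^2 / (4 * s)"
 have a: "a > 0" using k s by (simp add: a_def)
 define N where "N = sqrt (pi / s) ^ 3"
 have N0: "N >= 0" using s by (simp add: N_def)
 let ?U = "herglotz k g"
 let ?I = "%eta. LINT xi|S2. norm (g xi) * gaussian a (eta - xi)"
 let ?Q = "%eta. LINT xi|S2. g xi * cor (N * gaussian a (eta - xi))"
 have U: "subgaussian ?U" by (rule herglotz_subgaussian[OF g])
 have U': "subgaussian (%x. cnj (?U x))" by (rule subgaussian_linear[OF bounded_linear_cnj U])
 have intF: "integrable lborel (%x. cor (gaussian s x) * cnj (?U x))"
  using gauss_integrableD[OF subgaussian_imp_gauss_integrable[OF U'] s] by (simp add: scaleR_conv_of_real)
 have inner: "(LBINT x. iexp (k * (x \<bullet> eta)) * (cor (gaussian s x) * cnj (?U x)))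
   = cnj (?Q eta)" for eta
 proof -
  define F where "F x = iexp (x \<bullet> (- (k *R eta))) * cor (gaussian s x)" for x :: "real^3"
  have F: "integrable lborel F" unfolding F_def by (rule Bintegrable_bound[OF gaussian_fourier_shifted(1)[OF s, of 0]])
    (auto simp: norm_mult intro!: borel_measurable_continuous_onI continuous_intros)
  have "(LBINT x. iexp (k * (x \<bullet> eta)) * (cor (gaussian s x) * cnj (?U x))) = (LBINT x. cnj (F x * ?U x))"
   unfolding F_def by (intro Bintegral_cong refl) (simp add: exp_cnj mult_ac)
  also have "... = cnj (LBINT x. F x * ?U x)" by (rule Bochner_Integration.integral_cnj)
  also have "(LBINT x. F x * ?U x) = (LINT xi|S2. g xi * (LBINT x. iexp (k * (x \<bullet> xi)) * F x))" by (rule herglotz_pairing[OF g F])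
  also have "... = (?Q eta)"
  proof (intro Bintegral_cong refl)
   fix xi :: "real^3"
   have "(LBINT x. iexp (k * (x \<bullet> xi)) * F x) = (LBINT x. iexp (x \<bullet> (k *R (xi - eta))) * cor (gaussian s (x - 0)))"
   proof (intro Bintegral_cong refl)
    fix x
    have "\<i> * cor (x \<bullet> (k *R (xi - eta))) = \<i> * cor (k * (x \<bullet> xi)) + \<i> * cor (x \<bullet> (- (k *R eta)))"
     by (simp add: inner_diff_right algebra_simps)
    then show "iexp (k * (x \<bullet> xi)) * F x = iexp (x \<bullet> (k *R (xi - eta))) * cor (gaussian s (x - 0))"
     unfolding F_def by (simp only: exp_add mult.assoc diff_zero)
   qed
   also have "... = cor (N * exp (- ((norm (k *R (xi - eta)))^2 / (4 * s)))) * iexp (0 \<bullet> (k *R (xi - eta)))"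
    unfolding N_def by (rule gaussian_fourier_shifted(2)[OF s])
   also have "... = cor (N * gaussian a (eta - xi))" by (simp add: a_def power_mult_distrib norm_minus_commute)
   finally show "g xi * (LBINT x. iexp (k * (x \<bullet> xi)) * F x) = g xi * cor (N * gaussian a (eta - xi))" by simp
  qed
  finally show ?thesis .
 qed
 have "cor (gauss_mean (%x. (norm (?U x))^2) s) = (LBINT x. cor (gaussian s x) * cnj (?U x) * ?U x)"
  unfolding gauss_mean_def integral_complex_of_real[symmetric]
 proof (intro Bintegral_cong refl)
  fix x
  have "cor ((norm (?U x))^2) = ?U x * cnj (?U x)" by (rule complex_norm_square)
  then show "cor (gaussian s x * (norm (?U x))^2) = cor (gaussian s x) * cnj (?U x) * ?U x" by (simp only: of_real_mult mult_ac)
 qed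
 also have "... = (LINT eta|S2. g eta * cnj (?Q eta))" unfolding herglotz_pairing[OF g intF] inner ..
 finally have e: "cor (gauss_mean (%x. (norm (?U x))^2) s) = (LINT eta|S2. g eta * cnj (?Q eta))" .
 have "gauss_mean (%x. (norm (?U x))^2) s = norm (cor (gauss_mean (%x. (norm (?U x))^2) s))" by (simp add: gauss_mean_nonneg)
 also have "... = norm (LINT eta|S2. g eta * cnj (?Q eta))" by (simp only: e)
 also have "... <= (LINT eta|S2. N * (norm (g eta) * (?I eta)))"
 proof (rule integral_norm_le)
  show "integrable S2 (%eta. N * (norm (g eta) * (?I eta)))"
   by (intro integrable_mult_right sphere_Schur a g)
  fix eta :: "real^3"
  have "norm (?Q eta) <= (LINT xi|S2. norm (g xi * cor (N * gaussian a (eta - xi))))"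
   by (rule integral_norm_bound)
  also have "... = (LINT xi|S2. N * (norm (g xi) * gaussian a (eta - xi)))" using N0 by (simp add: norm_mult abs_mult mult_ac)
  also have "... = N * (?I eta)" by (rule integral_mult_right_zero)
  finally have "norm (g eta) * norm (?Q eta) <= norm (g eta) * (N * (?I eta))"
   by (rule mult_left_mono) simp
  then show "norm (g eta * cnj (?Q eta)) <= N * (norm (g eta) * (?I eta))"
   by (simp add: norm_mult mult_ac)
 qed
 also have "... = N * (LINT eta|S2. norm (g eta) * (?I eta))" by (rule integral_mult_right_zero)
 also have "... <= N * (pi / a * l2sq g)" by (intro mult_left_mono sphere_Schur a g N0)
 finally have "sqrt s * gauss_mean (%x. (norm (?U x))^2) s <= sqrt s * (N * (pi / a * l2sq g))" using s by (intro mult_left_mono) auto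
 also have "sqrt s * (N * (pi / a * l2sq g)) = (sqrt s * N * pi / a) * l2sq g" by simp
 also have "sqrt s * N * pi / a = 4 * pi^2 * sqrt pi / k^2"
 proof -
  have ss: "sqrt s * sqrt s = s" "sqrt pi * sqrt pi = pi" "sqrt s > 0" using s by auto
  have "sqrt s * N = sqrt pi * (sqrt pi * sqrt pi) / (sqrt s * sqrt s)"
   unfolding N_def real_sqrt_divide power_divide power3_eq_cube using ss(3) by (simp add: mult_ac)
  then have "sqrt s * N = sqrt pi * pi / s" by (simp only: ss)
  then show ?thesis using s k by (simp add: a_def field_simps power2_eq_square)
 qed
 finally show ?thesis .
qed


lemma partial_d_eq:
 assumes "(f has_derivative (%h. SUM j:UNIV. h $ j *R p j)) (at x)"
 shows "partial_d j f x = p j"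
proof -
 have ax: "(SUM i:UNIV. (axis j 1 :: real^3) $ i *R p i) = p j" using exhaust_3[of j] by (auto simp: sum_3 axis_def)
 have path: "((%t. x + t *R (axis j 1 :: real^3)) has_derivative (%t. t *R axis j 1)) (at 0)" by (auto intro!: derivative_eq_intros)
 have "((%t. f (x + t *R axis j 1)) has_derivative (%t. SUM i:UNIV. (t *R (axis j 1 :: real^3)) $ i *R p i)) (at 0)"
  by (rule has_derivative_compose[OF path]) (use assms in simp)
 moreover have "(%t. SUM i:UNIV. (t *R (axis j 1 :: real^3)) $ i *R p i) = (%t. t *R p j)" by (subst ax[symmetric]) (simp add: scaleR_sum_right)
 ultimately have "((%t. f (x + t *R axis j 1)) has_vector_derivative p j) (at 0)" by (simp add: has_vector_derivative_def)
 then show ?thesis unfolding partial_d_def by (rule vector_derivative_at)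
qed

abbreviation scalar_norm :: "(real^3 => complex) => ennreal" where
 "scalar_norm f == scalar_H f (%j. partial_d j f)"

lemma jet_scalar_norm:
 assumes "helmholtz_jet k f p q" shows "scalar_H f p = scalar_norm f"
proof -
 have "partial_d j f x = p j x" for j x
  by (rule partial_d_eq) (use assms in \<open>auto simp: helmholtz_jet_def\<close>)
 then have "p = (%j. partial_d j f)" by (simp add: fun_eq_iff)
 then show ?thesis by simp
qed

lemma herglotz_partial:
 "L2s g ==> partial_d j (herglotz k g) x = herglotz k (%xi. (\<i> * cor k) * (cor (xi $ j) * g xi)) x"
 by (rule partial_d_eq[OF herglotz_has_derivative])

lemma herglotz_upper:
 assumes k: "k > 0" and g: "L2s g"
 shows "scalar_norm (herglotz k g) <= ennreal (2 * sqrt 2 * exp 1 * (k^2 + 60 * sqrt 2) * (4 * pi^2 * sqrt pi / k^2 * l2sq g))"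
proof -
 obtain p q where jet: "helmholtz_jet k (herglotz k g) p q" using reproducing_jet[OF herglotz_reproducing[OF g]] .
 show ?thesis using jet_upper[OF jet herglotz_gauss_mean_le[OF g k]] unfolding jet_scalar_norm[OF jet] .
qed

subsection \<open>Injectivity\<close>

text \<open>Differentiating \<open>U = 0\<close> multiplies the density by a coordinate.\<close>

lemma herglotz_zero_component:
 assumes g: "L2s g" and k: "k ~= 0" and zero: "!!x. herglotz k g x = 0"
 shows "herglotz k (%xi. cor (xi $ j) * g xi) x = 0"
proof -
 have "herglotz k g = (%x. 0)" using zero by auto
 then have "partial_d j (herglotz k g) x = 0" by (simp add: partial_d_def)
 then show ?thesis unfolding herglotz_partial[OF g] using k by (simp add: herglotz_cmult)
qed

lemma bounded_linear_vec3:
 fixes f :: "real^3 => real"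
 assumes "bounded_linear f"
 shows "f x = x $ 1 * f (axis 1 1) + x $ 2 * f (axis 2 1) + x $ 3 * f (axis 3 1)"
proof -
 have lin: "linear f" using assms bounded_linear.linear by blast
 have "x = x $ 1 *R axis 1 1 + x $ 2 *R axis 2 1 + x $ 3 *R axis 3 1" by (simp add: vec_eq_iff forall_3 axis_def)
 then have "f x = f (x $ 1 *R axis 1 1 + x $ 2 *R axis 2 1 + x $ 3 *R axis 3 1)" by (rule arg_cong)
 then show ?thesis by (simp only: linear_add[OF lin] linear_cmul[OF lin] real_scaleR_def)
qed

lemma continuous_sphere_bounded:
 fixes m :: "real^3 => real"
 assumes "continuous_on (sphere 0 1) m"
 obtains B where "!!xi. norm xi = 1 ==> \<bar>m xi\<bar> <= B"
proof -
 have "bounded (m ` sphere 0 1)" by (intro compact_imp_bounded compact_continuous_image assms compact_sphere)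
 then obtain B where "\<forall>x\<in>m ` sphere 0 1. norm x <= B" unfolding bounded_iff by blast
 then have "\<bar>m xi\<bar> <= B" if "norm xi = 1" for xi using that by auto
 then show ?thesis by (rule that)
qed

lemma L2s_continuous_mult:
 assumes "L2s g" "continuous_on (sphere 0 1) m"
 shows "L2s (%xi. cor (m xi) * g xi)"
proof -
 obtain B where "!!xi. norm xi = 1 ==> \<bar>m xi\<bar> <= B" using continuous_sphere_bounded[OF assms(2)] by blast
 then show ?thesis by (intro L2s_bounded_mult[OF assms(1), where B = B] continuous_imp_sphere_measurable continuous_on_of_real assms) auto
qed

lemma herglotz_zero_polynomial:
 assumes p: "real_polynomial_function p" and k: "k ~= 0"
 shows "L2s g ==> (!!x. herglotz k g x = 0) ==> L2s (%xi. cor (p xi) * g xi) & (\<forall>x. herglotz k (%xi. cor (p xi) * g xi) x = 0)" using p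
proof (induction p arbitrary: g rule: real_polynomial_function.induct)
 case (linear f)
 have eq: "(%xi. cor (f xi) * g xi) = (%xi. (cor (f (axis 1 1)) * (cor (xi $ 1) * g xi) + cor (f (axis 2 1)) * (cor (xi $ 2) * g xi)) + cor (f (axis 3 1)) * (cor (xi $ 3) * g xi))"
  by (rule ext, subst bounded_linear_vec3[OF linear(1)]) (simp add: algebra_simps)
 have c: "L2s (%xi. cor (f (axis j 1)) * (cor (xi $ j) * g xi))" for j
  by (intro L2s_cmult L2s_component linear)
 show ?case unfolding eq by (simp add: L2s_add c herglotz_add herglotz_cmult herglotz_zero_component[OF linear(2) k linear(3)])
next
 case (const c)
 then show ?case by (simp add: L2s_cmult herglotz_cmult)
next
 case (add p q)
 have eq: "(%xi. cor (p xi + q xi) * g xi) = (%xi. cor (p xi) * g xi + cor (q xi) * g xi)" by (simp add: fun_eq_iff distrib_right)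
 show ?case unfolding eq using add.IH(1)[OF add.prems] add.IH(2)[OF add.prems] by (simp add: L2s_add herglotz_add)
next
 case (mult p q)
 have eq: "(%xi. cor (p xi * q xi) * g xi) = (%xi. cor (p xi) * (cor (q xi) * g xi))" by (simp add: fun_eq_iff)
 have q: "L2s (%xi. cor (q xi) * g xi)" "!!x. herglotz k (%xi. cor (q xi) * g xi) x = 0" using mult.IH(2)[OF mult.prems] by auto
 show ?case unfolding eq by (rule mult.IH(1)[OF q])
qed

lemma herglotz_zero_continuous:
 assumes g: "L2s g" and k: "k ~= 0" and zero: "!!x. herglotz k g x = 0" and m: "continuous_on (sphere 0 1) m"
 shows "(LINT xi|S2. cor (m xi) * g xi) = 0"
proof -
 have gi: "integrable S2 (%xi. norm (g xi))" by (intro integrable_norm L2s_integrable g)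
 define A where "A = (LINT xi|S2. norm (g xi))"
 have A: "A >= 0" by (simp add: A_def)
 have "norm (LINT xi|S2. cor (m xi) * g xi) <= 0 + e" if e: "e > 0" for e
 proof -
  define d where "d = e / (A + 1)"
  have d: "d > 0" using e A by (simp add: d_def)
  obtain p where p: "real_polynomial_function p" "!!xi. xi \<in> sphere 0 1 ==> \<bar>m xi - p xi\<bar> < d"
   using Stone_Weierstrass_real_polynomial_function[OF compact_sphere m d] by blast
  have pc: "continuous_on (sphere 0 1) p" using continuous_on_polymonial_function[of p] p(1) real_polynomial_function_eq by blast
  have P: "L2s (%xi. cor (p xi) * g xi)" "herglotz k (%xi. cor (p xi) * g xi) 0 = 0" using herglotz_zero_polynomial[OF p(1) k g zero] by auto
  have p0: "(LINT xi|S2. cor (p xi) * g xi) = 0" using P(2) by (simp add: herglotz_def)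
  have mi: "integrable S2 (%xi. cor (m xi) * g xi)" by (intro L2s_integrable L2s_continuous_mult g m)
  have "(LINT xi|S2. cor (m xi) * g xi) = (LINT xi|S2. cor (m xi) * g xi - cor (p xi) * g xi)"
   by (subst Bintegral_diff) (simp_all only: mi L2s_integrable[OF P(1)] p0 diff_zero)
  also have "norm ... <= (LINT xi|S2. d * norm (g xi))"
  proof (rule integral_norm_le)
   fix xi assume "xi \<in> space S2"
   then have "\<bar>m xi - p xi\<bar> * norm (g xi) <= d * norm (g xi)" using p(2)[of xi] by (intro mult_right_mono) auto
   moreover have "norm (cor (m xi) * g xi - cor (p xi) * g xi) = \<bar>m xi - p xi\<bar> * norm (g xi)"
    by (metis left_diff_distrib norm_mult norm_of_real of_real_diff)
   ultimately show "norm (cor (m xi) * g xi - cor (p xi) * g xi) <= d * norm (g xi)" by simp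
  qed (intro integrable_mult_right gi)
  also have "... = d * A" by (simp add: A_def)
  also have "... <= e" using e A by (simp add: d_def field_simps)
  finally show ?thesis by simp
 qed
 then have "norm (LINT xi|S2. cor (m xi) * g xi) <= 0" by (rule field_le_epsilon)
 then show ?thesis by simp
qed

text \<open>By iterated differentiation the product of the density with any polynomial also has transform 0; at the origin this says
that the density is orthogonal to all polynomials, hence to all continuous functions (Stone-Weierstrass), hence, by approximating indicators of closed sets, zero almost everywhere.\<close>

theorem herglotz_injective:
 assumes g: "L2s g" and k: "k ~= 0" and zero: "!!x. herglotz k g x = 0"
 shows "AE xi in S2. g xi = 0"
proof (rule sphere.density_zero)
 show gi: "integrable S2 g" by (rule L2s_integrable[OF g])
 have closed: "(LINT xi|S2. indicator C xi *R g xi) = 0" if C: "closed C" for C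
 proof (cases "C = {}")
  case False
  define m where "m n xi = max 0 (1 - real n * infdist xi C)" for n xi
  have m01: "0 <= m n xi" "m n xi <= 1" for n xi by (auto simp: m_def infdist_nonneg)
  have mc: "continuous_on (sphere 0 1) (m n)" for n unfolding m_def by (intro continuous_intros)
  have "(%n. \<integral>xi. cor (m n xi) * g xi \<partial>S2) ----> (LINT xi|S2. indicator C xi *R g xi)"
  proof (rule integral_dominated_convergence[where w = "%xi. norm (g xi)"])
   have ic: "indicator C \<in> borel_measurable S2" by (rule borel_imp_sphere_measurable) (use C in auto)
   show "(%xi. indicator C xi *R g xi) \<in> borel_measurable S2" by (intro borel_measurable_scaleR ic) (use g in measurable)
   show "(%xi. cor (m n xi) * g xi) \<in> borel_measurable S2" for n
    using L2s_continuous_mult[OF g mc] by (simp add: L2s_def)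
   show "AE xi in S2. (%n. cor (m n xi) * g xi) ----> indicator C xi *R g xi"
   proof (rule AE_I2)
    fix xi
    have "(%n. m n xi) ----> indicator C xi"
    proof (cases "xi \<in> C")
     case True then show ?thesis by (simp add: m_def)
    next
     case out: False
     then have pos: "infdist xi C > 0" using C False by (simp add: infdist_pos_not_in_closed)
     obtain N where N: "real N * infdist xi C > 1" using reals_Archimedean3[OF pos] by blast
     have "m n xi = 0" if "n >= N" for n
     proof -
      have "real N * infdist xi C <= real n * infdist xi C" using that pos by (intro mult_right_mono) auto
      then show ?thesis using N by (simp add: m_def)
     qed
     then have "\<forall>\<^sub>F n in sequentially. m n xi = indicator C xi" using out by (auto simp: eventually_sequentially)
     then show ?thesis by (rule tendsto_eventually)
    qed
    then have "(%n. cor (m n xi) * g xi) ----> cor (indicator C xi) * g xi" by (intro tendsto_mult tendsto_of_real tendsto_const)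
    then show "(%n. cor (m n xi) * g xi) ----> indicator C xi *R g xi" by (simp only: scaleR_conv_of_real)
   qed
   show "AE xi in S2. norm (cor (m n xi) * g xi) <= norm (g xi)" for n
    using m01 by (auto simp: norm_mult intro!: mult_left_le_one_le)
  qed (intro integrable_norm gi)
  then have "(%n. 0) ----> (LINT xi|S2. indicator C xi *R g xi)" by (simp only: herglotz_zero_continuous[OF g k zero mc])
  then show ?thesis using LIMSEQ_unique tendsto_const by blast
 qed simp
 have ii: "integrable S2 (%xi. indicator A xi *R g xi)" if "A \<in> sets borel" for A
 proof (rule Bintegrable_bound[OF gi])
  have "(%xi. indicator A xi :: real) \<in> borel_measurable S2" by (rule borel_imp_sphere_measurable) (use that in simp)
  then show "(%xi. indicator A xi *R g xi) \<in> borel_measurable S2" by (rule borel_measurable_scaleR) (rule L2s_meas[OF g])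
 qed (auto simp: indicator_def)
 have borel: "(LINT xi|S2. indicator A xi *R g xi) = 0" if A: "A \<in> sigma_sets UNIV {C. closed C}" for A
 proof -
  have b: "B \<in> sets borel" if "B \<in> sigma_sets UNIV {C :: (real^3) set. closed C}" for B
   using that borel_eq_closed by (metis sets_measure_of top_greatest Pow_UNIV)
  have "Int_stable {C :: (real^3) set. closed C}" "{C :: (real^3) set. closed C} \<subseteq> Pow UNIV" by (auto simp: Int_stable_def)
  then show ?thesis using A
  proof (induction rule: sigma_sets_induct_disjoint)
   case (compl A)
   have "(LINT xi|S2. indicator (UNIV - A) xi *R g xi) = (LINT xi|S2. indicator UNIV xi *R g xi - indicator A xi *R g xi)"
    by (intro Bintegral_cong refl) (auto simp: indicator_def)
   also have "... = 0" by (subst Bintegral_diff) (simp_all only: ii[OF b[OF compl(1)]] ii[OF borel_closed[OF closed_UNIV]] compl closed[OF closed_UNIV] diff_zero)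
   finally show ?case .
  next
   case (union A)
   have "A i \<in> sets borel" for i using union(2) b by blast
   then have Am: "A i \<inter> space S2 \<in> sets S2" for i
    unfolding sets_sphere_measure by (auto simp: sets_restrict_space)
   have eq: "set_lebesgue_integral S2 (B \<inter> space S2) g = (LINT xi|S2. indicator B xi *R g xi)" for B
    unfolding set_lebesgue_integral_def by (intro Bintegral_cong refl) (auto simp: indicator_def)
   have "(\<Union>i. A i) \<in> sets borel" using \<open>!!i. A i \<in> sets borel\<close> by blast
   then have "set_integrable S2 (\<Union>i. A i \<inter> space S2) g" unfolding set_integrable_def
    by (intro Bintegrable_cong[OF refl, THEN iffD1, OF _ ii[of "\<Union>i. A i"]]) (auto simp: indicator_def)
   then have "set_lebesgue_integral S2 (\<Union>i. A i \<inter> space S2) g = (\<Sum>i. set_lebesgue_integral S2 (A i \<inter> space S2) g)"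
    using union(1) by (intro lebesgue_integral_countable_add Am) (auto simp: disjoint_family_on_def)
   also have "... = 0" unfolding eq union(3) by simp
   also have "(\<Union>i. A i \<inter> space S2) = (\<Union>i. A i) \<inter> space S2" by blast
   finally show ?case unfolding eq .
  qed (use closed in auto)
 qed
 show "set_lebesgue_integral S2 A g = 0" if A: "A \<in> sets S2" for A
 proof -
  obtain B where B: "B \<in> sets borel" "A = sphere 0 1 \<inter> B" using A unfolding sets_sphere_measure by (auto simp: sets_restrict_space)
  have "B \<in> sigma_sets UNIV {C. closed C}" using B(1) borel_eq_closed by (metis sets_measure_of top_greatest Pow_UNIV)
  then have "(LINT xi|S2. indicator B xi *R g xi) = 0" by (rule borel)
  moreover have "(LINT xi|S2. indicator B xi *R g xi) = (LINT xi|S2. indicator A xi *R g xi)"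
   by (intro Bintegral_cong refl) (auto simp: B(2) indicator_def)
  ultimately show ?thesis by (simp add: set_lebesgue_integral_def)
 qed
qed

section \<open>Completeness of the space of square integrable functions on the sphere\<close>

lemma sphere_const_integral: "(LINT xi|S2. c) = (4 * pi) *R (c :: 'b::{banach, second_countable_topology})" using sphere_measure_total by simp

lemma sphere_integral_norm_le:
 assumes g: "L2s g"
 shows "(LINT xi|S2. norm (g xi))^2 <= 4 * pi * l2sq g"
proof -
 have "(LINT xi|S2. norm (g xi) * norm (1::complex))^2 <= (LINT xi|S2. (norm (g xi))^2) * (LINT xi|S2. (norm (1::complex))^2)"
  by (rule integral_Cauchy_Schwarz(2)) (use g in \<open>auto simp: L2s_def\<close>)
 then show ?thesis using sphere_const_integral[of "1::real"] by (simp add: l2sq_def mult.commute)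
qed

lemma herglotz_norm_le_l2: "L2s g ==> (norm (herglotz k g x))\<^sup>2 <= 4 * pi * l2sq g"
 using sphere_integral_norm_le[of g] power_mono[OF herglotz_norm_le[of k g x], of 2] by (meson norm_ge_zero order_trans)

lemma l2sq_add_le:
 assumes "L2s f" "L2s g"
 shows "l2sq (%xi. f xi + g xi) <= 2 * l2sq f + 2 * l2sq g"
proof -
 have "l2sq (%xi. f xi + g xi) <= (LINT xi|S2. 2 * (norm (f xi))^2 + 2 * (norm (g xi))^2)" unfolding l2sq_def
 proof (rule integral_mono)
  fix xi
  have "(norm (f xi + g xi))^2 <= (norm (f xi) + norm (g xi))^2" by (intro power_mono norm_triangle_ineq) auto
  also have "... <= 2 * (norm (f xi))^2 + 2 * (norm (g xi))^2"
   using zero_le_power2[of "norm (f xi) - norm (g xi)"] by (simp add: power2_sum power2_diff)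
  finally show "(norm (f xi + g xi))^2 <= 2 * (norm (f xi))^2 + 2 * (norm (g xi))^2" .
 qed (use assms L2s_add[OF assms] in \<open>auto simp: L2s_def\<close>)
 also have "... = 2 * l2sq f + 2 * l2sq g" using assms by (simp add: l2sq_def L2s_def)
 finally show ?thesis .
qed

lemma L2s_diff: "L2s f ==> L2s g ==> L2s (%xi. f xi - g xi)" using L2s_add[of f "%xi. - 1 * g xi"] L2s_cmult[of g "-1"] by simp

lemma l2sq_diff_commute: "l2sq (%xi. f xi - g xi) = l2sq (%xi. g xi - f xi)" by (simp add: l2sq_def norm_minus_commute)

lemma l2sq_triangle:
 assumes "L2s f" "L2s g" "L2s h"
 shows "l2sq (%xi. f xi - h xi) <= 2 * l2sq (%xi. f xi - g xi) + 2 * l2sq (%xi. g xi - h xi)"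
 using l2sq_add_le[OF L2s_diff[OF assms(1,2)] L2s_diff[OF assms(2,3)]] by simp

lemma nn_l2sq: "L2s g ==> (\<integral>\<^sup>+xi. ennreal ((norm (g xi))^2) \<partial>S2) = ennreal (l2sq g)"
 unfolding l2sq_def L2s_def by (intro nn_integral_eq_integral) auto

text \<open>The Riesz-Fischer argument: a subsequence with geometrically small increments converges almost everywhere, and Fatou's lemma
transfers the convergence to the norm.\<close>

lemma L2s_complete:
 assumes g: "!!n. L2s (g n)"
  and cauchy: "!!e. e > 0 ==> \<exists>N. \<forall>m\<ge>N. \<forall>n\<ge>N. l2sq (%xi. g m xi - g n xi) < e"
 obtains G where "L2s G" "(%n. l2sq (%xi. g n xi - G xi)) ----> 0"
proof -
 have "\<exists>N. \<forall>m\<ge>N. \<forall>n\<ge>N. l2sq (%xi. g m xi - g n xi) < (1/4) ^ i" for i :: nat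
  by (rule cauchy) simp
 then obtain N where N: "!!i m n. m >= N i ==> n >= N i ==> l2sq (%xi. g m xi - g n xi) < (1/4) ^ i" by metis
 define r where "r i = (\<Sum>j\<le>i. N j) + i" for i
 have rN: "N i <= r i" for i unfolding r_def by (simp add: member_le_sum trans_le_add1)
 have rmono: "r i <= r (Suc i)" for i unfolding r_def by simp
 have ri: "i <= r i" for i by (simp add: r_def)
 define d where "d i xi = g (r (Suc i)) xi - g (r i) xi" for i xi
 have d: "L2s (d i)" for i unfolding d_def by (intro L2s_diff g)
 have [measurable]: "d i \<in> borel_measurable S2" "g i \<in> borel_measurable S2" for i using d g by (auto simp: L2s_def)
 have dn: "(LINT xi|S2. norm (d i xi)) <= 4 * (1/2) ^ i" for i
 proof (rule power2_le_imp_le)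
  have "l2sq (d i) <= (1/4) ^ i" unfolding d_def using N[of i "r (Suc i)" "r i"] rN[of i] rmono[of i] by simp
  then have "4 * pi * l2sq (d i) <= 4 * pi * (1/4) ^ i" by (intro mult_left_mono) auto
  also have "... <= 16 * (1/4) ^ i" using pi_less_4 by (intro mult_right_mono) auto
  also have "... = (4 * (1/2) ^ i)^2" by (simp add: power_mult_distrib power2_eq_square flip: power_mult_distrib)
  finally show "(LINT xi|S2. norm (d i xi))^2 <= (4 * (1/2) ^ i)^2" using sphere_integral_norm_le[OF d[of i]] by linarith
 qed simp
 have "(\<integral>\<^sup>+xi. (\<Sum>i. ennreal (norm (d i xi))) \<partial>S2) = (\<Sum>i. \<integral>\<^sup>+xi. ennreal (norm (d i xi)) \<partial>S2)"
  by (rule nn_integral_suminf) measurable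
 also have "... <= (\<Sum>i. ennreal (4 * (1/2) ^ i))"
 proof (intro suminf_le)
  fix i
  have "(\<integral>\<^sup>+xi. ennreal (norm (d i xi)) \<partial>S2) = ennreal (LINT xi|S2. norm (d i xi))"
   by (intro nn_integral_eq_integral integrable_norm L2s_integrable d) simp
  also have "... <= ennreal (4 * (1/2) ^ i)" by (intro ennreal_leI dn)
  finally show "(\<integral>\<^sup>+xi. ennreal (norm (d i xi)) \<partial>S2) <= ennreal (4 * (1/2) ^ i)" .
 qed auto
 also have "... < \<infinity>"
 proof -
  have "(%i. 4 * (1/2::real) ^ i) sums (4 * (1 / (1 - 1/2)))" by (intro sums_mult geometric_sums) simp
  then have "(\<Sum>i. ennreal (4 * (1/2) ^ i)) = ennreal (4 * (1 / (1 - 1/2)))" by (intro suminf_ennreal_eq) auto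
  then show ?thesis by simp
 qed
 finally have "(\<integral>\<^sup>+xi. (\<Sum>i. ennreal (norm (d i xi))) \<partial>S2) ~= \<infinity>" by simp
 then have "AE xi in S2. (\<Sum>i. ennreal (norm (d i xi))) ~= \<infinity>" by (intro nn_integral_PInf_AE) measurable
 then have conv: "AE xi in S2. convergent (%i. g (r i) xi)"
 proof eventually_elim
  case (elim xi)
  then have "summable (%i. norm (d i xi))" by (intro summable_suminf_not_top) auto
  then have "summable (%i. d i xi)" by (rule summable_norm_cancel)
  then have "convergent (%n. \<Sum>i<n. d i xi)" by (simp add: summable_iff_convergent)
  moreover have "(\<Sum>i<n. d i xi) = g (r n) xi - g (r 0) xi" for n
   unfolding d_def by (rule sum_lessThan_telescope)
  ultimately have "convergent (%n. g (r n) xi - g (r 0) xi)" by simp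
  then show ?case by (simp add: convergent_diff_const_right_iff)
 qed
 define G where "G xi = lim (%i. g (r i) xi)" for xi
 have Gm [measurable]: "G \<in> borel_measurable S2" unfolding G_def by measurable
 have lim: "AE xi in S2. (%i. g (r i) xi) ----> G xi" using conv by eventually_elim (simp add: G_def convergent_LIMSEQ_iff)
 let ?E = "%n. \<integral>\<^sup>+xi. ennreal ((norm (g n xi - G xi))^2) \<partial>S2"
 have fatou: "(?E n) <= ennreal e" if n: "!!m. m >= n ==> l2sq (%xi. g n xi - g m xi) <= e" for n e
 proof -
  have "(?E n) = (\<integral>\<^sup>+xi. liminf (%i. ennreal ((norm (g n xi - g (r i) xi))^2)) \<partial>S2)"
  proof (rule nn_integral_cong_AE)
   show "AE xi in S2. ennreal ((norm (g n xi - G xi))^2) = liminf (%i. ennreal ((norm (g n xi - g (r i) xi))^2))" using lim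
   proof eventually_elim
    case (elim xi)
    then have "(%i. ennreal ((norm (g n xi - g (r i) xi))^2)) ----> ennreal ((norm (g n xi - G xi))^2)"
     by (intro tendsto_ennrealI tendsto_power tendsto_norm tendsto_diff tendsto_const)
    then show ?case by (rule lim_imp_Liminf[OF trivial_limit_sequentially, symmetric])
   qed
  qed
  also have "... <= liminf (%i. \<integral>\<^sup>+xi. ennreal ((norm (g n xi - g (r i) xi))^2) \<partial>S2)" by (rule nn_integral_liminf) measurable
  also have "... <= ennreal e"
  proof (rule Liminf_le)
   show "\<forall>\<^sub>F i in sequentially. (\<integral>\<^sup>+xi. ennreal ((norm (g n xi - g (r i) xi))^2) \<partial>S2) <= ennreal e"
    using eventually_ge_at_top[of n]
   proof eventually_elim
    case (elim i)
    then have "r i >= n" using ri[of i] by linarith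
    then show ?case using n[of "r i"] nn_l2sq[OF L2s_diff[OF g[of n] g[of "r i"]]] by (simp add: ennreal_leI)
   qed
  qed simp
  finally show ?thesis .
 qed
 have small: "\<exists>n0. \<forall>n\<ge>n0. (?E n) <= ennreal e" if "e > 0" for e
 proof -
  obtain n0 where n0: "!!m n. m >= n0 ==> n >= n0 ==> l2sq (%xi. g m xi - g n xi) < e" using cauchy[OF \<open>e > 0\<close>] by blast
  show ?thesis
  proof (intro exI allI impI)
   fix n assume "n >= n0"
   then show "(?E n) <= ennreal e" using n0[of n] by (intro fatou less_imp_le) auto
  qed
 qed
 obtain n1 where n1: "!!n. n >= n1 ==> (?E n) <= ennreal 1"
  using small[of 1] by auto
 have D: "L2s (%xi. g n xi - G xi)" if "n >= n1" for n
  unfolding L2s_def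
 proof
  show "integrable S2 (%xi. (norm (g n xi - G xi))^2)" using n1[OF that] by (intro integrableI_bounded) (auto simp: order_le_less_trans)
 qed measurable
 have GL: "L2s G" using L2s_diff[OF g[of n1] D[of n1]] by simp
 have "(%n. l2sq (%xi. g n xi - G xi)) ----> 0"
 proof (rule LIMSEQ_I)
  fix e :: real assume e: "e > 0"
  then obtain n0 where n0: "!!n. n >= n0 ==> (?E n) <= ennreal (e / 2)"
   using small[of "e / 2"] by auto
  have "norm (l2sq (%xi. g n xi - G xi) - 0) < e" if "n >= n0" for n
  proof -
   have "ennreal (l2sq (%xi. g n xi - G xi)) <= ennreal (e / 2)" using n0[OF that] nn_l2sq[OF L2s_diff[OF g GL]] by simp
   then have "l2sq (%xi. g n xi - G xi) <= e / 2" using e by (simp add: ennreal_le_iff)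
   then show ?thesis using e l2sq_nonneg[of "%xi. g n xi - G xi"] by simp
  qed
  then show "\<exists>no. \<forall>n\<ge>no. norm (l2sq (%xi. g n xi - G xi) - 0) < e" by blast
 qed
 then show ?thesis using that GL by blast
qed

section \<open>Radial mean values\<close>

text \<open>A function orthogonal to all Gaussians centred at \<open>y\<close> is orthogonal to all radial functions about \<open>y\<close> that are the Gaussian
\<open>E\<close> times a continuous function of \<open>E\<close>: approximate the latter by polynomials in \<open>E\<close>.\<close>

lemma gauss_transform_zero_radial:
 assumes h: "gauss_integrable h" and zero: "!!s. s > 0 ==> gauss_conv s h y = 0"
  and d: "\<delta> > 0" and q: "continuous_on {0..1} q"
 shows "(LBINT x. (gaussian \<delta> (x - y) * q (gaussian \<delta> (x - y))) *R h x) = 0"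
proof -
 let ?E = "%x. gaussian \<delta> (x - y)"
 have E: "?E x \<in> {0..1}" for x using d by simp
 have one: "subgaussian (%_. 1::real)" by simp
 have hm [measurable]: "h \<in> borel_measurable borel" using h by measurable
 have int1: "integrable lborel (%x. ?E x *R h x)" using gauss_transform_integrable[OF d one h, of y] by simp
 have qm: "(%x. q (?E x)) \<in> borel_measurable borel" 
 proof (rule borel_measurable_continuous_onI)
  show "continuous_on UNIV (%x. q (?E x))" by (rule continuous_on_compose2[OF q]) (use E in \<open>auto intro!: continuous_intros\<close>)
 qed
 define A where "A = (LBINT x. norm (?E x *R h x))"
 have A: "A >= 0" by (simp add: A_def)
 obtain B where B: "!!t. t \<in> {0..1} ==> \<bar>q t\<bar> <= B"
 proof -
  have "bounded (q ` {0..1})" by (intro compact_imp_bounded compact_continuous_image q) auto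
  then obtain B where "\<forall>x\<in>q ` {0..1}. norm x <= B" unfolding bounded_iff by blast
  then have "\<bar>q t\<bar> <= B" if "t \<in> {0..1}" for t using that by auto
  then show ?thesis by (rule that)
 qed
 have intq: "integrable lborel (%x. (?E x * q (?E x)) *R h x)"
 proof (rule Bintegrable_bound)
  show "integrable lborel (%x. B * norm (?E x *R h x))" by (intro integrable_mult_right integrable_norm int1)
  show "AE x in lborel. norm ((?E x * q (?E x)) *R h x) <= norm (B * norm (?E x *R h x))"
  proof (rule AE_I2)
   fix x
   have "\<bar>q (?E x)\<bar> * (?E x * norm (h x)) <= B * (?E x * norm (h x))" using B[OF E[of x]] by (intro mult_right_mono) auto
   also have "... <= norm (B * norm (?E x *R h x))" by simp
   finally show "norm ((?E x * q (?E x)) *R h x) <= norm (B * norm (?E x *R h x))" by (simp add: abs_mult mult_ac)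
  qed
  show "(%x. (?E x * q (?E x)) *R h x) \<in> borel_measurable lborel" using qm by measurable
 qed
 have "norm (LBINT x. (?E x * q (?E x)) *R h x) <= 0 + e" if e: "e > 0" for e
 proof -
  define e' where "e' = e / (A + 1)"
  have e': "e' > 0" using e A by (simp add: e'_def)
  obtain p where p: "real_polynomial_function p" "!!t. t \<in> {0..1} ==> \<bar>q t - p t\<bar> < e'"
   using Stone_Weierstrass_real_polynomial_function[OF compact_Icc q e'] by blast
  obtain a n where p_eq: "p = (%t. \<Sum>i\<le>n. a i * t ^ i)" using p(1) real_polynomial_function_iff_sum by blast
  have pw: "(?E x * ?E x ^ i) = gaussian ((real i + 1) * \<delta>) (x - y) * 1" for x and i :: nat
   by (simp add: exp_of_nat_mult[symmetric] algebra_simps flip: exp_add)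
  have pos: "(real i + 1) * \<delta> > 0" for i :: nat using d by simp
  have int_i: "integrable lborel (%x. a i *R ((gaussian ((real i + 1) * \<delta>) (x - y) * 1) *R h x))" for i
   by (intro integrable_scaleR_right gauss_transform_integrable[OF pos one h])
  have p_exp: "(?E x * p (?E x)) *R h x = (\<Sum>i\<le>n. a i *R ((gaussian ((real i + 1) * \<delta>) (x - y) * 1) *R h x))" for x
   unfolding p_eq pw[symmetric] by (simp add: sum_distrib_left scaleR_sum_left mult_ac)
  have intp: "integrable lborel (%x. (?E x * p (?E x)) *R h x)" unfolding p_exp by (intro Bintegrable_sum int_i)
  have "(LBINT x. (?E x * p (?E x)) *R h x) = (\<Sum>i\<le>n. a i *R gauss_transform ((real i + 1) * \<delta>) (%_. 1) h y)"
   unfolding p_exp gauss_transform_def by (subst Bintegral_sum[OF int_i]) (simp only: integral_scaleR_right)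
  also have "... = 0" by (simp add: zero[OF pos])
  finally have "(LBINT x. (?E x * q (?E x)) *R h x) = (LBINT x. (?E x * q (?E x)) *R h x - (?E x * p (?E x)) *R h x)"
   by (subst Bintegral_diff[OF intq intp]) simp
  also have "norm ... <= (LBINT x. e' * norm (?E x *R h x))"
  proof (rule integral_norm_le)
   fix x
   have "(?E x * q (?E x)) *R h x - (?E x * p (?E x)) *R h x = (q (?E x) - p (?E x)) *R (?E x *R h x)"
    by (simp add: scaleR_diff_left right_diff_distrib mult.commute)
   then have "norm ((?E x * q (?E x)) *R h x - (?E x * p (?E x)) *R h x) = \<bar>q (?E x) - p (?E x)\<bar> * norm (?E x *R h x)"
    by (simp only: norm_scaleR)
   also have "... <= e' * norm (?E x *R h x)" using p(2)[OF E[of x]] by (intro mult_right_mono) auto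
   finally show "norm ((?E x * q (?E x)) *R h x - (?E x * p (?E x)) *R h x) <= e' * norm (?E x *R h x)" .
  qed (intro integrable_mult_right integrable_norm int1)
  also have "... = e' * A" by (simp add: A_def)
  also have "... <= e" using e A by (simp add: e'_def field_simps)
  finally show ?thesis by simp
 qed
 then have "norm (LBINT x. (?E x * q (?E x)) *R h x) <= 0" by (rule field_le_epsilon)
 then show ?thesis by simp
qed

lemma L2s_one: "L2s (%_. 1)" by (simp add: L2s_def)

lemma L2s_exp: "L2s (%xi. iexp (k * (y \<bullet> xi)))" using L2s_bounded_mult[OF L2s_one exp_kernel_meas, of k y 1] by simp

text \<open>The constant density gives the radial solution \<open>4 pi sin (k r) / (k r)\<close>.\<close>

lemma herglotz_one:
 assumes k: "k > 0"
 shows "x ~= 0 ==> herglotz k (%_. 1) x = cor (4 * pi * sin (k * norm x) / (k * norm x))"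
  and "herglotz k (%_. 1) 0 = cor (4 * pi)"
  and "herglotz (- k) (%xi. iexp (k * (y \<bullet> xi))) x = herglotz k (%_. 1) (x - y)"
proof -
 show val: "herglotz k (%_. 1) x = cor (4 * pi * sin (k * norm x) / (k * norm x))" if x: "x ~= 0" for x
 proof -
  have "herglotz k (%_. 1) x = (LINT xi|S2. exp ((\<i> * cor k) * cor (x \<bullet> xi)))" by (simp add: herglotz_def mult.assoc)
  also have "... = 2 * pi * (exp ((\<i> * cor k) * norm x) - exp (- ((\<i> * cor k) * norm x))) / ((\<i> * cor k) * norm x)"
   using k x by (intro sphere_exp_integral) auto
  also have "... = cor (4 * pi * sin (k * norm x) / (k * norm x))"
  proof -
   have "iexp r - exp (- (\<i> * cor r)) = 2 * \<i> * cor (sin r)" for r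
    by (simp add: complex_eq_iff Re_exp Im_exp)
   from this[of "k * norm x"] show ?thesis using k x by (simp add: mult.assoc)
  qed
  finally show ?thesis .
 qed
 show zero: "herglotz k (%_. 1) 0 = cor (4 * pi)" using sphere_const_integral[of "1::complex"] by (simp add: herglotz_def scaleR_conv_of_real)
 show "herglotz (- k) (%xi. iexp (k * (y \<bullet> xi))) x = herglotz k (%_. 1) (x - y)"
 proof -
  have "herglotz (- k) (%xi. iexp (k * (y \<bullet> xi))) x = herglotz k (%_. 1) (y - x)"
   unfolding herglotz_def by (intro Bintegral_cong refl) (simp add: inner_diff_left algebra_simps flip: exp_add)
  also have "... = herglotz k (%_. 1) (x - y)" using val[of "y - x"] val[of "x - y"] by (cases "x = y") (auto simp: norm_minus_commute)
  finally show ?thesis .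
 qed
qed

lemma herglotz_one_bound:
 assumes k: "k > 0"
 shows "norm (herglotz k (%_. 1) x) * (1 + norm x) <= 4 * pi * (1 + 1 / k)"
proof (cases "x = 0")
 case True
 then show ?thesis using k by (simp add: herglotz_one(2)[OF k])
next
 case False
 have 1: "norm (herglotz k (%_. 1) x) <= 4 * pi" using herglotz_norm_le[of k "%_. 1" x] sphere_const_integral[of "1::real"] by simp
 have "norm (herglotz k (%_. 1) x) * norm x = 4 * pi / k * \<bar>sin (k * norm x)\<bar>"
  using False k by (simp add: herglotz_one(1)[OF k] norm_divide norm_mult abs_mult)
 also have "... <= 4 * pi / k * 1" using k by (intro mult_left_mono) auto
 finally have 2: "norm (herglotz k (%_. 1) x) * norm x <= 4 * pi / k" by simp
 show ?thesis using 1 2 by (simp add: distrib_left)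
qed

section \<open>Reconstruction of the density\<close>

definition herglotz_const :: "real => real" where
 "herglotz_const k = 4 * pi^2 * sqrt pi / k^2"

lemma herglotz_const_pos: "k > 0 ==> herglotz_const k > 0" by (simp add: herglotz_const_def)

lemma herglotz_const_eq:
 assumes "k > 0" "s > 0"
 shows "sqrt s * (sqrt (pi / s) ^ 3 * (pi / (k^2 / (4 * s)))) = herglotz_const k"
proof -
 have ss: "sqrt s * sqrt s = s" "sqrt pi * sqrt pi = pi" "sqrt s > 0" using assms by auto
 have "sqrt s * sqrt (pi / s) ^ 3 = sqrt pi * (sqrt pi * sqrt pi) / (sqrt s * sqrt s)"
  unfolding real_sqrt_divide power_divide power3_eq_cube using ss(3) by (simp add: mult_ac)
 then have "sqrt s * sqrt (pi / s) ^ 3 = sqrt pi * pi / s" by (simp only: ss)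
 then have "sqrt s * (sqrt (pi / s) ^ 3 * (pi / (k^2 / (4 * s)))) = sqrt pi * pi / s * (pi / (k^2 / (4 * s)))" by (simp only: mult.assoc[symmetric])
 then show ?thesis using assms by (simp add: herglotz_const_def field_simps power2_eq_square)
qed

text \<open>The Fourier transform of \<open>f\<close> on the sphere of radius \<open>k\<close>, regularised by a Gaussian. The scaling makes it converge to the
density when \<open>f\<close> is a Herglotz transform.\<close>

definition trace_approx :: "real => (real^3 => complex) => real => real^3 => complex" where
 "trace_approx k f s xi = cor (sqrt s / herglotz_const k) *
   (LBINT x. iexp ((- k) * (x \<bullet> xi)) * (cor (gaussian s x) * f x))"

lemma gauss_times_integrable:
 assumes "subgaussian f" "s > 0"
 shows "integrable lborel (%x. cor (gaussian s x) * f x)"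
 using gauss_integrableD[OF subgaussian_imp_gauss_integrable[OF assms(1)] assms(2)] by (simp add: scaleR_conv_of_real)

lemma trace_approx_L2s:
 assumes f: "subgaussian f" and s: "s > 0"
 shows "L2s (trace_approx k f s)"
proof -
 let ?I = "%xi. \<integral>x. iexp ((- k) * (x \<bullet> xi)) * (cor (gaussian s x) * f x) \<partial>lborel"
 have "(%p::(real^3) \<times> (real^3). iexp ((- k) * (snd p \<bullet> fst p)) * (cor (gaussian s (snd p)) * f (snd p))) \<in> borel_measurable (borel \<Otimes>\<^sub>M borel)"
  unfolding borel_prod by (intro borel_measurable_continuous_onI continuous_intros continuous_on_compose2[OF subgaussian_cont[OF f]]) auto
 moreover have "(%p. p) \<in> S2 \<Otimes>\<^sub>M lborel \<rightarrow>\<^sub>M borel \<Otimes>\<^sub>M borel"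
  by (intro measurable_pair) (auto intro!: measurable_compose[OF measurable_fst borel_imp_sphere_measurable] simp: o_def)
 ultimately have "(%(xi, x). iexp ((- k) * (x \<bullet> xi)) * (cor (gaussian s x) * f x)) \<in> borel_measurable (S2 \<Otimes>\<^sub>M lborel)"
  unfolding case_prod_beta using measurable_compose by blast
 then have I: "?I \<in> borel_measurable S2" by (rule lborel.borel_measurable_lebesgue_integral)
 have "norm (?I xi) <= (LBINT x. norm (cor (gaussian s x) * f x))" for xi
  by (rule integral_norm_le) (auto simp: norm_mult intro!: integrable_norm[OF gauss_times_integrable[OF f s], unfolded norm_mult, simplified])
 then have "L2s (%xi. ?I xi * 1)" by (intro L2s_bounded_mult[OF L2s_one I])
 then have "L2s (%xi. cor (sqrt s / herglotz_const k) * (?I xi * 1))" by (rule L2s_cmult)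
 then show ?thesis by (simp only: trace_approx_def[abs_def] mult_1_right)
qed

text \<open>The regularised trace is, up to the scaling, the adjoint of the Herglotz transform for the Gaussian weighted product.\<close>

lemma trace_approx_pairing:
 assumes f: "subgaussian f" and s: "s > 0" and h: "L2s h"
 shows "(LINT xi|S2. cnj (trace_approx k f s xi) * h xi)
  = cor (sqrt s / herglotz_const k) * (LBINT x. (cor (gaussian s x) * cnj (f x)) * herglotz k h x)"
proof -
 have f': "subgaussian (%x. cnj (f x))" by (rule subgaussian_linear[OF bounded_linear_cnj f])
 have "cnj (trace_approx k f s xi) = cor (sqrt s / herglotz_const k) * (LBINT x. iexp (k * (x \<bullet> xi)) * (cor (gaussian s x) * cnj (f x)))" for xi
  unfolding trace_approx_def complex_cnj_mult Bochner_Integration.integral_cnj[symmetric] by (simp add: exp_cnj)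
 then have "(LINT xi|S2. cnj (trace_approx k f s xi) * h xi) = (LINT xi|S2. cor (sqrt s / herglotz_const k) * (h xi * (LBINT x. iexp (k * (x \<bullet> xi)) * (cor (gaussian s x) * cnj (f x)))))"
  by (simp only: mult_ac)
 also have "... = cor (sqrt s / herglotz_const k) * (LBINT x. (cor (gaussian s x) * cnj (f x)) * herglotz k h x)"
  unfolding herglotz_pairing[OF h gauss_times_integrable[OF f' s]] by (rule integral_mult_right_zero)
 finally show ?thesis .
qed

lemma gauss_weighted_Cauchy_Schwarz:
 assumes f: "subgaussian (f :: real^3 => complex)" and g: "subgaussian g" and s: "s > 0"
 shows "(norm (LBINT x. (cor (gaussian s x) * f x) * g x))^2
   <= gauss_mean (%x. (norm (f x))^2) s * gauss_mean (%x. (norm (g x))^2) s"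
proof -
 define w where "w x = cor (gaussian (s / 2) x)" for x :: "real^3"
 have ww: "w x * w x = cor (gaussian s x)" for x
  unfolding w_def by (simp flip: of_real_mult exp_add)
 have nw: "(norm (w x * h x))^2 = gaussian s x * (norm (h x))^2" for h x
  unfolding w_def by (simp add: norm_mult power_mult_distrib power2_eq_square flip: exp_add mult.assoc)
 have meas: "(%x. w x * h x) \<in> borel_measurable lborel" if "subgaussian h" for h
  using subgaussian_meas[OF that] unfolding w_def by measurable
 have int: "integrable lborel (%x. (norm (w x * h x))^2)" if "subgaussian h" for h
  unfolding nw by (intro gauss_mean_integrable s subgaussian_intros that)
 have "(norm (LBINT x. (w x * f x) * (w x * g x)))^2 <= (LBINT x. (norm (w x * f x))^2) * (LBINT x. (norm (w x * g x))^2)"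
  by (rule integral_Cauchy_Schwarz(3)[OF meas[OF f] meas[OF g] int[OF f] int[OF g]])
 moreover have "(w x * f x) * (w x * g x) = (cor (gaussian s x) * f x) * g x" for x
  unfolding ww[symmetric] by (simp only: mult_ac)
 ultimately show ?thesis by (simp only: nw gauss_mean_def)
qed

lemma l2sq_complex: "cor (l2sq g) = (LINT xi|S2. cnj (g xi) * g xi)"
 unfolding l2sq_def integral_complex_of_real[symmetric] by (simp add: complex_norm_square mult.commute del: of_real_power)

text \<open>Pairing the trace with itself and using \<open>herglotz_gauss_mean_le\<close> for its own Herglotz transform cancels one factor of its norm.\<close>

lemma trace_approx_norm_le:
 assumes f: "subgaussian f" and s: "s > 0" and k: "k > 0"
 shows "l2sq (trace_approx k f s) <= sqrt s * gauss_mean (%x. (norm (f x))^2) s / herglotz_const k"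
proof -
 let ?g = "trace_approx k f s" and ?A = "herglotz_const k"
 define M where "M = sqrt s * gauss_mean (%x. (norm (f x))^2) s"
 define L where "L = l2sq ?g"
 have A: "?A > 0" by (rule herglotz_const_pos[OF k])
 have g: "L2s ?g" by (rule trace_approx_L2s[OF f s])
 have f': "subgaussian (%x. cnj (f x))" by (rule subgaussian_linear[OF bounded_linear_cnj f])
 have L0: "L >= 0" by (simp add: L_def l2sq_nonneg)
 have M0: "M >= 0" unfolding M_def using s by (intro mult_nonneg_nonneg gauss_mean_nonneg) auto
 have "L = norm (cor (sqrt s / ?A) * (LBINT x. (cor (gaussian s x) * cnj (f x)) * herglotz k ?g x))"
  using L0 unfolding L_def trace_approx_pairing[OF f s g, symmetric] l2sq_complex[symmetric] by simp
 then have "L^2 = (sqrt s / ?A)^2 * (norm (LBINT x. (cor (gaussian s x) * cnj (f x)) * herglotz k ?g x))^2"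
  using s A by (simp add: norm_mult power_mult_distrib norm_divide power_divide)
 also have "... <= (sqrt s / ?A)^2 * (gauss_mean (%x. (norm (cnj (f x)))^2) s * gauss_mean (%x. (norm (herglotz k ?g x))^2) s)"
  by (intro mult_left_mono gauss_weighted_Cauchy_Schwarz f' herglotz_subgaussian g s) auto
 also have "... = M * (sqrt s * gauss_mean (%x. (norm (herglotz k ?g x))^2) s) / ?A\<^sup>2" by (simp add: M_def power2_eq_square)
 also have "... <= M * (?A * L) / ?A\<^sup>2" using herglotz_gauss_mean_le[OF g k s] M0 unfolding herglotz_const_def[symmetric] L_def
  by (intro divide_right_mono mult_left_mono) auto
 also have "... = (M / ?A) * L" using A by (simp add: power2_eq_square)
 finally have "L * L <= (M / ?A) * L" by (simp add: power2_eq_square)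
 then have "L <= M / ?A" using L0 M0 A mult_right_le_imp_le[of L L "M / ?A"] by (cases "L = 0") auto
 then show ?thesis by (simp add: L_def M_def)
qed

lemma herglotz_one_energy:
 assumes k: "k > 0" and s: "s > 0"
 shows "cor (sqrt s / herglotz_const k) * (LBINT x. (cor (gaussian s x) * herglotz k (%_. 1) x) * herglotz k (%_. 1) x)
  = cor (4 * pi * (1 - exp (- (k^2 / s))))"
proof -
 define a where "a = k^2 / (4 * s)"
 have a: "a > 0" using k s by (simp add: a_def)
 let ?F = "%x. cor (gaussian s x) * herglotz k (%_. 1) x"
 have inner: "(LBINT x. iexp (k * (x \<bullet> xi)) * (?F x)) = cor (sqrt (pi / s) ^ 3 * (pi / a * (1 - exp (- 4 * a))))"
  if xi: "norm xi = 1" for xi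
 proof -
  define F where "F x = iexp (x \<bullet> (k *R xi)) * cor (gaussian s x)" for x :: "real^3"
  have F: "integrable lborel F" unfolding F_def by (rule Bintegrable_bound[OF gaussian_fourier_shifted(1)[OF s, of 0]])
    (auto simp: norm_mult intro!: borel_measurable_continuous_onI continuous_intros)
  have "(LBINT x. iexp (k * (x \<bullet> xi)) * (?F x)) = (LBINT x. F x * herglotz k (%_. 1) x)"
   unfolding F_def by (simp add: mult.assoc)
  also have "... = (LINT eta|S2. 1 * (LBINT x. iexp (k * (x \<bullet> eta)) * F x))" by (rule herglotz_pairing[OF L2s_one F])
  also have "... = (LINT eta|S2. cor (sqrt (pi / s) ^ 3 * gaussian a (- xi - eta)))"
  proof (intro Bintegral_cong refl)
   fix eta :: "real^3"
   have "(LBINT x. iexp (k * (x \<bullet> eta)) * F x) = (LBINT x. iexp (x \<bullet> (k *R (xi + eta))) * cor (gaussian s (x - 0)))"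
   proof (intro Bintegral_cong refl)
    fix x
    have "\<i> * cor (x \<bullet> (k *R (xi + eta))) = \<i> * cor (k * (x \<bullet> eta)) + \<i> * cor (x \<bullet> (k *R xi))"
     by (simp add: inner_add_right algebra_simps)
    then show "iexp (k * (x \<bullet> eta)) * F x = iexp (x \<bullet> (k *R (xi + eta))) * cor (gaussian s (x - 0))"
     unfolding F_def by (simp only: exp_add mult.assoc diff_zero)
   qed
   also have "... = cor (sqrt (pi / s) ^ 3 * exp (- ((norm (k *R (xi + eta)))^2 / (4 * s)))) * iexp (0 \<bullet> (k *R (xi + eta)))"
    by (rule gaussian_fourier_shifted(2)[OF s])
   also have "norm (k *R (xi + eta)) = \<bar>k\<bar> * norm (- xi - eta)"
   proof -
    have "- xi - eta = - (xi + eta)" by simp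
    then show ?thesis by (simp only: norm_scaleR norm_minus_cancel)
   qed
   finally show "1 * (LBINT x. iexp (k * (x \<bullet> eta)) * F x) = cor (sqrt (pi / s) ^ 3 * gaussian a (- xi - eta))"
    by (simp add: a_def power_mult_distrib)
  qed
  also have "... = cor (sqrt (pi / s) ^ 3 * (LINT eta|S2. gaussian a (- xi - eta)))" by (simp only: integral_complex_of_real integral_mult_right_zero)
  also have "(LINT eta|S2. gaussian a (- xi - eta)) = pi / a * (1 - exp (- 4 * a))" by (rule sphere_gaussian_integral[OF a]) (use xi in simp)
  finally show ?thesis .
 qed
 have "(LBINT x. (?F x) * herglotz k (%_. 1) x)
   = (LINT xi|S2. 1 * (LBINT x. iexp (k * (x \<bullet> xi)) * (?F x)))"
  by (rule herglotz_pairing[OF L2s_one gauss_times_integrable[OF herglotz_subgaussian[OF L2s_one] s]])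
 also have "... = (\<integral>xi. cor (sqrt (pi / s) ^ 3 * (pi / a * (1 - exp (- 4 * a)))) \<partial>(S2 :: (real^3) measure))"
  by (intro Bintegral_cong refl) (simp only: inner space_sphere_measure mem_sphere_0 mult_1_left)
 also have "... = cor (4 * pi * (sqrt (pi / s) ^ 3 * (pi / a * (1 - exp (- 4 * a)))))"
  unfolding sphere_const_integral by (simp add: scaleR_conv_of_real)
 finally have "cor (sqrt s / herglotz_const k) * (LBINT x. (?F x) * herglotz k (%_. 1) x)
   = cor (4 * pi * (sqrt s * (sqrt (pi / s) ^ 3 * (pi / a)) / herglotz_const k) * (1 - exp (- 4 * a)))" by (simp add: mult_ac)
 also have "sqrt s * (sqrt (pi / s) ^ 3 * (pi / a)) = herglotz_const k" unfolding a_def by (rule herglotz_const_eq[OF k s])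
 also have "- 4 * a = - (k^2 / s)" using s by (simp add: a_def)
 finally show ?thesis using herglotz_const_pos[OF k] by (simp add: a_def)
qed

text \<open>\<open>f\<close> and \<open>f y / (4 pi)\<close> times the radial solution about \<open>y\<close> have the same Gaussian means about \<open>y\<close>, because both are reproducing
with the same \<open>k\<close> and agree at \<open>y\<close>; hence they have the same radial means.\<close>

lemma radial_mean:
 assumes rep: "reproducing k f" and k: "k > 0" and s: "s > 0"
 shows "(LBINT x. (cor (gaussian s (x - y)) * herglotz k (%_. 1) (x - y)) * f x)
  = f y / cor (4 * pi) * (LBINT x. (cor (gaussian s x) * herglotz k (%_. 1) x) * herglotz k (%_. 1) x)"
proof -
 let ?P = "herglotz k (%_. 1)"
 have f: "gauss_integrable f" using rep by (simp add: reproducing_def)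
 define \<Phi> where "\<Phi> x = ?P (x - y)" for x
 have \<Phi>_eq: "\<Phi> = herglotz (- k) (%xi. iexp (k * (y \<bullet> xi)))" using herglotz_one(3)[OF k] by (auto simp: \<Phi>_def)
 have \<Phi>_rep: "reproducing k \<Phi>" using herglotz_reproducing[OF L2s_exp, of "- k" k y] unfolding \<Phi>_eq reproducing_def by simp
 have \<Phi>: "gauss_integrable \<Phi>" using \<Phi>_rep by (simp add: reproducing_def)
 have \<Phi>y: "\<Phi> y = cor (4 * pi)" by (simp add: \<Phi>_def herglotz_one(2)[OF k])
 define c where "c = f y / cor (4 * pi)"
 have c\<Phi>: "gauss_integrable (%x. c * \<Phi> x)"
 proof -
  have "continuous_on UNIV (%x. c * \<Phi> x)" using \<Phi> by (auto simp: gauss_integrable_def intro!: continuous_intros)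
  moreover have "integrable lborel (%x. gaussian \<delta> x *R (c * \<Phi> x))" if "\<delta> > 0" for \<delta>
   using integrable_mult_right[of c lborel "%x. gaussian \<delta> x *R \<Phi> x"] gauss_integrableD[OF \<Phi> that] by simp
  ultimately show ?thesis by (simp add: gauss_integrable_def)
 qed
 define h where "h x = 1 *R f x + (- 1) *R (c * \<Phi> x)" for x
 have h: "gauss_integrable h" unfolding h_def by (intro gauss_integrable_add gauss_integrable_cmult f c\<Phi>)
 have zero: "gauss_conv t h y = 0" if t: "t > 0" for t
 proof -
  have "gauss_conv t h y = 1 *R gauss_conv t f y + (- 1) *R gauss_conv t (%x. c * \<Phi> x) y"
   unfolding h_def by (rule gauss_transform_add_fun[OF t subgaussian_const f c\<Phi>])
  also have "gauss_conv t (%x. c * \<Phi> x) y = c * gauss_conv t \<Phi> y"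
   unfolding gauss_transform_def by (simp only: mult_scaleR_right[symmetric] integral_mult_right_zero)
  also have "1 *R gauss_conv t f y + (- 1) *R (c * gauss_conv t \<Phi> y) = 0" using rep \<Phi>_rep t \<Phi>y by (simp add: reproducing_def c_def)
  finally show ?thesis .
 qed
 define S where "S r = Re (?P (r *R axis 1 1))" for r
 have S_cont: "continuous_on UNIV S"
  unfolding S_def by (intro continuous_on_Re continuous_on_compose2[OF herglotz_continuous[OF L2s_one]] continuous_intros) auto
 have S: "?P z = cor (S (norm z))" for z
 proof (cases "z = 0")
  case True
  then show ?thesis by (simp add: S_def herglotz_one(2)[OF k])
 next
  case False
  then have "?P (norm z *R axis 1 1) = ?P z" by (simp add: herglotz_one(1)[OF k])
  then show ?thesis using False by (simp add: S_def herglotz_one(1)[OF k])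
 qed
 have Sb: "\<bar>S r\<bar> <= 4 * pi" for r
 proof -
  have "\<bar>S r\<bar> <= norm (?P (r *R axis 1 1))" unfolding S_def by (rule abs_Re_le_cmod)
  also have "... <= (\<integral>xi. norm (1::complex) \<partial>(S2 :: (real^3) measure))" by (rule herglotz_norm_le)
  also have "... = 4 * pi" using sphere_const_integral[of "1::real"] by simp
  finally show ?thesis .
 qed
 define \<delta> where "\<delta> = s / 2"
 have d: "\<delta> > 0" using s by (simp add: \<delta>_def)
 define q where "q z = z * S (sqrt (- ln z / \<delta>))" for z
 have q_cont: "continuous_on {0..1} q" unfolding continuous_on_eq_continuous_within
 proof
  fix z :: real assume z: "z \<in> {0..1}"
  show "continuous (at z within {0..1}) q"
  proof (cases "z = 0")
   case True
   have "((%t::real. 4 * pi * \<bar>t\<bar>) \<longlongrightarrow> 4 * pi * \<bar>0\<bar>) (at 0 within {0..1})" by (intro tendsto_intros)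
   then have lim0: "((%t::real. 4 * pi * \<bar>t\<bar>) \<longlongrightarrow> 0) (at 0 within {0..1})" by simp
   have ev: "\<forall>\<^sub>F t in at 0 within {0..1}. norm (q t) <= 4 * pi * \<bar>t\<bar>"
   proof (rule always_eventually, rule allI)
    fix t
    have "\<bar>t\<bar> * \<bar>S (sqrt (- ln t / \<delta>))\<bar> <= \<bar>t\<bar> * (4 * pi)" by (intro mult_left_mono Sb) auto
    then show "norm (q t) <= 4 * pi * \<bar>t\<bar>" by (simp add: q_def abs_mult mult.commute)
   qed
   have "(q \<longlongrightarrow> 0) (at 0 within {0..1})" by (rule Lim_null_comparison[OF ev lim0])
   then show ?thesis using True by (simp add: continuous_within q_def)
  next
   case False
   then have "continuous_on {0<..} q" unfolding q_def by (intro continuous_intros continuous_on_compose2[OF S_cont]) (use d in auto)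
   then have "isCont q z" using z False by (simp add: continuous_on_eq_continuous_at)
   then show ?thesis by (rule continuous_at_imp_continuous_within)
  qed
 qed
 have Eq: "gaussian \<delta> z * q (gaussian \<delta> z) = gaussian s z * S (norm z)" for z :: "real^3"
 proof -
  have "gaussian \<delta> z * q (gaussian \<delta> z) = (gaussian \<delta> z * gaussian \<delta> z) * S (norm z)" using d by (simp add: q_def)
  also have "gaussian \<delta> z * gaussian \<delta> z = gaussian s z" unfolding \<delta>_def by (simp flip: exp_add)
  finally show ?thesis .
 qed
 let ?w = "%x. cor (gaussian s (x - y)) * \<Phi> x"
 have w: "(gaussian \<delta> (x - y) * q (gaussian \<delta> (x - y))) *R v = ?w x * v" for x and v :: complex
  unfolding Eq \<Phi>_def S by (simp add: scaleR_conv_of_real)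
 have "(LBINT x. ?w x * h x) = 0" using gauss_transform_zero_radial[OF h zero d q_cont] unfolding w .
 have int: "integrable lborel (%x. ?w x * g x)" if g: "gauss_integrable g" for g
 proof (rule Bintegrable_bound)
  show "integrable lborel (%x. (4 * pi) *R ((gaussian s (x - y) * 1) *R g x))"
   by (intro integrable_scaleR_right gauss_transform_integrable[OF s subgaussian_const g])
  have "\<Phi> \<in> borel_measurable borel" "g \<in> borel_measurable borel" using \<Phi> g by measurable
  then show "(%x. ?w x * g x) \<in> borel_measurable lborel" by measurable
  show "AE x in lborel. norm (?w x * g x) <= norm ((4 * pi) *R ((gaussian s (x - y) * 1) *R g x))"
  proof (rule AE_I2)
   fix x
   have "norm (\<Phi> x) <= 4 * pi" unfolding \<Phi>_def S using Sb by simp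
   then have "norm (\<Phi> x) * (gaussian s (x - y) * norm (g x)) <= 4 * pi * (gaussian s (x - y) * norm (g x))" by (intro mult_right_mono) auto
   then show "norm (?w x * g x) <= norm ((4 * pi) *R ((gaussian s (x - y) * 1) *R g x))" by (simp add: norm_mult mult_ac)
  qed
 qed
 have "(LBINT x. ?w x * h x) = (LBINT x. ?w x * f x - c * (?w x * \<Phi> x))" unfolding h_def by (intro Bintegral_cong refl) (simp add: algebra_simps)
 also have "... = (LBINT x. ?w x * f x) - c * (LBINT x. ?w x * \<Phi> x)"
  by (subst Bintegral_diff[OF int[OF f]]) (simp_all only: integrable_mult_right int[OF \<Phi>] integral_mult_right_zero)
 finally have "(LBINT x. ?w x * f x) = c * (LBINT x. ?w x * \<Phi> x)" using \<open>(LBINT x. ?w x * h x) = 0\<close> by simp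
 also have "(LBINT x. ?w x * \<Phi> x) = (LBINT x. (%z. (cor (gaussian s z) * ?P z) * ?P z) (- y + x))" by (simp add: \<Phi>_def)
 also have "... = (LBINT z. (cor (gaussian s z) * ?P z) * ?P z)"
  by (rule integral_shift) (intro borel_measurable_continuous_onI continuous_intros herglotz_continuous L2s_one)
 finally show ?thesis by (simp only: \<Phi>_def c_def)
qed


lemma subgaussian_lborel_meas: "subgaussian f ==> f \<in> borel_measurable lborel" using subgaussian_meas by simp

lemma exp_difference_bound: "\<bar>exp (- a) - exp (- b)\<bar> <= \<bar>a - b\<bar> * (exp (- a) + exp (- b))" for a b :: real
proof -
 have *: "\<bar>exp (- a) - exp (- b)\<bar> <= \<bar>a - b\<bar> * (exp (- a) + exp (- b))" if "a <= b" for a b :: real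
 proof -
  have "1 + (a - b) <= exp (a - b)" by (rule exp_ge_add_one_self)
  then have "1 - exp (a - b) <= b - a" by linarith
  then have "exp (- a) * (1 - exp (a - b)) <= exp (- a) * (b - a)" by (rule mult_left_mono) simp
  moreover have "exp (- a) * (1 - exp (a - b)) = exp (- a) - exp (- b)" by (simp add: right_diff_distrib flip: exp_add)
  moreover have "0 <= (b - a) * exp (- b)" using that by simp
  moreover have "exp (- b) <= exp (- a)" using that by simp
  ultimately have "exp (- a) - exp (- b) <= (b - a) * exp (- a) + (b - a) * exp (- b)" by (simp only: mult.commute[of "exp (- a)"])
  moreover have "\<bar>exp (- a) - exp (- b)\<bar> = exp (- a) - exp (- b)" "\<bar>a - b\<bar> = b - a" using that by auto
  ultimately show ?thesis by (simp only: distrib_left)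
 qed
 show ?thesis using *[of a b] *[of b a] by (cases "a <= b") (auto simp: abs_minus_commute add.commute)
qed

text \<open>The Herglotz transform of the trace at \<open>y\<close> is the integral of \<open>f\<close> against the radial solution about \<open>y\<close> with a Gaussian weight
centred at 0. Recentring the weight at \<open>y\<close> costs an error of order \<open>sqrt s\<close>, because the radial solution decays like
\<open>1 / |x|\<close>, and leaves a mean given by \<open>radial_mean\<close>.\<close>

lemma trace_approx_converges:
 assumes rep: "reproducing k f" and f: "subgaussian f" and k: "k > 0"
  and B: "!!s. 0 < s ==> s <= 1 ==> sqrt s * gauss_mean (%x. (norm (f x))^2) s <= B"
 shows "((%s. herglotz k (trace_approx k f s) y) \<longlongrightarrow> f y) (at_right 0)"
proof -
 let ?P = "herglotz k (%_. 1)" and ?A = "herglotz_const k"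
 let ?G = "%s x. cor (gaussian s (x - y)) * ?P (x - y)"
 let ?F = "%s x. cor (gaussian s x) * f x"
 have A: "?A > 0" by (rule herglotz_const_pos[OF k])
 define K where "K = 4 * pi * (1 + 1 / k)"
 have K: "K >= 0" using k by (simp add: K_def)
 \<comment> \<open>D and E bound the cost of recentring the Gaussian weight from 0 to y; E tends to 0 with s.\<close>
 define D where "D = norm y * (2 + norm y) * K * (1 + exp ((norm y)^2))"
 have D: "D >= 0" unfolding D_def using K by (intro mult_nonneg_nonneg add_nonneg_nonneg) auto
 define E where "E s = sqrt s / ?A * (D * s * sqrt ((\<bar>B\<bar> + 1) / sqrt (s / 2) * sqrt (pi / (s / 2)) ^ 3))" for s
 have eq: "herglotz k (trace_approx k f s) y = cor (sqrt s / ?A) * (LBINT x. (?F s x) * ?P (x - y))" if s: "s > 0" for s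
 proof -
  have "herglotz k (trace_approx k f s) y = (LINT xi|S2. cor (sqrt s / ?A) * (iexp (k * (y \<bullet> xi)) * (LBINT x. iexp ((- k) * (x \<bullet> xi)) * (?F s x))))"
   unfolding herglotz_def trace_approx_def by (simp only: mult.left_commute)
  also have "... = cor (sqrt s / ?A) * (LBINT x. (?F s x) * herglotz (- k) (%xi. iexp (k * (y \<bullet> xi))) x)"
   unfolding herglotz_pairing[OF L2s_exp gauss_times_integrable[OF f s]] by (rule integral_mult_right_zero)
  finally show ?thesis unfolding herglotz_one(3)[OF k] .
 qed
 have mean: "cor (sqrt s / ?A) * (LBINT x. (?G s x) * f x) = f y * cor (1 - exp (- (k^2 / s)))" if s: "s > 0" for s
 proof -
  have "c * (f y / cor (4 * pi) * I) = f y * cor r" if "c * I = cor (4 * pi * r)" for c I r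
  proof -
   have "c * (f y / cor (4 * pi) * I) = f y / cor (4 * pi) * (c * I)" by (simp only: mult_ac)
   then show ?thesis unfolding that by simp
  qed
  then show ?thesis unfolding radial_mean[OF rep k s] using herglotz_one_energy[OF k s] by blast
 qed
 have f_abs: "subgaussian (%x. cor (norm (f x)))" by (intro subgaussian_linear[OF bounded_linear_of_real] subgaussian_norm f)
 have bound: "norm (herglotz k (trace_approx k f s) y - f y * cor (1 - exp (- (k^2 / s)))) <= E s" if s: "0 < s" "s <= 1" for s
 proof -
  have s2: "s / 2 > 0" using s by simp
  let ?I = "\<integral>x. gaussian (s / 2) x * norm (f x) \<partial>lborel"
  have "(norm (LBINT x. (cor (gaussian (s / 2) x) * cor (norm (f x))) * 1))^2
   <= gauss_mean (%x. (norm (cor (norm (f x))))^2) (s / 2) * gauss_mean (%x. (norm (1::complex))^2) (s / 2)"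
   by (rule gauss_weighted_Cauchy_Schwarz[OF f_abs subgaussian_const s2])
  also have "gauss_mean (%x. (norm (1::complex))^2) (s / 2) = sqrt (pi / (s / 2)) ^ 3"
   using gaussian_integral(2)[OF s2, where 'a = "real^3"] by (simp add: gauss_mean_def)
  also have "(LBINT x. (cor (gaussian (s / 2) x) * cor (norm (f x))) * 1) = cor ?I" by (simp flip: of_real_mult)
  finally have "?I\<^sup>2 <= gauss_mean (%x. (norm (f x))^2) (s / 2) * sqrt (pi / (s / 2)) ^ 3" by simp
  also have "... <= ((\<bar>B\<bar> + 1) / sqrt (s / 2)) * sqrt (pi / (s / 2)) ^ 3"
  proof (rule mult_right_mono)
   have "sqrt (s / 2) * gauss_mean (%x. (norm (f x))^2) (s / 2) <= \<bar>B\<bar> + 1" using B[of "s / 2"] s by simp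
   then show "gauss_mean (%x. (norm (f x))^2) (s / 2) <= (\<bar>B\<bar> + 1) / sqrt (s / 2)"
    using s2 by (subst pos_le_divide_eq) (simp_all add: mult.commute del: real_sqrt_divide)
  qed (use s in simp)
  finally have I: "?I <= sqrt ((\<bar>B\<bar> + 1) / sqrt (s / 2) * sqrt (pi / (s / 2)) ^ 3)" by (rule real_le_rsqrt)
  have intI: "integrable lborel (%x. D * s * (gaussian (s / 2) x * norm (f x)))"
   by (intro integrable_mult_right gauss_mean_integrable subgaussian_norm f s2)
  have int1: "integrable lborel (%x. (?F s x) * ?P (x - y))"
   and int2: "integrable lborel (%x. (?G s x) * f x)"
  proof -
   have P: "norm (?P z) <= 4 * pi" for z
    using herglotz_norm_le[of k "%_. 1" z] sphere_const_integral[of "1::real"] by simp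
   have Pm: "(%x. ?P (x - y)) \<in> borel_measurable borel"
    by (intro borel_measurable_continuous_onI continuous_on_compose2[OF herglotz_continuous[OF L2s_one]] continuous_intros) auto
   have fm: "f \<in> borel_measurable borel" by (rule subgaussian_meas[OF f])
   show "integrable lborel (%x. (?F s x) * ?P (x - y))"
   proof (rule Bintegrable_bound)
    show "integrable lborel (%x. (4 * pi) * norm (?F s x))"
     by (intro integrable_mult_right integrable_norm gauss_times_integrable f s)
    show "AE x in lborel. norm ((?F s x) * ?P (x - y)) <= norm ((4 * pi) * norm (?F s x))"
    proof (rule AE_I2)
     fix x
     show "norm ((?F s x) * ?P (x - y)) <= norm ((4 * pi) * norm (?F s x))"
      using mult_left_mono[OF P[of "x - y"], of "norm (?F s x)"] by (simp add: norm_mult mult_ac)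
    qed
   qed (use Pm fm in measurable)
   show "integrable lborel (%x. (?G s x) * f x)"
   proof (rule Bintegrable_bound)
    show "integrable lborel (%x. (4 * pi) *R ((gaussian s (x - y) * 1) *R f x))"
     by (intro integrable_scaleR_right gauss_transform_integrable subgaussian_const s subgaussian_imp_gauss_integrable f)
    show "AE x in lborel. norm ((?G s x) * f x) <= norm ((4 * pi) *R ((gaussian s (x - y) * 1) *R f x))"
    proof (rule AE_I2)
     fix x
     have "norm (?P (x - y)) * (gaussian s (x - y) * norm (f x)) <= 4 * pi * (gaussian s (x - y) * norm (f x))" by (intro mult_right_mono P) auto
     then show "norm ((?G s x) * f x) <= norm ((4 * pi) *R ((gaussian s (x - y) * 1) *R f x))"
      by (simp add: norm_mult mult_ac)
    qed
   qed (use Pm fm in measurable)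
  qed
  have "norm (LBINT x. (?F s x) * ?P (x - y) - (?G s x) * f x) <= (LBINT x. D * s * (gaussian (s / 2) x * norm (f x)))"
  proof (rule integral_norm_le[OF intI])
   fix x
   define z where "z = x - y"
   have xz: "x = z + y" by (simp add: z_def)
   have "\<bar>(norm x)\<^sup>2 - (norm z)\<^sup>2\<bar> = \<bar>2 * (z \<bullet> y) + (norm y)\<^sup>2\<bar>"
    unfolding xz by (simp add: power2_norm_eq_inner inner_add inner_commute)
   also have "... <= 2 * (norm z * norm y) + (norm y)^2"
   proof -
    have "0 <= (norm y)^2" by simp
    then show ?thesis using Cauchy_Schwarz_ineq2[of z y] by (simp only: abs_le_iff) linarith
   qed
   also have "... <= norm y * (2 + norm y) * (1 + norm z)" by (simp add: power2_eq_square algebra_simps)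
   finally have q: "\<bar>s * (norm x)^2 - s * (norm z)\<^sup>2\<bar> <= s * (norm y * (2 + norm y) * (1 + norm z))"
    using s by (simp add: right_diff_distrib[symmetric] abs_mult)
   have e1: "exp (- (s * (norm x)^2)) <= gaussian (s / 2) x" using s by simp
   have "gaussian s (x - y) <= exp (s * (norm y)^2) * gaussian (s / 2) x" using s by (intro exp_shift_bound) auto
   also have "... <= exp ((norm y)^2) * gaussian (s / 2) x" using s by (intro mult_right_mono) (auto intro: mult_left_le_one_le)
   finally have e2: "exp (- (s * (norm z)^2)) <= exp ((norm y)^2) * gaussian (s / 2) x" by (simp add: z_def)
   have "\<bar>exp (- (s * (norm x)^2)) - exp (- (s * (norm z)^2))\<bar> <= \<bar>s * (norm x)^2 - s * (norm z)\<^sup>2\<bar> * (exp (- (s * (norm x)^2)) + exp (- (s * (norm z)^2)))"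
    by (rule exp_difference_bound)
   also have "... <= (s * (norm y * (2 + norm y) * (1 + norm z))) * ((1 + exp ((norm y)^2)) * gaussian (s / 2) x)"
    using add_mono[OF e1 e2] s by (intro mult_mono q) (auto simp only: distrib_right mult_1_left intro!: mult_nonneg_nonneg add_nonneg_nonneg exp_ge_zero norm_ge_zero)
   finally have d: "\<bar>exp (- (s * (norm x)^2)) - exp (- (s * (norm z)^2))\<bar> <= (s * (norm y * (2 + norm y) * (1 + norm z))) * ((1 + exp ((norm y)^2)) * gaussian (s / 2) x)" .
   have "norm ((?F s x) * ?P (x - y) - (?G s x) * f x)
     = \<bar>exp (- (s * (norm x)^2)) - exp (- (s * (norm z)^2))\<bar> * (norm (?P z) * norm (f x))"
   proof -
    have "(?F s x) * ?P (x - y) - (?G s x) * f x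
     = cor (exp (- (s * (norm x)^2)) - exp (- (s * (norm z)^2))) * (?P z * f x)" by (simp add: z_def algebra_simps)
    then show ?thesis by (simp only: norm_mult norm_of_real)
   qed
   also have "... <= ((s * (norm y * (2 + norm y) * (1 + norm z))) * ((1 + exp ((norm y)^2)) * gaussian (s / 2) x)) * (norm (?P z) * norm (f x))"
    by (intro mult_right_mono d) auto
   also have "... = (s * (norm y * (2 + norm y)) * ((1 + exp ((norm y)^2)) * gaussian (s / 2) x) * norm (f x)) * (norm (?P z) * (1 + norm z))"
    by (simp only: mult_ac)
   also have "... <= (s * (norm y * (2 + norm y)) * ((1 + exp ((norm y)^2)) * gaussian (s / 2) x) * norm (f x)) * K"
    unfolding K_def using s by (intro mult_left_mono herglotz_one_bound k) (auto intro!: mult_nonneg_nonneg add_nonneg_nonneg)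
   also have "... = D * s * (gaussian (s / 2) x * norm (f x))" unfolding D_def by (simp only: mult_ac)
   finally show "norm ((?F s x) * ?P (x - y) - (?G s x) * f x) <= D * s * (gaussian (s / 2) x * norm (f x))" .
  qed
  also have "... = D * s * ?I" by (rule integral_mult_right_zero)
  also have "... <= D * s * sqrt ((\<bar>B\<bar> + 1) / sqrt (s / 2) * sqrt (pi / (s / 2)) ^ 3)" using D s by (intro mult_left_mono I) auto
  finally have fin: "norm (LBINT x. (?F s x) * ?P (x - y) - (?G s x) * f x) <= D * s * sqrt ((\<bar>B\<bar> + 1) / sqrt (s / 2) * sqrt (pi / (s / 2)) ^ 3)" .
  have "herglotz k (trace_approx k f s) y - f y * cor (1 - exp (- (k^2 / s))) = cor (sqrt s / ?A) * (LBINT x. (?F s x) * ?P (x - y) - (?G s x) * f x)"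
   unfolding eq[OF s(1)] mean[OF s(1), symmetric] Bintegral_diff[OF int1 int2] by (simp only: right_diff_distrib)
  then have "norm (herglotz k (trace_approx k f s) y - f y * cor (1 - exp (- (k^2 / s)))) = (sqrt s / ?A) * norm (LBINT x. (?F s x) * ?P (x - y) - (?G s x) * f x)"
   using A s by (simp only: norm_mult norm_of_real) (simp add: abs_of_nonneg)
  also have "... <= E s" unfolding E_def using A s by (intro mult_left_mono fin) auto
  finally show ?thesis .
 qed
 have "(E \<longlongrightarrow> 0) (at_right 0)"
 proof -
  have B1: "\<bar>B\<bar> + 1 > 0" by simp
  define b where "b = \<bar>B\<bar> + 1"
  have b: "b > 0" using B1 by (simp add: b_def)
  have "((%s. s * sqrt s * sqrt (b / sqrt (s / 2) * sqrt (pi / (s / 2)) ^ 3)) \<longlongrightarrow> 0) (at_right 0)" using b by real_asymp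
  then have "((%s. D / ?A * (s * sqrt s * sqrt (b / sqrt (s / 2) * sqrt (pi / (s / 2)) ^ 3))) \<longlongrightarrow> D / ?A * 0) (at_right 0)"
   by (rule tendsto_mult_left)
  then show ?thesis unfolding E_def b_def by (simp add: mult_ac)
 qed
 then have 1: "((%s. herglotz k (trace_approx k f s) y - f y * cor (1 - exp (- (k^2 / s)))) \<longlongrightarrow> 0) (at_right 0)"
 proof (rule Lim_null_comparison[rotated])
  have "\<forall>\<^sub>F s in at_right 0. s \<in> {0<..<1::real}" by (rule eventually_at_right_real) simp
  then show "\<forall>\<^sub>F s in at_right 0. norm (herglotz k (trace_approx k f s) y - f y * cor (1 - exp (- (k^2 / s)))) <= E s"
  proof eventually_elim
   case (elim s)
   then show ?case by (intro bound) auto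
  qed
 qed
 have "((%s. 1 - exp (- (k^2 / s))) \<longlongrightarrow> 1) (at_right 0)" using k by real_asymp
 then have 2: "((%s. f y * cor (1 - exp (- (k^2 / s)))) \<longlongrightarrow> f y * cor 1) (at_right 0)" by (intro tendsto_intros)
 show ?thesis using tendsto_add[OF 1 2] by simp
qed

text \<open>Choose \<open>s n\<close> tending to 0 such that \<open>M (s n)\<close> converges. By the adjoint relation the products of the traces \<open>g n\<close> and
\<open>g m\<close> tend, as \<open>m\<close> grows, to \<open>M (s n) / A\<close> with \<open>A = herglotz_const k\<close>, which also bounds the square of the norm of \<open>g n\<close>; so the traces form a Cauchy sequence.\<close>

theorem herglotz_lower:
 assumes k: "k > 0" and rep: "reproducing k f" and N: "scalar_norm f <= ennreal N" "N >= 0"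
 obtains g where "L2s g" "f = herglotz k g" "l2sq g <= 2 * (2 + 100 * exp 1 / k^2) / herglotz_const k * N"
proof -
 let ?A = "herglotz_const k"
 have A: "?A > 0" by (rule herglotz_const_pos[OF k])
 obtain p q where jet: "helmholtz_jet k f p q" using reproducing_jet[OF rep] .
 have f: "subgaussian f" using jet by (simp add: helmholtz_jet_def)
 define M where "M s = sqrt s * gauss_mean (%x. (norm (f x))^2) s" for s
 define B where "B = (2 + 100 * exp 1 / k^2) * N"
 have MB: "M s <= B" if "0 < s" "s <= 1" for s
 proof -
  have "k^2 * M s <= (2 * k^2 + 100 * exp 1) * N" using jet_lower[OF jet _ N(2) that] N(1) unfolding jet_scalar_norm[OF jet] M_def .
  also have "... = k^2 * B" using k by (simp add: B_def field_simps)
  finally show ?thesis using k by simp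
 qed
 have M0: "M s >= 0" if "s > 0" for s unfolding M_def using that by (intro mult_nonneg_nonneg gauss_mean_nonneg) auto
 define t where "t n = 1 / real (n + 1)" for n :: nat
 have t: "0 < t n" "t n <= 1" for n by (auto simp: t_def)
 have "\<exists>l\<in>{0..B}. \<exists>r. strict_mono r & ((%n. M (t n)) \<circ> r) ----> l"
  using compact_Icc[of 0 B] M0 MB t unfolding compact_def by auto
 then obtain l r where r: "strict_mono r" and Ml: "(%n. M (t (r n))) ----> l" by (auto simp: o_def)
 define s where "s n = t (r n)" for n
 have s: "0 < s n" "s n <= 1" for n using t by (auto simp: s_def)
 have "t ----> 0" unfolding t_def using LIMSEQ_inverse_real_of_nat by (simp add: inverse_eq_divide)
 then have "s ----> 0" unfolding s_def using LIMSEQ_subseq_LIMSEQ[OF _ r] by (simp add: o_def)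
 then have s_lim: "filterlim s (at_right 0) sequentially" using s(1) less_imp_neq[OF s(1), symmetric] by (simp add: filterlim_at always_eventually)
 define g where "g n = trace_approx k f (s n)" for n
 have g: "L2s (g n)" for n unfolding g_def by (rule trace_approx_L2s[OF f s(1)])
 have gM: "l2sq (g n) <= M (s n) / ?A" for n unfolding g_def M_def by (rule trace_approx_norm_le[OF f s(1) k])
 have gB: "l2sq (g n) <= B / ?A" for n
  using gM[of n] MB[OF s(1,2)[of n]] A by (meson divide_right_mono less_imp_le order_trans)
 have Ug: "(%n. herglotz k (g n) y) ----> f y" for y
  unfolding g_def using filterlim_compose[OF trace_approx_converges[OF rep f k MB[unfolded M_def]] s_lim] by simp
 define W where "W n m = Re (LINT xi|S2. cnj (g n xi) * g m xi)" for n m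
 have W_lim: "(%m. W n m) ----> M (s n) / ?A" for n
 proof -
  let ?w = "%x. cor (exp (- s n * (norm x)^2)) * cnj (f x)"
  have f': "subgaussian (%x. cnj (f x))" by (rule subgaussian_linear[OF bounded_linear_cnj f])
  have wi: "integrable lborel ?w" by (rule gauss_times_integrable[OF f' s(1)])
  define C where "C = sqrt (4 * pi * (B / ?A))"
  have C: "norm (herglotz k (g m) x) <= C" for m x
  proof -
   have "(norm (herglotz k (g m) x))^2 <= 4 * pi * l2sq (g m)" by (rule herglotz_norm_le_l2[OF g])
   also have "... <= 4 * pi * (B / ?A)" by (intro mult_left_mono gB) auto
   finally show ?thesis unfolding C_def by (rule real_le_rsqrt)
  qed
  have "(%m. \<integral>x. ?w x * herglotz k (g m) x \<partial>lborel) ----> (LBINT x. ?w x * f x)"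
  proof (rule integral_dominated_convergence[where w = "%x. norm (?w x) * C"])
   show "(%x. ?w x * f x) \<in> borel_measurable lborel"
    by (intro borel_measurable_times borel_measurable_integrable[OF wi] subgaussian_lborel_meas f)
   show "(%x. ?w x * herglotz k (g m) x) \<in> borel_measurable lborel" for m
    by (intro borel_measurable_times borel_measurable_integrable[OF wi] subgaussian_lborel_meas herglotz_subgaussian g)
   show "AE x in lborel. (%m. ?w x * herglotz k (g m) x) ----> ?w x * f x" by (intro AE_I2 tendsto_mult tendsto_const Ug)
   show "AE x in lborel. norm (?w x * herglotz k (g m) x) <= norm (?w x) * C" for m
    unfolding norm_mult[of "?w _"] by (intro AE_I2 mult_left_mono C) auto
  qed (intro integrable_mult_left integrable_norm wi)
  then have "(%m. Re (cor (sqrt (s n) / ?A) * (LBINT x. ?w x * herglotz k (g m) x))) ----> Re (cor (sqrt (s n) / ?A) * (LBINT x. ?w x * f x))"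
   by (intro tendsto_Re tendsto_mult tendsto_const)
  moreover have "Re (cor (sqrt (s n) / ?A) * (LBINT x. ?w x * herglotz k (g m) x)) = W n m" for m
   unfolding W_def g_def[of n] trace_approx_pairing[OF f s(1) g] ..
  moreover have "(LBINT x. ?w x * f x) = cor (gauss_mean (%x. (norm (f x))^2) (s n))" unfolding gauss_mean_def integral_complex_of_real[symmetric]
   by (intro Bintegral_cong refl) (simp only: of_real_mult complex_norm_square mult_ac)
  ultimately show ?thesis by (simp add: M_def)
 qed
 have expand: "l2sq (%xi. g n xi - g m xi) = l2sq (g n) + l2sq (g m) - 2 * W n m" for n m
 proof -
  have i: "integrable S2 (%xi. cnj (g n xi) * g m xi)"
  proof (rule integral_Cauchy_Schwarz(1))
   show "(%xi. cnj (g n xi)) \<in> borel_measurable S2"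
    by (rule measurable_compose[OF L2s_meas[OF g]]) (intro borel_measurable_continuous_onI continuous_intros)
  qed (use g[of n] g[of m] in \<open>auto simp: L2s_def\<close>)
  have "l2sq (%xi. g n xi - g m xi) = (LINT xi|S2. ((norm (g n xi))^2 + (norm (g m xi))^2) - 2 * Re (cnj (g n xi) * g m xi))"
   unfolding l2sq_def by (intro Bintegral_cong refl, unfold cmod_power2) (simp add: power2_eq_square algebra_simps)
  also have "... = l2sq (g n) + l2sq (g m) - 2 * W n m"
  proof -
   have gi: "integrable S2 (%xi. (norm (g n xi))^2)" "integrable S2 (%xi. (norm (g m xi))^2)" using g by (auto simp: L2s_def)
   have iR: "integrable S2 (%xi. Re (cnj (g n xi) * g m xi))" by (rule integrable_Re[OF i])
   have W: "W n m = (LINT xi|S2. Re (cnj (g n xi) * g m xi))" unfolding W_def using integral_Re[OF i] by simp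
   have a: "integrable S2 (%xi. (norm (g n xi))^2 + (norm (g m xi))^2)" by (rule Bintegrable_add[OF gi])
   have b: "integrable S2 (%xi. 2 * Re (cnj (g n xi) * g m xi))" by (rule integrable_mult_right[OF iR])
   have c: "(LINT xi|S2. (norm (g n xi))^2 + (norm (g m xi))^2) = l2sq (g n) + l2sq (g m)" unfolding l2sq_def by (rule Bintegral_add[OF gi])
   have d: "(LINT xi|S2. 2 * Re (cnj (g n xi) * g m xi)) = 2 * W n m" unfolding W by (rule integral_mult_right_zero)
   show ?thesis using Bintegral_diff[OF a b] unfolding c d .
  qed
  finally show ?thesis .
 qed
 have cauchy: "\<exists>n0. \<forall>m\<ge>n0. \<forall>n\<ge>n0. l2sq (%xi. g m xi - g n xi) < e" if e: "e > 0" for e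
 proof -
  have "(%n. (l - M (s n)) / ?A) ----> (l - l) / ?A" using Ml A unfolding s_def by (intro tendsto_intros) auto
  then have "\<forall>\<^sub>F n in sequentially. (l - M (s n)) / ?A < e / 4" using e by (intro order_tendstoD) auto
  then obtain n0 where n0: "!!n. n >= n0 ==> (l - M (s n)) / ?A < e / 4" by (auto simp: eventually_sequentially)
  have near: "\<forall>\<^sub>F j in sequentially. l2sq (%xi. g n xi - g j xi) < e / 4" if n: "n >= n0" for n
  proof -
   have "(%j. M (s n) / ?A + M (s j) / ?A - 2 * W n j) ----> M (s n) / ?A + l / ?A - 2 * (M (s n) / ?A)"
    using Ml A unfolding s_def[symmetric] by (intro tendsto_intros W_lim) auto
   moreover have "M (s n) / ?A + l / ?A - 2 * (M (s n) / ?A) < e / 4" using n0[OF n] by (simp add: diff_divide_distrib)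
   ultimately have "\<forall>\<^sub>F j in sequentially. M (s n) / ?A + M (s j) / ?A - 2 * W n j < e / 4" by (rule order_tendstoD)
   then show ?thesis
   proof eventually_elim
    case (elim j)
    then show ?case using expand[of n j] gM[of n] gM[of j] by linarith
   qed
  qed
  show ?thesis
  proof (intro exI allI impI)
   fix m n assume "n0 <= m" "n0 <= n"
   then obtain j where "l2sq (%xi. g m xi - g j xi) < e / 4" "l2sq (%xi. g n xi - g j xi) < e / 4"
    using eventually_happens[OF eventually_conj[OF near[of m] near[of n]]] by auto
   then show "l2sq (%xi. g m xi - g n xi) < e" using l2sq_triangle[OF g[of m] g[of j] g[of n]] l2sq_diff_commute[of "g j" "g n"] by simp
  qed
 qed
 obtain G where G: "L2s G" and Glim: "(%n. l2sq (%xi. g n xi - G xi)) ----> 0" using L2s_complete[of g, OF g cauchy] by blast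
 have "f y = herglotz k G y" for y
 proof -
  have "(%n. sqrt (4 * pi * l2sq (%xi. g n xi - G xi))) ----> sqrt (4 * pi * 0)" by (intro tendsto_intros Glim)
  have "(%n. herglotz k (%xi. g n xi - G xi) y) ----> 0"
   proof (rule Lim_null_comparison[rotated, of "%n. sqrt (4 * pi * l2sq (%xi. g n xi - G xi))"])
    show "\<forall>\<^sub>F n in sequentially. norm (herglotz k (%xi. g n xi - G xi) y) <= sqrt (4 * pi * l2sq (%xi. g n xi - G xi))"
     by (intro always_eventually allI real_le_rsqrt herglotz_norm_le_l2 L2s_diff g G)
    show "(%n. sqrt (4 * pi * l2sq (%xi. g n xi - G xi))) ----> 0"
     using \<open>(%n. sqrt (4 * pi * l2sq (%xi. g n xi - G xi))) ----> sqrt (4 * pi * 0)\<close> by (simp only: mult_zero_right real_sqrt_zero)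
   qed
  moreover have "herglotz k (%xi. g n xi - G xi) y = herglotz k (g n) y - herglotz k G y" for n
   using herglotz_add[OF g[of n] L2s_cmult[OF G, of "-1"], of k y] herglotz_cmult[of k "-1" G y] by simp
  ultimately have "(%n. herglotz k (g n) y - herglotz k G y) ----> 0" by simp
  then have "(%n. herglotz k (g n) y) ----> herglotz k G y" by (rule LIM_zero_cancel)
  then show ?thesis using Ug LIMSEQ_unique by blast
 qed
 then have fG: "f = herglotz k G" by blast
 have "l2sq G <= 2 * (B / ?A) + 2 * 0"
 proof (rule LIMSEQ_le_const)
  show "(%n. 2 * (B / ?A) + 2 * l2sq (%xi. g n xi - G xi)) ----> 2 * (B / ?A) + 2 * 0" by (intro tendsto_intros Glim)
  have "l2sq G <= 2 * (B / ?A) + 2 * l2sq (%xi. g n xi - G xi)" for n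
   using l2sq_add_le[OF g[of n] L2s_diff[OF G g[of n]]] gB[of n] l2sq_diff_commute[of G "g n"] by simp
  then show "\<exists>n0. \<forall>n\<ge>n0. l2sq G <= 2 * (B / ?A) + 2 * l2sq (%xi. g n xi - G xi)" by blast
 qed
 then have le: "l2sq G <= 2 * (2 + 100 * exp 1 / k^2) / ?A * N"
  unfolding B_def by (simp only: mult_zero_right add_0_right times_divide_eq_right times_divide_eq_left mult.assoc)
 show ?thesis by (rule that[OF G fG le])
qed

section \<open>Weak formulation with Gaussian test functions\<close>

lemma differentiable_has_partial_derivative:
 fixes f :: "real^3 => 'b::real_normed_vector"
 assumes "f differentiable (at x)"
 shows "(f has_derivative (%h. SUM j:UNIV. h $ j *R partial_d j f x)) (at x)"
proof -
 obtain D where D: "(f has_derivative D) (at x)" using assms by (auto simp: differentiable_def)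
 have lin: "linear D" by (rule has_derivative_linear[OF D])
 have Dh: "D h = (SUM j:UNIV. h $ j *R D (axis j 1))" for h
 proof -
  have "h = h $ 1 *R axis 1 1 + h $ 2 *R axis 2 1 + h $ 3 *R axis 3 1" by (simp add: vec_eq_iff forall_3 axis_def)
  then have "D h = D (h $ 1 *R axis 1 1 + h $ 2 *R axis 2 1 + h $ 3 *R axis 3 1)" by (rule arg_cong)
  then show ?thesis by (simp only: linear_add[OF lin] linear_cmul[OF lin] sum_3)
 qed
 then have eq: "D = (%h. SUM j:UNIV. h $ j *R D (axis j 1))" by blast
 have D': "(f has_derivative (%h. SUM j:UNIV. h $ j *R D (axis j 1))) (at x)" using D eq by simp
 have "partial_d j f x = D (axis j 1)" for j by (rule partial_d_eq[OF D'])
 then show ?thesis using D' by simp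
qed

lemma has_derivative_along_axis:
 fixes f :: "real^3 => 'b::real_normed_vector"
 assumes "(f has_derivative (%h. SUM j:UNIV. h $ j *R p j)) (at x)"
 shows "((%t. f (x + t *R axis j 1)) has_vector_derivative p j) (at 0)"
proof -
 have ax: "(SUM i:UNIV. (axis j 1 :: real^3) $ i *R p i) = p j" using exhaust_3[of j] by (auto simp: sum_3 axis_def)
 have path: "((%t. x + t *R (axis j 1 :: real^3)) has_derivative (%t. t *R axis j 1)) (at 0)" by (auto intro!: derivative_eq_intros)
 have "((%t. f (x + t *R axis j 1)) has_derivative (%t. SUM i:UNIV. (t *R (axis j 1 :: real^3)) $ i *R p i)) (at 0)"
  by (rule has_derivative_compose[OF path]) (use assms in simp)
 moreover have "(%t. SUM i:UNIV. (t *R (axis j 1 :: real^3)) $ i *R p i) = (%t. t *R p j)" by (subst ax[symmetric]) (simp add: scaleR_sum_right)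
 ultimately show ?thesis by (simp add: has_vector_derivative_def)
qed

lemma differentiable_imp_cont: "(!!x. f differentiable (at x)) ==> continuous_on UNIV f"
 by (intro continuous_at_imp_continuous_on ballI differentiable_imp_continuous_within)

lemma integrable_compact_support:
 fixes f :: "real^3 => 'b::euclidean_space"
 assumes "continuous_on UNIV f" "!!x. R < norm (x - c) ==> f x = 0"
 shows "integrable lborel f"
proof -
 have "integrable lborel (%x. indicator (cball c R) x *R f x)"
  by (intro borel_integrable_compact compact_cball continuous_on_subset[OF assms(1)]) simp
 moreover have "(%x. indicator (cball c R) x *R f x) = f" using assms(2) by (auto simp: indicator_def fun_eq_iff dist_norm norm_minus_commute)
 ultimately show ?thesis by simp
qed

lemma integration_by_parts_compact:
 fixes ph ph' :: "real^3 => real" and v :: "real^3 => complex"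
 assumes ph: "continuous_on UNIV ph" "continuous_on UNIV ph'" "!!x. ((%t. ph (x + t *R axis j 1)) has_real_derivative ph' x) (at 0)"
  and supp: "!!x. R < norm (x - c) ==> ph x = 0 & ph' x = 0"
  and v: "!!x. v differentiable (at x)" "continuous_on UNIV (partial_d j v)"
 shows "(LBINT x. ph x *R partial_d j v x) = - (LBINT x. ph' x *R v x)"
proof -
 have vc: "continuous_on UNIV v" by (rule differentiable_imp_cont[OF v(1)])
 have i1: "integrable lborel (%x. ph' x *R v x)" and i2: "integrable lborel (%x. ph x *R partial_d j v x)"
  and i3: "integrable lborel (%x. ph x *R v x)"
  by (rule integrable_compact_support[where R = R and c = c], intro continuous_intros ph vc v, simp add: supp)+
 have "(LBINT x. ph x *R partial_d j v x + ph' x *R v x) = 0"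
 proof (rule integral_directional_derivative_eq_0[where e = "axis j 1"])
  fix x
  have dv: "((%t. v (x + t *R axis j 1)) has_vector_derivative partial_d j v x) (at 0)"
   by (rule has_derivative_along_axis[OF differentiable_has_partial_derivative[OF v(1)]])
  show "((%t. ph (x + t *R axis j 1) *R v (x + t *R axis j 1)) has_vector_derivative ph x *R partial_d j v x + ph' x *R v x) (at 0)"
   using has_vector_derivative_scaleR[OF ph(3)[of x] dv] by simp
 qed (intro Bintegrable_add i1 i2 i3 continuous_intros ph vc v)+
 then show ?thesis using i1 i2 by (simp add: add_eq_0_iff2)
qed

lemma DERIV_pos_part_power: "((%u::real. (max 0 u) ^ (m + 2)) has_real_derivative real (m + 2) * (max 0 u) ^ (m + 1)) (at u)"
proof -
 consider "u > 0" | "u < 0" | "u = 0" by linarith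
 then show ?thesis
 proof cases
  case 1
  have "((%u::real. u ^ (m + 2)) has_real_derivative real (m + 2) * (max 0 u) ^ (m + 1)) (at u)" using 1 DERIV_pow[of "m + 2" u] by simp
  then show ?thesis by (rule has_field_derivative_transform_within_open[where S = "{0<..}"]) (use 1 in auto)
 next
  case 2
  have "((%u::real. 0) has_real_derivative real (m + 2) * (max 0 u) ^ (m + 1)) (at u)" using 2 by simp
  then show ?thesis by (rule has_field_derivative_transform_within_open[where S = "{..<0}"]) (use 2 in auto)
 next
  case 3
  have "((%h::real. ((max 0 (0 + h)) ^ (m + 2) - (max 0 0) ^ (m + 2)) / h) \<longlongrightarrow> 0) (at 0)"
  proof (rule Lim_null_comparison)
   show "\<forall>\<^sub>F h in at 0. norm (((max 0 (0 + h)) ^ (m + 2) - (max 0 0) ^ (m + 2)) / h) <= \<bar>h\<bar> ^ (m + 1)"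
   proof (rule always_eventually, rule allI)
    fix h :: real
    have "(max 0 h) ^ (m + 2) <= \<bar>h\<bar> ^ (m + 2)" by (intro power_mono) auto
    then have "(max 0 h) ^ (m + 2) / \<bar>h\<bar> <= \<bar>h\<bar> ^ (m + 2) / \<bar>h\<bar>" by (rule divide_right_mono) simp
    also have "... <= \<bar>h\<bar> ^ (m + 1)" by (cases "h = 0") auto
    finally show "norm (((max 0 (0 + h)) ^ (m + 2) - (max 0 0) ^ (m + 2)) / h) <= \<bar>h\<bar> ^ (m + 1)" by (simp add: abs_mult)
   qed
   have "((%h::real. \<bar>h\<bar> ^ (m + 1)) \<longlongrightarrow> \<bar>0\<bar> ^ (m + 1)) (at 0)" by (intro tendsto_intros)
   then show "((%h::real. \<bar>h\<bar> ^ (m + 1)) \<longlongrightarrow> 0) (at 0)" by simp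
  qed
  then show ?thesis using 3 by (simp add: DERIV_def)
 qed
qed

text \<open>These functions approximate a Gaussian from below and have compact support, so a \<open>C^2\<close> solution can be tested against them
without any growth bound on its derivatives; truncated powers keep enough smoothness for two integrations by parts.\<close>

definition cutoff :: "real => nat => nat => real^3 => real" where
 "cutoff s n m z = (max 0 (1 - s * (norm z)^2 / real (n + 1))) ^ m"

lemma cutoff_cont [continuous_intros]: "continuous_on A (%y. cutoff s n m (y - x))" unfolding cutoff_def by (intro continuous_intros) auto

lemma cutoff_nonneg: "cutoff s n m z >= 0" by (simp add: cutoff_def)

lemma cutoff_le:
 assumes "s > 0"
 shows "cutoff s n (n + 1 + i) z <= gaussian s z"
proof -
 define u where "u = s * (norm z)^2 / real (n + 1)"
 have u: "u >= 0" using assms by (simp add: u_def)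
 have "max 0 (1 - u) <= exp (- u)" using exp_ge_add_one_self[of "- u"] by simp
 then have "(max 0 (1 - u)) ^ (n + 1) <= exp (- u) ^ (n + 1)" by (intro power_mono) auto
 also have "... = gaussian s z" by (simp add: u_def exp_of_nat_mult[symmetric] del: of_nat_add of_nat_Suc power_Suc)
 finally have 1: "(max 0 (1 - u)) ^ (n + 1) <= gaussian s z" .
 have "(max 0 (1 - u)) ^ i <= 1" using u by (intro power_le_one) auto
 then have "(max 0 (1 - u)) ^ (n + 1) * (max 0 (1 - u)) ^ i <= (max 0 (1 - u)) ^ (n + 1) * 1" by (intro mult_left_mono) auto
 then show ?thesis using 1 unfolding cutoff_def u_def[symmetric] power_add[of _ "n + 1" i] by simp
qed

lemma cutoff_tendsto: "(%n. cutoff s n (n + 1 + i) z) ----> gaussian s z"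
proof -
 define t where "t = s * (norm z)^2"
 have "(%n. (1 + (- t) / real n) ^ n) ----> exp (- t)" by (rule tendsto_exp_limit_sequentially)
 then have 1: "(%n. (1 + (- t) / real (n + 1)) ^ (n + 1)) ----> exp (- t)" by (rule LIMSEQ_ignore_initial_segment)
 have "(%n. 1 + (- t) / real (n + 1)) ----> 1" by real_asymp
 then have "(%n. (1 + (- t) / real (n + 1)) ^ i) ----> 1 ^ i" by (rule tendsto_power)
 with 1 have 2: "(%n. (1 + (- t) / real (n + 1)) ^ (n + 1) * (1 + (- t) / real (n + 1)) ^ i) ----> exp (- t) * 1 ^ i" by (rule tendsto_mult)
 obtain N :: nat where N: "t <= real N" using real_arch_simple by blast
 have "\<forall>\<^sub>F n in sequentially. (1 + (- t) / real (n + 1)) ^ (n + 1) * (1 + (- t) / real (n + 1)) ^ i = cutoff s n (n + 1 + i) z"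
  using eventually_ge_at_top[of N]
 proof eventually_elim
  case (elim n)
  then have "t <= real (n + 1)" using N by linarith
  then have "0 <= 1 - t / real (n + 1)" by (simp add: field_simps)
  then have "max 0 (1 - t / real (n + 1)) = 1 + (- t) / real (n + 1)" by simp
  then show ?case unfolding cutoff_def t_def[symmetric] power_add[of _ "n + 1" i] by simp
 qed
 then have "(%n. cutoff s n (n + 1 + i) z) ----> exp (- t) * 1 ^ i" by (rule Lim_transform_eventually[OF 2])
 then show ?thesis by (simp add: t_def)
qed

lemma cutoff_support:
 assumes "s > 0" "real (n + 1) / s + 1 < norm z" "m > 0"
 shows "cutoff s n m z = 0"
proof -
 have a: "real (n + 1) / s > 0" using assms by simp
 have "b <= (b + 1)^2" if "b > 0" for b :: real using that by (simp add: power2_eq_square algebra_simps add_nonneg_nonneg)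
 then have "real (n + 1) / s <= (real (n + 1) / s + 1)^2" using a by blast
 also have "... <= (norm z)^2" using assms a by (intro power_mono) auto
 finally have "1 - s * (norm z)^2 / real (n + 1) <= 0" using assms by (simp add: field_simps)
 then show ?thesis using assms by (simp add: cutoff_def)
qed

lemma norm_sq_along_axis:
 "((%t. (norm (y + t *R axis j 1 - x))^2) has_real_derivative 2 * (y - x) $ j) (at 0)"
proof -
 have eq: "(norm (y + t *R axis j 1 - x))^2 = (norm (y - x))^2 + t * (2 * (y - x) $ j) + t^2" for t
 proof -
  have "y + t *R axis j 1 - x = (y - x) + t *R axis j 1" by simp
  then have "(norm (y + t *R axis j 1 - x))^2 = ((y - x) + t *R axis j 1) \<bullet> ((y - x) + t *R axis j 1)" by (simp only: power2_norm_eq_inner)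
  also have "... = (norm (y - x))^2 + t * (2 * (y - x) $ j) + t^2"
   unfolding power2_norm_eq_inner inner_add_left inner_add_right inner_scaleR_left inner_scaleR_right inner_axis inner_axis'
   by (simp add: power2_eq_square algebra_simps axis_nth)
  finally show ?thesis .
 qed
 show ?thesis unfolding eq by (auto intro!: derivative_eq_intros)
qed

lemma cutoff_along_axis:
 "((%t. cutoff s n (m + 2) (y + t *R axis j 1 - x)) has_real_derivative
   (real (m + 2) / real (n + 1)) * (- 2 * s) * (y - x) $ j * cutoff s n (m + 1) (y - x)) (at 0)"
proof -
 have g: "((%t. 1 - s * (norm (y + t *R axis j 1 - x))^2 / real (n + 1)) has_real_derivative - (s * (2 * (y - x) $ j) / real (n + 1))) (at 0)"
  by (rule derivative_eq_intros norm_sq_along_axis refl | simp)+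
 have "((%t. (max 0 (1 - s * (norm (y + t *R axis j 1 - x))^2 / real (n + 1))) ^ (m + 2)) has_real_derivative
  (real (m + 2) * (max 0 (1 - s * (norm (y + 0 *R axis j 1 - x))^2 / real (n + 1))) ^ (m + 1)) * (- (s * (2 * (y - x) $ j) / real (n + 1)))) (at 0)"
  by (rule DERIV_chain2[OF DERIV_pos_part_power g])
 moreover have "real (m + 2) * M * (- (s * (2 * c) / real (n + 1))) = real (m + 2) / real (n + 1) * (- 2 * s) * c * M" for M c :: real
  by (simp add: mult_ac)
 ultimately show ?thesis unfolding cutoff_def scaleR_zero_left add_0_right by (simp only:)
qed

lemma cutoff_integral_tendsto:
 assumes s: "s > 0" and p: "subgaussian p" and v: "gauss_integrable v" and c: "c ----> (1::real)"
 shows "(%n. \<integral>y. (c n * (p (y - x) * cutoff s n (n + 1 + i) (y - x))) *R v y \<partial>lborel) ----> gauss_transform s p v x"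
proof -
 have vm: "v \<in> borel_measurable borel" and pm: "p \<in> borel_measurable borel" using v p by measurable
 have cm: "(%y. cutoff s n m (y - x)) \<in> borel_measurable borel" for n m
  by (intro borel_measurable_continuous_onI continuous_intros)
 let ?c = "%n y. p (y - x) * cutoff s n (n + 1 + i) (y - x)"
 let ?k = "%y. gaussian s (y - x) * p (y - x)"
 have "(%n. \<integral>y. (?c n y) *R v y \<partial>lborel) ----> (LBINT y. (?k y) *R v y)"
 proof (rule integral_dominated_convergence[where w = "%y. norm ((?k y) *R v y)"])
  show "integrable lborel (%y. norm ((?k y) *R v y))" by (intro integrable_norm gauss_transform_integrable s p v)
  show "AE y in lborel. (%n. (?c n y) *R v y) ----> (?k y) *R v y"
   by (intro AE_I2 tendsto_scaleR tendsto_const) (use tendsto_mult_left[OF cutoff_tendsto] in \<open>simp add: mult.commute\<close>)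
  show "AE y in lborel. norm ((?c n y) *R v y) <= norm ((?k y) *R v y)" for n
  proof (rule AE_I2)
   fix y
   have "\<bar>cutoff s n (n + 1 + i) (y - x)\<bar> * (\<bar>p (y - x)\<bar> * norm (v y)) <= gaussian s (y - x) * (\<bar>p (y - x)\<bar> * norm (v y))"
    using cutoff_le[OF s] by (intro mult_right_mono) (auto simp: cutoff_nonneg)
   then show "norm ((?c n y) *R v y) <= norm ((?k y) *R v y)"
    by (simp add: abs_mult mult_ac)
  qed
  show "(%y. (?k y) *R v y) \<in> borel_measurable lborel"
   by (rule borel_measurable_integrable[OF gauss_transform_integrable[OF s p v]])
  show "(%y. (?c n y) *R v y) \<in> borel_measurable lborel" for n
   using vm pm cm[of n "n + 1 + i"] by measurable
 qed
 then have "(%n. c n *R (LBINT y. (?c n y) *R v y)) ----> 1 *R gauss_transform s p v x"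
  unfolding gauss_transform_def by (intro tendsto_scaleR c)
 then show ?thesis by (simp only: integral_scaleR_right[symmetric] scaleR_scaleR scaleR_one)
qed

lemma C_k2_facts:
 assumes "C_k 2 f"
 shows "f differentiable (at x)" "partial_d j f differentiable (at x)" "continuous_on UNIV (partial_d i (partial_d j f))"
  "continuous_on UNIV f" "continuous_on UNIV (partial_d j f)"
proof -
 have *: "!!x. f differentiable (at x)" "!!j x. partial_d j f differentiable (at x)" "!!i j. continuous_on UNIV (partial_d i (partial_d j f))"
  using assms by (auto simp: numeral_2_eq_2)
 show "f differentiable (at x)" "partial_d j f differentiable (at x)" "continuous_on UNIV (partial_d i (partial_d j f))"
  "continuous_on UNIV f" "continuous_on UNIV (partial_d j f)"
  using * differentiable_imp_cont[of f] differentiable_imp_cont[of "partial_d j f"] by auto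
qed

lemma cutoff_second_derivative:
 fixes f :: "real^3 => complex"
 assumes f: "C_k 2 f" and s: "s > 0"
 shows "(LBINT y. cutoff s n (n + 3) (y - x) *R partial_d i (partial_d j f) y)
  = (LBINT y. ((real (n + 3) / real (n + 1)) * (real (n + 2) / real (n + 1)) * (4 * s^2 * (y - x) $ i * (y - x) $ j * cutoff s n (n + 1) (y - x))
    - (real (n + 3) / real (n + 1)) * (2 * s * (if i = j then 1 else 0) * cutoff s n (n + 2) (y - x))) *R f y)"
proof -
 note F = C_k2_facts[OF f]
 define R where "R = real (n + 1) / s + 1"
 define ph1 where "ph1 y = (real (n + 3) / real (n + 1)) * (- 2 * s) * (y - x) $ i * cutoff s n (n + 2) (y - x)" for y
 define ph2 where "ph2 y = (real (n + 3) / real (n + 1)) * (real (n + 2) / real (n + 1)) * (4 * s^2 * (y - x) $ i * (y - x) $ j * cutoff s n (n + 1) (y - x))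
    - (real (n + 3) / real (n + 1)) * (2 * s * (if i = j then 1 else 0) * cutoff s n (n + 2) (y - x))" for y
 have supp: "cutoff s n m (y - x) = 0" if "R < norm (y - x)" "m > 0" for y m
  using cutoff_support[OF s] that unfolding R_def by blast
 have "(LBINT y. cutoff s n (n + 3) (y - x) *R partial_d i (partial_d j f) y) = - (LBINT y. ph1 y *R partial_d j f y)"
 proof (rule integration_by_parts_compact[where R = R and c = x])
  show "((%t. cutoff s n (n + 3) (y + t *R axis i 1 - x)) has_real_derivative ph1 y) (at 0)" for y
  proof -
   have e: "n + 1 + 2 = n + 3" "n + 1 + 1 = n + 2" by auto
   show ?thesis using cutoff_along_axis[of s n "n + 1" y i x] unfolding e ph1_def .
  qed
  show "continuous_on UNIV ph1" unfolding ph1_def by (intro continuous_intros)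
 qed (use supp in \<open>auto simp: ph1_def intro!: continuous_intros F\<close>)
 also have "(LBINT y. ph1 y *R partial_d j f y) = - (LBINT y. ph2 y *R f y)"
 proof (rule integration_by_parts_compact[where R = R and c = x])
  fix y
  have c: "((%t. cutoff s n (n + 2) (y + t *R axis j 1 - x)) has_real_derivative (real (n + 2) / real (n + 1)) * (- 2 * s) * (y - x) $ j * cutoff s n (n + 1) (y - x)) (at 0)"
   by (rule cutoff_along_axis)
  have z: "((%t. (y + t *R axis j 1 - x) $ i) has_real_derivative (if i = j then 1 else 0)) (at 0)"
   by (auto intro!: derivative_eq_intros simp: axis_def)
  have "((%t. (real (n + 3) / real (n + 1)) * (- 2 * s) * ((y + t *R axis j 1 - x) $ i * cutoff s n (n + 2) (y + t *R axis j 1 - x))) has_real_derivative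
    (real (n + 3) / real (n + 1)) * (- 2 * s) * ((if i = j then 1 else 0) * cutoff s n (n + 2) (y + 0 *R axis j 1 - x) + ((real (n + 2) / real (n + 1)) * (- 2 * s) * (y - x) $ j * cutoff s n (n + 1) (y - x)) * (y + 0 *R axis j 1 - x) $ i)) (at 0)"
   by (intro DERIV_cmult DERIV_mult z c)
  moreover have "(real (n + 3) / real (n + 1)) * (- 2 * s) * ((if i = j then 1 else 0) * cutoff s n (n + 2) (y + 0 *R axis j 1 - x) + ((real (n + 2) / real (n + 1)) * (- 2 * s) * (y - x) $ j * cutoff s n (n + 1) (y - x)) * (y + 0 *R axis j 1 - x) $ i) = ph2 y"
  proof -
   have "A * (- 2 * s) * (d * C2 + (B * (- 2 * s) * zj * C1) * zi) = A * B * (4 * s^2 * zi * zj * C1) - A * (2 * s * d * C2)" for A B C1 C2 d zi zj :: real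
    by (simp add: algebra_simps power2_eq_square)
   then show ?thesis unfolding ph2_def scaleR_zero_left add_0_right by blast
  qed
  ultimately show "((%t. ph1 (y + t *R axis j 1)) has_real_derivative ph2 y) (at 0)" unfolding ph1_def by (simp only: mult.assoc)
 next
  show "continuous_on UNIV ph1" "continuous_on UNIV ph2" unfolding ph1_def ph2_def by (intro continuous_intros)+
 qed (use supp F in \<open>auto simp: ph1_def ph2_def\<close>)
 finally show ?thesis by (simp add: ph2_def)
qed

text \<open>In the limit two integrations by parts fall on the Gaussian, although the second derivatives of \<open>f\<close> may fail to be integrable
against it.\<close>

lemma weak_second_derivative:
 assumes f: "C_k 2 f" "gauss_integrable f" and s: "s > 0"
 shows "(%n. \<integral>y. cutoff s n (n + 3) (y - x) *R partial_d i (partial_d j f) y \<partial>lborel)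
  ----> gauss_transform s (%z. 4 * s^2 * z $ i * z $ j - 2 * s * (if i = j then 1 else 0)) f x"
proof -
 define p q where "p z = 4 * s^2 * z $ i * z $ j" and "q z = 2 * s * (if i = j then 1 else 0 :: real)" for z :: "real^3"
 have p: "subgaussian p" "subgaussian q" unfolding p_def q_def by (intro subgaussian_intros)+
 define a b where "a n = (real (n + 3) / real (n + 1)) * (real (n + 2) / real (n + 1))" and "b n = real (n + 3) / real (n + 1)" for n :: nat
 have a: "a ----> 1" "b ----> 1" unfolding a_def b_def by real_asymp+
 have i1: "integrable lborel (%y. (a n * (p (y - x) * cutoff s n (n + 1 + 0) (y - x))) *R f y)"
  and i2: "integrable lborel (%y. (b n * (q (y - x) * cutoff s n (n + 1 + 1) (y - x))) *R f y)" for n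
  unfolding p_def q_def by (rule integrable_compact_support[where R = "real (n + 1) / s + 1" and c = x], intro continuous_intros C_k2_facts[OF f(1)],
    use cutoff_support[OF s] in simp)+
 have "(%n. (LBINT y. (a n * (p (y - x) * cutoff s n (n + 1 + 0) (y - x))) *R f y) - (LBINT y. (b n * (q (y - x) * cutoff s n (n + 1 + 1) (y - x))) *R f y))
   ----> gauss_transform s p f x - gauss_transform s q f x" by (intro tendsto_diff cutoff_integral_tendsto s p f(2) a)
 moreover have "(LBINT y. (a n * (p (y - x) * cutoff s n (n + 1 + 0) (y - x))) *R f y) - (LBINT y. (b n * (q (y - x) * cutoff s n (n + 1 + 1) (y - x))) *R f y)
   = (LBINT y. cutoff s n (n + 3) (y - x) *R partial_d i (partial_d j f) y)" for n
  unfolding cutoff_second_derivative[OF f(1) s] Bintegral_diff[OF i1 i2, symmetric]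
  by (intro Bintegral_cong refl) (simp add: p_def q_def a_def b_def scaleR_diff_left)
 moreover have "gauss_transform s p f x - gauss_transform s q f x = gauss_transform s (%z. 4 * s^2 * z $ i * z $ j - 2 * s * (if i = j then 1 else 0)) f x"
  using gauss_transform_linear[OF s p f(2), of 1 "-1" x] by (simp add: p_def q_def)
 ultimately show ?thesis by simp
qed

lemma weak_value:
 assumes f: "gauss_integrable f" and s: "s > 0"
 shows "(%n. \<integral>y. cutoff s n (n + 3) (y - x) *R f y \<partial>lborel) ----> gauss_conv s f x"
 using cutoff_integral_tendsto[OF s subgaussian_const[of 1] f tendsto_const, where i = 2 and x = x] by (simp add: numeral_3_eq_3 numeral_2_eq_2)

lemma weak_equation:
 fixes v :: "3 => real^3 => complex" and a :: "3 => 3 => 3 => real" and b :: "3 => real"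
 assumes v: "!!l. C_k 2 (v l)" "!!l. gauss_integrable (v l)" and s: "s > 0"
  and eq: "!!y. (SUM l:UNIV. (SUM i:UNIV. SUM j:UNIV. a l i j *R partial_d i (partial_d j (v l)) y) + b l *R v l y) = 0"
 shows "(SUM l:UNIV. (SUM i:UNIV. SUM j:UNIV. a l i j *R gauss_transform s (%z. 4 * s^2 * z $ i * z $ j - 2 * s * (if i = j then 1 else 0)) (v l) x)
   + b l *R gauss_conv s (v l) x) = 0" (is "?L = 0")
proof -
 let ?c = "%n y. cutoff s n (n + 3) (y - x)"
 have i1: "integrable lborel (%y. ?c n y *R partial_d i (partial_d j (v l)) y)"
  and i2: "integrable lborel (%y. ?c n y *R v l y)" for n i j l
  by (rule integrable_compact_support[where R = "real (n + 1) / s + 1" and c = x], intro continuous_intros C_k2_facts[OF v(1)],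
    use cutoff_support[OF s] in simp)+
 have "(%n. SUM l:UNIV. (SUM i:UNIV. SUM j:UNIV. a l i j *R (LBINT y. ?c n y *R partial_d i (partial_d j (v l)) y)) + b l *R (LBINT y. ?c n y *R v l y)) ----> ?L"
  by (intro tendsto_sum tendsto_add tendsto_scaleR tendsto_const weak_second_derivative weak_value v s)
 moreover have "(SUM l:UNIV. (SUM i:UNIV. SUM j:UNIV. a l i j *R (LBINT y. ?c n y *R partial_d i (partial_d j (v l)) y)) + b l *R (LBINT y. ?c n y *R v l y)) = 0" for n
 proof -
  have "(SUM l:UNIV. (SUM i:UNIV. SUM j:UNIV. a l i j *R (LBINT y. ?c n y *R partial_d i (partial_d j (v l)) y)) + b l *R (LBINT y. ?c n y *R v l y))
   = (SUM l:UNIV. (SUM i:UNIV. SUM j:UNIV. (LBINT y. a l i j *R (?c n y *R partial_d i (partial_d j (v l)) y))) + (LBINT y. b l *R (?c n y *R v l y)))"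
   by (simp only: integral_scaleR_right)
  also have "... = (LBINT y. (SUM l:UNIV. (SUM i:UNIV. SUM j:UNIV. a l i j *R (?c n y *R partial_d i (partial_d j (v l)) y)) + b l *R (?c n y *R v l y)))"
   by (simp only: Bintegral_sum Bintegral_add Bintegrable_sum Bintegrable_add integrable_scaleR_right i1 i2)
  also have "... = (LBINT y. ?c n y *R (SUM l:UNIV. (SUM i:UNIV. SUM j:UNIV. a l i j *R partial_d i (partial_d j (v l)) y) + b l *R v l y))"
   by (simp only: scaleR_sum_right scaleR_add_right scaleR_left_commute)
  also have "... = 0" by (simp only: eq) simp
  finally show ?thesis .
 qed
 ultimately have "(%n. 0) ----> ?L" by simp
 then show ?thesis using LIMSEQ_unique tendsto_const by blast
qed

lemma cutoff_rotation:
 fixes f :: "real^3 => complex"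
 assumes f: "C_k 2 f" and s: "s > 0"
 shows "(LBINT y. cutoff s n (n + 2) (y - x) *R (y $ i *R partial_d j f y - y $ j *R partial_d i f y))
  = (LBINT y. (real (n + 2) / real (n + 1) * ((x $ i * (2 * s * (y - x) $ j) - x $ j * (2 * s * (y - x) $ i)) * cutoff s n (n + 1 + 0) (y - x))) *R f y)"
proof -
 note F = C_k2_facts[OF f]
 define R where "R = real (n + 1) / s + 1"
 have supp: "cutoff s n m (y - x) = 0" if "R < norm (y - x)" "m > 0" for y m
  using cutoff_support[OF s] that unfolding R_def by blast
 define C where "C y = cutoff s n (n + 2) (y - x)" for y
 define D where "D j y = (real (n + 2) / real (n + 1)) * (- 2 * s) * (y - x) $ j * cutoff s n (n + 1) (y - x)" for j y
 have C': "((%t. C (y + t *R axis j 1)) has_real_derivative D j y) (at 0)" for y j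
  unfolding C_def D_def by (rule cutoff_along_axis)
 have cont: "continuous_on UNIV C" "continuous_on UNIV (D j)" for j unfolding C_def D_def by (intro continuous_intros)+
 have ibp: "(LBINT y. (y $ i * C y) *R partial_d j f y) = - (LBINT y. ((if i = j then 1 else 0) * C y + y $ i * D j y) *R f y)" for i j
 proof (rule integration_by_parts_compact[where R = R and c = x])
  fix y
  have z: "((%t. (y + t *R axis j 1) $ i) has_real_derivative (if i = j then 1 else 0)) (at 0)" by (auto intro!: derivative_eq_intros simp: axis_def)
  show "((%t. (y + t *R axis j 1) $ i * C (y + t *R axis j 1)) has_real_derivative (if i = j then 1 else 0) * C y + y $ i * D j y) (at 0)"
   using DERIV_mult[OF z C'[of y j]] by (simp add: mult.commute)
 qed (use supp in \<open>auto simp: C_def D_def intro!: continuous_intros cont[unfolded C_def D_def] F\<close>)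
 have int: "integrable lborel (%y. (y $ i * C y) *R partial_d j f y)" "integrable lborel (%y. ((if i = j then 1 else 0) * C y + y $ i * D j y) *R f y)" for i j
  by (rule integrable_compact_support[where R = R and c = x], intro continuous_intros cont F, use supp in \<open>simp add: C_def D_def\<close>)+
 have "(LBINT y. cutoff s n (n + 2) (y - x) *R (y $ i *R partial_d j f y - y $ j *R partial_d i f y))
   = (LBINT y. (y $ i * C y) *R partial_d j f y - (y $ j * C y) *R partial_d i f y)"
  by (intro Bintegral_cong refl) (simp add: C_def scaleR_diff_right mult.commute)
 also have "... = (LBINT y. ((if j = i then 1 else 0) * C y + y $ j * D i y) *R f y) - (LBINT y. ((if i = j then 1 else 0) * C y + y $ i * D j y) *R f y)"
  unfolding Bintegral_diff[OF int(1) int(1)] ibp by simp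
 also have "... = (LBINT y. ((if j = i then 1 else 0) * C y + y $ j * D i y) *R f y - ((if i = j then 1 else 0) * C y + y $ i * D j y) *R f y)"
  by (rule Bintegral_diff[OF int(2) int(2), symmetric])
 also have "... = (LBINT y. (real (n + 2) / real (n + 1) * ((x $ i * (2 * s * (y - x) $ j) - x $ j * (2 * s * (y - x) $ i)) * cutoff s n (n + 1 + 0) (y - x))) *R f y)"
 proof (intro Bintegral_cong refl)
  fix y
  have alg: "(d * c + yj * (A * (- 2 * s) * (yi - xi) * k)) - (d * c + yi * (A * (- 2 * s) * (yj - xj) * k)) = A * ((xi * (2 * s * (yj - xj)) - xj * (2 * s * (yi - xi))) * k)"
   for d c yi yj xi xj A k :: real by (simp add: algebra_simps)
  show "((if j = i then 1 else 0) * C y + y $ j * D i y) *R f y - ((if i = j then 1 else 0) * C y + y $ i * D j y) *R f y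
   = (real (n + 2) / real (n + 1) * ((x $ i * (2 * s * (y - x) $ j) - x $ j * (2 * s * (y - x) $ i)) * cutoff s n (n + 1 + 0) (y - x))) *R f y"
   unfolding D_def scaleR_diff_left[symmetric] eq_commute[of j i] vector_minus_component alg by simp
 qed
 finally show ?thesis .
qed

text \<open>Gaussian convolution commutes with rotation fields, because the Gaussian is radial. The convolution of the rotated
function is formed first for cutoffs, since the partial derivatives alone have no growth bound.\<close>

lemma gauss_transform_rotation:
 assumes f: "C_k 2 f" "gauss_integrable f" and s: "s > 0"
  and L: "gauss_integrable (%y. y $ i *R partial_d j f y - y $ j *R partial_d i f y)"
 shows "gauss_conv s (%y. y $ i *R partial_d j f y - y $ j *R partial_d i f y) x
  = x $ i *R gauss_transform s (%z. 2 * s * z $ j) f x - x $ j *R gauss_transform s (%z. 2 * s * z $ i) f x"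
proof -
 have sg: "subgaussian (%z. 2 * s * z $ l)" for l by (intro subgaussian_intros)
 have p: "subgaussian (%z. x $ i * (2 * s * z $ j) - x $ j * (2 * s * z $ i))" by (intro subgaussian_intros)
 have c: "(%n. real (n + 2) / real (n + 1)) ----> 1" by real_asymp
 have "(%n. \<integral>y. (1 * (1 * cutoff s n (n + 1 + 1) (y - x))) *R (y $ i *R partial_d j f y - y $ j *R partial_d i f y) \<partial>lborel)
   ----> gauss_conv s (%y. y $ i *R partial_d j f y - y $ j *R partial_d i f y) x"
  by (rule cutoff_integral_tendsto[OF s subgaussian_const L tendsto_const])
 moreover have "(%n. \<integral>y. (1 * (1 * cutoff s n (n + 1 + 1) (y - x))) *R (y $ i *R partial_d j f y - y $ j *R partial_d i f y) \<partial>lborel)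
   ----> gauss_transform s (%z. x $ i * (2 * s * z $ j) - x $ j * (2 * s * z $ i)) f x"
  using cutoff_integral_tendsto[OF s p f(2) c, of x 0] cutoff_rotation[OF f(1) s, of _ x i j] by (simp add: numeral_2_eq_2)
 ultimately have "gauss_conv s (%y. y $ i *R partial_d j f y - y $ j *R partial_d i f y) x = gauss_transform s (%z. x $ i * (2 * s * z $ j) - x $ j * (2 * s * z $ i)) f x"
  by (rule LIMSEQ_unique)
 also have "... = x $ i *R gauss_transform s (%z. 2 * s * z $ j) f x - x $ j *R gauss_transform s (%z. 2 * s * z $ i) f x"
  using gauss_transform_linear[OF s sg sg f(2), of "x $ i" j "- x $ j" i x] by simp
 finally show ?thesis .
qed

section \<open>Separation of two wave numbers by the Gaussian transform\<close>

definition gauss_factor :: "real => real => real" where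
 "gauss_factor k s = sqrt (pi / s) ^ 3 * exp (- (k^2 / (4 * s)))"

lemma gauss_factor_pos: "s > 0 ==> gauss_factor k s > 0" by (simp add: gauss_factor_def)

lemma gauss_factor_has_derivative:
 assumes s: "s > 0"
 shows "(gauss_factor k has_real_derivative gauss_factor k s * (k^2 / (4 * s^2) - 3 / (2 * s))) (at s)"
proof -
 define r where "r = sqrt (pi / s)"
 have r: "r > 0" "pi / s = r * r" using s by (auto simp: r_def)
 have "((%s. pi / s) has_real_derivative - (pi / (s * s))) (at s)" using s by (auto intro!: derivative_eq_intros)
 then have "((%s. sqrt (pi / s)) has_real_derivative inverse (sqrt (pi / s)) / 2 * - (pi / (s * s))) (at s)"
  using s by (intro DERIV_chain2[OF DERIV_real_sqrt]) auto
 moreover have "inverse (sqrt (pi / s)) / 2 * - (pi / (s * s)) = r * (- 1 / (2 * s))"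
 proof -
  have "pi / (s * s) = r * r / s" using r(2) s by (simp add: field_simps)
  then show ?thesis using r s unfolding r_def[symmetric] by (simp add: field_simps)
 qed
 ultimately have d1: "((%s. sqrt (pi / s)) has_real_derivative r * (- 1 / (2 * s))) (at s)" by simp
 have d2: "((%s. exp (- (k^2 / (4 * s)))) has_real_derivative exp (- (k^2 / (4 * s))) * (k^2 / (4 * s^2))) (at s)"
  using s by (auto intro!: derivative_eq_intros simp: power2_eq_square)
 have "real 3 * (r * (- 1 / (2 * s)) * r ^ (3 - Suc 0)) * e + e * c * r ^ 3 = r ^ 3 * e * (c - 3 / (2 * s))" for e c
  by (simp add: algebra_simps power3_eq_cube power2_eq_square)
 note alg = this
 have "((%s. sqrt (pi / s) ^ 3 * exp (- (k^2 / (4 * s)))) has_real_derivative r ^ 3 * exp (- (k^2 / (4 * s))) * (k^2 / (4 * s^2) - 3 / (2 * s))) (at s)"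
  using DERIV_mult[OF DERIV_power[OF d1, of 3] d2] unfolding r_def[symmetric] alg .
 moreover have "gauss_factor k = (%s. sqrt (pi / s) ^ 3 * exp (- (k^2 / (4 * s))))" by (simp add: fun_eq_iff gauss_factor_def)
 ultimately show ?thesis by (simp add: r_def)
qed

text \<open>Uniqueness for the equation in \<open>s\<close> that the convolution of a Helmholtz solution obeys.\<close>

lemma gauss_factor_ode:
 fixes f :: "real => complex"
 assumes f: "!!s. s > 0 ==> (f has_vector_derivative (k^2 / (4 * s^2) - 3 / (2 * s)) *R f s) (at s)" and s: "s > 0"
 shows "f s = gauss_factor k s *R ((1 / gauss_factor k 1) *R f 1)"
proof -
 have "((%s. inverse (gauss_factor k s) *R f s) has_vector_derivative 0) (at s within {0<..})" if "s \<in> {0<..}" for s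
 proof -
  have s: "s > 0" using that by simp
  let ?c = "k^2 / (4 * s^2) - 3 / (2 * s)"
  have w: "gauss_factor k s ~= 0" using gauss_factor_pos[OF s, of k] by simp
  have "((%s. inverse (gauss_factor k s)) has_real_derivative - (inverse (gauss_factor k s) * (gauss_factor k s * ?c) * inverse (gauss_factor k s))) (at s)"
   by (rule DERIV_inverse_fun[OF gauss_factor_has_derivative[OF s] w, THEN DERIV_cong]) (use w in \<open>simp add: field_simps power2_eq_square\<close>)
  moreover have "- (inverse (gauss_factor k s) * (gauss_factor k s * ?c) * inverse (gauss_factor k s)) = - (?c * inverse (gauss_factor k s))"
   using w by simp
  ultimately have "((%s. inverse (gauss_factor k s)) has_real_derivative - (?c * inverse (gauss_factor k s))) (at s)" by simp
  then have "((%s. inverse (gauss_factor k s) *R f s) has_vector_derivative inverse (gauss_factor k s) *R (?c *R f s) + (- (?c * inverse (gauss_factor k s))) *R f s) (at s)"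
   by (rule has_vector_derivative_scaleR[OF _ f[OF s]])
  moreover have "inverse (gauss_factor k s) *R (?c *R f s) + (- (?c * inverse (gauss_factor k s))) *R f s = 0"
   by (simp only: scaleR_scaleR scaleR_add_left[symmetric] mult.commute[of "inverse (gauss_factor k s)" ?c] add.right_inverse scaleR_zero_left)
  ultimately have "((%s. inverse (gauss_factor k s) *R f s) has_vector_derivative 0) (at s)" by (simp only:)
  then show ?thesis by (rule has_vector_derivative_at_within)
 qed
 then obtain c where c: "!!s. s \<in> {0<..} ==> inverse (gauss_factor k s) *R f s = c"
  using has_vector_derivative_zero_constant[of "{0<..}" "%s. inverse (gauss_factor k s) *R f s"] by (auto simp: convex_real_interval)
 have "inverse (gauss_factor k s) *R f s = inverse (gauss_factor k 1) *R f 1" using c[of s] c[of 1] s by simp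
 then have "gauss_factor k s *R (inverse (gauss_factor k s) *R f s) = gauss_factor k s *R (inverse (gauss_factor k 1) *R f 1)" by simp
 then show ?thesis using gauss_factor_pos[OF s, of k] by (simp add: divide_inverse)
qed

lemma gauss_factor_limit: "((%s. 1 / sqrt (pi / s) ^ 3 * gauss_factor k s) \<longlongrightarrow> 1) at_top"
proof -
 have "((%s. exp (- (k^2 / (4 * s)))) \<longlongrightarrow> 1) at_top" by real_asymp
 moreover have "\<forall>\<^sub>F s in at_top. exp (- (k^2 / (4 * s))) = 1 / sqrt (pi / s) ^ 3 * gauss_factor k s"
  using eventually_gt_at_top[of 0] by eventually_elim (simp add: gauss_factor_def)
 ultimately show ?thesis by (rule Lim_transform_eventually)
qed

lemma gauss_factor_semigroup:
 assumes "s > 0" "t > 0"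
 shows "sqrt (pi / (s + t)) ^ 3 * gauss_factor k (s * t / (s + t)) = gauss_factor k s * gauss_factor k t"
proof -
 have "sqrt (pi / (s + t)) * sqrt (pi / (s * t / (s + t))) = sqrt (pi / s) * sqrt (pi / t)"
 proof -
  have "s + t ~= 0" using assms by simp
  then have "pi / (s + t) * (pi / (s * t / (s + t))) = pi / s * (pi / t)" using assms by (simp add: divide_simps)
  then show ?thesis by (simp only: real_sqrt_mult[symmetric])
 qed
 then have "sqrt (pi / (s + t)) ^ 3 * sqrt (pi / (s * t / (s + t))) ^ 3 = sqrt (pi / s) ^ 3 * sqrt (pi / t) ^ 3"
  by (simp only: power_mult_distrib[symmetric])
 moreover have "exp (- (k^2 / (4 * (s * t / (s + t))))) = exp (- (k^2 / (4 * s))) * exp (- (k^2 / (4 * t)))"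
 proof -
  have "- (k^2 / (4 * (s * t / (s + t)))) = - (k^2 / (4 * s)) + - (k^2 / (4 * t))" using assms by (simp add: field_simps)
  then show ?thesis by (simp only: exp_add)
 qed
 moreover have "a * (b * e) = c * e1 * (d * e2)" if "a * b = c * d" "e = e1 * e2" for a b c d e e1 e2 :: real
  using arg_cong[OF that(1), of "%u. u * (e1 * e2)"] by (simp add: that(2) mult_ac)
 ultimately show ?thesis unfolding gauss_factor_def by blast
qed

text \<open>For different wave numbers the vectors of factors at \<open>s = 1\<close> and \<open>s = 2\<close> are linearly independent.\<close>

lemma two_scale_solve:
 assumes "p^2 ~= q\<^sup>2"
 obtains \<alpha> \<beta> where "\<alpha> * gauss_factor p 1 + \<beta> * gauss_factor p 2 = 1" "\<alpha> * gauss_factor q 1 + \<beta> * gauss_factor q 2 = 0"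
proof -
 have "gauss_factor k 1 * gauss_factor l 2 = sqrt pi ^ 3 * sqrt (pi / 2) ^ 3 * exp (- (k^2 / 4) - l^2 / 8)" for k l
 proof -
  have "- (k^2 / 4) - l^2 / 8 = - (k^2 / (4 * 1)) + - (l^2 / (4 * 2))" by simp
  then have "exp (- (k^2 / 4) - l^2 / 8) = exp (- (k^2 / (4 * 1))) * exp (- (l^2 / (4 * 2)))" by (simp only: exp_add)
  then show ?thesis by (simp add: gauss_factor_def mult_ac)
 qed
 moreover have "- (p^2 / 4) - q^2 / 8 ~= - (q^2 / 4) - p^2 / 8" using assms by (simp add: field_simps)
 ultimately have d: "gauss_factor p 1 * gauss_factor q 2 - gauss_factor q 1 * gauss_factor p 2 ~= 0" (is "?d ~= 0") by simp
 show ?thesis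
 proof (rule that[of "gauss_factor q 2 / ?d" "- gauss_factor q 1 / ?d"])
  show "gauss_factor q 2 / ?d * gauss_factor p 1 + - gauss_factor q 1 / ?d * gauss_factor p 2 = 1" using d
   by (simp add: divide_simps) (simp add: algebra_simps)?
  show "gauss_factor q 2 / ?d * gauss_factor q 1 + - gauss_factor q 1 / ?d * gauss_factor q 2 = 0" by (simp add: mult.commute)
 qed
qed

lemma complete_square:
 fixes y z :: "'a::real_inner"
 assumes "a + t ~= 0"
 shows "a * (norm y)^2 + t * (norm (z - y))^2 = (a + t) * (norm (y - (t / (a + t)) *R z))^2 + a * t / (a + t) * (norm z)^2"
proof -
 have alg: "a * Y + t * (Z - 2 * W + Y) = (a + t) * (Y - 2 * (t / (a + t)) * W + (t / (a + t))^2 * Z) + a * t / (a + t) * Z" for Y Z W :: real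
  using assms by (simp add: divide_simps power2_eq_square) algebra
 have e1: "(norm (z - y))^2 = z \<bullet> z - 2 * (y \<bullet> z) + y \<bullet> y"
  by (simp add: power2_norm_eq_inner inner_diff_left inner_diff_right inner_commute[of z y])
 have e2: "(norm (y - c *R z))^2 = y \<bullet> y - 2 * c * (y \<bullet> z) + c^2 * (z \<bullet> z)" for c
  unfolding power2_norm_eq_inner inner_diff_left inner_diff_right inner_scaleR_left inner_scaleR_right inner_commute[of z y]
  by (simp add: power2_eq_square algebra_simps)
 show ?thesis unfolding e1 e2 power2_norm_eq_inner[of y] power2_norm_eq_inner[of z] by (rule alg)
qed

text \<open>Parameters add as \<open>1 / s\<close>, the variance. Fubini is applied after half of the first Gaussian has been set
aside as an integrable factor and the rest of the exponent has been completed to a square.\<close>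

lemma gauss_transform_semigroup:
 assumes s: "s > 0" and t: "t > 0" and f: "gauss_integrable f"
 shows "gauss_conv s (gauss_conv t f) x = sqrt (pi / (s + t)) ^ 3 *R gauss_transform (s * t / (s + t)) (%_. 1) f x"
proof -
 \<comment> \<open>The minimum over y of s/2 |y - x|^2 + t |z - y|^2 is r |z - x|^2, so the kernel K is bounded by 1.\<close>
 define r where "r = s / 2 * t / (s / 2 + t)"
 have r: "r > 0" using s t by (simp add: r_def)
 define K where "K y z = cor (exp (- (s / 2) * (norm (y - x))^2 - t * (norm (z - y))^2 + r * (norm (z - x))^2))" for y z
 define F where "F y = cor (gaussian (s / 2) (y - x))" for y
 define g where "g z = cor (gaussian r (z - x)) * f z" for z
 have sq: "a * (norm (y - x))^2 + t * (norm (z - y))^2 = (a + t) * (norm (y - (x + (t / (a + t)) *R (z - x))))^2 + a * t / (a + t) * (norm (z - x))^2" if "a > 0" for a and y z :: "real^3"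
  using complete_square[of a t "y - x" "z - x"] that t by (simp add: algebra_simps)
 have "(LBINT y. F y * (LBINT z. K y z * g z)) = (LBINT z. g z * (LBINT y. K y z * F y))"
 proof (rule Fubini_bounded_kernel)
  show "integrable lborel F" unfolding F_def using gaussian_fourier_shifted(1)[of "s / 2" x] s by simp
  show "integrable lborel g" unfolding g_def using gauss_transform_integrable[OF r subgaussian_const[of 1] f, of x] by (simp add: scaleR_conv_of_real)
  show "(%(y, z). K y z) \<in> borel_measurable (lborel \<Otimes>\<^sub>M lborel)" unfolding K_def by measurable
  show "norm (K y z) <= 1" for y z
  proof -
   have "r * (norm (z - x))^2 <= s / 2 * (norm (y - x))^2 + t * (norm (z - y))^2" using sq[of "s / 2" y z] s t by (simp add: r_def)
   then show ?thesis unfolding K_def by (simp add: norm_of_real)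
  qed
 qed (rule sigma_finite_lborel)+
 moreover have "(LBINT y. F y * (LBINT z. K y z * g z)) = gauss_conv s (gauss_conv t f) x" unfolding gauss_transform_def
 proof (intro Bintegral_cong refl)
  fix y
  have "F y * (K y z * g z) = cor (gaussian s (y - x)) * ((gaussian t (z - y) * 1) *R f z)" for z
  proof -
   have "exp (- (s / 2) * A) * (exp (- (s / 2) * A - B + C) * exp (- C)) = exp (- s * A) * exp (- B)" for A B C :: real
    by (simp add: exp_add[symmetric] exp_diff[symmetric])
   from this[of "(norm (y - x))^2" "t * (norm (z - y))^2" "r * (norm (z - x))^2"]
   have "cor (gaussian (s / 2) (y - x)) * (cor (exp (- (s / 2) * (norm (y - x))^2 - t * (norm (z - y))^2 + r * (norm (z - x))^2)) * cor (gaussian r (z - x)))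
     = cor (gaussian s (y - x)) * cor (gaussian t (z - y))" by (simp only: of_real_mult[symmetric] minus_mult_left)
   then show ?thesis unfolding F_def K_def g_def by (simp add: scaleR_conv_of_real mult.assoc[symmetric])
  qed
  then show "F y * (LBINT z. K y z * g z) = (gaussian s (y - x) * 1) *R (LBINT z. (gaussian t (z - y) * 1) *R f z)"
   by (simp only: integral_mult_right_zero[symmetric]) (simp only: integral_mult_right_zero scaleR_conv_of_real mult_1_right)
 qed
 moreover have "(LBINT z. g z * (LBINT y. K y z * F y)) = sqrt (pi / (s + t)) ^ 3 *R gauss_transform (s * t / (s + t)) (%_. 1) f x"
  unfolding gauss_transform_def integral_scaleR_right[symmetric]
 proof (intro Bintegral_cong refl)
  fix z
  define c where "c = x + (t / (s + t)) *R (z - x)"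
  have "K y z * F y = cor (exp ((r - s * t / (s + t)) * (norm (z - x))^2)) * cor (gaussian (s + t) (y - c))" for y
  proof -
   have "exp (- (s / 2) * A - B + C) * exp (- (s / 2) * A) = exp (- (s * A + B) + C)" for A B C :: real by (simp add: exp_add[symmetric])
   from this[of "(norm (y - x))^2" "t * (norm (z - y))^2"] have "K y z * F y = cor (exp (- (s * (norm (y - x))^2 + t * (norm (z - y))^2) + r * (norm (z - x))^2))"
    unfolding K_def F_def of_real_mult[symmetric] by simp
   also have "... = cor (exp ((r - s * t / (s + t)) * (norm (z - x))^2) * gaussian (s + t) (y - c))"
    unfolding sq[OF s] c_def[symmetric] exp_add[symmetric] by (simp add: algebra_simps)
   finally show ?thesis by simp
  qed
  then have "(LBINT y. K y z * F y) = cor (exp ((r - s * t / (s + t)) * (norm (z - x))^2)) * (LBINT y. cor (gaussian (s + t) (y - c)))"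
   by (simp only: integral_mult_right_zero)
  also have "(LBINT y. cor (gaussian (s + t) (y - c))) = cor (sqrt (pi / (s + t)) ^ 3)" using gaussian_fourier_shifted(2)[of "s + t" 0 c] s t by simp
  finally have K: "(LBINT y. K y z * F y) = cor (exp ((r - s * t / (s + t)) * (norm (z - x))^2)) * cor (sqrt (pi / (s + t)) ^ 3)" .
  have "exp (- r * A) * exp ((r - s * t / (s + t)) * A) = exp (- (s * t / (s + t)) * A)" for A
   by (simp add: exp_add[symmetric] algebra_simps)
  then have e: "cor (gaussian r (z - x)) * cor (exp ((r - s * t / (s + t)) * (norm (z - x))^2)) = cor (gaussian (s * t / (s + t)) (z - x))"
   by (simp only: of_real_mult[symmetric])
  have alg: "A * f * (B * S) = S * (C * f)" if "A * B = C" for A B C S f :: complex unfolding that[symmetric] by (simp add: mult_ac)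
  from e show "g z * (LBINT y. K y z * F y) = sqrt (pi / (s + t)) ^ 3 *R (gaussian (s * t / (s + t)) (z - x) * 1) *R f z"
   unfolding K g_def scaleR_conv_of_real mult_1_right by (rule alg)
 qed
 ultimately show ?thesis by simp
qed

section \<open>The Gaussian transform on the weighted space\<close>

definition weighted_sq :: "(real^3 => complex) => ennreal" where
 "weighted_sq h = (NN x. ennreal ((norm (h x))^2 / bracket3 x))"

lemma subgaussian_bracket: "subgaussian japanese_bracket"
proof (rule subgaussian_bound[where K = 1])
 show "subgaussian (%x. 1 + norm x)" by (intro subgaussian_intros)
 show "continuous_on UNIV japanese_bracket" unfolding japanese_bracket_def by (intro continuous_intros)
 have "sqrt (1 + r^2) <= 1 + r" if "r >= 0" for r :: real using that by (intro real_le_lsqrt) (auto simp: power2_sum)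
 then show "norm (japanese_bracket x) <= 1 * norm (1 + norm x)" for x
  using japanese_bracket_pos[of x] by (simp add: japanese_bracket_def)
qed

lemma bracket_meas [measurable]: "japanese_bracket \<in> borel_measurable borel" by (rule subgaussian_meas[OF subgaussian_bracket])

text \<open>Peetre's inequality: translating the weight costs a polynomial factor, which the Gaussian absorbs.\<close>

lemma bracket_Peetre: "1 / bracket3 x <= sqrt 2 ^ 3 * bracket3 (y - x) / bracket3 y"
proof -
 have "(norm y)^2 <= (norm x + norm (y - x))^2" using norm_triangle_ineq[of x "y - x"] by (intro power_mono) auto
 also have "... <= 2 * (norm x)^2 + 2 * (norm (y - x))^2" using zero_le_power2[of "norm x - norm (y - x)"] by (simp add: power2_sum power2_diff)
 finally have n: "(norm y)^2 <= 2 * (norm x)^2 + 2 * (norm (y - x))^2" .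
 have "1 + (norm y)^2 <= 2 * ((1 + (norm x)^2) * (1 + (norm (y - x))^2))"
 proof -
  have "2 * ((1 + X) * (1 + Y)) = 2 + 2 * X + 2 * Y + 2 * (X * Y)" for X Y :: real by (simp add: algebra_simps)
  moreover have "0 <= (norm x)^2 * (norm (y - x))^2" by simp
  ultimately show ?thesis using n by (smt (verit))
 qed
 then have "japanese_bracket y <= sqrt 2 * (japanese_bracket x * japanese_bracket (y - x))"
  unfolding japanese_bracket_def real_sqrt_mult[symmetric] by simp
 then have "bracket3 y <= (sqrt 2 * (japanese_bracket x * japanese_bracket (y - x))) ^ 3" using japanese_bracket_pos[of y] by (intro power_mono) auto
 then show ?thesis using japanese_bracket_pos[of x] japanese_bracket_pos[of y] by (simp add: field_simps)
qed

lemma weighted_gauss_integrable: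
 assumes h: "continuous_on UNIV h" and fin: "weighted_sq h < \<infinity>"
 shows "gauss_integrable h" unfolding gauss_integrable_def
proof (intro conjI allI impI h)
 fix \<delta> :: real assume d: "\<delta> > 0"
 have [measurable]: "h \<in> borel_measurable borel" by (rule borel_measurable_continuous_onI[OF h])
 have i1: "integrable lborel (%x. (norm (h x))^2 / bracket3 x)"
  by (rule integrableI_nonneg) (use fin japanese_bracket_pos in \<open>auto simp: weighted_sq_def less_imp_le\<close>)
 have "subgaussian (%x. bracket3 x)" by (intro subgaussian_intros subgaussian_bracket)
 then have i2: "integrable lborel (%x. gaussian (2 * \<delta>) x * bracket3 x)"
  using gauss_integrableD[OF subgaussian_imp_gauss_integrable, of _ "2 * \<delta>"] d by fastforce
 show "integrable lborel (%x. gaussian \<delta> x *R h x)"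
 proof (rule Bintegrable_bound[OF Bintegrable_add[OF i1 i2]])
  show "AE x in lborel. norm (gaussian \<delta> x *R h x) <= norm ((norm (h x))^2 / bracket3 x + gaussian (2 * \<delta>) x * bracket3 x)"
  proof (rule AE_I2)
   fix x :: "real^3"
   define J a e where "J = bracket3 x" and "a = norm (h x)" and "e = gaussian \<delta> x"
   have J: "J > 0" using japanese_bracket_pos[of x] by (simp add: J_def)
   have e2: "gaussian (2 * \<delta>) x = e^2" by (simp add: e_def power2_eq_square flip: exp_add)
   have ae: "a >= 0" "e >= 0" by (auto simp: a_def e_def)
   have "2 * (e * a) * J <= a^2 + (e * J)^2" using zero_le_power2[of "a - e * J"] by (simp add: power2_diff algebra_simps)
   then have "2 * (e * a) <= a^2 / J + e^2 * J" using J by (simp add: field_simps power2_eq_square)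
   moreover have "0 <= e * a" using ae by simp
   ultimately have "e * a <= a^2 / J + e^2 * J" by linarith
   then show "norm (gaussian \<delta> x *R h x) <= norm ((norm (h x))^2 / bracket3 x + gaussian (2 * \<delta>) x * bracket3 x)"
    unfolding e2 J_def[symmetric] a_def[symmetric] norm_scaleR real_norm_def e_def[symmetric] using ae J by simp
  qed
 qed measurable
qed

lemma gauss_transform_pointwise_le:
 assumes s: "s > 0" and h: "continuous_on UNIV h"
 shows "ennreal ((norm (gauss_conv s h x))^2) <= ennreal (sqrt (pi / s) ^ 3) * (NN y. ennreal (gaussian s (y - x) * (norm (h y))^2))"
  (is "_ <= _ * ?I")
proof (cases "?I = \<infinity>")
 case True
 then show ?thesis using s by (simp add: ennreal_mult_top)
next
 case False
 have [measurable]: "h \<in> borel_measurable borel" by (rule borel_measurable_continuous_onI[OF h])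
 define E where "E y = gaussian (s / 2) (y - x)" for y
 have E2: "(E y)^2 = gaussian s (y - x)" for y by (simp add: E_def power2_eq_square flip: exp_add)
 have [measurable]: "E \<in> borel_measurable borel" unfolding E_def by measurable
 have nI: "integrable lborel (%y. gaussian s (y - x) * (norm (h y))^2)"
  by (rule integrableI_nonneg) (use False in \<open>auto simp: top.not_eq_extremum\<close>)
 have i1: "integrable lborel (%y. (norm (cor (E y) * h y))^2)" using nI by (simp add: norm_mult power_mult_distrib E2)
 have gi: "integrable lborel (%y. gaussian s (y - x))" and gv: "(LBINT y. gaussian s (y - x)) = sqrt (pi / s) ^ 3"
 proof -
  show "integrable lborel (%y. gaussian s (y - x))" using integrable_shift[OF gaussian_integral(1)[OF s], of "- x"] by (simp add: add.commute)
  show "(LBINT y. gaussian s (y - x)) = sqrt (pi / s) ^ 3"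
  proof -
   have "(LBINT y. gaussian s (y - x)) = (LBINT y. gaussian s (- x + y))" by (simp add: add.commute)
   also have "... = (LBINT y. gaussian s (y :: real^3))" by (rule integral_shift[of "%z::real^3. gaussian s z"]) measurable
   also have "... = sqrt (pi / s) ^ DIM(real^3)" by (rule gaussian_integral(2)[OF s])
   also have "DIM(real^3) = 3" by simp
   finally show ?thesis .
  qed
 qed
 have i2: "integrable lborel (%y. (norm (cor (E y)))^2)" using gi by (simp add: E2)
 have "(norm (LBINT y. cor (E y) * (cor (E y) * h y)))^2
   <= (LBINT y. (norm (cor (E y)))^2) * (LBINT y. (norm (cor (E y) * h y))^2)" by (rule integral_Cauchy_Schwarz(3)[OF _ _ i2 i1]) measurable
 moreover have "(LBINT y. cor (E y) * (cor (E y) * h y)) = gauss_conv s h x"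
  unfolding gauss_transform_def E2[symmetric] by (simp add: scaleR_conv_of_real power2_eq_square mult.assoc)
 ultimately have le: "(norm (gauss_conv s h x))^2 <= sqrt (pi / s) ^ 3 * (LBINT y. gaussian s (y - x) * (norm (h y))^2)"
  using gv by (simp add: norm_mult power_mult_distrib E2)
 have "?I = ennreal (LBINT y. gaussian s (y - x) * (norm (h y))^2)" by (rule nn_integral_eq_integral[OF nI]) simp
 then show ?thesis using le s by (simp add: ennreal_mult'[symmetric] ennreal_leI)
qed

text \<open>Gaussian convolution is bounded on the weighted space: Cauchy-Schwarz, Tonelli and Peetre's inequality.\<close>

lemma weighted_sq_gauss_transform:
 assumes s: "s > 0"
 obtains K where "K >= 0" "!!h. continuous_on UNIV h ==> weighted_sq (gauss_conv s h) <= ennreal K * weighted_sq h"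
proof -
 define c where "c = sqrt (pi / s) ^ 3"
 define k where "k z = gaussian s z * (sqrt 2 ^ 3 * bracket3 z)" for z
 have c: "c >= 0" using s by (simp add: c_def)
 have k: "k z >= 0" for z using japanese_bracket_pos[of z] by (simp add: k_def)
 have [measurable]: "k \<in> borel_measurable borel" unfolding k_def by measurable
 have sk: "subgaussian (%z. sqrt 2 ^ 3 * bracket3 z)" by (intro subgaussian_intros subgaussian_bracket)
 have ik: "integrable lborel k" using gauss_integrableD[OF subgaussian_imp_gauss_integrable[OF sk] s] by (simp add: k_def[abs_def])
 define K0 where "K0 = (LBINT z. k z)"
 have K0: "K0 >= 0" unfolding K0_def using k by simp
 have nk: "(NN x. ennreal (k (y - x))) = ennreal K0" for y
 proof -
  have "(NN x. ennreal (k (y - x))) = (NN x. ennreal (k (x - y)))" by (simp add: k_def japanese_bracket_def norm_minus_commute)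
  also have "... = (NN x. ennreal (k x))" using nn_integral_shift[of "%z. ennreal (k z)" "- y"] by (simp add: add.commute)
  also have "... = ennreal K0" unfolding K0_def by (rule nn_integral_eq_integral[OF ik]) (use k in simp)
  finally show ?thesis .
 qed
 show ?thesis
 proof (rule that)
  show "c * K0 >= 0" using c K0 by simp
  fix h :: "real^3 => complex" assume h: "continuous_on UNIV h"
  have [measurable]: "h \<in> borel_measurable borel" by (rule borel_measurable_continuous_onI[OF h])
  define w where "w y = (norm (h y))^2 / bracket3 y" for y
  have w: "w y >= 0" for y using japanese_bracket_pos[of y] by (simp add: w_def)
  have [measurable]: "w \<in> borel_measurable borel" unfolding w_def by measurable
  have pt: "ennreal ((norm (gauss_conv s h x))^2 / bracket3 x) <= ennreal c * (NN y. ennreal (k (y - x)) * ennreal (w y))" for x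
  proof -
   have J: "1 / bracket3 x >= 0" using japanese_bracket_pos[of x] by simp
   have "ennreal ((norm (gauss_conv s h x))^2 / bracket3 x) = ennreal ((norm (gauss_conv s h x))^2) * ennreal (1 / bracket3 x)"
    using J by (simp add: ennreal_mult[symmetric])
   also have "... <= (ennreal c * (NN y. ennreal (gaussian s (y - x) * (norm (h y))^2))) * ennreal (1 / bracket3 x)"
    unfolding c_def by (intro mult_right_mono gauss_transform_pointwise_le s h) simp
   also have "... = ennreal c * (NN y. ennreal (gaussian s (y - x) * (norm (h y))^2) * ennreal (1 / bracket3 x))"
    by (subst nn_integral_multc) (auto simp: mult.assoc)
   also have "... <= ennreal c * (NN y. ennreal (k (y - x)) * ennreal (w y))"
   proof (intro mult_left_mono nn_integral_mono)
    fix y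
    have "(gaussian s (y - x) * (norm (h y))^2) * (1 / bracket3 x) <= (gaussian s (y - x) * (norm (h y))^2) * (sqrt 2 ^ 3 * bracket3 (y - x) / bracket3 y)"
     by (intro mult_left_mono bracket_Peetre) simp
    also have "... = k (y - x) * w y" by (simp add: k_def w_def)
    finally show "ennreal (gaussian s (y - x) * (norm (h y))^2) * ennreal (1 / bracket3 x) <= ennreal (k (y - x)) * ennreal (w y)"
     using J k w by (simp add: ennreal_mult[symmetric] ennreal_leI)
   qed simp
   finally show ?thesis .
  qed
  have "weighted_sq (gauss_conv s h) <= (NN x. ennreal c * (NN y. ennreal (k (y - x)) * ennreal (w y)))"
   unfolding weighted_sq_def by (intro nn_integral_mono pt)
  also have "... = ennreal c * (NN x. (NN y. ennreal (k (y - x)) * ennreal (w y)))" by (rule nn_integral_cmult) measurable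
  also have "(NN x. (NN y. ennreal (k (y - x)) * ennreal (w y))) = (NN y. (NN x. ennreal (k (y - x)) * ennreal (w y)))"
   by (rule lborel_pair.Fubini') measurable
  also have "... = (NN y. ennreal K0 * ennreal (w y))" by (intro nn_integral_cong) (simp add: nn_integral_multc nk)
  also have "... = ennreal K0 * weighted_sq h" unfolding weighted_sq_def w_def[symmetric] by (rule nn_integral_cmult) measurable
  finally show "weighted_sq (gauss_conv s h) <= ennreal (c * K0) * weighted_sq h" using c K0 by (simp add: ennreal_mult mult.assoc)
 qed
qed


definition rotation :: "3 => 3 => (real^3 => complex) => real^3 => complex" where
 "rotation i j f x = x $ i *R partial_d j f x - x $ j *R partial_d i f x"

lemma C_k_1: "C_k 1 f \<longleftrightarrow> (\<forall>x. f differentiable (at x)) & (\<forall>j. continuous_on UNIV (partial_d j f))"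
 by (simp add: One_nat_def)

lemma C_k_2_imp_1: "C_k 2 f ==> C_k 1 f" using C_k2_facts[of f] by (auto simp: C_k_1)

lemma rotation_cont: "C_k 1 f ==> continuous_on UNIV (rotation i j f)" unfolding rotation_def C_k_1 by (intro continuous_intros) auto

lemma C_k_1_cont: "C_k 1 f ==> continuous_on UNIV f" by (auto simp: C_k_1 intro: differentiable_imp_cont)

lemma scalar_norm_rotations:
 assumes f: "C_k 1 f"
 shows "scalar_norm f = weighted_sq f + weighted_sq (rotation 1 2 f) + weighted_sq (rotation 2 3 f) + weighted_sq (rotation 3 1 f)"
proof -
 have [measurable]: "f \<in> borel_measurable borel" "rotation i j f \<in> borel_measurable borel" for i j
  using C_k_1_cont[OF f] rotation_cont[OF f] by (auto intro: borel_measurable_continuous_onI)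
 have "scalar_norm f = (NN x. ennreal ((norm (f x))^2 / bracket3 x) + ennreal ((norm (rotation 1 2 f x))^2 / bracket3 x)
   + ennreal ((norm (rotation 2 3 f x))^2 / bracket3 x) + ennreal ((norm (rotation 3 1 f x))^2 / bracket3 x))" unfolding scalar_H_def
 proof (intro nn_integral_cong)
  fix x
  have J: "bracket3 x > 0" using japanese_bracket_pos[of x] by simp
  show "ennreal (((norm (f x))^2 + angular x (%j. partial_d j f x)) / bracket3 x)
   = ennreal ((norm (f x))^2 / bracket3 x) + ennreal ((norm (rotation 1 2 f x))^2 / bracket3 x)
   + ennreal ((norm (rotation 2 3 f x))^2 / bracket3 x) + ennreal ((norm (rotation 3 1 f x))^2 / bracket3 x)"
   unfolding angular_eq_rotations using J by (simp add: rotation_def add_divide_distrib add.assoc flip: ennreal_plus)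
 qed
 also have "... = weighted_sq f + weighted_sq (rotation 1 2 f) + weighted_sq (rotation 2 3 f) + weighted_sq (rotation 3 1 f)"
  unfolding weighted_sq_def by (subst nn_integral_add, measurable)+
 finally show ?thesis .
qed

lemma partial_d_linear:
 assumes "f differentiable (at x)" "g differentiable (at x)"
 shows "partial_d j (%x. a *R f x + b *R g x) x = a *R partial_d j f x + b *R partial_d j g x"
proof (rule partial_d_eq)
 have "((%x. a *R f x + b *R g x) has_derivative (%h. a *R (SUM j:UNIV. h $ j *R partial_d j f x) + b *R (SUM j:UNIV. h $ j *R partial_d j g x))) (at x)"
  by (intro has_derivative_add has_derivative_scaleR_right differentiable_has_partial_derivative assms)
 then show "((%x. a *R f x + b *R g x) has_derivative (%h. SUM j:UNIV. h $ j *R (a *R partial_d j f x + b *R partial_d j g x))) (at x)"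
  by (simp add: scaleR_sum_right sum.distrib scaleR_add_right mult.commute)
qed

lemma C_k_1_linear:
 assumes "C_k 1 f" "C_k 1 g" shows "C_k 1 (%x. a *R f x + b *R g x)"
proof -
 have "partial_d j (%x. a *R f x + b *R g x) = (%x. a *R partial_d j f x + b *R partial_d j g x)" for j
  using assms by (auto simp: C_k_1 partial_d_linear)
 then show ?thesis using assms unfolding C_k_1 by (auto intro!: continuous_intros derivative_intros)
qed

lemma weighted_sq_linear:
 assumes "continuous_on UNIV f" "continuous_on UNIV g"
 shows "weighted_sq (%x. a *R f x + b *R g x) <= ennreal (2 * a^2) * weighted_sq f + ennreal (2 * b^2) * weighted_sq g"
proof -
 have [measurable]: "f \<in> borel_measurable borel" "g \<in> borel_measurable borel" using assms by (auto intro: borel_measurable_continuous_onI)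
 have "weighted_sq (%x. a *R f x + b *R g x) <= (NN x. ennreal (2 * a^2) * ennreal ((norm (f x))^2 / bracket3 x) + ennreal (2 * b^2) * ennreal ((norm (g x))^2 / bracket3 x))"
  unfolding weighted_sq_def
 proof (intro nn_integral_mono)
  fix x
  have J: "bracket3 x > 0" using japanese_bracket_pos[of x] by simp
  have "(norm (a *R f x + b *R g x))^2 <= (\<bar>a\<bar> * norm (f x) + \<bar>b\<bar> * norm (g x))^2"
   using norm_triangle_ineq[of "a *R f x" "b *R g x"] by (intro power_mono) auto
  also have "... <= 2 * (\<bar>a\<bar> * norm (f x))^2 + 2 * (\<bar>b\<bar> * norm (g x))^2"
   using zero_le_power2[of "\<bar>a\<bar> * norm (f x) - \<bar>b\<bar> * norm (g x)"] by (simp add: power2_sum power2_diff)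
  also have "... = 2 * a^2 * (norm (f x))^2 + 2 * b^2 * (norm (g x))^2" by (simp add: power_mult_distrib)
  finally have "(norm (a *R f x + b *R g x))^2 / bracket3 x <= (2 * a^2 * (norm (f x))^2 + 2 * b^2 * (norm (g x))^2) / bracket3 x"
   using J by (intro divide_right_mono) auto
  then have "ennreal ((norm (a *R f x + b *R g x))^2 / bracket3 x) <= ennreal (2 * a^2 * ((norm (f x))^2 / bracket3 x) + 2 * b^2 * ((norm (g x))^2 / bracket3 x))"
   by (intro ennreal_leI) (simp add: add_divide_distrib)
  also have "... = ennreal (2 * a^2 * ((norm (f x))^2 / bracket3 x)) + ennreal (2 * b^2 * ((norm (g x))^2 / bracket3 x))"
   using J by (intro ennreal_plus) auto
  also have "... = ennreal (2 * a^2) * ennreal ((norm (f x))^2 / bracket3 x) + ennreal (2 * b^2) * ennreal ((norm (g x))^2 / bracket3 x)"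
   using J by (intro arg_cong2[where f = "(+)"] ennreal_mult) auto
  finally show "ennreal ((norm (a *R f x + b *R g x))^2 / bracket3 x) <= ennreal (2 * a^2) * ennreal ((norm (f x))^2 / bracket3 x) + ennreal (2 * b^2) * ennreal ((norm (g x))^2 / bracket3 x)" .
 qed
 also have "... = ennreal (2 * a^2) * weighted_sq f + ennreal (2 * b^2) * weighted_sq g"
  unfolding weighted_sq_def by (simp add: nn_integral_add nn_integral_cmult)
 finally show ?thesis .
qed

lemma scalar_norm_linear:
 assumes f: "C_k 1 f" and g: "C_k 1 g"
 shows "scalar_norm (%x. a *R f x + b *R g x) <= ennreal (2 * a^2) * scalar_norm f + ennreal (2 * b^2) * scalar_norm g"
proof -
 let ?h = "%x. a *R f x + b *R g x" and ?A = "ennreal (2 * a^2)" and ?B = "ennreal (2 * b^2)"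
 have rot: "rotation i j ?h = (%x. a *R rotation i j f x + b *R rotation i j g x)" for i j
  using f g by (auto simp: rotation_def C_k_1 partial_d_linear fun_eq_iff algebra_simps)
 note le = weighted_sq_linear[OF rotation_cont[OF f] rotation_cont[OF g], of a _ _ b _ _, folded rot]
 have "scalar_norm ?h <= (?A * weighted_sq f + ?B * weighted_sq g) + (?A * weighted_sq (rotation 1 2 f) + ?B * weighted_sq (rotation 1 2 g))
  + (?A * weighted_sq (rotation 2 3 f) + ?B * weighted_sq (rotation 2 3 g)) + (?A * weighted_sq (rotation 3 1 f) + ?B * weighted_sq (rotation 3 1 g))"
  unfolding scalar_norm_rotations[OF C_k_1_linear[OF f g]] unfolding rot by (intro add_mono weighted_sq_linear rotation_cont C_k_1_cont f g)
 also have "... = ?A * scalar_norm f + ?B * scalar_norm g"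
  unfolding scalar_norm_rotations[OF f] scalar_norm_rotations[OF g] by (simp add: distrib_left add_ac)
 finally show ?thesis .
qed

lemma gauss_transform_jet:
 assumes s: "s > 0" and f: "gauss_integrable f"
 shows "partial_d j (gauss_conv s f) x = gauss_transform s (%z. 2 * s * z $ j) f x"
  and "C_k 1 (gauss_conv s f)" and "subgaussian (gauss_conv s f)"
proof -
 have d0: "((%_. 1) has_derivative (%h. SUM j:UNIV. h $ j * (0::real))) (at z)" for z :: "real^3" by simp
 have D: "(gauss_conv s f has_derivative (%h. SUM j:UNIV. h $ j *R gauss_transform s (%z. 2 * s * z $ j) f x)) (at x)" for x
  using gauss_transform_has_derivative[OF s subgaussian_const subgaussian_const d0 f] by simp
 show p: "partial_d j (gauss_conv s f) x = gauss_transform s (%z. 2 * s * z $ j) f x" for j x by (rule partial_d_eq[OF D])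
 show "subgaussian (gauss_conv s f)" by (rule gauss_transform_subgaussian[OF s subgaussian_const subgaussian_const d0 f])
 have d1: "((%z. 2 * s * z $ j) has_derivative (%h. SUM i:UNIV. h $ i * (2 * s * (if i = j then 1 else 0)))) (at z)" for j and z :: "real^3"
  using has_derivative_mult_right[OF has_derivative_component_sum[of j z], of "2 * s"] by (simp add: sum_distrib_left mult_ac)
 have "subgaussian (gauss_transform s (%z. 2 * s * z $ j) f)" for j
  by (rule gauss_transform_subgaussian[OF s _ _ d1 f]) (intro subgaussian_intros)+
 then show "C_k 1 (gauss_conv s f)" unfolding C_k_1 p[abs_def] using D by (auto simp: differentiable_def intro: subgaussian_cont)
qed

lemma scalar_norm_gauss_integrable:
 assumes f: "C_k 1 f" and fin: "scalar_norm f < \<infinity>"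
 shows "gauss_integrable f" "gauss_integrable (rotation i j f)"
proof -
 have "weighted_sq f < \<infinity>" and r: "weighted_sq (rotation 1 2 f) < \<infinity>" "weighted_sq (rotation 2 3 f) < \<infinity>" "weighted_sq (rotation 3 1 f) < \<infinity>"
  using fin unfolding scalar_norm_rotations[OF f] by auto
 then show "gauss_integrable f" using weighted_gauss_integrable C_k_1_cont[OF f] by blast
 have g: "gauss_integrable (rotation 1 2 f)" "gauss_integrable (rotation 2 3 f)" "gauss_integrable (rotation 3 1 f)"
  using r weighted_gauss_integrable rotation_cont[OF f] by blast+
 have z: "rotation i i f = (%x. 0)" for i by (auto simp: rotation_def)
 have m: "rotation i j f = (%x. (-1) *R rotation j i f x)" for i j by (auto simp: rotation_def)
 have 0: "gauss_integrable (%x::real^3. 0::complex)" by (simp add: gauss_integrable_def)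
 show "gauss_integrable (rotation i j f)"
  using exhaust_3[of i] exhaust_3[of j] g 0 z m[of 2 1] m[of 3 2] m[of 1 3] gauss_integrable_cmult[OF g(1), of "-1"] gauss_integrable_cmult[OF g(2), of "-1"] gauss_integrable_cmult[OF g(3), of "-1"]
  by (elim disjE) (simp_all only:)
qed

lemma gauss_transform_scalar_norm:
 assumes s: "s > 0"
 obtains K where "K >= 0" "!!f. C_k 2 f ==> scalar_norm f < \<infinity> ==> scalar_norm (gauss_conv s f) <= ennreal K * scalar_norm f"
proof -
 obtain K where K: "K >= 0" "!!h. continuous_on UNIV h ==> weighted_sq (gauss_conv s h) <= ennreal K * weighted_sq h"
  using weighted_sq_gauss_transform[OF s] by blast
 show ?thesis
 proof (rule that[OF K(1)])
  fix f assume f: "C_k 2 f" and fin: "scalar_norm f < \<infinity>"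
  note f1 = C_k_2_imp_1[OF f]
  note gi = scalar_norm_gauss_integrable[OF f1 fin]
  let ?T = "gauss_conv s"
  have rot: "rotation i j (?T f) = ?T (rotation i j f)" for i j
  proof
   fix x
   show "rotation i j (?T f) x = ?T (rotation i j f) x"
    using gauss_transform_rotation[OF f gi(1) s gi(2)[of i j, unfolded rotation_def[abs_def]], of x]
    by (simp add: rotation_def[abs_def] gauss_transform_jet(1)[OF s gi(1)])
  qed
  show "scalar_norm (?T f) <= ennreal K * scalar_norm f"
   unfolding scalar_norm_rotations[OF f1] scalar_norm_rotations[OF gauss_transform_jet(2)[OF s gi(1)]] rot distrib_left
   by (intro add_mono K(2) rotation_cont C_k_1_cont f1)
 qed
qed

text \<open>A convolution that is a superposition of two factors determines both amplitudes: each is a combination of the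
convolutions at \<open>s = 1\<close> and \<open>s = 2\<close>. The semigroup law makes each amplitude reproducing for its own wave number.\<close>

lemma separated_part:
 assumes pq: "p^2 ~= q\<^sup>2"
 obtains C where "C >= 0"
  "!!f A B. C_k 2 f ==> scalar_norm f < \<infinity> ==>
   (!!s x. s > 0 ==> gauss_conv s f x = gauss_factor p s *R A x + gauss_factor q s *R B x) ==>
   reproducing p A & scalar_norm A <= ennreal C * scalar_norm f"
proof -
 obtain \<alpha> \<beta> where ab: "\<alpha> * gauss_factor p 1 + \<beta> * gauss_factor p 2 = 1" "\<alpha> * gauss_factor q 1 + \<beta> * gauss_factor q 2 = 0"
  using two_scale_solve[OF pq] by blast
 obtain K1 where K1: "K1 >= 0" "!!f. C_k 2 f ==> scalar_norm f < \<infinity> ==> scalar_norm (gauss_conv 1 f) <= ennreal K1 * scalar_norm f"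
  using gauss_transform_scalar_norm[OF zero_less_one] by blast
 obtain K2 where K2: "K2 >= 0" "!!f. C_k 2 f ==> scalar_norm f < \<infinity> ==> scalar_norm (gauss_conv 2 f) <= ennreal K2 * scalar_norm f"
  using gauss_transform_scalar_norm[OF zero_less_numeral] by blast
 show ?thesis
 proof (rule that)
  show "2 * \<alpha>^2 * K1 + 2 * \<beta>^2 * K2 >= 0" using K1 K2 by simp
  fix f A B
  assume f: "C_k 2 f" and fin: "scalar_norm f < \<infinity>"
   and T: "!!s x. s > 0 ==> gauss_conv s f x = gauss_factor p s *R A x + gauss_factor q s *R B x"
  have gi: "gauss_integrable f" by (rule scalar_norm_gauss_integrable(1)[OF C_k_2_imp_1[OF f] fin])
  have pos: "(0::real) < 1" "(0::real) < 2" by auto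
  note jet = gauss_transform_jet[OF pos(1) gi] gauss_transform_jet[OF pos(2) gi]
  define T1 T2 where "T1 = gauss_conv 1 f" and "T2 = gauss_conv 2 f"
  have comb: "\<alpha> *R (a *R X + b *R Y) + \<beta> *R (c *R X + d *R Y) = (\<alpha> * a + \<beta> * c) *R X + (\<alpha> * b + \<beta> * d) *R Y" for a b c d and X Y :: complex
   by (simp add: algebra_simps)
  have A: "A = (%x. \<alpha> *R T1 x + \<beta> *R T2 x)" unfolding T1_def T2_def T[OF pos(1)] T[OF pos(2)] comb ab by simp
  have g: "gauss_integrable T1" "gauss_integrable T2" unfolding T1_def T2_def using jet(3,6) by (auto intro: subgaussian_imp_gauss_integrable)
  have gA: "gauss_integrable A" unfolding A by (intro gauss_integrable_add gauss_integrable_cmult g)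
  have semi: "gauss_conv s (gauss_conv t f) x = (gauss_factor p s * gauss_factor p t) *R A x + (gauss_factor q s * gauss_factor q t) *R B x" if "s > 0" "t > 0" for s t x
  proof -
   have "s * t / (s + t) > 0" using that by simp
   then show ?thesis unfolding gauss_transform_semigroup[OF that gi]
    by (subst T) (simp_all add: scaleR_add_right gauss_factor_semigroup[OF that, symmetric])
  qed
  have "reproducing p A" unfolding reproducing_def
  proof (intro conjI gA allI impI)
   fix s :: real and x assume s: "s > 0"
   have "gauss_conv s A x = \<alpha> *R gauss_conv s T1 x + \<beta> *R gauss_conv s T2 x"
    unfolding A by (rule gauss_transform_add_fun[OF s subgaussian_const g])
   also have "... = (gauss_factor p s * (\<alpha> * gauss_factor p 1 + \<beta> * gauss_factor p 2)) *R A x + (gauss_factor q s * (\<alpha> * gauss_factor q 1 + \<beta> * gauss_factor q 2)) *R B x"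
    unfolding T1_def T2_def semi[OF s pos(1)] semi[OF s pos(2)] comb by (simp add: algebra_simps)
   finally show "gauss_conv s A x = (sqrt (pi / s) ^ 3 * exp (- (p^2 / (4 * s)))) *R A x" unfolding ab by (simp add: gauss_factor_def)
  qed
  moreover have "scalar_norm A <= ennreal (2 * \<alpha>^2 * K1 + 2 * \<beta>^2 * K2) * scalar_norm f"
  proof -
   have "scalar_norm A <= ennreal (2 * \<alpha>^2) * scalar_norm T1 + ennreal (2 * \<beta>^2) * scalar_norm T2"
    unfolding A using jet(2,5) by (intro scalar_norm_linear) (auto simp: T1_def T2_def)
   also have "... <= ennreal (2 * \<alpha>^2) * (ennreal K1 * scalar_norm f) + ennreal (2 * \<beta>^2) * (ennreal K2 * scalar_norm f)"
    unfolding T1_def T2_def by (intro add_mono mult_left_mono K1 K2 f fin) auto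
   also have "... = ennreal (2 * \<alpha>^2 * K1 + 2 * \<beta>^2 * K2) * scalar_norm f"
    using K1(1) K2(1) by (simp add: ennreal_plus ennreal_mult distrib_right mult.assoc)
   finally show ?thesis .
  qed
  ultimately show "reproducing p A & scalar_norm A <= ennreal (2 * \<alpha>^2 * K1 + 2 * \<beta>^2 * K2) * scalar_norm f" by blast
 qed
qed

section \<open>Decomposition of Navier solutions\<close>

lemma weak_equation_kernel:
 fixes v :: "3 => real^3 => complex" and a :: "3 => 3 => 3 => real" and b :: "3 => real"
 assumes v: "!!l. C_k 2 (v l)" "!!l. gauss_integrable (v l)" and s: "s > 0"
  and eq: "!!y. (SUM l:UNIV. (SUM i:UNIV. SUM j:UNIV. a l i j *R partial_d i (partial_d j (v l)) y) + b l *R v l y) = 0"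
 shows "(SUM l:UNIV. gauss_transform s (%z. (SUM i:UNIV. SUM j:UNIV. a l i j * (4 * s^2 * z $ i * z $ j - 2 * s * (if i = j then 1 else 0))) + b l) (v l) x) = 0"
proof -
 let ?k = "%i j z. 4 * s^2 * z $ i * z $ j - 2 * s * (if i = j then 1 else 0 :: real)"
 have k: "subgaussian (%z. ?k i j z)" "subgaussian (%z. a l i j * ?k i j z)" "subgaussian (%z. SUM j:UNIV. a l i j * ?k i j z)" "subgaussian (%z. SUM i:UNIV. SUM j:UNIV. a l i j * ?k i j z)" for i j l
  by (intro subgaussian_intros)+
 have "gauss_transform s (%z. (SUM i:UNIV. SUM j:UNIV. a l i j * ?k i j z) + b l) (v l) x
  = (SUM i:UNIV. SUM j:UNIV. a l i j *R gauss_transform s (?k i j) (v l) x) + b l *R gauss_conv s (v l) x" for l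
 proof -
  have "gauss_transform s (%z. 1 * (SUM i:UNIV. SUM j:UNIV. a l i j * ?k i j z) + b l * 1) (v l) x
    = 1 *R gauss_transform s (%z. SUM i:UNIV. SUM j:UNIV. a l i j * ?k i j z) (v l) x + b l *R gauss_conv s (v l) x"
   by (rule gauss_transform_linear[OF s k(4) subgaussian_const v(2)])
  also have "gauss_transform s (%z. SUM i:UNIV. SUM j:UNIV. a l i j * ?k i j z) (v l) x = (SUM i:UNIV. gauss_transform s (%z. SUM j:UNIV. a l i j * ?k i j z) (v l) x)"
   by (rule gauss_transform_sum[OF s k(3) v(2)])
  also have "... = (SUM i:UNIV. SUM j:UNIV. gauss_transform s (%z. a l i j * ?k i j z) (v l) x)"
   by (intro sum.cong refl gauss_transform_sum[OF s k(2) v(2)])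
  also have "... = (SUM i:UNIV. SUM j:UNIV. a l i j *R gauss_transform s (?k i j) (v l) x)"
   by (intro sum.cong refl gauss_transform_cmult[OF s k(1) v(2)])
  finally show ?thesis by simp
 qed
 then show ?thesis using weak_equation[OF v s eq, of x] by simp
qed

lemma partial_d_component:
 fixes u :: "real^3 => complex^3"
 assumes "u differentiable (at x)"
 shows "partial_d j (%y. u y $ i) x = partial_d j u x $ i" and "(%y. u y $ i) differentiable (at x)"
proof -
 have D: "((%y. u y $ i) has_derivative (%h. (SUM j:UNIV. h $ j *R partial_d j u x) $ i)) (at x)"
  by (rule bounded_linear.has_derivative[OF bounded_linear_vec_nth differentiable_has_partial_derivative[OF assms]])
 then show "(%y. u y $ i) differentiable (at x)" by (auto simp: differentiable_def)
 show "partial_d j (%y. u y $ i) x = partial_d j u x $ i" by (rule partial_d_eq) (use D in simp)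
qed

lemma partial_d_sum:
 assumes "!!i. g i differentiable (at x)"
 shows "partial_d m (%x. \<Sum>i\<in>(UNIV :: 3 set). g i x) x = (SUM i:UNIV. partial_d m (g i) x)"
proof (rule partial_d_eq)
 have "((%x. SUM i:UNIV. g i x) has_derivative (%h. SUM i:UNIV. SUM j:UNIV. h $ j *R partial_d j (g i) x)) (at x)"
  by (intro has_derivative_sum differentiable_has_partial_derivative assms)
 also have "(%h::real^3. SUM i:UNIV. SUM j:UNIV. h $ j *R partial_d j (g i) x) = (%h. SUM j:UNIV. h $ j *R (SUM i:UNIV. partial_d j (g i) x))"
  by (subst sum.swap) (simp add: scaleR_sum_right)
 finally show "((%x. SUM i:UNIV. g i x) has_derivative (%h. SUM j:UNIV. h $ j *R (SUM i:UNIV. partial_d j (g i) x))) (at x)" .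
qed

lemma navier_components:
 assumes sol: "entire_navier_solution lam mu rho om u"
 shows "C_k 2 (%y. u y $ m)"
  and "mu *R (SUM j:UNIV. partial_d j (partial_d j (%y. u y $ m)) x) + (lam + mu) *R (SUM j:UNIV. partial_d m (partial_d j (%y. u y $ j)) x) + (rho * om^2) *R u x $ m = 0"
proof -
 have u: "C_k 2 u" using sol by (simp add: entire_navier_solution_def)
 have u1: "!!x. u differentiable (at x)" "!!j x. partial_d j u differentiable (at x)" "!!i j. continuous_on UNIV (partial_d i (partial_d j u))"
  using u by (auto simp: numeral_2_eq_2)
 have p1: "partial_d j (%y. u y $ i) = (%y. partial_d j u y $ i)" for i j
  using partial_d_component(1)[OF u1(1)] by blast
 have p2: "partial_d k (%y. partial_d j u y $ i) = (%y. partial_d k (partial_d j u) y $ i)" for i j k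
  using partial_d_component(1)[OF u1(2)] by blast
 show "C_k 2 (%y. u y $ m)"
  using u1 partial_d_component(2)[OF u1(1)] partial_d_component(2)[OF u1(2)] by (auto simp: numeral_2_eq_2 p1 p2 intro: continuous_intros)
 have d: "divergence u = (%x. SUM i:UNIV. partial_d i (%y. u y $ i) x)" by (simp add: fun_eq_iff divergence_def)
 have g: "gradient (divergence u) x $ m = (SUM j:UNIV. partial_d m (partial_d j (%y. u y $ j)) x)" unfolding gradient_def vec_lambda_beta d
  by (rule partial_d_sum) (unfold p1, rule partial_d_component(2)[OF u1(2)])
 have "(mu *R vector_laplacian u x + (lam + mu) *R gradient (divergence u) x + (rho * om^2) *R u x) $ m = 0"
  using sol by (simp add: entire_navier_solution_def)
 then show "mu *R (SUM j:UNIV. partial_d j (partial_d j (%y. u y $ m)) x) + (lam + mu) *R (SUM j:UNIV. partial_d m (partial_d j (%y. u y $ j)) x) + (rho * om^2) *R u x $ m = 0"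
  by (simp only: vector_add_component vector_scaleR_component g) (simp add: vector_laplacian_def laplacian_def)
qed

lemma gauss_transform_quadratic:
 assumes s: "s > 0" and f: "gauss_integrable f"
 shows "(gauss_transform s (%z. c1 * (norm z)^2 + c2 + c3 * (z $ m * z $ l)) f has_derivative
  (%h. SUM j:UNIV. h $ j *R gauss_transform s (%z. 2 * s * z $ j * (c1 * (norm z)^2 + c2 + c3 * (z $ m * z $ l))
   - (c1 * (2 * z $ j) + c3 * ((if j = m then 1 else 0) * z $ l + z $ m * (if j = l then 1 else 0)))) f x)) (at x)"
proof (rule gauss_transform_has_derivative[OF s _ _ _ f])
 fix z :: "real^3"
 have n: "((%z::real^3. (norm z)^2) has_derivative (%h. z \<bullet> h + h \<bullet> z)) (at z)"
  unfolding power2_norm_eq_inner by (auto intro!: derivative_eq_intros)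
 have "((%z. c1 * (norm z)^2 + c2 + c3 * (z $ m * z $ l)) has_derivative
   (%h. c1 * (z \<bullet> h + h \<bullet> z) + 0 + c3 * (z $ m * (\<Sum>j\<in>(UNIV::3 set). h $ j * (if j = l then 1 else 0)) + (\<Sum>j\<in>(UNIV::3 set). h $ j * (if j = m then 1 else 0)) * z $ l))) (at z)"
  by (intro has_derivative_add has_derivative_const has_derivative_mult_right has_derivative_mult has_derivative_component_sum n)
 moreover have "(%h. c1 * (z \<bullet> h + h \<bullet> z) + 0 + c3 * (z $ m * (\<Sum>j\<in>(UNIV::3 set). h $ j * (if j = l then 1 else 0)) + (\<Sum>j\<in>(UNIV::3 set). h $ j * (if j = m then 1 else 0)) * z $ l))
  = (%h. SUM j:UNIV. h $ j * (c1 * (2 * z $ j) + c3 * ((if j = m then 1 else 0) * z $ l + z $ m * (if j = l then 1 else 0))))"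
  unfolding inner_vec3 sum_3 by (rule ext, algebra)
 ultimately show "((%z. c1 * (norm z)^2 + c2 + c3 * (z $ m * z $ l)) has_derivative
   (%h. SUM j:UNIV. h $ j * (c1 * (2 * z $ j) + c3 * ((if j = m then 1 else 0) * z $ l + z $ m * (if j = l then 1 else 0))))) (at z)" by (simp only:)
qed (intro subgaussian_intros)+

text \<open>Let \<open>T\<close> be the convolution of \<open>u\<close>, which again solves the Navier equation, and \<open>D\<close> its divergence. Derivatives in \<open>s\<close> of
\<open>T\<close> are Laplacians, so \<open>D\<close> and, once \<open>D\<close> is known, \<open>T\<close> obey ordinary differential equations in \<open>s\<close>. Each wave number
enters through its factor, and letting \<open>s\<close> tend to infinity recovers \<open>u\<close>.\<close>

lemma navier_decomposition:
 fixes u :: "real^3 => complex^3"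
 assumes sol: "entire_navier_solution lam mu rho om u"
  and mu: "mu > 0" "2 * mu + lam > 0" and kp: "kp > 0" "kp^2 = om^2 * rho / (2 * mu + lam)" and ks: "ks^2 = om^2 * rho / mu"
  and gi: "!!m. gauss_integrable (%y. u y $ m)"
 obtains P S :: "3 => real^3 => complex" and \<Psi> :: "real^3 => complex"
 where "!!m s x. s > 0 ==> gauss_conv s (%y. u y $ m) x = gauss_factor kp s *R P m x + gauss_factor ks s *R S m x"
  and "!!m x. u x $ m = P m x + S m x"
  and "!!s x. s > 0 ==> (SUM l:UNIV. partial_d l (gauss_conv s (%y. u y $ l)) x) = gauss_factor kp s *R \<Psi> x"
  and "!!m x. P m x = - ((1 / kp^2) *R partial_d m \<Psi> x)"
proof -
 define v where "v l y = u y $ l" for l y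
 let ?h = "%s. rho * om^2 - 6 * s * mu"
 let ?q = "%s. 2 * s * rho * om^2 - (2 * mu + lam) * 20 * s^2"
 have v: "C_k 2 (v l)" "gauss_integrable (v l)" for l
  using navier_components(1)[OF sol, of l] gi[of l] unfolding v_def by auto
 \<comment> \<open>K s m l is the kernel acting on component l when equation m is tested against a Gaussian.\<close>
 define K where "K s m l z = (if l = m then 4 * s^2 * mu else 0) * (norm z)^2 + ((if l = m then rho * om^2 - 6 * s * mu else 0) - (lam + mu) * (2 * s * (if m = l then 1 else 0)))
   + (lam + mu) * (4 * s^2) * (z $ m * z $ l)" for s m l and z :: "real^3"
 have WN: "(SUM l:UNIV. gauss_transform s (K s m l) (v l) x) = 0" if s: "s > 0" for s m x
 proof -
  define a where "a l i j = (if l = m & i = j then mu else 0) + (if i = m & j = l then lam + mu else 0)" for l i j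
  define b where "b l = (if l = m then rho * om^2 else 0)" for l
  have e: "(SUM l:UNIV. (SUM i:UNIV. SUM j:UNIV. a l i j *R partial_d i (partial_d j (v l)) y) + b l *R v l y) = 0" for y
  proof -
   have "(SUM l:UNIV. (SUM i:UNIV. SUM j:UNIV. a l i j *R X i j l) + b l *R Y l)
    = mu *R (SUM j:UNIV. X j j m) + (lam + mu) *R (SUM j:UNIV. X m j j) + (rho * om^2) *R Y m" for X :: "3 => 3 => 3 => complex" and Y
    unfolding a_def b_def using exhaust_3[of m] by (elim disjE) (simp_all add: sum_3 algebra_simps)
   from this[of "%i j l. partial_d i (partial_d j (v l)) y" "%l. v l y"] show ?thesis
    using navier_components(2)[OF sol, of m y] by (simp add: v_def[abs_def])
  qed
  have "(SUM i:UNIV. SUM j:UNIV. a l i j * (4 * s^2 * z $ i * z $ j - 2 * s * (if i = j then 1 else 0))) + b l = K s m l z" for l and z :: "real^3"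
   unfolding a_def b_def K_def norm_sq_vec3 using exhaust_3[of m] exhaust_3[of l] by (elim disjE) (simp_all add: sum_3 algebra_simps power2_eq_square)
  then show ?thesis using weak_equation_kernel[OF v s e, of x] by (simp add: K_def[abs_def])
 qed
 define d where "d s x = (SUM l:UNIV. gauss_transform s (%z. z $ l) (v l) x)" for s x
 define B where "B s x = (SUM l:UNIV. gauss_transform s (%z. (norm z)^2 * z $ l) (v l) x)" for s x
 have sub: "subgaussian (%z. z $ l)" "subgaussian (%z. (norm z)^2 * z $ l)" "subgaussian (%z. (norm z)^2)" for l by (intro subgaussian_intros)+
 \<comment> \<open>The divergence of the tested system: differentiate equation m in x_m and sum.\<close>
 have divWN: "((2 * mu + lam) * 8 * s ^ 3) *R B s x + (?q s) *R d s x = 0" if s: "s > 0" for s x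
 proof -
  define K' where "K' m l j z = 2 * s * z $ j * K s m l z - ((if l = m then 4 * s^2 * mu else 0) * (2 * z $ j) + (lam + mu) * (4 * s^2) * ((if j = m then 1 else 0) * z $ l + z $ m * (if j = l then 1 else 0)))" for m l j and z :: "real^3"
  have subK: "subgaussian (K' m l j)" for m l j unfolding K'_def K_def by (intro subgaussian_intros)
  have z: "(SUM l:UNIV. gauss_transform s (K' m l m) (v l) x) = 0" for m
  proof -
   have "((%x. SUM l:UNIV. gauss_transform s (K s m l) (v l) x) has_derivative (%h. SUM l:UNIV. SUM j:UNIV. h $ j *R gauss_transform s (K' m l j) (v l) x)) (at x)"
    unfolding K'_def K_def[abs_def] by (intro has_derivative_sum gauss_transform_quadratic s v(2))
   also have "(%h::real^3. SUM l:UNIV. SUM j:UNIV. h $ j *R gauss_transform s (K' m l j) (v l) x) = (%h. SUM j:UNIV. h $ j *R (SUM l:UNIV. gauss_transform s (K' m l j) (v l) x))"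
    by (subst sum.swap) (simp add: scaleR_sum_right)
   finally have "partial_d m (%x. SUM l:UNIV. gauss_transform s (K s m l) (v l) x) x = (SUM l:UNIV. gauss_transform s (K' m l m) (v l) x)"
    by (rule partial_d_eq)
   then show ?thesis unfolding WN[OF s] by (simp add: partial_d_def vector_derivative_const_at)
  qed
  have "0 = (SUM m:UNIV. SUM l:UNIV. gauss_transform s (K' m l m) (v l) x)" by (simp add: z)
  also have "... = (SUM l:UNIV. SUM m:UNIV. gauss_transform s (K' m l m) (v l) x)" by (rule sum.swap)
  also have "... = (SUM l:UNIV. gauss_transform s (%z. SUM m:UNIV. K' m l m z) (v l) x)"
   by (intro sum.cong refl gauss_transform_sum[symmetric] s subK v(2))
  also have "... = (SUM l:UNIV. gauss_transform s (%z. ((2 * mu + lam) * 8 * s ^ 3) * ((norm z)^2 * z $ l) + (?q s) * z $ l) (v l) x)"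
  proof (intro sum.cong refl)
   fix l :: 3
   have "(SUM m:UNIV. K' m l m z) = ((2 * mu + lam) * 8 * s ^ 3) * ((norm z)^2 * z $ l) + (?q s) * z $ l" for z
    unfolding K'_def K_def norm_sq_vec3 using exhaust_3[of l] by (elim disjE) (simp_all add: sum_3 algebra_simps power2_eq_square power3_eq_cube)
   then show "gauss_transform s (%z. SUM m:UNIV. K' m l m z) (v l) x = gauss_transform s (%z. ((2 * mu + lam) * 8 * s ^ 3) * ((norm z)^2 * z $ l) + (?q s) * z $ l) (v l) x"
    by simp
  qed
  also have "... = ((2 * mu + lam) * 8 * s ^ 3) *R B s x + (?q s) *R d s x"
   unfolding gauss_transform_linear[OF s sub(2,1) v(2)] B_def d_def by (simp add: sum.distrib scaleR_sum_right)
  finally show ?thesis by simp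
 qed
 define D where "D s x = (SUM l:UNIV. gauss_transform s (%z. 2 * s * z $ l) (v l) x)" for s x
 have Dd: "D s x = (2 * s) *R d s x" if "s > 0" for s x
  unfolding D_def d_def scaleR_sum_right by (intro sum.cong refl gauss_transform_cmult that sub v(2))
 have D_ode: "((%s. D s x) has_vector_derivative (kp^2 / (4 * s^2) - 3 / (2 * s)) *R D s x) (at s)" if s: "s > 0" for s x
 proof -
  have dB: "((%s. d s x) has_vector_derivative (SUM l:UNIV. - gauss_transform s (%z. (norm z)^2 * z $ l) (v l) x)) (at s)"
   unfolding d_def by (intro has_vector_derivative_sum gauss_transform_has_derivative_scale s sub v(2))
  have "((%s::real. 2 * s) has_real_derivative 2) (at s)" by (auto intro!: derivative_eq_intros)
  from has_vector_derivative_scaleR[OF this dB]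
  have "((%s. (2 * s) *R d s x) has_vector_derivative (2 * s) *R - B s x + 2 *R d s x) (at s)" by (simp add: B_def sum_negf)
  moreover have "(2 * s) *R - B s x + 2 *R d s x = (kp^2 / (4 * s^2) - 3 / (2 * s)) *R D s x"
  proof -
   let ?A = "(2 * mu + lam) * 8 * s ^ 3" and ?C = "2 * s * rho * om^2 - (2 * mu + lam) * 20 * s^2"
   have A: "?A ~= 0" using s mu by simp
   have "?A *R B s x = - (?C *R d s x)" using divWN[OF s, of x] by (simp add: add_eq_0_iff)
   then have "(1 / ?A) *R (?A *R B s x) = (1 / ?A) *R - (?C *R d s x)" by (rule arg_cong)
   then have "B s x = (- (?C / ?A)) *R d s x" using A by simp
   moreover have "?C / ?A = kp^2 / (4 * s^2) - 5 / (2 * s)"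
   proof -
    have "(2 * s * rho * om^2 - M * 20 * s^2) / (M * 8 * s ^ 3) = (om^2 * rho / M) / (4 * s^2) - 5 / (2 * s)" if "M ~= 0" for M
     using that s by (simp add: field_simps power2_eq_square power3_eq_cube)
    note q = this
    show ?thesis unfolding kp(2) by (rule q) (use mu in simp)
   qed
   ultimately have Bd: "B s x = (- (kp^2 / (4 * s^2) - 5 / (2 * s))) *R d s x" by (simp only:)
   have c: "(2 * s) * (c - 5 / (2 * s)) + 2 = (c - 3 / (2 * s)) * (2 * s)" for c using s by (simp add: field_simps)
   have "(2 * s) *R - B s x + 2 *R d s x = ((2 * s) * (kp^2 / (4 * s^2) - 5 / (2 * s)) + 2) *R d s x"
   proof -
    have "a *R - ((- c) *R y) + 2 *R y = (a * c + 2) *R y" for a c and y :: complex by (simp add: algebra_simps)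
    then show ?thesis unfolding Bd .
   qed
   then show ?thesis unfolding c Dd[OF s] by simp
  qed
  ultimately have "((%s. (2 * s) *R d s x) has_vector_derivative (kp^2 / (4 * s^2) - 3 / (2 * s)) *R D s x) (at s)" by simp
  then show ?thesis by (rule has_vector_derivative_transform_within_open[where S = "{0<..}"]) (use s in \<open>auto simp: Dd\<close>)
 qed
 \<comment> \<open>The divergence of the convolution, freed from its dependence on s.\<close>
 define \<Psi> where "\<Psi> x = (1 / gauss_factor kp 1) *R D 1 x" for x
 have D: "D s x = gauss_factor kp s *R \<Psi> x" if "s > 0" for s x
  unfolding \<Psi>_def by (rule gauss_factor_ode[OF D_ode that])
 define e where "e s m l z = 2 * s * z $ m * (2 * s * z $ l) - 2 * s * (if m = l then 1 else 0)" for s m l and z :: "real^3"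
 define E where "E s m x = (SUM l:UNIV. gauss_transform s (e s m l) (v l) x)" for s m x
 have sube: "subgaussian (e s m l)" for s m l unfolding e_def by (intro subgaussian_intros)
 have D': "(D s has_derivative (%h. SUM j:UNIV. h $ j *R E s j x)) (at x)" if s: "s > 0" for s x
 proof -
  have d1: "((%z. 2 * s * z $ j) has_derivative (%h. SUM i:UNIV. h $ i * (2 * s * (if i = j then 1 else 0)))) (at z)" for j and z :: "real^3"
   using has_derivative_mult_right[OF has_derivative_component_sum[of j z], of "2 * s"] by (simp add: sum_distrib_left mult_ac)
  have "((%x. SUM l:UNIV. gauss_transform s (%z. 2 * s * z $ l) (v l) x) has_derivative (%h. SUM l:UNIV. SUM j:UNIV. h $ j *R gauss_transform s (e s j l) (v l) x)) (at x)"
   unfolding e_def by (intro has_derivative_sum gauss_transform_has_derivative[OF s _ _ d1 v(2)] subgaussian_intros)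
  also have "(%h::real^3. SUM l:UNIV. SUM j:UNIV. h $ j *R gauss_transform s (e s j l) (v l) x) = (%h. SUM j:UNIV. h $ j *R E s j x)"
   by (subst sum.swap) (simp add: scaleR_sum_right E_def)
  finally show ?thesis by (simp add: D_def[abs_def])
 qed
 have \<Psi>': "\<Psi> differentiable (at x)" for x
 proof -
  have "(\<Psi> has_derivative (%h. (1 / gauss_factor kp 1) *R (SUM j:UNIV. h $ j *R E 1 j x))) (at x)"
   unfolding \<Psi>_def[abs_def] by (intro has_derivative_scaleR_right D') simp
  then show ?thesis by (auto simp: differentiable_def)
 qed
 have E: "E s m x = gauss_factor kp s *R partial_d m \<Psi> x" if s: "s > 0" for s m x
 proof -
  have "D s = (%x. gauss_factor kp s *R \<Psi> x + 0 *R \<Psi> x)" using D[OF s] by auto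
  then have "partial_d m (D s) x = gauss_factor kp s *R partial_d m \<Psi> x + 0 *R partial_d m \<Psi> x"
   by (simp only: partial_d_linear[OF \<Psi>' \<Psi>'])
  then show ?thesis using partial_d_eq[OF D'[OF s], of m x] by simp
 qed
 \<comment> \<open>The multiple of the gradient that is a particular solution of the equation for T in s.\<close>
 define P where "P m x = - ((1 / kp^2) *R partial_d m \<Psi> x)" for m x
 define T where "T m s x = gauss_conv s (v m) x" for m s x
 define N where "N m s x = gauss_transform s (%z. (norm z)^2) (v m) x" for m s x
 have WN': "(4 * s^2 * mu) *R N m s x + (?h s) *R T m s x + (lam + mu) *R E s m x = 0" if s: "s > 0" for s m x
 proof -
  have subH: "subgaussian (%z. (4 * s^2 * mu) * (norm z)^2 + (?h s) * 1)" by (intro subgaussian_intros)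
  have Kdec: "K s m l = (%z. (if l = m then 1 else 0) * ((4 * s^2 * mu) * (norm z)^2 + (?h s) * 1) + (lam + mu) * e s m l z)" for l
   unfolding K_def e_def by (auto simp: fun_eq_iff algebra_simps power2_eq_square)
  have "gauss_transform s (K s m l) (v l) x = (if l = m then 1 else 0) *R ((4 * s^2 * mu) *R N l s x + (?h s) *R T l s x) + (lam + mu) *R gauss_transform s (e s m l) (v l) x" for l
   unfolding Kdec gauss_transform_linear[OF s subH sube v(2)] gauss_transform_linear[OF s sub(3) subgaussian_const v(2)] N_def T_def ..
  then have "(SUM l:UNIV. (if l = m then 1 else 0) *R ((4 * s^2 * mu) *R N l s x + (?h s) *R T l s x)) + (lam + mu) *R E s m x = 0"
   using WN[OF s, of m x] by (simp add: sum.distrib scaleR_sum_right E_def)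
  moreover have "(SUM l:UNIV. (if l = m then 1 else 0) *R X l) = X m" for X :: "3 => complex" using exhaust_3[of m] by (auto simp: sum_3)
  ultimately show ?thesis by simp
 qed
 \<comment> \<open>Subtracting the particular solution leaves the homogeneous equation with wave number ks.\<close>
 define V where "V m s x = T m s x - gauss_factor kp s *R P m x" for m s x
 have V_ode: "((%s. V m s x) has_vector_derivative (ks^2 / (4 * s^2) - 3 / (2 * s)) *R V m s x) (at s)" if s: "s > 0" for s m x
 proof -
  let ?w = "gauss_factor kp s"
  have T': "((%s. T m s x) has_vector_derivative - N m s x) (at s)"
   using gauss_transform_has_derivative_scale[OF s subgaussian_const[of 1] v(2)[of m], of x] by (simp add: T_def N_def)
  have "((%s. V m s x) has_vector_derivative - N m s x - (?w * (kp^2 / (4 * s^2) - 3 / (2 * s))) *R P m x) (at s)"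
   using has_vector_derivative_diff[OF T' has_vector_derivative_scaleR[OF gauss_factor_has_derivative[OF s, of kp] has_vector_derivative_const[of "P m x"]]]
   by (simp add: V_def)
  moreover have "- N m s x - (?w * (kp^2 / (4 * s^2) - 3 / (2 * s))) *R P m x = (ks^2 / (4 * s^2) - 3 / (2 * s)) *R V m s x"
  proof -
   have a: "4 * s^2 * mu ~= 0" using s mu by simp
   have "E s m x = (- (?w * kp^2)) *R P m x" using kp(1) by (simp add: E[OF s] P_def)
   then have "(4 * s^2 * mu) *R - N m s x = (?h s) *R T m s x - ((lam + mu) * (?w * kp^2)) *R P m x"
    using WN'[OF s, of m x] by (simp add: algebra_simps add_eq_0_iff)
   then have "(1 / (4 * s^2 * mu)) *R ((4 * s^2 * mu) *R - N m s x) = (1 / (4 * s^2 * mu)) *R ((?h s) *R T m s x - ((lam + mu) * (?w * kp^2)) *R P m x)"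
    by (rule arg_cong)
   then have N: "- N m s x = ((?h s) / (4 * s^2 * mu)) *R T m s x - ((lam + mu) * (?w * kp^2) / (4 * s^2 * mu)) *R P m x"
    using a by (simp add: scaleR_diff_right)
   have c1: "(?h s) / (4 * s^2 * mu) = ks^2 / (4 * s^2) - 3 / (2 * s)"
    unfolding ks using s mu by (simp add: field_simps power2_eq_square)
   have "kp^2 * (2 * mu + lam) = ks^2 * mu" unfolding kp(2) ks using mu by simp
   then have lm: "(lam + mu) * kp^2 = (ks^2 - kp^2) * mu" by (simp add: algebra_simps)
   have "(lam + mu) * (?w * kp^2) / (4 * s^2 * mu) = ?w * ((ks^2 - kp^2) * mu) / (4 * s^2 * mu)"
    by (simp only: mult.left_commute[of "lam + mu" ?w] lm)
   also have "... = ?w * (ks^2 / (4 * s^2) - kp^2 / (4 * s^2))" using mu by (simp add: diff_divide_distrib[symmetric])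
   finally have c2: "(lam + mu) * (?w * kp^2) / (4 * s^2 * mu) = ?w * (ks^2 / (4 * s^2) - kp^2 / (4 * s^2))" .
   have "c *R t - (w * (a - b)) *R p - (w * (b - r)) *R p = c *R t - ((a - r) * w) *R p" for a b c r w and t p :: complex by (simp add: algebra_simps)
   then show ?thesis unfolding N c1 c2 V_def by (simp add: scaleR_diff_right)
  qed
  ultimately show ?thesis by simp
 qed
 define S where "S m x = (1 / gauss_factor ks 1) *R V m 1 x" for m x
 have T: "T m s x = gauss_factor kp s *R P m x + gauss_factor ks s *R S m x" if s: "s > 0" for m s x
  using gauss_factor_ode[OF V_ode s, of m x] by (simp add: V_def S_def diff_eq_eq add.commute)
 have vPS: "v m x = P m x + S m x" for m x
 proof -
  have "((%s. (1 / sqrt (pi / s) ^ 3 * gauss_factor kp s) *R P m x + (1 / sqrt (pi / s) ^ 3 * gauss_factor ks s) *R S m x) \<longlongrightarrow> 1 *R P m x + 1 *R S m x) at_top"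
   by (intro tendsto_intros gauss_factor_limit)
  moreover have "\<forall>\<^sub>F s in at_top. (1 / sqrt (pi / s) ^ 3 * gauss_factor kp s) *R P m x + (1 / sqrt (pi / s) ^ 3 * gauss_factor ks s) *R S m x = (1 / sqrt (pi / s) ^ 3) *R gauss_conv s (v m) x"
   using eventually_gt_at_top[of 0] by eventually_elim (simp add: T[unfolded T_def] scaleR_add_right)
  ultimately have "((%s. (1 / sqrt (pi / s) ^ 3) *R gauss_conv s (v m) x) \<longlongrightarrow> 1 *R P m x + 1 *R S m x) at_top"
   by (rule Lim_transform_eventually)
  then show ?thesis using tendsto_unique[OF _ gauss_transform_limit[OF v(2)[of m], of x]] by auto
 qed
 have v_eq: "v l = (%y. u y $ l)" for l by (simp add: v_def[abs_def])
 show ?thesis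
 proof (rule that)
  show "gauss_conv s (%y. u y $ m) x = gauss_factor kp s *R P m x + gauss_factor ks s *R S m x" if "s > 0" for m s x
   using T[OF that] by (simp add: T_def v_eq)
  show "u x $ m = P m x + S m x" for m x using vPS by (simp add: v_def)
  show "(SUM l:UNIV. partial_d l (gauss_conv s (%y. u y $ l)) x) = gauss_factor kp s *R \<Psi> x" if "s > 0" for s x
   using D[OF that] by (simp add: D_def gauss_transform_jet(1)[OF that v(2)] flip: v_eq)
  show "P m x = - ((1 / kp^2) *R partial_d m \<Psi> x)" for m x by (rule P_def)
 qed
qed

text \<open>The component \<open>\<xi> . a\<close> of a vector density, given as a family of scalar densities.\<close>

definition radial_part :: "(3 => real^3 => complex) => real^3 => complex" where
 "radial_part a xi = (SUM l:UNIV. cor (xi $ l) * a l xi)"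

lemma L2s_sum: "(!!l. l \<in> A ==> L2s (f l)) ==> L2s (%xi. \<Sum>l\<in>A. f l xi)"
proof (induction A rule: infinite_finite_induct)
 case (insert x F)
 then show ?case using L2s_add[of "f x" "%xi. \<Sum>l\<in>F. f l xi"] by simp
qed (simp_all add: L2s_def)

lemma herglotz_sum:
 assumes "!!l. L2s (f l)"
 shows "herglotz k (%xi. \<Sum>l\<in>(UNIV :: 3 set). f l xi) x = (SUM l:UNIV. herglotz k (f l) x)"
 unfolding herglotz_def sum_distrib_left by (rule Bintegral_sum) (rule herglotz_integrable[OF assms])

lemma radial_part_L2s: "(!!l. L2s (a l)) ==> L2s (radial_part a)" unfolding radial_part_def[abs_def] by (intro L2s_sum L2s_component)

lemma herglotz_divergence:
 assumes a: "!!l. L2s (a l)"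
 shows "(SUM l:UNIV. partial_d l (herglotz k (a l)) x) = herglotz k (%xi. (\<i> * cor k) * radial_part a xi) x"
 unfolding herglotz_partial[OF a] radial_part_def sum_distrib_left by (rule herglotz_sum[symmetric]) (intro L2s_cmult L2s_component a)

text \<open>Two derivatives multiply a density by \<open>- k^2 \<xi>_m \<xi>_l\<close>, so \<open>- grad div / k^2\<close> projects it onto its radial part.\<close>

lemma herglotz_gradient:
 assumes r: "L2s r" and k: "k > 0"
 shows "- ((1 / k^2) *R partial_d m (herglotz k (%xi. (\<i> * cor k) * r xi)) x) = herglotz k (%xi. cor (xi $ m) * r xi) x"
proof -
 let ?c = "cor (- (1 / k^2))" and ?k = "\<i> * cor k"
 have "- ((1 / k^2) *R partial_d m (herglotz k (%xi. ?k * r xi)) x) = ?c * herglotz k (%xi. ?k * (cor (xi $ m) * (?k * r xi))) x"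
  unfolding herglotz_partial[OF L2s_cmult[OF r]] by (simp add: scaleR_conv_of_real)
 also have "... = herglotz k (%xi. ?c * (?k * (cor (xi $ m) * (?k * r xi)))) x" by (rule herglotz_cmult[symmetric])
 also have "(%xi. ?c * (?k * (cor (xi $ m) * (?k * r xi)))) = (%xi. cor (xi $ m) * r xi)"
 proof
  fix xi
  have 1: "?c * (?k * ?k) = 1" using k by (simp add: power2_eq_square)
  have "c * (k * (y * (k * r))) = c * (k * k) * (y * r)" for c k y r :: complex by (simp only: mult_ac)
  from this[of ?c ?k "cor (xi $ m)" "r xi"]
  show "?c * (?k * (cor (xi $ m) * (?k * r xi))) = cor (xi $ m) * r xi" unfolding 1 mult_1_left .
 qed
 finally show ?thesis .
qed

lemma herglotz_eqD:
 assumes "L2s f" "L2s g" "k ~= 0" "!!x. herglotz k f x = herglotz k g x"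
 shows "AE xi in S2. f xi = g xi"
proof -
 have "herglotz k (%xi. f xi - g xi) x = 0" for x
  using herglotz_add[OF assms(1) L2s_cmult[OF assms(2), of "-1"], of k x] herglotz_cmult[of k "-1" g x] assms(4)[of x] by simp
 from herglotz_injective[OF L2s_diff[OF assms(1,2)] assms(3) this] show ?thesis by simp
qed

lemma herglotz_exists:
 assumes "k > 0" "reproducing k f" "scalar_norm f < \<infinity>"
 obtains g where "L2s g" "f = herglotz k g"
proof -
 have "scalar_norm f <= ennreal (enn2real (scalar_norm f))" using assms(3) by simp
 from herglotz_lower[OF assms(1,2) this enn2real_nonneg] show ?thesis using that by blast
qed

text \<open>For \<open>kp = ks\<close> the components of \<open>u\<close> themselves are Herglotz waves, and their density is split pointwise. Otherwise the two parts of
the decomposition are Herglotz waves. The first is a gradient and the second is divergence free, which fixes the directions of the densities.\<close>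

lemma navier_patterns_exist:
 fixes u :: "real^3 => complex^3"
 assumes sol: "entire_navier_solution lam mu rho om u"
  and mu: "mu > 0" "2 * mu + lam > 0" and kp: "kp > 0" "kp^2 = om^2 * rho / (2 * mu + lam)"
  and ks: "ks > 0" "ks^2 = om^2 * rho / mu"
  and fin: "!!m. scalar_norm (%y. u y $ m) < \<infinity>"
 obtains a b where "!!m. L2s (a m)" "!!m. L2s (b m)" "!!m x. u x $ m = herglotz kp (a m) x + herglotz ks (b m) x"
  "!!m. AE xi in S2. a m xi = cor (xi $ m) * radial_part a xi"
  "AE xi in S2. radial_part b xi = 0"
proof -
 define v where "v l y = u y $ l" for l y
 have v_eq: "(%y. u y $ l) = v l" for l by (simp add: v_def[abs_def])
 have C2: "C_k 2 (v m)" for m using navier_components(1)[OF sol, of m] by (simp add: v_eq)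
 have gi: "gauss_integrable (v m)" for m
  using scalar_norm_gauss_integrable(1)[OF C_k_2_imp_1[OF C2] fin[unfolded v_eq]] .
 obtain P S \<Psi> where T: "!!m s x. s > 0 ==> gauss_conv s (v m) x = gauss_factor kp s *R P m x + gauss_factor ks s *R S m x"
  and uPS: "!!m x. u x $ m = P m x + S m x"
  and div: "!!s x. s > 0 ==> (SUM l:UNIV. partial_d l (gauss_conv s (v l)) x) = gauss_factor kp s *R \<Psi> x"
  and P\<Psi>: "!!m x. P m x = - ((1 / kp^2) *R partial_d m \<Psi> x)"
  by (rule navier_decomposition[OF sol mu kp ks(2) gi[folded v_eq], unfolded v_eq]) (rule that, blast+)
 show ?thesis
 proof (cases "kp = ks")
  case True
  have "reproducing kp (v m)" for m
   unfolding reproducing_def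
  proof (intro conjI allI impI gi)
   fix s x assume "(s::real) > 0"
   then show "gauss_conv s (v m) x = (sqrt (pi / s) ^ 3 * exp (- (kp^2 / (4 * s)))) *R v m x"
    using T[of s m x] uPS[of x m] by (simp add: True v_def gauss_factor_def scaleR_add_right)
  qed
  then have "\<exists>g. L2s g & v m = herglotz kp g" for m
   using herglotz_exists[OF kp(1) _ fin[unfolded v_eq]] by metis
  then obtain c where c: "!!m. L2s (c m)" "!!m. v m = herglotz kp (c m)" by metis
  define a where "a m xi = cor (xi $ m) * radial_part c xi" for m xi
  define b where "b m xi = c m xi - a m xi" for m xi
  have L: "L2s (a m)" "L2s (b m)" for m
   unfolding a_def b_def by (intro L2s_component L2s_diff radial_part_L2s c)+
  have rad: "radial_part a xi = radial_part c xi" if "norm xi = 1" for xi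
  proof -
   have "(SUM l:UNIV. (xi $ l)^2) = 1" using norm_sq_vec3[of xi] that by simp
   then have "cor (SUM l:UNIV. (xi $ l)^2) = 1" by simp
   moreover have "radial_part a xi = cor (SUM l:UNIV. (xi $ l)^2) * radial_part c xi"
    unfolding radial_part_def[of a] a_def of_real_sum sum_distrib_right by (simp add: power2_eq_square mult.assoc)
   ultimately show ?thesis by simp
  qed
  show ?thesis
  proof (rule that[OF L])
   show "u x $ m = herglotz kp (a m) x + herglotz ks (b m) x" for m x
    using herglotz_add[OF L, of kp m m x] c(2)[of m] by (simp add: True b_def v_def[abs_def] fun_eq_iff)
   show "AE xi in S2. a m xi = cor (xi $ m) * radial_part a xi" for m
    by (rule AE_I2) (simp add: rad a_def)
   show "AE xi in S2. radial_part b xi = 0"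
   proof (rule AE_I2)
    fix xi assume "xi \<in> space S2"
    then have "radial_part a xi = radial_part c xi" using rad by simp
    moreover have "radial_part b xi = radial_part c xi - radial_part a xi"
     unfolding radial_part_def b_def by (simp add: right_diff_distrib sum_subtractf)
    ultimately show "radial_part b xi = 0" by simp
   qed
  qed
 next
  case False
  then have ne: "kp^2 ~= ks\<^sup>2" "ks^2 ~= kp\<^sup>2" using kp(1) ks(1) by (auto simp: power2_eq_iff)
  have lt: "scalar_norm A < \<infinity>" if "scalar_norm A <= ennreal C * scalar_norm (v m)" for A C m
   using that fin[of m] unfolding v_eq by (simp add: ennreal_mult_less_top le_less_trans)
  obtain C1 where C1: "!!f A B. C_k 2 f ==> scalar_norm f < \<infinity> ==>
   (!!s x. s > 0 ==> gauss_conv s f x = gauss_factor kp s *R A x + gauss_factor ks s *R B x) ==>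
   reproducing kp A & scalar_norm A <= ennreal C1 * scalar_norm f" using separated_part[OF ne(1)] by metis
  obtain C2 where C2': "!!f A B. C_k 2 f ==> scalar_norm f < \<infinity> ==>
   (!!s x. s > 0 ==> gauss_conv s f x = gauss_factor ks s *R A x + gauss_factor kp s *R B x) ==>
   reproducing ks A & scalar_norm A <= ennreal C2 * scalar_norm f" using separated_part[OF ne(2)] by metis
  have "\<exists>g. L2s g & P m = herglotz kp g" for m
   using C1[OF C2 fin[unfolded v_eq] T, of m] lt herglotz_exists[OF kp(1)] by metis
  then obtain a where a: "!!m. L2s (a m)" "!!m. P m = herglotz kp (a m)" by metis
  have T': "s > 0 ==> gauss_conv s (v m) x = gauss_factor ks s *R S m x + gauss_factor kp s *R P m x" for m s x
   using T by (simp add: add.commute)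
  have "\<exists>g. L2s g & S m = herglotz ks g" for m
   using C2'[OF C2 fin[unfolded v_eq] T', of m] lt herglotz_exists[OF ks(1)] by metis
  then obtain b where b: "!!m. L2s (b m)" "!!m. S m = herglotz ks (b m)" by metis
  define X Y where "X x = (SUM l:UNIV. partial_d l (P l) x)" and "Y x = (SUM l:UNIV. partial_d l (S l) x)" for x
  have diff: "P l differentiable (at x)" "S l differentiable (at x)" for l x
   using herglotz_has_derivative[OF a(1)] herglotz_has_derivative[OF b(1)] unfolding a(2) b(2) differentiable_def by blast+
  have eq: "gauss_factor kp s *R X x + gauss_factor ks s *R Y x = gauss_factor kp s *R \<Psi> x" if s: "s > 0" for s x
  proof -
   have "gauss_conv s (v l) = (%x. gauss_factor kp s *R P l x + gauss_factor ks s *R S l x)" for l using T[OF s] by auto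
   then show ?thesis using div[OF s, of x] by (simp add: partial_d_linear[OF diff] X_def Y_def sum.distrib scaleR_sum_right)
  qed
  obtain \<alpha> \<beta> where ab: "\<alpha> * gauss_factor kp 1 + \<beta> * gauss_factor kp 2 = 1" "\<alpha> * gauss_factor ks 1 + \<beta> * gauss_factor ks 2 = 0"
   using two_scale_solve[OF ne(1)] by blast
  have X: "X x = \<Psi> x" and Y: "Y x = 0" for x
  proof -
   have e1: "gauss_factor kp 1 *R X x + gauss_factor ks 1 *R Y x = gauss_factor kp 1 *R \<Psi> x" and e2: "gauss_factor kp 2 *R X x + gauss_factor ks 2 *R Y x = gauss_factor kp 2 *R \<Psi> x"
    by (rule eq, simp)+
   have comb: "(\<alpha> * p + \<beta> * q) *R y + (\<alpha> * r + \<beta> * t) *R z = \<alpha> *R (p *R y + r *R z) + \<beta> *R (q *R y + t *R z)" for p q r t and y z :: complex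
    by (simp add: algebra_simps)
   have "X x = (\<alpha> * gauss_factor kp 1 + \<beta> * gauss_factor kp 2) *R X x + (\<alpha> * gauss_factor ks 1 + \<beta> * gauss_factor ks 2) *R Y x" by (simp add: ab)
   also have "... = (\<alpha> * gauss_factor kp 1 + \<beta> * gauss_factor kp 2) *R \<Psi> x" unfolding comb e1 e2 by (simp add: scaleR_add_left)
   finally show "X x = \<Psi> x" by (simp add: ab)
   then have "gauss_factor ks 1 *R Y x = 0" using e1 by simp
   then show "Y x = 0" using gauss_factor_pos[of 1 ks] by simp
  qed
  show ?thesis
  proof (rule that[OF a(1) b(1)])
   show "u x $ m = herglotz kp (a m) x + herglotz ks (b m) x" for m x using uPS[of x m] by (simp add: a b)
   have "herglotz ks (%xi. (\<i> * cor ks) * radial_part b xi) x = 0" for x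
    using Y[of x] unfolding Y_def b(2) herglotz_divergence[OF b(1)] .
   from herglotz_injective[OF L2s_cmult[OF radial_part_L2s[OF b(1)]] _ this] ks
   show "AE xi in S2. radial_part b xi = 0" by simp
   have \<Psi>: "\<Psi> = herglotz kp (%xi. (\<i> * cor kp) * radial_part a xi)" using X unfolding X_def a(2) herglotz_divergence[OF a(1)] by auto
   fix m
   have "herglotz kp (a m) x = herglotz kp (%xi. cor (xi $ m) * radial_part a xi) x" for x
   proof -
    have "herglotz kp (a m) x = - ((1 / kp^2) *R partial_d m (herglotz kp (%xi. (\<i> * cor kp) * radial_part a xi)) x)"
     using P\<Psi>[of m x] unfolding a(2) \<Psi> .
    also have "... = herglotz kp (%xi. cor (xi $ m) * radial_part a xi) x" by (rule herglotz_gradient[OF radial_part_L2s[OF a(1)] kp(1)])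
    finally show ?thesis .
   qed
   then show "AE xi in S2. a m xi = cor (xi $ m) * radial_part a xi"
    using kp(1) by (intro herglotz_eqD[where k = kp, OF a(1) L2s_component[OF radial_part_L2s[OF a(1)]]]) auto
  qed
 qed
qed

section \<open>The spherical gradient in Cartesian coordinates\<close>

lemma hat_nth [simp]:
 "theta_hat th ph $ 1 = cos th * cos ph" "theta_hat th ph $ 2 = cos th * sin ph" "theta_hat th ph $ 3 = - sin th"
 "phi_hat th ph $ 1 = - sin ph" "phi_hat th ph $ 2 = cos ph" "phi_hat th ph $ 3 = 0" by (simp_all add: theta_hat_def phi_hat_def)

lemma hat_derivatives:
 "((%t. r_hat t ph $ i) has_real_derivative theta_hat th ph $ i) (at th)"
 "((%t. theta_hat t ph $ i) has_real_derivative (- r_hat th ph) $ i) (at th)"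
 "((%t. phi_hat t ph $ i) has_real_derivative (0 :: real^3) $ i) (at th)"
 "((%p. r_hat th p $ i) has_real_derivative (sin th *R phi_hat th ph) $ i) (at ph)"
 "((%p. theta_hat th p $ i) has_real_derivative (cos th *R phi_hat th ph) $ i) (at ph)"
 "((%p. phi_hat th p $ i) has_real_derivative (- (sin th *R r_hat th ph + cos th *R theta_hat th ph)) $ i) (at ph)"
proof -
 have "- cos ph = - (sin th * (sin th * cos ph) + cos th * (cos th * cos ph))" "- sin ph = - (sin th * (sin th * sin ph) + cos th * (cos th * sin ph))"
  using sin_cos_squared_add[of th] by algebra+
 then show "((%p. phi_hat th p $ i) has_real_derivative (- (sin th *R r_hat th ph + cos th *R theta_hat th ph)) $ i) (at ph)"
  using exhaust_3[of i] by (auto intro!: derivative_eq_intros)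
qed (use exhaust_3[of i] in \<open>auto intro!: derivative_eq_intros\<close>)

lemma has_vector_derivative_vec3:
 fixes ga :: "real => real^3"
 assumes "!!i. ((%t. ga t $ i) has_real_derivative ga' $ i) (at t)"
 shows "(ga has_vector_derivative ga') (at t)"
proof -
 have "((%t. SUM i:UNIV. ga t $ i *R (axis i 1 :: real^3)) has_vector_derivative (SUM i:UNIV. ga t $ i *R 0 + ga' $ i *R axis i 1)) (at t)"
  by (intro has_vector_derivative_sum has_vector_derivative_scaleR assms has_vector_derivative_const)
 moreover have e: "(SUM i:UNIV. x $ i *R axis i 1) = x" for x :: "real^3" by (simp add: vec_eq_iff forall_3 sum_3 axis_def)
 ultimately show ?thesis by (simp only: scaleR_zero_right add_0_left e)
qed

text \<open>The product rule for a component of \<open>u\<close> along a moving unit vector. The derivatives of the unit vectors produce exactly the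
terms without derivatives that the definition of \<open>sph_grad_coord\<close> subtracts.\<close>

lemma dot_along_curve:
 fixes u :: "real^3 => complex^3" and w ga :: "real => real^3"
 assumes w: "!!i. ((%t. w t $ i) has_real_derivative w' $ i) (at t)"
  and ga: "!!i. ((%t. ga t $ i) has_real_derivative ga' $ i) (at t)"
  and u: "!!i. (%y. u y $ i) differentiable (at (r *R ga t))"
 shows "vector_derivative (%t. dot_rc (w t) (u (r *R ga t))) (at t)
  = dot_rc w' (u (r *R ga t)) + dot_rc (w t) (\<chi> i. SUM k:UNIV. cor (r * ga' $ k) * partial_d k (%y. u y $ i) (r *R ga t))"
proof (rule vector_derivative_at)
 let ?D = "%i. SUM k:UNIV. cor (r * ga' $ k) * partial_d k (%y. u y $ i) (r *R ga t)"
 have "((%t. r *R ga t) has_vector_derivative r *R ga') (at t)"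
  using has_vector_derivative_scaleR[OF DERIV_const[of r] has_vector_derivative_vec3[OF ga]] by simp
 then have path: "((%t. r *R ga t) has_derivative (%h. h *R (r *R ga'))) (at t)" by (simp add: has_vector_derivative_def)
 have ui: "((%t. u (r *R ga t) $ i) has_vector_derivative ?D i) (at t)" for i
 proof -
  have "((%t. u (r *R ga t) $ i) has_derivative (%h. SUM k:UNIV. (h *R (r *R ga')) $ k *R partial_d k (%y. u y $ i) (r *R ga t))) (at t)"
   by (rule has_derivative_compose[OF path differentiable_has_partial_derivative[OF u]])
  moreover have "(h *R (r *R ga')) $ k *R X = h *R (cor (r * ga' $ k) * X)" for h k X
   by (simp only: vector_scaleR_component) (simp add: scaleR_conv_of_real mult.assoc)
  ultimately show ?thesis by (simp only: has_vector_derivative_def scaleR_sum_right)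
 qed
 have "((%t. SUM i:UNIV. cor (w t $ i) * u (r *R ga t) $ i) has_vector_derivative
   (SUM i:UNIV. cor (w t $ i) * ?D i + cor (w' $ i) * u (r *R ga t) $ i)) (at t)"
  by (intro has_vector_derivative_sum has_vector_derivative_mult ui has_vector_derivative_of_real) (use w in \<open>simp add: has_real_derivative_iff_has_vector_derivative\<close>)
 then show "((%t. dot_rc (w t) (u (r *R ga t))) has_vector_derivative dot_rc w' (u (r *R ga t)) + dot_rc (w t) (\<chi> i. ?D i)) (at t)"
  by (simp add: dot_rc_def sum.distrib add.commute)
qed

lemma frame_expansion:
 "dot_rc (r_hat th ph) A * cor (r_hat th ph $ j) + dot_rc (theta_hat th ph) A * cor (theta_hat th ph $ j)
  + dot_rc (phi_hat th ph) A * cor (phi_hat th ph $ j) = A $ j"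
proof -
 have t: "(cor (sin th))^2 + (cor (cos th))^2 = 1" "(cor (sin ph))^2 + (cor (cos ph))^2 = 1" by (simp_all flip: of_real_power of_real_add)
 let ?e = "%j. dot_rc (r_hat th ph) A * cor (r_hat th ph $ j) + dot_rc (theta_hat th ph) A * cor (theta_hat th ph $ j)
  + dot_rc (phi_hat th ph) A * cor (phi_hat th ph $ j)"
 have "?e 1 = A $ 1" "?e 2 = A $ 2" "?e 3 = A $ 3"
  unfolding dot_rc_def sum_3 r_hat_nth hat_nth of_real_mult of_real_minus of_real_0 using t by algebra+
 then show ?thesis using exhaust_3[of j] by (elim disjE) (simp_all only:)
qed

lemma frame_Pythagoras:
 fixes v :: "3 => complex"
 shows "(norm (SUM k:UNIV. cor (r * theta_hat th ph $ k) * v k))^2 + (norm (SUM k:UNIV. cor (r * phi_hat th ph $ k) * v k))^2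
  = angular (r *R r_hat th ph) v"
proof -
 have t: "(sin th)^2 + (cos th)^2 = 1" "(sin ph)^2 + (cos ph)^2 = 1" by simp_all
 have real: "(SUM k:UNIV. r * theta_hat th ph $ k * w k)^2 + (SUM k:UNIV. r * phi_hat th ph $ k * w k)^2 = angular (r *R r_hat th ph) w" for w :: "3 => real"
  unfolding angular_def norm_scaleR norm_r_hat sum_3 real_norm_def power2_abs
   vector_scaleR_component r_hat_nth hat_nth real_scaleR_def mult_1_right using t by algebra
 have c: "(norm (SUM k:UNIV. cor (c k) * v k))^2 = (SUM k:UNIV. c k * Re (v k))^2 + (SUM k:UNIV. c k * Im (v k))^2" for c :: "3 => real"
  by (simp add: cmod_power2)
 show ?thesis unfolding c angular_of_real_parts[of _ v] real[symmetric] by simp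
qed

text \<open>In the moving frame the spherical gradient is \<open>\<theta> \<otimes> A + \<phi> \<otimes> B\<close>, where \<open>A\<close> and \<open>B\<close> are \<open>|x|\<close> times the derivatives of \<open>u\<close> in
the two tangent directions. The hypothesis on \<open>x\<close> excludes a null set that contains the polar axis.\<close>

lemma norm_sph_grad:
 fixes u :: "real^3 => complex^3"
 assumes x: "x $ 1 ~= 0" and u: "!!i. (%y. u y $ i) differentiable (at x)"
 shows "(norm (sph_grad u x))^2 = (SUM i:UNIV. angular x (%k. partial_d k (%y. u y $ i) x))"
proof -
 define r th ph where "r = norm x" and "th = arccos (x $ 3 / norm x)" and "ph = Arg2pi (Complex (x $ 1) (x $ 2))"
 have x0: "x ~= 0" using x by auto
 have xr: "r *R r_hat th ph = x" using spherical_coordinates[OF x0] by (simp add: r_def th_def ph_def)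
 have sin: "sin th ~= 0"
 proof
  assume "sin th = 0"
  then have "(r *R r_hat th ph) $ 1 = 0" by simp
  then show False using x xr by simp
 qed
 define A where "A = (\<chi> i. SUM k:UNIV. cor (r * theta_hat th ph $ k) * partial_d k (%y. u y $ i) x)"
 define B where "B = (\<chi> i. SUM k:UNIV. cor (r * phi_hat th ph $ k) * partial_d k (%y. u y $ i) x)"
 have B': "(\<chi> i. SUM k:UNIV. cor (r * (sin th *R phi_hat th ph) $ k) * partial_d k (%y. u y $ i) x) = cor (sin th) *s B"
  unfolding B_def by (simp add: vec_eq_iff sum_distrib_left mult_ac)
 have ux: "(%y. u y $ i) differentiable (at (r *R r_hat th ph))" for i using u xr by simp
 let ?R = "r_hat th ph" and ?T = "theta_hat th ph" and ?P = "phi_hat th ph"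
 note dT = dot_along_curve[OF _ hat_derivatives(1) ux, unfolded xr, folded A_def]
 note dP = dot_along_curve[OF _ hat_derivatives(4) ux, unfolded xr B']
 have dot: "dot_rc (- a) w = - dot_rc a w" "dot_rc (c *R a) w = cor c * dot_rc a w" "dot_rc (a + b) w = dot_rc a w + dot_rc b w"
  "dot_rc 0 w = 0" "dot_rc a (z *s w) = z * dot_rc a w" for a b w c z
  by (simp_all add: dot_rc_def sum_negf sum_distrib_left mult_ac distrib_left distrib_right sum.distrib)
 have sg: "sph_grad u x = tensor3 (dot_rc ?R A) ?T ?R + tensor3 (dot_rc ?T A) ?T ?T + tensor3 (dot_rc ?P A) ?T ?P
   + tensor3 (dot_rc ?R B) ?P ?R + tensor3 (dot_rc ?T B) ?P ?T + tensor3 (dot_rc ?P B) ?P ?P"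
  unfolding sph_grad_def th_def[symmetric] ph_def[symmetric] unfolding r_def[symmetric] sph_grad_coord_def Let_def xr
   dT[OF hat_derivatives(1)] dT[OF hat_derivatives(2)] dT[OF hat_derivatives(3)]
   dP[OF hat_derivatives(4)] dP[OF hat_derivatives(5)] dP[OF hat_derivatives(6)] dot using sin by (simp add: cot_def field_simps)
 have entry: "sph_grad u x $ i $ j = cor (?T $ i) * A $ j + cor (?P $ i) * B $ j" for i j
  unfolding sg frame_expansion[of th ph A j, symmetric] frame_expansion[of th ph B j, symmetric] by (simp add: tensor3_def distrib_left mult_ac)
 have n3: "(norm M)^2 = (SUM i:UNIV. (norm (M $ i))^2)" for M :: "'b::real_normed_vector ^ 3" by (simp add: norm_vec_def L2_set_def sum_nonneg)
 have t: "(sin th)^2 + (cos th)^2 = 1" "(sin ph)^2 + (cos ph)^2 = 1" by simp_all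
 have col: "(SUM i:UNIV. (norm (cor (?T $ i) * a + cor (?P $ i) * b))^2) = (norm a)^2 + (norm b)^2" for a b
  unfolding sum_3 cmod_power2 plus_complex.sel times_complex.sel Re_complex_of_real Im_complex_of_real hat_nth using t by algebra
 have "(norm (sph_grad u x))^2 = (SUM i:UNIV. SUM j:UNIV. (norm (cor (?T $ i) * A $ j + cor (?P $ i) * B $ j))^2)" unfolding n3 entry ..
 also have "... = (SUM j:UNIV. (norm (A $ j))^2 + (norm (B $ j))^2)" by (subst sum.swap) (simp only: col)
 also have "... = (SUM i:UNIV. angular x (%k. partial_d k (%y. u y $ i) x))" unfolding A_def B_def vec_lambda_beta frame_Pythagoras xr ..
 finally show ?thesis .
qed

lemma H_norm_sq_components:
 fixes u :: "real^3 => complex^3"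
 assumes u: "!!i. C_k 1 (%y. u y $ i)"
 shows "H_norm_sq u = (SUM i:UNIV. scalar_norm (%y. u y $ i))"
proof -
 have ud: "(%y. u y $ i) differentiable (at x)" for i x using u by (auto simp: C_k_1)
 have [measurable]: "(%y. u y $ i) \<in> borel_measurable borel" "partial_d j (%y. u y $ i) \<in> borel_measurable borel" for i j
  using C_k_1_cont[OF u] u by (auto simp: C_k_1 intro: borel_measurable_continuous_onI)
 have [measurable]: "(%x. angular x (%j. partial_d j (%y. u y $ i) x)) \<in> borel_measurable borel" for i
  unfolding angular_eq_rotations by measurable
 have null: "{x::real^3. x $ 1 = 0} \<in> null_sets lborel"
 proof -
  have "negligible {x::real^3. x $ 1 = 0}" by (rule negligible_standard_hyperplane_cart)
  moreover have "{x::real^3. x $ 1 = 0} \<in> sets lborel" by simp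
  ultimately show ?thesis by (simp add: negligible_iff_null_sets null_sets_completion_iff)
 qed
 let ?R = "%x. SUM i:UNIV. ennreal (((norm (u x $ i))^2 + angular x (%j. partial_d j (%y. u y $ i) x)) / bracket3 x)"
 have "H_norm_sq u = (NN x. (?R x))"
  unfolding H_norm_sq_def
 proof (rule nn_integral_cong_AE, rule AE_I'[OF null], rule subsetI, rule CollectI, rule ccontr)
  fix x assume x: "x \<in> {x \<in> space lborel. ennreal (((norm (u x))^2 + (norm (sph_grad u x))^2) / bracket3 x) ~= (?R x)}"
   and x1: "x $ 1 ~= 0"
  have J: "bracket3 x > 0" using japanese_bracket_pos[of x] by simp
  have n3: "(norm (u x))^2 = (SUM i:UNIV. (norm (u x $ i))^2)" by (simp add: norm_vec_def L2_set_def sum_nonneg)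
  have "ennreal (((norm (u x))^2 + (norm (sph_grad u x))^2) / bracket3 x) = (?R x)"
   unfolding norm_sph_grad[OF x1 ud] n3 sum.distrib[symmetric] sum_divide_distrib
   using J angular_nonneg by (subst sum_ennreal) (auto intro!: divide_nonneg_pos add_nonneg_nonneg)
  then show False using x by simp
 qed
 also have "... = (SUM i:UNIV. scalar_norm (%y. u y $ i))" unfolding scalar_H_def by (rule nn_integral_sum) measurable
 finally show ?thesis .
qed

section \<open>Vector densities and the parts of an elastic Herglotz wave function\<close>

lemma vec3_eq_axis_sum: "F = (SUM i:UNIV. axis i (F $ i))" for F :: "complex^3" by (simp add: vec_eq_iff forall_3 sum_3 axis_def)

lemma bounded_linear_axis3: "bounded_linear (axis i :: complex => complex^3)"
 unfolding linear_conv_bounded_linear[symmetric] by (rule linearI) (auto simp: vec_eq_iff axis_def)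

lemma vec3_measurable:
 fixes F :: "'a => complex^3"
 shows "F \<in> borel_measurable M \<longleftrightarrow> (\<forall>i. (%x. F x $ i) \<in> borel_measurable M)"
proof
 assume F: "F \<in> borel_measurable M"
 show "\<forall>i. (%x. F x $ i) \<in> borel_measurable M"
  by (intro allI measurable_compose[OF F] borel_measurable_continuous_onI bounded_linear.continuous_on[OF bounded_linear_vec_nth] continuous_on_id)
next
 assume F: "\<forall>i. (%x. F x $ i) \<in> borel_measurable M"
 have "(%x. axis i (F x $ i)) \<in> borel_measurable M" for i
  by (rule measurable_compose[OF F[rule_format] borel_measurable_continuous_onI[OF bounded_linear.continuous_on[OF bounded_linear_axis3 continuous_on_id]]])
 then have "(%x. SUM i:UNIV. axis i (F x $ i)) \<in> borel_measurable M" by (intro borel_measurable_sum)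
 then show "F \<in> borel_measurable M" by (simp only: vec3_eq_axis_sum[symmetric])
qed

lemma vec3_integral:
 fixes F :: "'a => complex^3"
 assumes "!!i. integrable M (%x. F x $ i)"
 shows "(LINT x|M. F x) $ i = (LINT x|M. F x $ i)"
proof -
 have "integrable M (%x. SUM i:UNIV. axis i (F x $ i))" by (intro Bintegrable_sum integrable_bounded_linear[OF bounded_linear_axis3] assms)
 then have "integrable M F" by (simp only: vec3_eq_axis_sum[symmetric])
 then show ?thesis by (rule integral_bounded_linear[OF bounded_linear_vec_nth, symmetric])
qed

lemma norm_sq_components: "(norm v)^2 = (SUM i:UNIV. (norm (v $ i))^2)" for v :: "complex^3" by (simp add: norm_vec_def L2_set_def sum_nonneg)

lemma L2_sphere_iff: "g \<in> L2_sphere \<longleftrightarrow> (\<forall>i. L2s (%xi. g xi $ i))"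
proof
 assume g: "g \<in> L2_sphere"
 then have gm: "g \<in> borel_measurable S2" "integrable S2 (%xi. (norm (g xi))^2)" by (auto simp: L2_sphere_def)
 then have cm: "(%xi. g xi $ i) \<in> borel_measurable S2" for i by (simp add: vec3_measurable)
 have "integrable S2 (%xi. (norm (g xi $ i))^2)" for i
  by (rule Bintegrable_bound[OF gm(2)]) (use cm[of i] in \<open>auto intro!: power_mono Finite_Cartesian_Product.norm_nth_le\<close>)
 then show "\<forall>i. L2s (%xi. g xi $ i)" using cm by (simp add: L2s_def)
next
 assume "\<forall>i. L2s (%xi. g xi $ i)"
 then show "g \<in> L2_sphere" by (auto simp: L2_sphere_def L2s_def vec3_measurable norm_sq_components)
qed

lemma L2_sphere_norm_eq:
 assumes "g \<in> L2_sphere" shows "L2_sphere_norm g = sqrt (SUM i:UNIV. l2sq (%xi. g xi $ i))"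
 using assms unfolding L2_sphere_iff L2_sphere_norm_def norm_sq_components l2sq_def by (subst Bintegral_sum) (auto simp: L2s_def)

lemma cross_rc_nth [simp]:
 "cross_rc xi v $ 1 = cor (xi $ 2) * v $ 3 - cor (xi $ 3) * v $ 2"
 "cross_rc xi v $ 2 = cor (xi $ 3) * v $ 1 - cor (xi $ 1) * v $ 3"
 "cross_rc xi v $ 3 = cor (xi $ 1) * v $ 2 - cor (xi $ 2) * v $ 1" by (simp_all add: cross_rc_def)

lemma unit_vec3: "norm xi = 1 ==> (cor (xi $ 1))\<^sup>2 + (cor (xi $ 2))^2 + (cor (xi $ 3))^2 = 1" for xi :: "real^3"
 using norm_sq_vec3[of xi] by (simp add: sum_3 flip: of_real_power of_real_add)

lemma cross_rc_eq_0_iff: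
 assumes "norm xi = 1"
 shows "cross_rc xi v = 0 \<longleftrightarrow> (\<forall>m. v $ m = cor (xi $ m) * dot_rc xi v)"
proof
 assume "cross_rc xi v = 0"
 then have "cross_rc xi v $ 1 = 0" "cross_rc xi v $ 2 = 0" "cross_rc xi v $ 3 = 0" by simp_all
 then show "\<forall>m. v $ m = cor (xi $ m) * dot_rc xi v"
  using unit_vec3[OF assms] unfolding cross_rc_nth dot_rc_def sum_3 forall_3 by (intro conjI; algebra)
next
 assume *: "\<forall>m. v $ m = cor (xi $ m) * dot_rc xi v"
 have "a * (b * d) - b * (a * d) = 0" for a b d :: complex by simp
 then show "cross_rc xi v = 0" unfolding vec_eq_iff forall_3 cross_rc_nth using * by simp
qed

lemma cross_rc_twice:
 assumes "norm xi = 1" "dot_rc xi v = 0"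
 shows "cross_rc xi (cross_rc xi v) $ m = - v $ m"
proof -
 have "cross_rc xi (cross_rc xi v) $ 1 = - v $ 1" "cross_rc xi (cross_rc xi v) $ 2 = - v $ 2" "cross_rc xi (cross_rc xi v) $ 3 = - v $ 3"
  using assms(2) unit_vec3[OF assms(1)] unfolding cross_rc_nth dot_rc_def sum_3 by algebra+
 then show ?thesis using exhaust_3[of m] by (elim disjE) (simp_all only:)
qed

text \<open>The far field patterns written as scalar densities, with transversality and longitudinality expressed by \<open>radial_part\<close>.\<close>

definition pattern_components ::
 "real => real => (real^3 => complex^3) => (3 => real^3 => complex) => (3 => real^3 => complex) => bool" where
 "pattern_components kp ks u a b \<longleftrightarrow>
   (\<forall>m. L2s (a m) & L2s (b m)) & (\<forall>x m. u x $ m = herglotz kp (a m) x + herglotz ks (b m) x) &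
   (AE xi in S2. \<forall>m. a m xi = cor (xi $ m) * radial_part a xi) &
   (AE xi in S2. radial_part b xi = 0)"

lemma radial_part_dot: "radial_part a xi = dot_rc xi (\<chi> l. a l xi)" by (simp add: radial_part_def dot_rc_def)

lemma far_field_patterns_iff:
 "far_field_patterns kp ks u g1 g2 \<longleftrightarrow> pattern_components kp ks u (%m xi. g1 xi $ m) (%m xi. g2 xi $ m)"
proof (cases "g1 \<in> L2_sphere & g2 \<in> L2_sphere")
 case True
 then have L: "L2s (%xi. g1 xi $ m)" "L2s (%xi. g2 xi $ m)" for m by (auto simp: L2_sphere_iff)
 let ?e = "%x xi. iexp (kp * (x \<bullet> xi)) *s g1 xi + iexp (ks * (x \<bullet> xi)) *s g2 xi"
 have "(LINT xi|S2. (?e x xi)) $ m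
   = herglotz kp (%xi. g1 xi $ m) x + herglotz ks (%xi. g2 xi $ m) x" for x m
 proof (subst vec3_integral)
  show "integrable S2 (%xi. (?e x xi) $ i)" for i
   unfolding vector_add_component vector_smult_component by (intro Bintegrable_add herglotz_integrable L)
  show "(LINT xi|S2. (?e x xi) $ m)
   = herglotz kp (%xi. g1 xi $ m) x + herglotz ks (%xi. g2 xi $ m) x"
   unfolding vector_add_component vector_smult_component herglotz_def by (intro Bintegral_add herglotz_integrable L)
 qed
 then have "(\<forall>x. u x = (LINT xi|S2. (?e x xi)))
   \<longleftrightarrow> (\<forall>x m. u x $ m = herglotz kp (%xi. g1 xi $ m) x + herglotz ks (%xi. g2 xi $ m) x)" by (simp add: vec_eq_iff)
 moreover have "(AE xi in S2. cross_rc xi (g1 xi) = 0) \<longleftrightarrow> (AE xi in S2. \<forall>m. g1 xi $ m = cor (xi $ m) * radial_part (%m xi. g1 xi $ m) xi)"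
  by (rule AE_cong) (simp add: cross_rc_eq_0_iff radial_part_dot)
 ultimately show ?thesis using True L
  unfolding far_field_patterns_def pattern_components_def L2_sphere_p_def L2_sphere_s_def by (simp add: radial_part_dot) blast
next
 case False
 then show ?thesis by (auto simp: far_field_patterns_def pattern_components_def L2_sphere_p_def L2_sphere_s_def L2_sphere_iff)
qed

lemma herglotz_cong_AE:
 assumes "L2s f" "L2s g" "AE xi in S2. f xi = g xi"
 shows "herglotz k f x = herglotz k g x" unfolding herglotz_def
proof (rule integral_cong_AE)
 show "AE xi in S2. iexp (k * (x \<bullet> xi)) * f xi = iexp (k * (x \<bullet> xi)) * g xi" using assms(3) by eventually_elim simp
qed (intro borel_measurable_integrable herglotz_integrable assms)+

lemma L2s_zero: "L2s (%xi. 0)" by (simp add: L2s_def)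

lemma herglotz_zero: "herglotz k (%xi. 0) x = 0" by (simp add: herglotz_def)

lemma herglotz_diff: "L2s f ==> L2s g ==> herglotz k f x - herglotz k g x = herglotz k (%xi. f xi - g xi) x" unfolding herglotz_def right_diff_distrib
 by (rule Bintegral_diff[symmetric]) (rule herglotz_integrable, assumption)+

lemma herglotz_differentiable: "L2s g ==> herglotz k g differentiable (at x)" using herglotz_has_derivative unfolding differentiable_def by blast

lemma herglotz_C_k_1:
 assumes "L2s g" shows "C_k 1 (herglotz k g)"
proof -
 have "partial_d j (herglotz k g) = herglotz k (%xi. (\<i> * cor k) * (cor (xi $ j) * g xi))" for j
  using herglotz_partial[OF assms] by blast
 then show ?thesis unfolding C_k_1 using herglotz_differentiable[OF assms] herglotz_continuous[OF L2s_cmult[OF L2s_component[OF assms]]] by simp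
qed

lemma herglotz_pair_partial:
 assumes "L2s f" "L2s g"
 shows "partial_d j (%y. herglotz p f y + herglotz q g y) x
  = herglotz p (%xi. (\<i> * cor p) * (cor (xi $ j) * f xi)) x + herglotz q (%xi. (\<i> * cor q) * (cor (xi $ j) * g xi)) x"
 using partial_d_linear[OF herglotz_differentiable[OF assms(1), where k = p and x = x] herglotz_differentiable[OF assms(2), where k = q and x = x], where j = j and a = 1 and b = 1] assms
 by (simp add: herglotz_partial)

lemma cross_rc_L2s: "(!!l. L2s (a l)) ==> L2s (%xi. c * cross_rc xi (\<chi> l. a l xi) $ m)"
 using exhaust_3[of m] by (elim disjE) (simp, intro L2s_cmult L2s_diff L2s_component, assumption+)+

text \<open>Stated for a sum of two waves, because a field and its curl are both of this form.\<close>

lemma curl_herglotz: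
 assumes a: "!!l. L2s (a l)" and b: "!!l. L2s (b l)" and w: "!!x l. w x $ l = herglotz p (a l) x + herglotz q (b l) x"
 shows "curl w x $ m = herglotz p (%xi. (\<i> * cor p) * cross_rc xi (\<chi> l. a l xi) $ m) x
  + herglotz q (%xi. (\<i> * cor q) * cross_rc xi (\<chi> l. b l xi) $ m) x"
proof -
 have h: "herglotz k (%xi. (\<i> * cor k) * (cor (xi $ j) * c l xi)) x - herglotz k (%xi. (\<i> * cor k) * (cor (xi $ j') * c l' xi)) x
  = herglotz k (%xi. (\<i> * cor k) * (cor (xi $ j) * c l xi - cor (xi $ j') * c l' xi)) x" if "!!l. L2s (c l)" for c k j l j' l'
  unfolding right_diff_distrib by (intro herglotz_diff L2s_cmult L2s_component that)
 have "curl w x $ 1 = herglotz p (%xi. (\<i> * cor p) * cross_rc xi (\<chi> l. a l xi) $ 1) x + herglotz q (%xi. (\<i> * cor q) * cross_rc xi (\<chi> l. b l xi) $ 1) x"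
  "curl w x $ 2 = herglotz p (%xi. (\<i> * cor p) * cross_rc xi (\<chi> l. a l xi) $ 2) x + herglotz q (%xi. (\<i> * cor q) * cross_rc xi (\<chi> l. b l xi) $ 2) x"
  "curl w x $ 3 = herglotz p (%xi. (\<i> * cor p) * cross_rc xi (\<chi> l. a l xi) $ 3) x + herglotz q (%xi. (\<i> * cor q) * cross_rc xi (\<chi> l. b l xi) $ 3) x"
  unfolding curl_def vector_3 w herglotz_pair_partial[OF a b] add_diff_add cross_rc_nth vec_lambda_beta h[of a, OF a] h[of b, OF b] by (rule refl)+
 then show ?thesis using exhaust_3[of m] by (elim disjE) (simp_all only:)
qed

lemma compressional_part_herglotz:
 assumes P: "pattern_components kp ks u a b" and kp: "kp > 0"
 shows "compressional_part kp u x $ m = herglotz kp (a m) x"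
proof -
 have a: "!!l. L2s (a l)" and b: "!!l. L2s (b l)" and u: "!!x m. u x $ m = herglotz kp (a m) x + herglotz ks (b m) x"
  and rad: "AE xi in S2. \<forall>m. a m xi = cor (xi $ m) * radial_part a xi" and trans: "AE xi in S2. radial_part b xi = 0"
  using P by (auto simp: pattern_components_def)
 have "divergence u x = herglotz kp (%xi. (\<i> * cor kp) * radial_part a xi) x" for x
 proof -
  have "divergence u x = (SUM l:UNIV. partial_d l (herglotz kp (a l)) x) + (SUM l:UNIV. partial_d l (herglotz ks (b l)) x)"
   unfolding divergence_def u herglotz_pair_partial[OF a b] herglotz_partial[OF a] herglotz_partial[OF b] by (rule sum.distrib)
  also have "(SUM l:UNIV. partial_d l (herglotz ks (b l)) x) = herglotz ks (%xi. 0) x" unfolding herglotz_divergence[OF b]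
   by (intro herglotz_cong_AE L2s_cmult radial_part_L2s b L2s_zero) (use trans in \<open>eventually_elim, simp\<close>)
  finally show ?thesis unfolding herglotz_divergence[OF a] herglotz_zero by simp
 qed
 then have "divergence u = herglotz kp (%xi. (\<i> * cor kp) * radial_part a xi)" by blast
 then have "compressional_part kp u x $ m = herglotz kp (%xi. cor (xi $ m) * radial_part a xi) x"
  using herglotz_gradient[OF radial_part_L2s[OF a] kp, where m = m and x = x] by (simp add: compressional_part_def gradient_def)
 also have "... = herglotz kp (a m) x" by (intro herglotz_cong_AE L2s_component radial_part_L2s a) (use rad in \<open>eventually_elim, metis\<close>)
 finally show ?thesis .
qed

text \<open>The curl removes the radial density, and applying \<open>\<xi> \<times>\<close> twice to a tangential one is multiplication by \<open>-1\<close>.\<close>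

lemma shear_part_herglotz:
 assumes P: "pattern_components kp ks u a b" and ks: "ks > 0"
 shows "shear_part ks u x $ m = herglotz ks (b m) x"
proof -
 have a: "!!l. L2s (a l)" and b: "!!l. L2s (b l)" and u: "!!x m. u x $ m = herglotz kp (a m) x + herglotz ks (b m) x"
  and rad: "AE xi in S2. \<forall>m. a m xi = cor (xi $ m) * radial_part a xi" and trans: "AE xi in S2. radial_part b xi = 0"
  using P by (auto simp: pattern_components_def)
 let ?k = "\<i> * cor ks"
 define c where "c m xi = ?k * cross_rc xi (\<chi> l. b l xi) $ m" for m xi
 have c: "L2s (c m)" for m unfolding c_def by (rule cross_rc_L2s[OF b])
 have curl1: "curl u x $ m = herglotz kp (%xi. 0) x + herglotz ks (c m) x" for x m
 proof -
  have "AE xi in S2. (\<i> * cor kp) * cross_rc xi (\<chi> l. a l xi) $ m = 0" using rad AE_space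
  proof eventually_elim
   case (elim xi)
   have "\<forall>m. (\<chi> l. a l xi) $ m = cor (xi $ m) * dot_rc xi (\<chi> l. a l xi)" using elim(1) unfolding radial_part_dot vec_lambda_beta .
   moreover have "norm xi = 1" using elim(2) by simp
   ultimately have "cross_rc xi (\<chi> l. a l xi) = 0" using cross_rc_eq_0_iff by blast
   then show ?case by simp
  qed
  then have "herglotz kp (%xi. (\<i> * cor kp) * cross_rc xi (\<chi> l. a l xi) $ m) x = herglotz kp (%xi. 0) x"
   by (intro herglotz_cong_AE cross_rc_L2s a L2s_zero)
  then show ?thesis unfolding curl_herglotz[OF a b u] c_def by (simp only:)
 qed
 have z: "cross_rc xi (\<chi> l. 0) $ m = 0" for xi using exhaust_3[of m] by (elim disjE) simp_all
 have "curl (curl u) x $ m = herglotz ks (%xi. ?k * cross_rc xi (\<chi> l. c l xi) $ m) x"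
  unfolding curl_herglotz[OF L2s_zero c curl1] z by (simp add: herglotz_zero)
 also have "... = herglotz ks (%xi. cor (ks^2) * b m xi) x"
 proof (intro herglotz_cong_AE cross_rc_L2s c L2s_cmult b)
  show "AE xi in S2. ?k * cross_rc xi (\<chi> l. c l xi) $ m = cor (ks^2) * b m xi" using trans AE_space
  proof eventually_elim
   case (elim xi)
   have "(\<chi> l. c l xi) = ?k *s cross_rc xi (\<chi> l. b l xi)" by (simp add: vec_eq_iff c_def)
   moreover have "cross_rc xi (z *s v) $ m = z * cross_rc xi v $ m" for z v
    using exhaust_3[of m] by (elim disjE) (simp_all add: algebra_simps)
   ultimately have "?k * cross_rc xi (\<chi> l. c l xi) $ m = ?k * (?k * cross_rc xi (cross_rc xi (\<chi> l. b l xi)) $ m)" by simp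
   also have "cross_rc xi (cross_rc xi (\<chi> l. b l xi)) $ m = - (b m xi)" using elim by (subst cross_rc_twice) (simp_all add: radial_part_dot)
   also have "?k * (?k * - (b m xi)) = - ((?k * ?k) * b m xi)" by (simp only: mult_minus_right mult.assoc)
   also have "?k * ?k = - cor (ks^2)" by (simp add: complex_eq_iff power2_eq_square)
   also have "- (- cor (ks^2) * b m xi) = cor (ks^2) * b m xi" by simp
   finally show ?case .
  qed
 qed
 also have "... = cor (ks^2) * herglotz ks (b m) x" by (rule herglotz_cmult)
 finally have c: "curl (curl u) x $ m = cor (ks^2) * herglotz ks (b m) x" .
 show ?thesis unfolding shear_part_def vector_scaleR_component c using ks by (simp add: scaleR_conv_of_real)
qed

section \<open>Norm equivalences\<close>

text \<open>The constants of \<open>herglotz_upper\<close> and \<open>herglotz_lower\<close>.\<close>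

definition upper_const :: "real => real" where
 "upper_const k = 2 * sqrt 2 * exp 1 * (k^2 + 60 * sqrt 2) * (4 * pi^2 * sqrt pi / k^2)"

definition lower_const :: "real => real" where
 "lower_const k = 2 * (2 + 100 * exp 1 / k^2) / herglotz_const k"

lemma const_nonneg: "upper_const k >= 0" "k > 0 ==> lower_const k >= 0"
 using herglotz_const_pos[of k] by (auto simp: upper_const_def lower_const_def intro!: mult_nonneg_nonneg divide_nonneg_nonneg add_nonneg_nonneg)

lemma scalar_norm_herglotz_le:
 "k > 0 ==> L2s g ==> scalar_norm (herglotz k g) <= ennreal (upper_const k * l2sq g)"
 using herglotz_upper[of k g] by (simp add: upper_const_def mult.assoc)

lemma l2sq_le_scalar_norm:
 assumes k: "k > 0" and g: "L2s g"
 shows "ennreal (l2sq g) <= ennreal (lower_const k) * scalar_norm (herglotz k g)"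
proof -
 have fin: "scalar_norm (herglotz k g) < \<infinity>" using scalar_norm_herglotz_le[OF k g] by (simp add: le_less_trans)
 then have N: "scalar_norm (herglotz k g) = ennreal (enn2real (scalar_norm (herglotz k g)))" by simp
 obtain g' where g': "L2s g'" "herglotz k g = herglotz k g'" "l2sq g' <= 2 * (2 + 100 * exp 1 / k^2) / herglotz_const k * enn2real (scalar_norm (herglotz k g))"
  using herglotz_lower[OF k herglotz_reproducing[OF g] _ enn2real_nonneg[of "scalar_norm (herglotz k g)"]] N by (metis order_refl)
 have "AE xi in S2. g xi = g' xi" using herglotz_eqD[OF g g'(1), of k] g'(2) k by simp
 then have "l2sq g = l2sq g'" unfolding l2sq_def using g g'(1) by (intro integral_cong_AE) (auto simp: L2s_def)
 then have "ennreal (l2sq g) <= ennreal (lower_const k * enn2real (scalar_norm (herglotz k g)))"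
  using g'(3) by (intro ennreal_leI) (simp add: lower_const_def)
 then show ?thesis using N const_nonneg(2)[OF k] by (simp add: ennreal_mult)
qed

lemma scalar_norm_add_le:
 assumes "C_k 1 f" "C_k 1 g" "scalar_norm f <= ennreal A" "scalar_norm g <= ennreal B" "A >= 0" "B >= 0"
 shows "scalar_norm (%x. f x + g x) <= ennreal (2 * A + 2 * B)"
proof -
 have "scalar_norm (%x. f x + g x) <= ennreal 2 * scalar_norm f + ennreal 2 * scalar_norm g" using scalar_norm_linear[OF assms(1,2), of 1 1] by simp
 also have "... <= ennreal 2 * ennreal A + ennreal 2 * ennreal B" using assms by (intro add_mono mult_left_mono) auto
 also have "... = ennreal (2 * A + 2 * B)" using assms by (simp add: ennreal_mult ennreal_plus)
 finally show ?thesis .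
qed

lemma pattern_upper:
 assumes P: "pattern_components kp ks u a b" and k: "kp > 0" "ks > 0"
 shows "H_norm_sq u <= ennreal (2 * upper_const kp * (SUM m:UNIV. l2sq (a m)) + 2 * upper_const ks * (SUM m:UNIV. l2sq (b m)))"
proof -
 have a: "!!l. L2s (a l)" and b: "!!l. L2s (b l)" and u: "!!x m. u x $ m = herglotz kp (a m) x + herglotz ks (b m) x"
  using P by (auto simp: pattern_components_def)
 have C1: "C_k 1 (%y. u y $ m)" for m
  unfolding u using C_k_1_linear[OF herglotz_C_k_1[OF a[of m], of kp] herglotz_C_k_1[OF b[of m], of ks], where a = 1 and b = 1] by simp
 have le: "scalar_norm (%y. u y $ m) <= ennreal (2 * (upper_const kp * l2sq (a m)) + 2 * (upper_const ks * l2sq (b m)))" for m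
  unfolding u by (intro scalar_norm_add_le herglotz_C_k_1 scalar_norm_herglotz_le a b k mult_nonneg_nonneg const_nonneg l2sq_nonneg)
 have "H_norm_sq u <= (SUM m:UNIV. ennreal (2 * (upper_const kp * l2sq (a m)) + 2 * (upper_const ks * l2sq (b m))))"
  unfolding H_norm_sq_components[OF C1] by (intro sum_mono le)
 also have "... = ennreal (SUM m:UNIV. 2 * (upper_const kp * l2sq (a m)) + 2 * (upper_const ks * l2sq (b m)))"
  by (rule sum_ennreal) (intro add_nonneg_nonneg mult_nonneg_nonneg const_nonneg l2sq_nonneg, simp_all)
 finally show ?thesis by (simp add: sum.distrib sum_distrib_left mult.assoc)
qed

lemma herglotz_vector_lower:
 assumes a: "!!m. L2s (a m)" and w: "!!x m. w x $ m = herglotz k (a m) x" and k: "k > 0"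
 shows "ennreal (SUM m:UNIV. l2sq (a m)) <= ennreal (lower_const k) * H_norm_sq w"
proof -
 have "H_norm_sq w = (SUM m:UNIV. scalar_norm (herglotz k (a m)))" using H_norm_sq_components[of w] herglotz_C_k_1[OF a] by (simp add: w)
 moreover have "ennreal (SUM m:UNIV. l2sq (a m)) = (SUM m:UNIV. ennreal (l2sq (a m)))" by (simp add: sum_ennreal l2sq_nonneg)
 moreover have "(SUM m:UNIV. ennreal (l2sq (a m))) <= (SUM m:UNIV. ennreal (lower_const k) * scalar_norm (herglotz k (a m)))"
  by (intro sum_mono l2sq_le_scalar_norm k a)
 ultimately show ?thesis by (simp add: sum_distrib_left)
qed

text \<open>Radial and tangential vectors are orthogonal; this replaces the separation of wave numbers when \<open>kp = ks\<close>.\<close>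

lemma orthogonal_parts:
 fixes xi :: "real^3"
 assumes "!!m. \<alpha> m = cor (xi $ m) * \<rho>" "(SUM l:UNIV. cor (xi $ l) * \<beta> l) = 0"
 shows "(SUM m:UNIV. (norm (\<alpha> m + \<beta> m))^2) = (SUM m:UNIV. (norm (\<alpha> m))^2) + (SUM m:UNIV. (norm (\<beta> m))^2)"
proof -
 have "Re (SUM l:UNIV. cor (xi $ l) * \<beta> l) = 0" "Im (SUM l:UNIV. cor (xi $ l) * \<beta> l) = 0" using assms(2) by simp_all
 then have "xi $ 1 * Re (\<beta> 1) + xi $ 2 * Re (\<beta> 2) + xi $ 3 * Re (\<beta> 3) = 0" "xi $ 1 * Im (\<beta> 1) + xi $ 2 * Im (\<beta> 2) + xi $ 3 * Im (\<beta> 3) = 0"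
  by (simp_all add: sum_3)
 then show ?thesis unfolding assms(1) sum_3 cmod_power2 plus_complex.sel times_complex.sel Re_complex_of_real Im_complex_of_real by algebra
qed

text \<open>The patterns are bounded by \<open>u\<close> with a constant independent of \<open>u\<close>. For different wave numbers this applies
\<open>separated_part\<close> to the given splitting, since Herglotz waves are reproducing.\<close>

lemma pattern_lower:
 assumes k: "kp > 0" "ks > 0"
 obtains L where "L >= 0" "!!u a b. (!!m. C_k 2 (%y. u y $ m)) ==> pattern_components kp ks u a b ==>
  ennreal ((SUM m:UNIV. l2sq (a m)) + (SUM m:UNIV. l2sq (b m))) <= ennreal L * H_norm_sq u"
proof (cases "kp = ks")
 case True
 show ?thesis
 proof (rule that[OF const_nonneg(2)[OF k(1)]])
  fix u a b assume "!!m. C_k 2 (%y. u y $ m)" and P: "pattern_components kp ks u a b"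
  have a: "!!l. L2s (a l)" and b: "!!l. L2s (b l)" and u: "!!x m. u x $ m = herglotz kp (a m) x + herglotz ks (b m) x"
   and rad: "AE xi in S2. \<forall>m. a m xi = cor (xi $ m) * radial_part a xi" and trans: "AE xi in S2. radial_part b xi = 0"
   using P by (auto simp: pattern_components_def)
  have ab: "L2s (%xi. a m xi + b m xi)" for m by (rule L2s_add[OF a b])
  have u': "u x $ m = herglotz kp (%xi. a m xi + b m xi) x" for x m by (simp add: u True[symmetric] herglotz_add[OF a b])
  have i: "integrable S2 (%xi. (norm (c xi))^2)" if "L2s c" for c using that by (simp add: L2s_def)
  have "(SUM m:UNIV. l2sq (%xi. a m xi + b m xi)) = (LINT xi|S2. (SUM m:UNIV. (norm (a m xi + b m xi))^2))"
   unfolding l2sq_def by (rule Bintegral_sum[symmetric]) (rule i[OF ab])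
  also have "... = (LINT xi|S2. (SUM m:UNIV. (norm (a m xi))^2) + (SUM m:UNIV. (norm (b m xi))^2))"
  proof (rule integral_cong_AE)
   show "AE xi in S2. (SUM m:UNIV. (norm (a m xi + b m xi))^2) = (SUM m:UNIV. (norm (a m xi))^2) + (SUM m:UNIV. (norm (b m xi))^2)" using rad trans
   proof eventually_elim
    case (elim xi)
    show ?case by (rule orthogonal_parts[OF elim(1)[rule_format] elim(2)[unfolded radial_part_def]])
   qed
  qed (intro borel_measurable_integrable Bintegrable_add Bintegrable_sum i ab a b)+
  also have "... = (SUM m:UNIV. l2sq (a m)) + (SUM m:UNIV. l2sq (b m))"
   unfolding l2sq_def by (simp only: Bintegral_add Bintegral_sum Bintegrable_sum i a b)
  finally show "ennreal ((SUM m:UNIV. l2sq (a m)) + (SUM m:UNIV. l2sq (b m))) <= ennreal (lower_const kp) * H_norm_sq u"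
   using herglotz_vector_lower[OF ab u' k(1)] by simp
 qed
next
 case False
 then have ne: "kp^2 ~= ks\<^sup>2" "ks^2 ~= kp\<^sup>2" using k by (auto simp: power2_eq_iff)
 obtain C1 where C1: "C1 >= 0" "!!f A B. C_k 2 f ==> scalar_norm f < \<infinity> ==>
   (!!s x. s > 0 ==> gauss_conv s f x = gauss_factor kp s *R A x + gauss_factor ks s *R B x) ==>
   reproducing kp A & scalar_norm A <= ennreal C1 * scalar_norm f" using separated_part[OF ne(1)] by metis
 obtain C2 where C2: "C2 >= 0" "!!f A B. C_k 2 f ==> scalar_norm f < \<infinity> ==>
   (!!s x. s > 0 ==> gauss_conv s f x = gauss_factor ks s *R A x + gauss_factor kp s *R B x) ==>
   reproducing ks A & scalar_norm A <= ennreal C2 * scalar_norm f" using separated_part[OF ne(2)] by metis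
 note lc = const_nonneg(2)[OF k(1)] const_nonneg(2)[OF k(2)]
 show ?thesis
 proof (rule that[of "lower_const kp * C1 + lower_const ks * C2"])
  show "lower_const kp * C1 + lower_const ks * C2 >= 0" using lc C1(1) C2(1) by simp
  fix u a b assume u2: "!!m. C_k 2 (%y. u y $ m)" and P: "pattern_components kp ks u a b"
  have a: "!!l. L2s (a l)" and b: "!!l. L2s (b l)" and u: "!!x m. u x $ m = herglotz kp (a m) x + herglotz ks (b m) x"
   using P by (auto simp: pattern_components_def)
  have Hs: "H_norm_sq u = (SUM m:UNIV. scalar_norm (%y. u y $ m))" by (rule H_norm_sq_components[OF C_k_2_imp_1[OF u2]])
  have "H_norm_sq u < \<infinity>" using pattern_upper[OF P k] by (simp add: le_less_trans)
  then have fin: "scalar_norm (%y. u y $ m) < \<infinity>" for m unfolding Hs by (auto simp: less_top[symmetric])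
  have T: "gauss_conv s (%y. u y $ m) x = gauss_factor kp s *R herglotz kp (a m) x + gauss_factor ks s *R herglotz ks (b m) x" if s: "s > 0" for s m x
  proof -
   note r = herglotz_reproducing[OF a[of m], of kp] herglotz_reproducing[OF b[of m], of ks]
   have "gauss_conv s (%y. 1 *R herglotz kp (a m) y + 1 *R herglotz ks (b m) y) x
     = 1 *R gauss_conv s (herglotz kp (a m)) x + 1 *R gauss_conv s (herglotz ks (b m)) x"
    using r by (intro gauss_transform_add_fun s) (auto simp: reproducing_def)
   then show ?thesis using r s by (simp add: u reproducing_def gauss_factor_def)
  qed
  have "ennreal (l2sq (a m)) + ennreal (l2sq (b m)) <= ennreal (lower_const kp * C1 + lower_const ks * C2) * scalar_norm (%y. u y $ m)" for m
  proof -
   let ?N = "scalar_norm (%y. u y $ m)"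
   have A1: "scalar_norm (herglotz kp (a m)) <= ennreal C1 * ?N" using C1(2)[OF u2 fin T] by blast
   have A2: "scalar_norm (herglotz ks (b m)) <= ennreal C2 * ?N"
    using C2(2)[OF u2[of m] fin[of m], of "herglotz ks (b m)" "herglotz kp (a m)"] T by (simp add: add.commute)
   have "ennreal (l2sq (a m)) <= ennreal (lower_const kp) * (ennreal C1 * ?N)"
    by (rule order_trans[OF l2sq_le_scalar_norm[OF k(1) a]]) (intro mult_left_mono A1, simp)
   moreover have "ennreal (l2sq (b m)) <= ennreal (lower_const ks) * (ennreal C2 * ?N)"
    by (rule order_trans[OF l2sq_le_scalar_norm[OF k(2) b]]) (intro mult_left_mono A2, simp)
   ultimately have "ennreal (l2sq (a m)) + ennreal (l2sq (b m)) <= ennreal (lower_const kp) * (ennreal C1 * ?N) + ennreal (lower_const ks) * (ennreal C2 * ?N)"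
    by (rule add_mono)
   also have "... = ennreal (lower_const kp * C1 + lower_const ks * C2) * ?N"
    using lc C1(1) C2(1) by (simp add: ennreal_plus ennreal_mult distrib_right mult.assoc)
   finally show ?thesis .
  qed
  then have "(SUM m:UNIV. ennreal (l2sq (a m)) + ennreal (l2sq (b m))) <= ennreal (lower_const kp * C1 + lower_const ks * C2) * H_norm_sq u"
   unfolding Hs sum_distrib_left by (intro sum_mono)
  moreover have "(SUM m:UNIV. ennreal (l2sq (a m)) + ennreal (l2sq (b m))) = ennreal ((SUM m:UNIV. l2sq (a m)) + (SUM m:UNIV. l2sq (b m)))"
   by (simp add: sum.distrib sum_ennreal l2sq_nonneg ennreal_plus sum_nonneg)
  ultimately show "ennreal ((SUM m:UNIV. l2sq (a m)) + (SUM m:UNIV. l2sq (b m))) <= ennreal (lower_const kp * C1 + lower_const ks * C2) * H_norm_sq u" by simp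
 qed
qed

lemma H_norm_le: "H_norm_sq u <= ennreal Y ==> Y >= 0 ==> H_norm u <= sqrt Y" unfolding H_norm_def by (intro real_sqrt_le_mono enn2real_leI)

lemma H_norm_ge:
 assumes "ennreal X <= ennreal L * H_norm_sq u" "H_norm_sq u < \<infinity>" "L >= 0"
 shows "sqrt X <= sqrt L * H_norm u"
proof -
 have "H_norm_sq u = ennreal (enn2real (H_norm_sq u))" using assms(2) by simp
 then have "ennreal X <= ennreal (L * enn2real (H_norm_sq u))" using assms(1,3) by (metis ennreal_mult enn2real_nonneg)
 then have "X <= L * enn2real (H_norm_sq u)" using assms(3) by (simp add: ennreal_le_iff)
 then show ?thesis by (simp add: H_norm_def flip: real_sqrt_mult)
qed

lemma sqrt_add_le: "A >= 0 ==> B >= 0 ==> sqrt A + sqrt B <= 2 * sqrt (A + B)" for A B :: real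
proof -
 assume "A >= 0" "B >= 0"
 then have "sqrt A <= sqrt (A + B)" "sqrt B <= sqrt (A + B)" by (auto intro!: real_sqrt_le_mono)
 then show ?thesis by linarith
qed

theorem theorem1p2:
  fixes lam mu rho om kp ks :: real
  assumes "rho > 0" and "om > 0" and "mu > 0" and "2 * mu + lam > 0"
    and "kp > 0" and "kp\<^sup>2 = om\<^sup>2 * rho / (2 * mu + lam)"
    and "ks > 0" and "ks\<^sup>2 = om\<^sup>2 * rho / mu"
  shows "(\<forall>u. entire_navier_solution lam mu rho om u \<longrightarrow>
            (elastic_herglotz lam mu rho om kp ks u \<longleftrightarrow> H_norm_sq u < \<infinity>))
    \<and> (\<exists>c>0. \<exists>C>0. \<forall>u g1 g2.
          entire_navier_solution lam mu rho om u \<and> far_field_patterns kp ks u g1 g2 \<longrightarrow>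
            c * (L2_sphere_norm g1 + L2_sphere_norm g2) \<le> H_norm u \<and>
            H_norm u \<le> C * (L2_sphere_norm g1 + L2_sphere_norm g2))
    \<and> (\<exists>c>0. \<exists>C>0. \<forall>u g1 g2.
          entire_navier_solution lam mu rho om u \<and> far_field_patterns kp ks u g1 g2 \<longrightarrow>
            H_norm_sq (compressional_part kp u) < \<infinity> \<and>
            H_norm_sq (shear_part ks u) < \<infinity> \<and>
            c * (H_norm (compressional_part kp u) + H_norm (shear_part ks u))
              \<le> L2_sphere_norm g1 + L2_sphere_norm g2 \<and>
            L2_sphere_norm g1 + L2_sphere_norm g2
              \<le> C * (H_norm (compressional_part kp u) + H_norm (shear_part ks u)))"
proof -
 note k = \<open>kp > 0\<close> \<open>ks > 0\<close>
 have fin: "H_norm_sq u < \<infinity>" if "pattern_components kp ks u a b" for u a b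
  using pattern_upper[OF that k] by (simp add: le_less_trans)
 have norms: "L2_sphere_norm g1 = sqrt (SUM m:UNIV. l2sq (%xi. g1 xi $ m))" "L2_sphere_norm g2 = sqrt (SUM m:UNIV. l2sq (%xi. g2 xi $ m))"
  if "far_field_patterns kp ks u g1 g2" for u g1 g2
  using that by (auto simp: far_field_patterns_def L2_sphere_p_def L2_sphere_s_def L2_sphere_norm_eq)
 define K where "K = sqrt (2 * upper_const kp) + sqrt (2 * upper_const ks) + 1"
 have K: "K > 0" "sqrt (2 * upper_const kp) <= K" "sqrt (2 * upper_const ks) <= K"
  using const_nonneg(1)[of kp] const_nonneg(1)[of ks] by (auto simp: K_def add_nonneg_pos)
 have up: "H_norm u <= K * (sqrt (SUM m:UNIV. l2sq (a m)) + sqrt (SUM m:UNIV. l2sq (b m)))" if P: "pattern_components kp ks u a b" for u a b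
 proof -
  define A B where "A = (SUM m:UNIV. l2sq (a m))" and "B = (SUM m:UNIV. l2sq (b m))"
  have AB: "A >= 0" "B >= 0" by (auto simp: A_def B_def intro: sum_nonneg l2sq_nonneg)
  have "H_norm u <= sqrt (2 * upper_const kp * A + 2 * upper_const ks * B)"
   using H_norm_le[OF pattern_upper[OF P k]] AB const_nonneg(1) by (simp add: A_def B_def)
  also have "... <= sqrt (2 * upper_const kp * A) + sqrt (2 * upper_const ks * B)" using AB const_nonneg(1) by (intro sqrt_add_le_add_sqrt) auto
  also have "... = sqrt (2 * upper_const kp) * sqrt A + sqrt (2 * upper_const ks) * sqrt B" by (simp add: real_sqrt_mult)
  also have "... <= K * sqrt A + K * sqrt B" using K AB by (intro add_mono mult_right_mono) auto
  finally show ?thesis by (simp add: A_def B_def distrib_left)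
 qed
 have 1: "\<forall>u. entire_navier_solution lam mu rho om u --> (elastic_herglotz lam mu rho om kp ks u \<longleftrightarrow> H_norm_sq u < \<infinity>)"
 proof (intro allI impI iffI)
  fix u assume "elastic_herglotz lam mu rho om kp ks u"
  then show "H_norm_sq u < \<infinity>" using fin by (auto simp: elastic_herglotz_def far_field_patterns_iff)
 next
  fix u assume sol: "entire_navier_solution lam mu rho om u" and H: "H_norm_sq u < \<infinity>"
  have "scalar_norm (%y. u y $ m) < \<infinity>" for m
   using H unfolding H_norm_sq_components[OF C_k_2_imp_1[OF navier_components(1)[OF sol]]] by (auto simp: less_top[symmetric])
  from navier_patterns_exist[OF sol assms(3-8) this] obtain a b where
   ab: "!!m. L2s (a m)" "!!m. L2s (b m)" "!!m x. u x $ m = herglotz kp (a m) x + herglotz ks (b m) x"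
   "!!m. AE xi in S2. a m xi = cor (xi $ m) * radial_part a xi" "AE xi in S2. radial_part b xi = 0" by blast
  then have "pattern_components kp ks u a b" by (auto simp: pattern_components_def AE_all_countable)
  then have "far_field_patterns kp ks u (%xi. \<chi> m. a m xi) (%xi. \<chi> m. b m xi)" by (simp add: far_field_patterns_iff)
  then show "elastic_herglotz lam mu rho om kp ks u" using sol by (auto simp: elastic_herglotz_def)
 qed
 obtain L where L: "L >= 0" "!!u a b. (!!m. C_k 2 (%y. u y $ m)) ==> pattern_components kp ks u a b ==>
  ennreal ((SUM m:UNIV. l2sq (a m)) + (SUM m:UNIV. l2sq (b m))) <= ennreal L * H_norm_sq u" using pattern_lower[OF k] by metis
 have 2: "1 / (2 * sqrt L + 1) * (L2_sphere_norm g1 + L2_sphere_norm g2) <= H_norm u & H_norm u <= K * (L2_sphere_norm g1 + L2_sphere_norm g2)"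
  if sol: "entire_navier_solution lam mu rho om u" and ff: "far_field_patterns kp ks u g1 g2" for u g1 g2
 proof
  define A B where "A = (SUM m:UNIV. l2sq (%xi. g1 xi $ m))" and "B = (SUM m:UNIV. l2sq (%xi. g2 xi $ m))"
  note n = norms[OF ff, folded A_def B_def]
  have AB: "A >= 0" "B >= 0" by (auto simp: A_def B_def intro: sum_nonneg l2sq_nonneg)
  note P = ff[unfolded far_field_patterns_iff]
  show "H_norm u <= K * (L2_sphere_norm g1 + L2_sphere_norm g2)" unfolding n A_def B_def by (rule up[OF P])
  have "sqrt (A + B) <= sqrt L * H_norm u" unfolding A_def B_def by (rule H_norm_ge[OF L(2)[OF navier_components(1)[OF sol] P] fin[OF P] L(1)])
  then have "sqrt A + sqrt B <= 2 * (sqrt L * H_norm u)" using sqrt_add_le[OF AB] by linarith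
  also have "... <= (2 * sqrt L + 1) * H_norm u" by (simp add: distrib_right H_norm_def)
  finally have f: "sqrt A + sqrt B <= (2 * sqrt L + 1) * H_norm u" .
  have p: "2 * sqrt L + 1 > 0" using L(1) by (simp add: add_nonneg_pos)
  show "1 / (2 * sqrt L + 1) * (L2_sphere_norm g1 + L2_sphere_norm g2) <= H_norm u"
   unfolding n using mult_left_mono[OF f, of "1 / (2 * sqrt L + 1)"] p by simp
 qed
 define M where "M = sqrt (lower_const kp) + sqrt (lower_const ks) + 1"
 have lc: "lower_const kp >= 0" "lower_const ks >= 0" using const_nonneg(2) k by auto
 have M: "M > 0" "sqrt (lower_const kp) <= M" "sqrt (lower_const ks) <= M" using lc by (auto simp: M_def add_nonneg_pos)
 have 3: "H_norm_sq (compressional_part kp u) < \<infinity> & H_norm_sq (shear_part ks u) < \<infinity> &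
   1 / K * (H_norm (compressional_part kp u) + H_norm (shear_part ks u)) <= L2_sphere_norm g1 + L2_sphere_norm g2 &
   L2_sphere_norm g1 + L2_sphere_norm g2 <= M * (H_norm (compressional_part kp u) + H_norm (shear_part ks u))"
  if ff: "far_field_patterns kp ks u g1 g2" for u g1 g2
 proof -
  define a b where "a m xi = g1 xi $ m" and "b m xi = g2 xi $ m" for m xi
  define A B where "A = (SUM m:UNIV. l2sq (a m))" and "B = (SUM m:UNIV. l2sq (b m))"
  have n: "L2_sphere_norm g1 = sqrt A" "L2_sphere_norm g2 = sqrt B" using norms[OF ff] by (simp_all add: A_def B_def a_def[abs_def] b_def[abs_def])
  have P: "pattern_components kp ks u a b" using ff by (simp add: far_field_patterns_iff a_def[abs_def] b_def[abs_def])
  then have ab: "!!m. L2s (a m)" "!!m. L2s (b m)" by (auto simp: pattern_components_def)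
  let ?up = "compressional_part kp u" and ?us = "shear_part ks u"
  note up_eq = compressional_part_herglotz[OF P k(1)] and us_eq = shear_part_herglotz[OF P k(2)]
  have rz: "radial_part (%m xi. 0) xi = 0" for xi by (simp add: radial_part_def)
  have Pp: "pattern_components kp ks ?up a (%m xi. 0)" and Ps: "pattern_components kp ks ?us (%m xi. 0) b"
   using P L2s_zero by (auto simp: pattern_components_def up_eq us_eq herglotz_zero rz)
  have z: "l2sq (%xi. 0) = 0" by (simp add: l2sq_def)
  have "H_norm ?up <= K * sqrt A" "H_norm ?us <= K * sqrt B" using up[OF Pp] up[OF Ps] by (simp_all add: z A_def B_def)
  then have u1: "1 / K * (H_norm ?up + H_norm ?us) <= sqrt A + sqrt B" using K(1) by (simp add: field_simps)
  have "sqrt A <= sqrt (lower_const kp) * H_norm ?up"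
   unfolding A_def by (rule H_norm_ge[OF herglotz_vector_lower[OF ab(1) up_eq k(1)] fin[OF Pp] lc(1)])
  moreover have "sqrt B <= sqrt (lower_const ks) * H_norm ?us"
   unfolding B_def by (rule H_norm_ge[OF herglotz_vector_lower[OF ab(2) us_eq k(2)] fin[OF Ps] lc(2)])
  moreover have "sqrt (lower_const kp) * H_norm ?up <= M * H_norm ?up" "sqrt (lower_const ks) * H_norm ?us <= M * H_norm ?us"
   using M by (auto intro!: mult_right_mono simp: H_norm_def)
  ultimately have u2: "sqrt A + sqrt B <= M * (H_norm ?up + H_norm ?us)" by (simp add: distrib_left)
  show ?thesis using u1 u2 fin[OF Pp] fin[OF Ps] by (simp add: n)
 qed
 have pos: "1 / (2 * sqrt L + 1) > 0" "1 / K > 0" using L(1) K(1) by (auto simp: add_nonneg_pos)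
 show ?thesis using 1 2 3 pos K(1) M(1) by blast
qed

end
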